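(* Let $1<p<\infty$, $1/p+1/q=1$, and let $(a,b)\in L^\infty\times L^\infty$ be a Fredholm $\alpha$-matching pair (with respect to $H^p$) with subordinated pair $(c,d)$, $c=ab^{-1}$, $d=ba_\alpha^{-1}$; put $\kappa_1:=\operatorname{ind}T(c)$, $\kappa_2:=\operatorname{ind}T(d)$ on $H^p$. Assume $\kappa_1\le-1$ and $\kappa_2\ge1$, and let $m\in\mathbb N$ satisfy $1\ge 2m-\kappa_2\ge0$. Let $\varphi_\alpha^\pm:=\varphi^\pm_{\alpha;(\overline a\chi^{-m},\,\overline b_\alpha\chi^m)}$ (on $H^q$). Consider $T(a)\pm H_\alpha(b)$ on $H^p$, whose cokernels are subspaces of $H^q$. Then, with all operators and spaces on the right-hand sides taken on $H^q$: (i) If $\kappa_2$ is odd and $d=d_-t^{-\kappa_2}d_+$ is the Wiener–Hopf factorization of $d$ in $H^p$, then $$\operatorname{coker}(T(a)\pm H_\alpha(b))=T(\chi^{-m})\left(\left\{\frac{1\mp\boldsymbol\sigma_\alpha(\overline d)}2\,\overline{d_-^{-1}}\,\mathbb C\dotplus\varphi_\alpha^\pm(\operatorname{im}\mathbf P_\alpha^\pm(\overline c))\right\}\cap\operatorname{im}T(\chi^m)\right).$$ (ii) If $\kappa_2$ is even, then $$\operatorname{coker}(T(a)\pm H_\alpha(b))=T(\chi^{-m})\left(\varphi_\alpha^\pm(\operatorname{im}\mathbf P_\alpha^\pm(\overline c))\cap\operatorname{im}T(\chi^m)\right).$$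
   Context: $\mathbb T$ is the unit circle, $L^p=L^p(\mathbb T)$. For $1\le p\le\infty$, $H^p=\{f\in L^p:\widehat f_n=0,\ n<0\}$, $\overline{H^p}=\{f\in L^p:\widehat f_n=0,\ n>0\}$; elements of $H^p$ are identified with their analytic extensions to the open unit disc, and for $f\in\overline{H^p}$, $f(\infty):=\widehat f_0$. For $1<p<\infty$, $P:\sum_{n\in\mathbb Z}\widehat f_nt^n\mapsto\sum_{n\ge0}\widehat f_nt^n$ on $L^p$, $Q=I-P$. Fix $\beta\in\mathbb C$, $|\beta|>1$, $\lambda:=i\sqrt{|\beta|^2-1}$, $\alpha(t)=\dfrac{t-\beta}{\overline\beta t-1}$ (a map of $\mathbb T$ onto itself, $\alpha\circ\alpha=\mathrm{id}$), $a_\alpha:=a\circ\alpha$, $\chi(t):=(\overline\beta t-1)/\lambda$ (so $\chi\chi_\alpha=1$), and $J_\alpha\varphi(t):=\chi(t)^{-1}\varphi(\alpha(t))$. For $a\in L^\infty$, on $H^p$: $T(a)\varphi=P(a\varphi)$, $H_\alpha(a)\varphi=P(aQJ_\alpha\varphi)$. The dual of $H^p$ is identified with $H^q$ via $\langle f,g\rangle=\frac1{2\pi}\int_{\mathbb T}f\overline g\,|dt|$; $\operatorname{coker}A:=\ker A^*\subset H^q$; one has $(T(a)\pm H_\alpha(b))^*=T(\overline a)\pm H_\alpha(\overline b_\alpha)$ with $\overline b_\alpha=\overline{b\circ\alpha}$. $A$ is Fredholm if its range is closed and $\ker A$, $\operatorname{coker}A$ are finite-dimensional; $\operatorname{ind}A=\dim\ker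 A-\dim\operatorname{coker}A$. $(a,b)\in L^\infty\times L^\infty$ is an $\alpha$-matching pair if $a$ is invertible in $L^\infty$ and $aa_\alpha=bb_\alpha$ (so $b$ is invertible too). Its subordinated pair is $(c,d)$, $c=ab^{-1}$, $d=ba_\alpha^{-1}$; then $cc_\alpha=dd_\alpha=1$. The pair $(a,b)$ is Fredholm if $T(c),T(d)$ are Fredholm on $H^p$. The pair $(\overline a,\overline b_\alpha)$ is $\alpha$-matching with subordinated pair $(\overline d,\overline c)$, and $(\overline a\chi^{-m},\overline b_\alpha\chi^m)$ is $\alpha$-matching with subordinated pair $(\overline d\chi^{-2m},\overline c)$. For $g\in L^\infty$ with $gg_\alpha=1$: $\mathbf P_\alpha(g):=J_\alpha QgP|_{\ker T(g)}$ maps $\ker T(g)$ to itself with square $I$, and $\mathbf P_\alpha^\pm(g):=\frac12(I\pm\mathbf P_\alpha(g))$ are complementary projections on $\ker T(g)$. Wiener–Hopf factorization of $g$ in $H^p$, where $T(g)$ is Fredholm on $H^p$ with index $n$: $g=g_-t^{-n}g_+$, $g_-(\infty)=1$, $g_+\in H^q$, $g_+^{-1}\in H^p$, $g_-\in\overline{H^p}$, $g_-^{-1}\in\overline{H^q}$, and $g_+^{-1}Pg_-^{-1}I$, defined on $\operatorname{span}\{t^k:k\ge0\}$, extends to a bounded operator on $H^p$ (it exists and is unique). If also $gg_\alpha=1$, the $\alpha$-signature is $\boldsymbol\sigma_\alpha(g):=(\lambda/\overline\beta)^n\,g_+^{-1}(1/\overline\beta)\in\{-1,1\}$. If $T(g)$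 is Fredholm with index $\kappa\ge0$, $T_r^{-1}(g):=T^{-1}(gt^{\kappa})T(t^{\kappa})$, a right inverse of $T(g)$. For an $\alpha$-matching pair $(a',b')$ with subordinated pair $(c',d')$, $T(c')$ Fredholm of non-negative index, and $s\in\ker T(d')$: $$2\varphi^\pm_{\alpha;(a',b')}(s):=T_r^{-1}(c')T((a'_\alpha)^{-1})s\mp J_\alpha Qc'P\,T_r^{-1}(c')T((a'_\alpha)^{-1})s\pm J_\alpha Q(a'_\alpha)^{-1}s.$$ All these notions are used with $p$ and $q$ interchanged when the underlying space is $H^q$; in particular $\boldsymbol\sigma_\alpha(\overline d)$ refers to the factorization of $\overline d$ in $H^q$. $\dotplus$ denotes direct sum, and $z f\,\mathbb C:=\{z w f:w\in\mathbb C\}$. *)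

theory Defs
  imports "HOL-Probability.Probability"
begin

text \<open>
  The normalised arc length measure \<open>|dt| / (2 \<pi>)\<close> on the unit circle, regarded as a Borel
  measure on the complex plane which is concentrated on the circle.
\<close>

definition circle :: "complex measure" where
  "circle = distr (uniform_measure lborel {0..2 * pi}) borel cis"

lemma sets_circle [measurable_cong, simp]: "sets circle = sets borel"
  by (simp add: circle_def)

lemma space_circle [simp]: "space circle = UNIV"
  by (simp add: circle_def)

lemma measurable_cis [measurable]: "cis \<in> borel_measurable borel"
  by (intro borel_measurable_continuous_onI continuous_intros)

lemma prob_space_circle: "prob_space circle"
proof -
  have "prob_space (uniform_measure lborel {0..2 * pi})"
    by (rule prob_space_uniform_measure) auto
  thus ?thesis
    unfolding circle_def by (rule prob_space.prob_space_distr) simp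
qed

definition circ_eq :: "(complex \<Rightarrow> complex) \<Rightarrow> (complex \<Rightarrow> complex) \<Rightarrow> bool" where
  "circ_eq f g \<longleftrightarrow>
     f \<in> borel_measurable circle \<and> g \<in> borel_measurable circle \<and> (AE t in circle. f t = g t)"

lemma part_equivp_circ_eq: "part_equivp circ_eq"
proof (rule part_equivpI)
  show "\<exists>f. circ_eq f f"
    by (rule exI[of _ "\<lambda>_. 0"]) (simp add: circ_eq_def)
  show "symp circ_eq"
    by (auto simp: symp_def circ_eq_def elim: eventually_mono)
  show "transp circ_eq"
    by (auto simp: transp_def circ_eq_def elim: eventually_elim2)
qed

text \<open>Measurable functions on the circle, identified when they agree almost everywhere.\<close>

quotient_type circfun = "complex \<Rightarrow> complex" / partial: circ_eq
  by (rule part_equivp_circ_eq)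

text \<open>Here \<open>inverse\<close> is pointwise; it is the reciprocal of functions that are nonzero almost everywhere.\<close>

instantiation circfun :: "{comm_ring_1, inverse}"
begin

lift_definition zero_circfun :: circfun is "\<lambda>_. 0"
  by (simp add: circ_eq_def)

lift_definition one_circfun :: circfun is "\<lambda>_. 1"
  by (simp add: circ_eq_def)

lift_definition plus_circfun :: "circfun \<Rightarrow> circfun \<Rightarrow> circfun" is "\<lambda>f g t. f t + g t"
  by (auto simp: circ_eq_def)

lift_definition minus_circfun :: "circfun \<Rightarrow> circfun \<Rightarrow> circfun" is "\<lambda>f g t. f t - g t"
  by (auto simp: circ_eq_def)

lift_definition uminus_circfun :: "circfun \<Rightarrow> circfun" is "\<lambda>f t. - f t"
  by (auto simp: circ_eq_def)

lift_definition times_circfun :: "circfun \<Rightarrow> circfun \<Rightarrow> circfun" is "\<lambda>f g t. f t * g t"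
  by (auto simp: circ_eq_def)

lift_definition inverse_circfun :: "circfun \<Rightarrow> circfun" is "\<lambda>f t. inverse (f t)"
  by (auto simp: circ_eq_def)

definition divide_circfun :: "circfun \<Rightarrow> circfun \<Rightarrow> circfun" where
  "divide_circfun f g = f * inverse g"

instance
proof
  show "(0::circfun) \<noteq> 1"
  proof transfer
    interpret prob_space circle by (rule prob_space_circle)
    show "\<not> circ_eq (\<lambda>_. 0) (\<lambda>_. 1)"
      by (simp add: circ_eq_def AE_False prob_space)
  qed
qed (transfer; auto simp: circ_eq_def algebra_simps)+

end

lift_definition cscale :: "complex \<Rightarrow> circfun \<Rightarrow> circfun" is "\<lambda>z f t. z * f t"
  by (auto simp: circ_eq_def)

global_interpretation circ: vector_space cscale
  by unfold_locales (transfer; auto simp: circ_eq_def algebra_simps)+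

definition fin_dim :: "circfun set \<Rightarrow> bool" where
  "fin_dim V \<longleftrightarrow> (\<exists>B. finite B \<and> V \<subseteq> circ.span B)"

lemma measurable_cnj_comp [measurable (raw)]:
  "f \<in> borel_measurable M \<Longrightarrow> (\<lambda>x. cnj (f x)) \<in> borel_measurable M"
  by (rule borel_measurable_continuous_on[where f = cnj])
     (auto intro: continuous_intros)

lift_definition conj_fun :: "circfun \<Rightarrow> circfun" is "\<lambda>f t. cnj (f t)"
  by (auto simp: circ_eq_def intro: measurable_cnj_comp)

lift_definition tvar :: circfun is "\<lambda>t. t"
  by (simp add: circ_eq_def)

lift_definition fourier :: "circfun \<Rightarrow> int \<Rightarrow> complex"
  is "\<lambda>f n. LINT t|circle. f t * t powi (- n)"
proof (rule ext, rule integral_cong_AE)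
  fix f g :: "complex \<Rightarrow> complex" and n :: int
  assume fg: "circ_eq f g"
  have m: "(\<lambda>t::complex. t powi (- n)) \<in> borel_measurable circle"
    by (auto simp: power_int_def)
  show "(\<lambda>t. f t * t powi (- n)) \<in> borel_measurable circle"
    using fg m by (auto simp: circ_eq_def)
  show "(\<lambda>t. g t * t powi (- n)) \<in> borel_measurable circle"
    using fg m by (auto simp: circ_eq_def)
  show "AE t in circle. f t * t powi (- n) = g t * t powi (- n)"
    using fg by (auto simp: circ_eq_def)
qed

lift_definition pairing :: "circfun \<Rightarrow> circfun \<Rightarrow> complex"
  is "\<lambda>f g. LINT t|circle. f t * cnj (g t)"
  by (rule integral_cong_AE) (auto simp: circ_eq_def intro: measurable_cnj_comp)

lift_definition in_Lp :: "real \<Rightarrow> circfun \<Rightarrow> bool"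
  is "\<lambda>p f. integrable circle (\<lambda>t. cmod (f t) powr p)"
  by (rule integrable_cong_AE) (auto simp: circ_eq_def)

definition Lp :: "real \<Rightarrow> circfun set" where
  "Lp p = {f. in_Lp p f}"

lift_definition Lp_norm :: "real \<Rightarrow> circfun \<Rightarrow> real"
  is "\<lambda>p f. (LINT t|circle. cmod (f t) powr p) powr (1 / p)"
  by (rule arg_cong[where f = "\<lambda>x. x powr _"], rule integral_cong_AE) (auto simp: circ_eq_def)

lift_definition ess_bounded :: "circfun \<Rightarrow> bool"
  is "\<lambda>f. \<exists>C. AE t in circle. cmod (f t) \<le> C"
  by (auto simp: circ_eq_def elim!: eventually_elim2 intro!: ex_cong1)

definition Linf :: "circfun set" where
  "Linf = {f. ess_bounded f}"

definition Hp :: "real \<Rightarrow> circfun set" where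
  "Hp p = {f \<in> Lp p. \<forall>n<0. fourier f n = 0}"

definition Hp_bar :: "real \<Rightarrow> circfun set" where
  "Hp_bar p = {f \<in> Lp p. \<forall>n>0. fourier f n = 0}"

text \<open>Used only for \<open>1 < p\<close>: the \<open>q\<close> with \<open>1 / p + 1 / q = 1\<close>.\<close>

definition dual_exp :: "real \<Rightarrow> real" where
  "dual_exp p = p / (p - 1)"

text \<open>The value at a point of the open unit disc of the analytic extension of a function in \<open>Hp p\<close>.\<close>

definition disc_ext :: "circfun \<Rightarrow> complex \<Rightarrow> complex" where
  "disc_ext f z = (\<Sum>n. fourier f (int n) * z ^ n)"

text \<open>
  The Riesz projections. Integrable functions are determined by their Fourier coefficients, so the
  description below has at most one solution; for functions in \<open>Lp p\<close>, \<open>1 < p\<close>, a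
  solution exists and lies in \<open>Lp p\<close>. In particular the same formula serves all exponents.
\<close>

definition Pproj :: "circfun \<Rightarrow> circfun" where
  "Pproj f = (THE g. g \<in> Lp 1 \<and> (\<forall>n. fourier g n = (if n \<ge> 0 then fourier f n else 0)))"

definition Qproj :: "circfun \<Rightarrow> circfun" where
  "Qproj f = f - Pproj f"

text \<open>
  Operators on \<open>Hp p\<close> are functions of type \<^typ>\<open>circfun \<Rightarrow> circfun\<close>
  of which only the restriction to the carrier \<open>Hp p\<close> matters. Closedness of the range
  and boundedness refer to the norm of \<open>Lp p\<close>.
\<close>

definition ker_op :: "real \<Rightarrow> (circfun \<Rightarrow> circfun) \<Rightarrow> circfun set" where
  "ker_op p A = {f \<in> Hp p. A f = 0}"

text \<open>
  The adjoint with respect to the sesquilinear pairing which identifies the dual of \<open>Hp p\<close> with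
  \<open>Hp (dual_exp p)\<close>; the cokernel is by definition the kernel of the adjoint.
\<close>

definition adj_op :: "real \<Rightarrow> (circfun \<Rightarrow> circfun) \<Rightarrow> circfun \<Rightarrow> circfun" where
  "adj_op p A g = (THE h. h \<in> Hp (dual_exp p) \<and> (\<forall>f\<in>Hp p. pairing (A f) g = pairing f h))"

definition coker_op :: "real \<Rightarrow> (circfun \<Rightarrow> circfun) \<Rightarrow> circfun set" where
  "coker_op p A = ker_op (dual_exp p) (adj_op p A)"

definition closed_range :: "real \<Rightarrow> (circfun \<Rightarrow> circfun) \<Rightarrow> bool" where
  "closed_range p A \<longleftrightarrow>
     (\<forall>f g. (\<forall>n::nat. f n \<in> A ` Hp p) \<and> g \<in> Hp p \<and> (\<lambda>n. Lp_norm p (f n - g)) \<longlonglongrightarrow> 0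
        \<longrightarrow> g \<in> A ` Hp p)"

definition fredholm :: "real \<Rightarrow> (circfun \<Rightarrow> circfun) \<Rightarrow> bool" where
  "fredholm p A \<longleftrightarrow> closed_range p A \<and> fin_dim (ker_op p A) \<and> fin_dim (coker_op p A)"

definition ind :: "real \<Rightarrow> (circfun \<Rightarrow> circfun) \<Rightarrow> int" where
  "ind p A = int (circ.dim (ker_op p A)) - int (circ.dim (coker_op p A))"

definition bounded_op :: "real \<Rightarrow> (circfun \<Rightarrow> circfun) \<Rightarrow> bool" where
  "bounded_op p B \<longleftrightarrow>
     (\<forall>f\<in>Hp p. B f \<in> Hp p) \<and>
     (\<forall>f\<in>Hp p. \<forall>g\<in>Hp p. B (f + g) = B f + B g) \<and>
     (\<forall>z. \<forall>f\<in>Hp p. B (cscale z f) = cscale z (B f)) \<and>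
     (\<exists>C. \<forall>f\<in>Hp p. Lp_norm p (B f) \<le> C * Lp_norm p f)"

definition lam :: "complex \<Rightarrow> complex" where
  "lam \<beta> = \<i> * complex_of_real (sqrt ((cmod \<beta>)\<^sup>2 - 1))"

definition alpha :: "complex \<Rightarrow> complex \<Rightarrow> complex" where
  "alpha \<beta> t = (t - \<beta>) / (cnj \<beta> * t - 1)"

text \<open>
  For \<open>|\<beta>| > 1\<close> the shift preserves null sets, so the class of \<open>f \<circ> \<alpha>\<close> does not
  depend on the representative; see \<open>comp_alpha_abs\<close> below.
\<close>

definition comp_alpha :: "complex \<Rightarrow> circfun \<Rightarrow> circfun" where
  "comp_alpha \<beta> f = abs_circfun (rep_circfun f \<circ> alpha \<beta>)"

lift_definition chi :: "complex \<Rightarrow> circfun" is "\<lambda>\<beta> t. (cnj \<beta> * t - 1) / lam \<beta>"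
  by (simp add: circ_eq_def)

lemma alpha_measurable: "alpha \<beta> \<in> borel_measurable borel"
  unfolding alpha_def[abs_def] by measurable

lemma alpha_on_circle:
  assumes "cmod \<beta> > 1" "cmod t = 1"
  shows "cnj \<beta> * t \<noteq> 1" "cmod (alpha \<beta> t) = 1" "alpha \<beta> (alpha \<beta> t) = t"
proof -
  show nz: "cnj \<beta> * t \<noteq> 1"
    using assms by (metis complex_mod_cnj less_irrefl mult.right_neutral norm_mult norm_one)
  have tt: "t * cnj t = 1"
    using assms by (simp add: complex_norm_square[symmetric])
  have "cnj \<beta> * t - 1 = - t * cnj (t - \<beta>)"
    using tt by (simp add: algebra_simps)
  hence "cmod (cnj \<beta> * t - 1) = cmod (t - \<beta>)"
    using assms by (metis complex_mod_cnj mult_1 norm_minus_cancel norm_mult)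
  moreover have "t \<noteq> \<beta>" using assms by auto
  ultimately show "cmod (alpha \<beta> t) = 1"
    by (simp add: alpha_def norm_divide)
  have bb: "cnj \<beta> * \<beta> \<noteq> 1"
    using assms by (metis complex_mod_cnj less_irrefl mult.right_neutral norm_mult norm_one
        less_1_mult)
  have d: "cnj \<beta> * t - 1 \<noteq> 0" using nz by simp
  have num: "alpha \<beta> t - \<beta> = (1 - cnj \<beta> * \<beta>) * t / (cnj \<beta> * t - 1)"
    using d by (simp add: alpha_def divide_simps) (simp add: algebra_simps)
  have den: "cnj \<beta> * alpha \<beta> t - 1 = (1 - cnj \<beta> * \<beta>) / (cnj \<beta> * t - 1)"
    using d by (simp add: alpha_def divide_simps) (simp add: algebra_simps)
  show "alpha \<beta> (alpha \<beta> t) = t"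
    using d bb by (subst alpha_def) (simp add: num den)
qed

lemma AE_circle_iff:
  assumes "Measurable.pred borel P"
  shows "(AE t in circle. P t) \<longleftrightarrow> negligible {x \<in> {0..2*pi}. \<not> P (cis x)}"
proof -
  have [measurable]: "Measurable.pred borel P" by fact
  have "(AE t in circle. P t) \<longleftrightarrow> (AE x in uniform_measure lborel {0..2*pi}. P (cis x))"
    unfolding circle_def by (subst AE_distr_iff) (auto simp: pred_def)
  also have "\<dots> \<longleftrightarrow> (AE x in lborel. x \<in> {0..2*pi} \<longrightarrow> P (cis x))"
    by (subst AE_uniform_measure) auto
  also have "\<dots> \<longleftrightarrow> {x \<in> {0..2*pi}. \<not> P (cis x)} \<in> null_sets lborel"
    by (subst AE_iff_null_sets) (auto intro!: arg_cong[where f = "\<lambda>S. S \<in> null_sets lborel"])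
  also have "\<dots> \<longleftrightarrow> negligible {x \<in> {0..2*pi}. \<not> P (cis x)}"
    unfolding negligible_iff_null_sets
    by (subst null_sets_completion_iff) auto
  finally show ?thesis .
qed

lemma AE_circle_alpha:
  assumes b: "cmod \<beta> > 1" and P: "Measurable.pred borel P" and ae: "AE t in circle. P t"
  shows "AE t in circle. P (alpha \<beta> t)"
proof -
  define S where "S = {x \<in> {0..2*pi}. \<not> P (cis x)}"
  define S1 where "S1 = {x \<in> S. - alpha \<beta> (cis x) \<notin> \<real>\<^sub>\<le>\<^sub>0}"
  define h where "h = (\<lambda>x. Im (Ln (- alpha \<beta> (cis x))) + pi)"
  have "negligible S"
    using ae AE_circle_iff[OF P] by (simp add: S_def)
  hence n1: "negligible S1" by (rule negligible_subset) (auto simp: S1_def)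
  have "h differentiable (at x within S1)" if "x \<in> S1" for x
  proof -
    have d: "cnj \<beta> * cis x - 1 \<noteq> 0" using alpha_on_circle(1)[OF b, of "cis x"] by simp
    have 0: "- alpha \<beta> (cis x) \<notin> \<real>\<^sub>\<le>\<^sub>0" using that by (simp add: S1_def)
    have c: "(cis has_vector_derivative \<i> * cis x) (at x within S1)"
      unfolding cis_conv_exp[abs_def]
      by (rule has_vector_derivative_real_field) (auto intro!: derivative_eq_intros)
    have 1: "((\<lambda>z. Ln (- alpha \<beta> z)) has_field_derivative
        deriv (\<lambda>z. Ln (- alpha \<beta> z)) (cis x)) (at (cis x))"
    proof -
      have "alpha \<beta> field_differentiable (at (cis x))"
        unfolding alpha_def[abs_def]
        by (intro field_differentiable_divide field_differentiable_diff field_differentiable_mult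
            field_differentiable_const field_differentiable_ident d)
      hence "(\<lambda>z. - alpha \<beta> z) field_differentiable (at (cis x))"
        by (rule field_differentiable_minus)
      from field_differentiable_compose[OF this field_differentiable_at_Ln[OF 0]]
      have "(\<lambda>z. Ln (- alpha \<beta> z)) field_differentiable (at (cis x))"
        by (simp only: o_def)
      thus ?thesis by (rule DERIV_deriv_iff_field_differentiable[THEN iffD2])
    qed
    from field_vector_diff_chain_within[OF c has_field_derivative_at_within[OF 1]]
    obtain D where "((\<lambda>x. Ln (- alpha \<beta> (cis x))) has_vector_derivative D) (at x within S1)"
      unfolding o_def by blast
    hence "((\<lambda>x. Ln (- alpha \<beta> (cis x))) has_derivative (\<lambda>y. y *\<^sub>R D)) (at x within S1)"
      by (simp only: has_vector_derivative_def)
    from has_derivative_add_const[OF bounded_linear.has_derivative[OF bounded_linear_Im this]]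
    show ?thesis unfolding h_def differentiable_def by blast
  qed
  hence "h differentiable_on S1" by (simp add: differentiable_on_def)
  hence "negligible (h ` S1)"
    by (intro negligible_differentiable_image_negligible n1) auto
  hence n2: "negligible (insert 0 (insert (2*pi) (h ` S1)))" by simp
  have "{x \<in> {0..2*pi}. \<not> P (alpha \<beta> (cis x))} \<subseteq> insert 0 (insert (2*pi) (h ` S1))"
  proof
    fix x assume "x \<in> {x \<in> {0..2*pi}. \<not> P (alpha \<beta> (cis x))}"
    hence x: "x \<in> {0..2*pi}" and nP: "\<not> P (alpha \<beta> (cis x))" by auto
    show "x \<in> insert 0 (insert (2*pi) (h ` S1))"
    proof (rule ccontr)
      assume "x \<notin> insert 0 (insert (2*pi) (h ` S1))"
      hence "x \<noteq> 0" and n2: "x \<noteq> 2*pi" and nh: "x \<notin> h ` S1" by auto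
      define y where "y = Arg2pi (alpha \<beta> (cis x))"
      have "exp (\<i> * complex_of_real y) = alpha \<beta> (cis x)"
        unfolding y_def by (rule complex_norm_eq_1_exp[THEN iffD1, OF alpha_on_circle(2)[OF b]]) simp
      hence cy: "cis y = alpha \<beta> (cis x)" by (simp only: cis_conv_exp[of y])
      have "y \<in> {0..2*pi}"
        unfolding y_def using Arg2pi_ge_0 Arg2pi_lt_2pi[THEN less_imp_le] by simp
      moreover have "\<not> P (cis y)" unfolding cy by (rule nP)
      ultimately have yS: "y \<in> S" unfolding S_def by blast
      have ya: "alpha \<beta> (cis y) = cis x"
        unfolding cy by (rule alpha_on_circle(3)[OF b]) simp
      have mc: "- cis x = cis (x - pi)"
        by (simp add: complex_eq_iff cos_diff sin_diff)
      have "Ln (cis (x - pi)) = \<i> * complex_of_real (x - pi)"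
        unfolding cis_conv_exp using x n2 \<open>x \<noteq> 0\<close> by (intro Ln_exp) simp_all
      hence L: "Ln (- cis x) = \<i> * complex_of_real (x - pi)"
        by (simp only: mc)
      have "- cis x \<notin> \<real>\<^sub>\<le>\<^sub>0"
      proof
        assume "- cis x \<in> \<real>\<^sub>\<le>\<^sub>0"
        hence cs: "sin x = 0" "cos x \<ge> 0"
          by (simp_all add: complex_nonpos_Reals_iff)
        hence "(cos x)\<^sup>2 = 1"
          using sin_cos_squared_add[of x] by simp
        hence "cos x = 1"
          using cs(2) by (simp add: power2_eq_1_iff)
        hence "cis x = 1"
          using cs(1) by (simp add: complex_eq_iff)
        hence "Ln (- cis x) = \<i> * complex_of_real pi" by simp
        hence "x - pi = pi" using L by (simp del: of_real_diff)
        with n2 show False by simp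
      qed
      hence "y \<in> S1" using yS ya by (simp add: S1_def)
      moreover have "h y = x" unfolding h_def ya L by simp
      ultimately show False using nh by blast
    qed
  qed
  hence "negligible {x \<in> {0..2*pi}. \<not> P (alpha \<beta> (cis x))}"
    using n2 negligible_subset by blast
  moreover have "Measurable.pred borel (\<lambda>t. P (alpha \<beta> t))"
    using P alpha_measurable by (rule measurable_compose[rotated])
  ultimately show ?thesis using AE_circle_iff by blast
qed

lemma comp_alpha_abs:
  assumes "cmod \<beta> > 1" "f \<in> borel_measurable borel"
  shows "comp_alpha \<beta> (abs_circfun f) = abs_circfun (f \<circ> alpha \<beta>)"
proof -
  let ?g = "rep_circfun (abs_circfun f)"
  have "circ_eq f f" using assms(2) by (simp add: circ_eq_def measurable_cong_sets[of circle borel])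
  hence g: "circ_eq ?g f" by (rule Quotient3_rep_abs[OF Quotient3_circfun])
  hence [measurable]: "?g \<in> borel_measurable borel"
    by (simp add: circ_eq_def measurable_cong_sets[of circle borel])
  note [measurable] = assms(2) alpha_measurable
  have "AE t in circle. ?g (alpha \<beta> t) = f (alpha \<beta> t)"
    by (rule AE_circle_alpha[OF assms(1)]) (use g in \<open>auto simp: circ_eq_def\<close>)
  hence "circ_eq (?g \<circ> alpha \<beta>) (f \<circ> alpha \<beta>)"
    by (auto simp: circ_eq_def comp_def measurable_cong_sets[of circle borel])
  thus ?thesis unfolding comp_alpha_def
    by (rule Quotient3_rel_abs[OF Quotient3_circfun])
qed

definition J_alpha :: "complex \<Rightarrow> circfun \<Rightarrow> circfun" where
  "J_alpha \<beta> f = inverse (chi \<beta>) * comp_alpha \<beta> f"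

definition toep :: "circfun \<Rightarrow> circfun \<Rightarrow> circfun" where
  "toep a f = Pproj (a * f)"

definition hank :: "complex \<Rightarrow> circfun \<Rightarrow> circfun \<Rightarrow> circfun" where
  "hank \<beta> a f = Pproj (a * Qproj (J_alpha \<beta> f))"

definition invertible_Linf :: "circfun \<Rightarrow> bool" where
  "invertible_Linf a \<longleftrightarrow> a \<in> Linf \<and> (\<exists>a'\<in>Linf. a * a' = 1)"

definition matching_pair :: "complex \<Rightarrow> circfun \<Rightarrow> circfun \<Rightarrow> bool" where
  "matching_pair \<beta> a b \<longleftrightarrow>
     a \<in> Linf \<and> b \<in> Linf \<and> invertible_Linf a \<and> a * comp_alpha \<beta> a = b * comp_alpha \<beta> b"

definition sub_c :: "circfun \<Rightarrow> circfun \<Rightarrow> circfun" where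
  "sub_c a b = a * inverse b"

definition sub_d :: "complex \<Rightarrow> circfun \<Rightarrow> circfun \<Rightarrow> circfun" where
  "sub_d \<beta> a b = b * inverse (comp_alpha \<beta> a)"

definition fredholm_pair :: "real \<Rightarrow> complex \<Rightarrow> circfun \<Rightarrow> circfun \<Rightarrow> bool" where
  "fredholm_pair p \<beta> a b \<longleftrightarrow> fredholm p (toep (sub_c a b)) \<and> fredholm p (toep (sub_d \<beta> a b))"

text \<open>
  For a sign \<open>s = 1\<close> or \<open>s = -1\<close>, \<open>im_Pa_s\<close> is the image of the projection \<open>(I + s Pa) / 2\<close>
  on the kernel of \<open>toep g\<close> in \<open>Hp p\<close>.
\<close>

definition Pa :: "complex \<Rightarrow> circfun \<Rightarrow> circfun \<Rightarrow> circfun" where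
  "Pa \<beta> g f = J_alpha \<beta> (Qproj (g * Pproj f))"

definition im_Pa_s :: "real \<Rightarrow> complex \<Rightarrow> complex \<Rightarrow> circfun \<Rightarrow> circfun set" where
  "im_Pa_s p \<beta> s g = (\<lambda>f. cscale (1 / 2) (f + cscale s (Pa \<beta> g f))) ` ker_op p (toep g)"

definition wh_fact :: "real \<Rightarrow> circfun \<Rightarrow> int \<Rightarrow> circfun \<Rightarrow> circfun \<Rightarrow> bool" where
  "wh_fact p g n gm gp \<longleftrightarrow>
     fredholm p (toep g) \<and> ind p (toep g) = n \<and>
     g = gm * tvar powi (- n) * gp \<and> fourier gm 0 = 1 \<and>
     gp * inverse gp = 1 \<and> gm * inverse gm = 1 \<and>
     gp \<in> Hp (dual_exp p) \<and> inverse gp \<in> Hp p \<and>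
     gm \<in> Hp_bar p \<and> inverse gm \<in> Hp_bar (dual_exp p) \<and>
     (\<exists>B. bounded_op p B \<and>
        (\<forall>f\<in>circ.span (range (\<lambda>k::nat. tvar ^ k)). B f = inverse gp * Pproj (inverse gm * f)))"

text \<open>The normalisation \<open>fourier gm 0 = 1\<close> makes the factorization, and hence this value, unique.\<close>

definition alpha_sig :: "real \<Rightarrow> complex \<Rightarrow> circfun \<Rightarrow> complex" where
  "alpha_sig p \<beta> g =
     (THE s. \<exists>n gm gp. wh_fact p g n gm gp \<and>
        s = (lam \<beta> / cnj \<beta>) powi n * disc_ext (inverse gp) (1 / cnj \<beta>))"

definition toep_inv :: "real \<Rightarrow> circfun \<Rightarrow> circfun \<Rightarrow> circfun" where
  "toep_inv p g = inv_into (Hp p) (toep g)"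

definition toep_rinv :: "real \<Rightarrow> circfun \<Rightarrow> circfun \<Rightarrow> circfun" where
  "toep_rinv p g f =
     (let \<kappa> = ind p (toep g) in toep_inv p (g * tvar powi \<kappa>) (toep (tvar powi \<kappa>) f))"

text \<open>The function \<open>\<phi>\<close> for the matching pair \<open>(a, b)\<close> on \<open>Hp p\<close>; the sign \<open>s = \<plusminus>1\<close> selects \<open>\<phi>\<^sup>\<plusminus>\<close>.\<close>

definition phi :: "real \<Rightarrow> complex \<Rightarrow> complex \<Rightarrow> circfun \<Rightarrow> circfun \<Rightarrow> circfun \<Rightarrow> circfun" where
  "phi p \<beta> s a b f =
     (let c = sub_c a b;
          g = inverse (comp_alpha \<beta> a) * f;
          h = toep_rinv p c (toep (inverse (comp_alpha \<beta> a)) f)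
      in cscale (1 / 2)
           (h - cscale s (J_alpha \<beta> (Qproj (c * Pproj h))) + cscale s (J_alpha \<beta> (Qproj g))))"

definition set_sum :: "circfun set \<Rightarrow> circfun set \<Rightarrow> circfun set" where
  "set_sum U V = {u + v | u v. u \<in> U \<and> v \<in> V}"

end

theory Submission
  imports Defs "HOL-Complex_Analysis.Complex_Analysis"
begin

text \<open>
  Put \<open>J = J\<^sub>\<alpha>\<close>. On \<open>H\<^sup>q\<close> one has \<open>H\<^sub>\<alpha>(b) f = P (b J f)\<close>, and the adjoint of \<open>T(a) \<plusminus> H\<^sub>\<alpha>(b)\<close> is an
  operator of the same kind. Multiplication by \<open>\<chi>\<^sup>m\<close> identifies its kernel with the part in the
  image of \<open>T(\<chi>\<^sup>m)\<close> of the kernel of the operator with the matching pair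
  \<open>(a\<^sub>1, b\<^sub>1)\<close>, \<open>a\<^sub>1 = cnj a \<chi>\<^sup>-\<^sup>m\<close>, whose subordinated pair is \<open>(c\<^sub>1, d\<^sub>1) = (cnj d \<chi>\<^sup>-\<^sup>2\<^sup>m, cnj c)\<close>.

  A function \<open>f\<close> lies in this kernel iff \<open>g = a\<^sub>1 f \<plusminus> b\<^sub>1 J f\<close> is antianalytic with mean \<open>0\<close>. Then
  \<open>\<plusminus> J g\<close> is analytic and lies in the \<open>\<plusminus>1\<close>-eigenspace of \<open>h \<mapsto> J (d\<^sub>1 h)\<close>, which is the image of the projection
  attached to \<open>d\<^sub>1\<close>; the function \<open>\<phi>\<close> of the right inverse of \<open>T(c\<^sub>1)\<close> inverts this map,
  and \<open>g = 0\<close> means that \<open>f\<close> lies in the \<open>\<mp>1\<close>-eigenspace of \<open>h \<mapsto> J (c\<^sub>1 h)\<close>. The latter is contained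
  in the kernel of \<open>T(c\<^sub>1)\<close>, of dimension \<open>2 m - \<kappa>\<^sub>2 \<le> 1\<close>; in the one-dimensional case it is spanned by the inverse
  plus factor of \<open>cnj d\<close>, and evaluation at \<open>1 / cnj \<beta>\<close> identifies the eigenvalue with the signature.

  For the dimension count with \<open>k = \<kappa>\<^sub>2\<close>, \<open>T(cnj d t\<^sup>-\<^sup>k)\<close> is bijective on \<open>H\<^sup>q\<close>, because \<open>T(d t\<^sup>k)\<close> is
  bijective on \<open>H\<^sup>p\<close> by Coburn's lemma. The passage to the adjoint rests on best approximation in
  \<open>L\<^sup>p\<close> and the uniform boundedness principle instead of the duality of \<open>L\<^sup>p\<close> and \<open>L\<^sup>q\<close>.
\<close>

section \<open>Functions on the circle\<close>

text \<open>Two facts about \<alpha> carry the argument. It exchanges the disc and its exterior, so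
  J exchanges H^q and the antianalytic functions of mean 0; projections can therefore be removed
  from the equations, which become pointwise identities in J. And since \<chi> \<chi>_\<alpha> = 1,
  multiplying one symbol by \<chi>^-m and the other by \<chi>^m keeps the pair matching, which
  powers of t would not do. Yet \<chi>^-1 is t^-1 times the invertible antianalytic factor t
  \<chi>^-1, so for kernels and index \<chi>^-2m counts like t^-2m. This lifts the index of T(cnj d)
  on H^q, which is -\<kappa>_2, to 2 m - \<kappa>_2 in {0, 1}: large enough for the right inverse in
  \<phi>, small enough for a kernel that is at most a line. The obstacle is that Fredholmness is
  given on H^p while the formula lives on H^q. Carrying it over needs the boundedness of the Riesz
  projection on every L^p with p > 1, and a passage from surjectivity of an operator to a lower
  bound for its adjoint. Most of the analysis below serves these two points.\<close>

abbreviation ev :: "circfun \<Rightarrow> complex \<Rightarrow> complex" where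
  "ev \<equiv> rep_circfun"

interpretation circle: prob_space circle
  by (rule prob_space_circle)

lemma prob_circle_UNIV [simp]: "measure circle UNIV = 1"
  using circle.prob_space by simp

lemma cnj_unit: "cmod t = 1 \<Longrightarrow> cnj t = inverse t"
  by (simp add: divide_conv_cnj inverse_eq_divide)

lemma circ_eq_ev: "circ_eq (ev f) (ev f)"
  by (rule Quotient3_rep_reflp[OF Quotient3_circfun])

lemma ev_measurable [measurable]: "ev f \<in> borel_measurable borel"
  using circ_eq_ev[of f] by (simp add: circ_eq_def measurable_cong_sets[of circle borel])

text \<open>A class is handled through an arbitrary representative, so each pointwise rule for
  \<open>ev\<close> holds only almost everywhere.\<close>

lemma ev_abs_AE:
  assumes "f \<in> borel_measurable borel"
  shows "AE t in circle. ev (abs_circfun f) t = f t"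
proof -
  have "circ_eq f f" using assms by (simp add: circ_eq_def measurable_cong_sets[of circle borel])
  hence "circ_eq (ev (abs_circfun f)) f" by (rule Quotient3_rep_abs[OF Quotient3_circfun])
  thus ?thesis by (simp add: circ_eq_def)
qed

lemma circfun_eqI: "(AE t in circle. ev f t = ev g t) \<Longrightarrow> f = g"
  using Quotient3_rel_rep[OF Quotient3_circfun, of f g]
  by (simp add: circ_eq_def measurable_cong_sets[of circle borel])

lemma ev_plus: "AE t in circle. ev (f + g) t = ev f t + ev g t"
  unfolding plus_circfun_def by (simp add: ev_abs_AE)

lemma ev_minus: "AE t in circle. ev (f - g) t = ev f t - ev g t"
  unfolding minus_circfun_def by (simp add: ev_abs_AE)

lemma ev_mult: "AE t in circle. ev (f * g) t = ev f t * ev g t"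
  unfolding times_circfun_def by (simp add: ev_abs_AE)

lemma ev_inverse: "AE t in circle. ev (inverse f) t = inverse (ev f t)"
  unfolding inverse_circfun_def by (simp add: ev_abs_AE)

lemma ev_0: "AE t in circle. ev 0 t = 0"
  unfolding zero_circfun_def by (simp add: ev_abs_AE)

lemma ev_1: "AE t in circle. ev 1 t = 1"
  unfolding one_circfun_def by (simp add: ev_abs_AE)

lemma ev_cscale: "AE t in circle. ev (cscale z f) t = z * ev f t"
  unfolding cscale_def by (simp add: ev_abs_AE)

lemma ev_conj: "AE t in circle. ev (conj_fun f) t = cnj (ev f t)"
  unfolding conj_fun_def by (simp add: ev_abs_AE measurable_cnj_comp)

lemma ev_tvar: "AE t in circle. ev tvar t = t"
  unfolding tvar_def by (simp add: ev_abs_AE)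

lemma ev_sum: "AE t in circle. ev (\<Sum>i\<in>I. f i) t = (\<Sum>i\<in>I. ev (f i) t)"
proof (induction I rule: infinite_finite_induct)
  case (insert x F)
  from ev_plus[of "f x" "sum f F"] insert.IH show ?case by eventually_elim (simp add: insert.hyps)
qed (use ev_0 in auto)

lemma ev_power: "AE t in circle. ev (f ^ n) t = ev f t ^ n"
proof (induction n)
  case (Suc n)
  with ev_mult[of f "f ^ n"] show ?case by eventually_elim simp
qed (simp add: ev_1)

lemma ev_powi: "AE t in circle. ev (f powi n) t = ev f t powi n"
proof (cases "n \<ge> 0")
  case True
  thus ?thesis using ev_power[of f "nat n"] by (simp add: power_int_def)
next
  case False
  show ?thesis using ev_power[of "inverse f" "nat (-n)"] ev_inverse[of f]
    by eventually_elim (use False in \<open>simp add: power_int_def power_inverse\<close>)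
qed

lemma AE_circle_norm: "AE t in circle. cmod t = 1"
  by (subst AE_circle_iff) auto

lemma ev_tvar_powi: "AE t in circle. ev (tvar powi n) t = t powi n"
  using ev_powi[of tvar n] ev_tvar by eventually_elim simp

section \<open>Conjugation, inverses and powers of classes\<close>

named_theorems conj_simps

lemma conj_fun_add [conj_simps]: "conj_fun (f + g) = conj_fun f + conj_fun g"
  by transfer (auto simp: circ_eq_def intro!: measurable_cnj_comp)
lemma conj_fun_mult [conj_simps]: "conj_fun (f * g) = conj_fun f * conj_fun g"
  by transfer (auto simp: circ_eq_def intro!: measurable_cnj_comp)
lemma conj_fun_inverse [conj_simps]: "conj_fun (inverse f) = inverse (conj_fun f)"
  by transfer (auto simp: circ_eq_def intro!: measurable_cnj_comp)
lemma conj_fun_cscale [conj_simps]: "conj_fun (cscale z f) = cscale (cnj z) (conj_fun f)"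
  by transfer (auto simp: circ_eq_def intro!: measurable_cnj_comp)
lemma conj_fun_conj [simp, conj_simps]: "conj_fun (conj_fun f) = f"
  by transfer (auto simp: circ_eq_def intro!: measurable_cnj_comp)
lemma conj_fun_0 [simp]: "conj_fun 0 = 0"
  by transfer (auto simp: circ_eq_def)
lemma conj_fun_1 [simp]: "conj_fun 1 = 1"
  by transfer (auto simp: circ_eq_def)
lemma conj_fun_power [conj_simps]: "conj_fun (f ^ n) = conj_fun f ^ n"
  by (induction n) (auto simp: conj_simps)
lemma circ_inverse_mult: "inverse (f * g) = inverse f * inverse (g :: circfun)"
  by transfer (auto simp: circ_eq_def)
lemma circ_inverse_inverse [simp]: "inverse (inverse f) = (f :: circfun)"
  by transfer (auto simp: circ_eq_def)
lemma circ_inverse_1 [simp]: "inverse 1 = (1 :: circfun)"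
  by transfer (auto simp: circ_eq_def)

lemma circ_inverse_unique: "f * g = 1 \<Longrightarrow> inverse f = (g :: circfun)"
proof (rule circfun_eqI)
  assume *: "f * g = 1"
  show "AE t in circle. ev (inverse f) t = ev g t"
    using ev_mult[of f g] ev_inverse[of f] ev_1 unfolding *
    by eventually_elim (simp add: inverse_unique)
qed

text \<open>The ring of classes has zero divisors and the pointwise inverse of 0 is 0, so
  \<open>f * inverse f = 1\<close> is the algebraic form of being nonzero almost everywhere. It is
  the hypothesis under which factors are cancelled throughout.\<close>

lemma circ_nz_iff: "f * inverse f = (1::circfun) \<longleftrightarrow> (AE t in circle. ev f t \<noteq> 0)"
proof
  assume *: "f * inverse f = 1"
  show "AE t in circle. ev f t \<noteq> 0"
    using ev_mult[of f "inverse f"] ev_inverse[of f] ev_1 unfolding * by eventually_elim auto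
next
  assume *: "AE t in circle. ev f t \<noteq> 0"
  show "f * inverse f = 1"
    by (rule circfun_eqI)
      (use ev_mult[of f "inverse f"] ev_inverse[of f] ev_1 * in eventually_elim, simp)
qed

lemma circ_powi_add:
  assumes "f * inverse f = (1::circfun)"
  shows "f powi (m + n) = f powi m * f powi n"
proof (rule circfun_eqI)
  show "AE t in circle. ev (f powi (m + n)) t = ev (f powi m * f powi n) t"
    using ev_mult[of "f powi m" "f powi n"] ev_powi[of f m] ev_powi[of f n] ev_powi[of f "m+n"]
      assms[unfolded circ_nz_iff]
    by eventually_elim (simp add: power_int_add)
qed

lemma circ_powi_inv:
  assumes "f * inverse f = (1::circfun)"
  shows "f powi n * f powi (- n) = 1"
  using circ_powi_add[OF assms, of n "-n"] by simp

lemma tvar_inverse: "tvar * inverse tvar = 1"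
  unfolding circ_nz_iff using ev_tvar AE_circle_norm by eventually_elim auto

lemma conj_tvar [simp]: "conj_fun tvar = inverse tvar"
proof (rule circfun_eqI)
  show "AE t in circle. ev (conj_fun tvar) t = ev (inverse tvar) t"
    using ev_inverse[of tvar] ev_conj[of tvar] ev_tvar AE_circle_norm
    by eventually_elim (simp add: divide_conv_cnj inverse_eq_divide)
qed

lemma tvar_powi_add: "tvar powi (m + n) = tvar powi m * tvar powi n"
  by (rule circ_powi_add[OF tvar_inverse])

lemma conj_tvar_powi [simp]: "conj_fun (tvar powi n) = tvar powi (- n)"
proof (rule circfun_eqI)
  show "AE t in circle. ev (conj_fun (tvar powi n)) t = ev (tvar powi (-n)) t"
    using ev_conj[of "tvar powi n"] ev_tvar_powi[of "n"] ev_tvar_powi[of "-n"] AE_circle_norm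
    by eventually_elim (simp add: power_int_minus cnj_unit power_int_inverse)
qed

lemma cscale_mult_left: "cscale z f * g = cscale z (f * g)"
  by transfer (auto simp: circ_eq_def)
lemma cscale_mult_right: "f * cscale z g = cscale z (f * g)"
  by transfer (auto simp: circ_eq_def)
lemma cscale_cscale [simp]: "cscale z (cscale w f) = cscale (z * w) f"
  by transfer (auto simp: circ_eq_def)
lemma cscale_1 [simp]: "cscale 1 f = f"
  by transfer (auto simp: circ_eq_def)
lemma cscale_zero [simp]: "cscale z 0 = 0"
  by transfer (auto simp: circ_eq_def)
lemma cscale_add: "cscale z (f + g) = cscale z f + cscale z g"
  by (rule circ.scale_right_distrib)
lemma cscale_diff: "cscale z (f - g) = cscale z f - cscale z g"
  by (rule circ.scale_right_diff_distrib)
lemma cscale_m1: "cscale (-1) f = - f"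
  by transfer (auto simp: circ_eq_def)
lemma cscale_left_add: "cscale (z + w) f = cscale z f + cscale w f"
  by (rule circ.scale_left_distrib)

lemma circ_inverse_cscale: "z \<noteq> 0 \<Longrightarrow> inverse (cscale z f) = cscale (inverse z) (inverse f)"
  by transfer (auto simp: circ_eq_def)

lemma cscale_inj: "f \<noteq> 0 \<Longrightarrow> cscale z f = cscale w f \<longleftrightarrow> z = w"
  by simp

section \<open>Membership, norms and Fourier coefficients in L^p\<close>

lemma Lp_iff: "f \<in> Lp p \<longleftrightarrow> integrable circle (\<lambda>t. cmod (ev f t) powr p)"
  by (simp add: Lp_def in_Lp_def)

lemma Lp_1_iff: "f \<in> Lp 1 \<longleftrightarrow> integrable circle (ev f)"
  unfolding Lp_iff by (simp add: integrable_norm_iff)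

lemma Linf_iff: "f \<in> Linf \<longleftrightarrow> (\<exists>C. AE t in circle. cmod (ev f t) \<le> C)"
  by (simp add: Linf_def ess_bounded_def)

lemma Lp_norm_eq: "Lp_norm p f = (LINT t|circle. cmod (ev f t) powr p) powr (1 / p)"
  by (simp add: Lp_norm_def)

lemma fourier_eq: "fourier f n = (LINT t|circle. ev f t * t powi (- n))"
  by (simp add: fourier_def)

lemma pairing_eq: "pairing f g = (LINT t|circle. ev f t * cnj (ev g t))"
  by (simp add: pairing_def)

lemma fourier_0: "fourier f 0 = (LINT t|circle. ev f t)"
  by (simp add: fourier_eq)

lemma ev_integral_cong:
  fixes F G :: "complex \<Rightarrow> 'a::{banach, second_countable_topology}"
  assumes "AE t in circle. F t = G t" "F \<in> borel_measurable borel" "G \<in> borel_measurable borel"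
  shows "integral\<^sup>L circle F = integral\<^sup>L circle G"
  by (rule integral_cong_AE) (use assms in \<open>simp_all add: measurable_cong_sets[of circle borel]\<close>)

lemma ev_integrable_cong:
  fixes F G :: "complex \<Rightarrow> 'a::{banach, second_countable_topology}"
  assumes "AE t in circle. F t = G t" "F \<in> borel_measurable borel" "G \<in> borel_measurable borel"
  shows "integrable circle F \<longleftrightarrow> integrable circle G"
  by (rule integrable_cong_AE) (use assms in \<open>simp_all add: measurable_cong_sets[of circle borel]\<close>)

lemma powi_measurable [measurable (raw)]:
  "f \<in> borel_measurable M \<Longrightarrow> (\<lambda>x. f x powi n :: complex) \<in> borel_measurable M"
  by (auto simp: power_int_def)

lemma pairing_fourier: "pairing f g = fourier (f * conj_fun g) 0"
  unfolding pairing_eq fourier_0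
proof (rule ev_integral_cong)
  show "AE t in circle. ev f t * cnj (ev g t) = ev (f * conj_fun g) t"
    using ev_mult[of f "conj_fun g"] ev_conj[of g] by eventually_elim simp
qed (measurable; auto)+

lemma fourier_shift: "fourier (f * tvar powi k) n = fourier f (n - k)"
  unfolding fourier_eq
proof (rule ev_integral_cong)
  show "AE t in circle. ev (f * tvar powi k) t * t powi (- n) = ev f t * t powi (- (n - k))"
    using ev_mult[of f "tvar powi k"] ev_tvar_powi[of k] AE_circle_norm
  proof eventually_elim
    case (elim t)
    hence "t powi (k - n) = t powi k * t powi (-n)" by (subst power_int_add[symmetric]) auto
    with elim show ?case by simp
  qed
qed (measurable; auto)+

lemma fourier_conj: "fourier (conj_fun f) n = cnj (fourier f (- n))"
proof -
  have "fourier (conj_fun f) n = (LINT t|circle. cnj (ev f t * t powi n))"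
    unfolding fourier_eq
  proof (rule ev_integral_cong)
    show "AE t in circle. ev (conj_fun f) t * t powi (- n) = cnj (ev f t * t powi n)"
      using ev_conj[of f] AE_circle_norm
    proof eventually_elim
      case (elim t)
      thus ?case by (simp add: cnj_unit power_int_minus power_int_inverse)
    qed
  qed measurable
  also have "\<dots> = cnj (LINT t|circle. ev f t * t powi n)"
    by (rule Bochner_Integration.integral_cnj)
  finally show ?thesis unfolding fourier_eq by simp
qed

lemma cscale_in_Lp: "f \<in> Lp p \<Longrightarrow> cscale z f \<in> Lp p"
proof -
  assume "f \<in> Lp p"
  hence "integrable circle (\<lambda>t. cmod z powr p * cmod (ev f t) powr p)"
    by (simp add: Lp_iff)
  moreover have "AE t in circle. cmod (ev (cscale z f) t) powr p = cmod z powr p * cmod (ev f t) powr p"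
    using ev_cscale[of z f] by eventually_elim (simp add: norm_mult powr_mult)
  ultimately show ?thesis unfolding Lp_iff by (subst ev_integrable_cong) auto
qed

lemma Lp_norm_cscale: "p > 0 \<Longrightarrow> Lp_norm p (cscale z f) = cmod z * Lp_norm p f"
proof -
  assume p: "p > 0"
  have "(LINT t|circle. cmod (ev (cscale z f) t) powr p) =
        (LINT t|circle. cmod z powr p * cmod (ev f t) powr p)"
    by (rule ev_integral_cong) (use ev_cscale[of z f] in \<open>eventually_elim, simp add: norm_mult powr_mult\<close>, measurable)
  also have "\<dots> = cmod z powr p * (LINT t|circle. cmod (ev f t) powr p)"
    by simp
  finally show ?thesis using p
    by (simp add: Lp_norm_eq powr_mult integral_nonneg powr_powr)
qed

lemma Lp_norm_nonneg [simp]: "Lp_norm p f \<ge> 0"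
  by (simp add: Lp_norm_eq)

lemma Lp_norm_powr: "p > 0 \<Longrightarrow> Lp_norm p f powr p = (LINT t|circle. cmod (ev f t) powr p)"
  by (simp add: Lp_norm_eq powr_powr)

lemma Lp_norm_leI:
  assumes "p > 0" "A \<ge> 0" "(LINT t|circle. cmod (ev f t) powr p) \<le> A powr p"
  shows "Lp_norm p f \<le> A"
proof -
  have "Lp_norm p f \<le> (A powr p) powr (1/p)"
    unfolding Lp_norm_eq using assms by (intro powr_mono2) auto
  thus ?thesis using assms by (simp add: powr_powr)
qed

text \<open>Convexity for positive arguments and weights; when one of them vanishes, a weight w in
  [0, 1] satisfies w^p \<le> w.\<close>

lemma powr_convex_comb:
  fixes p x y u v :: real
  assumes "p \<ge> 1" "x \<ge> 0" "y \<ge> 0" "u \<ge> 0" "v \<ge> 0" "u + v = 1"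
  shows "(u * x + v * y) powr p \<le> u * x powr p + v * y powr p"
proof (cases "x = 0 \<or> y = 0 \<or> u = 0 \<or> v = 0")
  case False
  thus ?thesis using powr_convex[OF assms(1)] assms
    by (auto simp: convex_on_def)
next
  case True
  have *: "w powr p \<le> w" if "w \<ge> 0" "w \<le> 1" for w
    using powr_mono'[of 1 p w] that assms by (cases "w = 0") auto
  show ?thesis using True assms *[of u] *[of v]
    by (auto simp: powr_mult intro!: mult_right_mono)
qed

text \<open>Convexity at the points x / A and y / B with weights A / (A + B) and B / (A + B). With A
  and B close to the norms, integrating this gives Minkowski's inequality.\<close>

lemma powr_add_le:
  fixes p x y A B :: real
  assumes "p \<ge> 1" "x \<ge> 0" "y \<ge> 0" "A > 0" "B > 0"
  shows "(x + y) powr p \<le> (A + B) powr p * (A / (A + B) * (x powr p / A powr p) + B / (A + B) * (y powr p / B powr p))"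
proof -
  have "(x + y) = (A + B) * (A / (A + B) * (x / A) + B / (A + B) * (y / B))"
  proof -
    have "A / S * (x / A) = x / S" "B / S * (y / B) = y / S" for S
      using assms by auto
    moreover have "A + B \<noteq> 0" using assms by simp
    ultimately show ?thesis by (simp add: add_divide_distrib[symmetric])
  qed
  hence "(x + y) powr p = (A + B) powr p * (A / (A + B) * (x / A) + B / (A + B) * (y / B)) powr p"
    using assms by (subst powr_mult[symmetric]) auto
  also have "(A / (A + B) * (x / A) + B / (A + B) * (y / B)) powr p \<le>
    A / (A + B) * (x / A) powr p + B / (A + B) * (y / B) powr p"
    using assms by (intro powr_convex_comb) (auto simp: add_divide_distrib[symmetric])
  finally show ?thesis using assms by (simp add: powr_divide mult_left_mono)
qed

lemma Lp_add_aux: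
  assumes p: "p \<ge> 1" and f: "f \<in> Lp p" and g: "g \<in> Lp p"
  shows Lp_add: "f + g \<in> Lp p"
    and Lp_norm_add: "Lp_norm p (f + g) \<le> Lp_norm p f + Lp_norm p g"
proof -
  define R where "R = (\<lambda>A B t. (A + B) powr p *
    (A / (A + B) * (cmod (ev f t) powr p / A powr p) + B / (A + B) * (cmod (ev g t) powr p / B powr p)))"
  have intR: "integrable circle (R A B)" for A B
    using f g unfolding R_def Lp_iff by auto
  have le: "AE t in circle. cmod (ev (f + g) t) powr p \<le> R A B t" if "A > 0" "B > 0" for A B
    using ev_plus[of f g]
  proof eventually_elim
    case (elim t)
    have "cmod (ev (f + g) t) powr p \<le> (cmod (ev f t) + cmod (ev g t)) powr p"
      using elim p by (intro powr_mono2) (auto simp: norm_triangle_ineq)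
    also have "\<dots> \<le> R A B t" unfolding R_def by (rule powr_add_le) (use p that in auto)
    finally show ?case .
  qed
  show 1: "f + g \<in> Lp p"
    unfolding Lp_iff
  proof (rule Bochner_Integration.integrable_bound[OF intR[of 1 1]])
    show "AE t in circle. norm (cmod (ev (f + g) t) powr p) \<le> norm (R 1 1 t)"
      using le[of 1 1] by auto
  qed simp
  show "Lp_norm p (f + g) \<le> Lp_norm p f + Lp_norm p g"
  proof (rule field_le_epsilon)
    fix e :: real assume e: "e > 0"
    \<comment> \<open>A and B exceed the norms, so that they are positive even if a norm
      vanishes.\<close>
    define A where "A = Lp_norm p f + e / 2"
    define B where "B = Lp_norm p g + e / 2"
    have AB: "A > 0" "B > 0" using e Lp_norm_nonneg[of p f] Lp_norm_nonneg[of p g]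
      unfolding A_def B_def by linarith+
    have A: "(LINT t|circle. cmod (ev f t) powr p) / A powr p \<le> 1"
      using p AB e by (subst Lp_norm_powr[symmetric]) (auto simp: A_def intro!: powr_mono2)
    have B: "(LINT t|circle. cmod (ev g t) powr p) / B powr p \<le> 1"
      using p AB e by (subst Lp_norm_powr[symmetric]) (auto simp: B_def intro!: powr_mono2)
    have "(LINT t|circle. cmod (ev (f + g) t) powr p) \<le> (LINT t|circle. R A B t)"
      using 1 AB by (intro integral_mono_AE intR le) (auto simp: Lp_iff)
    also have "\<dots> = (A + B) powr p * (A / (A + B) * ((LINT t|circle. cmod (ev f t) powr p) / A powr p)
       + B / (A + B) * ((LINT t|circle. cmod (ev g t) powr p) / B powr p))"
      unfolding R_def using f g by (simp add: Lp_iff)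
    also have "\<dots> \<le> (A + B) powr p * (A / (A + B) * 1 + B / (A + B) * 1)"
      using AB by (intro mult_left_mono add_mono A B) auto
    also have "\<dots> = (A + B) powr p" using AB by (simp add: add_divide_distrib[symmetric])
    finally have "Lp_norm p (f + g) \<le> A + B"
      using p AB by (intro Lp_norm_leI) auto
    thus "Lp_norm p (f + g) \<le> Lp_norm p f + Lp_norm p g + e"
      by (simp add: A_def B_def)
  qed
qed

lemma Lp_0 [simp]: "0 \<in> Lp p" and Lp_norm_0 [simp]: "Lp_norm p 0 = 0"
proof -
  have e: "AE t in circle. cmod (ev 0 t) powr p = 0"
    using ev_0 by eventually_elim simp
  show "0 \<in> Lp p" unfolding Lp_iff by (subst ev_integrable_cong[OF e]) auto
  show "Lp_norm p 0 = 0" unfolding Lp_norm_eq by (subst ev_integral_cong[OF e]) auto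
qed

lemma Lp_uminus: "f \<in> Lp p \<Longrightarrow> - f \<in> Lp p"
  using cscale_in_Lp[of f p "-1"] by (simp add: cscale_m1)

lemma Lp_norm_uminus: "p > 0 \<Longrightarrow> Lp_norm p (- f) = Lp_norm p f"
  using Lp_norm_cscale[of p "-1" f] by (simp add: cscale_m1)

lemma Lp_diff: "p \<ge> 1 \<Longrightarrow> f \<in> Lp p \<Longrightarrow> g \<in> Lp p \<Longrightarrow> f - g \<in> Lp p"
  using Lp_add[of p f "- g"] by (simp add: Lp_uminus)

lemma Lp_norm_diff: "p \<ge> 1 \<Longrightarrow> f \<in> Lp p \<Longrightarrow> g \<in> Lp p \<Longrightarrow> Lp_norm p (f - g) \<le> Lp_norm p f + Lp_norm p g"
  using Lp_norm_add[of p f "- g"] by (simp add: Lp_uminus Lp_norm_uminus)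

lemma Lp_norm_minus_commute: "p > 0 \<Longrightarrow> Lp_norm p (f - g) = Lp_norm p (g - f)"
  using Lp_norm_uminus[of p "f - g"] by simp

lemma Lp_norm_triangle3:
  assumes "p \<ge> 1" "f \<in> Lp p" "g \<in> Lp p" "h \<in> Lp p"
  shows "Lp_norm p (f - h) \<le> Lp_norm p (f - g) + Lp_norm p (g - h)"
  using Lp_norm_add[of p "f - g" "g - h"] assms by (simp add: Lp_diff)

lemma Lp_norm_triangle_sub:
  assumes "p \<ge> 1" "f \<in> Lp p" "g \<in> Lp p"
  shows "Lp_norm p f \<le> Lp_norm p (f - g) + Lp_norm p g"
  using Lp_norm_add[of p "f - g" g] assms by (simp add: Lp_diff)

lemma Lp_sum: "p \<ge> 1 \<Longrightarrow> (\<And>i. i \<in> I \<Longrightarrow> f i \<in> Lp p) \<Longrightarrow> sum f I \<in> Lp p"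
  by (induction I rule: infinite_finite_induct) (auto intro: Lp_add)

lemma Lp_conj [simp]: "conj_fun f \<in> Lp p \<longleftrightarrow> f \<in> Lp p"
  unfolding Lp_iff
  by (rule ev_integrable_cong) (use ev_conj[of f] in \<open>eventually_elim, simp\<close>, measurable)

lemma Lp_norm_conj [simp]: "Lp_norm p (conj_fun f) = Lp_norm p f"
  unfolding Lp_norm_eq
  by (rule arg_cong[where f = "\<lambda>x. x powr _"], rule ev_integral_cong)
     (use ev_conj[of f] in \<open>eventually_elim, simp\<close>, measurable)

text \<open>The total mass is 1 and x \<le> 1 + x^p for x \<ge> 0.\<close>

lemma Lp_mono:
  assumes "f \<in> Lp p" "p \<ge> 1"
  shows "f \<in> Lp 1"
  unfolding Lp_1_iff
proof (rule Bochner_Integration.integrable_bound)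
  show "integrable circle (\<lambda>t. 1 + cmod (ev f t) powr p)"
    using assms by (auto simp: Lp_iff)
  have "x \<le> 1 + x powr p" if "x \<ge> 0" for x
  proof (cases "x \<le> 1")
    case False
    hence "x powr 1 \<le> x powr p" using assms by (intro powr_mono) auto
    thus ?thesis using that by simp
  qed (simp add: add_increasing2)
  thus "AE t in circle. cmod (ev f t) \<le> norm (1 + cmod (ev f t) powr p)"
    by (auto simp: abs_of_nonneg)
qed simp

lemma bounded_in_Lp:
  assumes "AE t in circle. cmod (ev f t) \<le> C" "p > 0"
  shows "f \<in> Lp p"
  unfolding Lp_iff
proof (rule Bochner_Integration.integrable_bound)
  show "integrable circle (\<lambda>t. C powr p)" by simp
  show "AE t in circle. norm (cmod (ev f t) powr p) \<le> norm (C powr p)"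
    using assms(1) by eventually_elim (use assms(2) in \<open>auto intro!: powr_mono2\<close>)
qed simp

lemma bounded_Lp_norm:
  assumes "AE t in circle. cmod (ev f t) \<le> C" "p > 0"
  shows "Lp_norm p f \<le> C"
proof -
  \<comment> \<open>A statement about a constant that holds almost everywhere holds outright,
    because the measure is not zero.\<close>
  have "AE t in circle. C \<ge> 0" using assms(1) by eventually_elim (use norm_ge_zero order.trans in blast)
  hence C: "C \<ge> 0" by simp
  have "(LINT t|circle. cmod (ev f t) powr p) \<le> (LINT t|circle. C powr p)"
    using bounded_in_Lp[OF assms] assms(1)
    by (intro integral_mono_AE) (auto simp: Lp_iff elim!: eventually_mono intro!: powr_mono2 assms(2)[THEN less_imp_le])
  thus ?thesis using C assms(2) by (intro Lp_norm_leI) (auto simp: circle.prob_space)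
qed

lemma Linf_in_Lp: "f \<in> Linf \<Longrightarrow> p > 0 \<Longrightarrow> f \<in> Lp p"
  using bounded_in_Lp by (auto simp: Linf_iff)

lemma Linf_mult_Lp:
  assumes C: "AE t in circle. cmod (ev a t) \<le> C" and f: "f \<in> Lp p" and p: "p > 0"
  shows "a * f \<in> Lp p" "Lp_norm p (a * f) \<le> C * Lp_norm p f"
proof -
  have "AE t in circle. C \<ge> 0" using assms(1) by eventually_elim (use norm_ge_zero order.trans in blast)
  hence C0: "C \<ge> 0" by simp
  have le: "AE t in circle. cmod (ev (a * f) t) powr p \<le> C powr p * cmod (ev f t) powr p"
    using C ev_mult[of a f]
  proof eventually_elim
    case (elim t)
    have "cmod (ev (a * f) t) powr p \<le> (C * cmod (ev f t)) powr p"
      using elim p by (intro powr_mono2) (auto simp: norm_mult intro!: mult_right_mono)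
    thus ?case using C0 by (simp add: powr_mult)
  qed
  have i: "integrable circle (\<lambda>t. C powr p * cmod (ev f t) powr p)"
    using f by (simp add: Lp_iff)
  show 1: "a * f \<in> Lp p"
    unfolding Lp_iff by (rule Bochner_Integration.integrable_bound[OF i]) (use le in auto)
  have "(LINT t|circle. cmod (ev (a * f) t) powr p) \<le> (LINT t|circle. C powr p * cmod (ev f t) powr p)"
    using 1 by (intro integral_mono_AE i le) (auto simp: Lp_iff)
  also have "\<dots> = (C * Lp_norm p f) powr p"
    using p C0 by (simp add: powr_mult Lp_norm_powr)
  finally show "Lp_norm p (a * f) \<le> C * Lp_norm p f"
    using p C0 by (intro Lp_norm_leI) auto
qed

lemma Linf_mult_in_Lp: "a \<in> Linf \<Longrightarrow> f \<in> Lp p \<Longrightarrow> p > 0 \<Longrightarrow> a * f \<in> Lp p"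
  using Linf_mult_Lp(1) unfolding Linf_iff by blast

lemma Linf_bound: "a \<in> Linf \<Longrightarrow> \<exists>C\<ge>0. AE t in circle. cmod (ev a t) \<le> C"
proof -
  assume "a \<in> Linf"
  then obtain C where C: "AE t in circle. cmod (ev a t) \<le> C" by (auto simp: Linf_iff)
  hence "AE t in circle. C \<ge> 0" by eventually_elim (use norm_ge_zero order.trans in blast)
  with C show ?thesis by auto
qed

lemma Linf_mult: "a \<in> Linf \<Longrightarrow> b \<in> Linf \<Longrightarrow> a * b \<in> Linf"
proof -
  assume "a \<in> Linf" "b \<in> Linf"
  then obtain C D where C: "C \<ge> 0" "AE t in circle. cmod (ev a t) \<le> C"
    and D: "AE t in circle. cmod (ev b t) \<le> D" using Linf_bound by metis
  have "AE t in circle. cmod (ev (a * b) t) \<le> C * D"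
    using C(2) D ev_mult[of a b] by eventually_elim (use C(1) in \<open>auto simp: norm_mult intro!: mult_mono\<close>)
  thus ?thesis by (auto simp: Linf_iff)
qed

lemma Linf_add: "a \<in> Linf \<Longrightarrow> b \<in> Linf \<Longrightarrow> a + b \<in> Linf"
proof -
  assume "a \<in> Linf" "b \<in> Linf"
  then obtain C D where C: "AE t in circle. cmod (ev a t) \<le> C"
    and D: "AE t in circle. cmod (ev b t) \<le> D" using Linf_bound by metis
  have "AE t in circle. cmod (ev (a + b) t) \<le> C + D"
    using C D ev_plus[of a b] by eventually_elim (auto intro!: norm_triangle_le)
  thus ?thesis by (auto simp: Linf_iff)
qed

lemma Linf_conj [simp]: "conj_fun a \<in> Linf \<longleftrightarrow> a \<in> Linf"
proof -
  have "a \<in> Linf \<Longrightarrow> conj_fun a \<in> Linf" for a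
  proof -
    assume "a \<in> Linf"
    then obtain C where C: "AE t in circle. cmod (ev a t) \<le> C" by (auto simp: Linf_iff)
    have "AE t in circle. cmod (ev (conj_fun a) t) \<le> C"
      using C ev_conj[of a] by eventually_elim auto
    thus ?thesis by (auto simp: Linf_iff)
  qed
  from this[of a] this[of "conj_fun a"] show ?thesis by auto
qed

lemma Linf_1 [simp]: "1 \<in> Linf"
  unfolding Linf_iff by (rule exI[of _ 1]) (use ev_1 in \<open>eventually_elim, simp\<close>)

lemma Linf_cscale: "a \<in> Linf \<Longrightarrow> cscale z a \<in> Linf"
proof -
  assume "a \<in> Linf"
  then obtain C where C: "AE t in circle. cmod (ev a t) \<le> C" by (auto simp: Linf_iff)
  have "AE t in circle. cmod (ev (cscale z a) t) \<le> cmod z * C"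
    using C ev_cscale[of z a] by eventually_elim (auto simp: norm_mult intro!: mult_left_mono)
  thus ?thesis by (auto simp: Linf_iff)
qed

lemma Linf_power: "a \<in> Linf \<Longrightarrow> a ^ n \<in> Linf"
  by (induction n) (auto intro: Linf_mult)

lemma tvar_powi_norm: "AE t in circle. cmod (ev (tvar powi n) t) \<le> 1"
  using ev_tvar_powi[of n] AE_circle_norm by eventually_elim (simp add: norm_power_int)

lemma tvar_powi_Linf [simp]: "tvar powi n \<in> Linf"
  unfolding Linf_iff by (rule exI[of _ 1]) (rule tvar_powi_norm)

lemma tvar_Linf [simp]: "tvar \<in> Linf"
  using tvar_powi_Linf[of 1] by simp

lemma L1_mult_ev:
  assumes f: "f \<in> Lp 1" and g: "g \<in> borel_measurable borel" and C: "AE t in circle. cmod (g t) \<le> C"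
  shows "integrable circle (\<lambda>t. ev f t * g t)"
proof (rule Bochner_Integration.integrable_bound)
  show "integrable circle (\<lambda>t. ev f t * complex_of_real C)" using f by (simp add: Lp_1_iff)
  show "AE t in circle. norm (ev f t * g t) \<le> norm (ev f t * complex_of_real C)"
    using C by eventually_elim (auto simp: norm_mult intro!: mult_left_mono)
qed (use g in simp)

lemma fourier_integrable: "f \<in> Lp 1 \<Longrightarrow> integrable circle (\<lambda>t. ev f t * t powi n)"
  by (rule L1_mult_ev[of _ _ 1]) (use AE_circle_norm in \<open>auto elim!: eventually_mono simp: norm_power_int\<close>)

lemma fourier_add: "f \<in> Lp 1 \<Longrightarrow> g \<in> Lp 1 \<Longrightarrow> fourier (f + g) n = fourier f n + fourier g n"
proof -
  assume fg: "f \<in> Lp 1" "g \<in> Lp 1"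
  have "fourier (f + g) n = (LINT t|circle. ev f t * t powi (- n) + ev g t * t powi (- n))"
    unfolding fourier_eq
    by (rule ev_integral_cong) (use ev_plus[of f g] in \<open>eventually_elim, simp add: algebra_simps\<close>, measurable)
  thus ?thesis unfolding fourier_eq using fg by (simp add: fourier_integrable)
qed

lemma fourier_cscale: "fourier (cscale z f) n = z * fourier f n"
proof -
  have "fourier (cscale z f) n = (LINT t|circle. z * (ev f t * t powi (- n)))"
    unfolding fourier_eq
    by (rule ev_integral_cong) (use ev_cscale[of z f] in \<open>eventually_elim, simp add: algebra_simps\<close>, measurable)
  thus ?thesis unfolding fourier_eq by simp
qed

lemma fourier_uminus: "fourier (- f) n = - fourier f n"
  using fourier_cscale[of "-1" f n] by (simp add: cscale_m1)

lemma fourier_diff: "f \<in> Lp 1 \<Longrightarrow> g \<in> Lp 1 \<Longrightarrow> fourier (f - g) n = fourier f n - fourier g n"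
  using fourier_add[of f "- g" n] by (simp add: Lp_uminus fourier_uminus)

lemma fourier_zero [simp]: "fourier 0 n = 0"
  using fourier_cscale[of 0 0 n] by simp

lemma fourier_sum: "(\<And>i. i \<in> I \<Longrightarrow> f i \<in> Lp 1) \<Longrightarrow> fourier (sum f I) n = (\<Sum>i\<in>I. fourier (f i) n)"
  by (induction I rule: infinite_finite_induct) (auto simp: fourier_add Lp_sum)

lemma fourier_bound: "f \<in> Lp 1 \<Longrightarrow> cmod (fourier f n) \<le> Lp_norm 1 f"
proof -
  assume f: "f \<in> Lp 1"
  have "cmod (fourier f n) \<le> (LINT t|circle. cmod (ev f t * t powi (- n)))"
    unfolding fourier_eq by (rule integral_norm_bound)
  also have "\<dots> = (LINT t|circle. cmod (ev f t))"
    by (rule ev_integral_cong)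
       (use AE_circle_norm in \<open>eventually_elim, simp add: norm_mult norm_power_int\<close>, measurable)
  finally show ?thesis by (simp add: Lp_norm_eq)
qed

section \<open>Hoelder's inequality and trigonometric polynomials\<close>

definition conj_exps :: "real \<Rightarrow> real \<Rightarrow> bool" where
  "conj_exps p q \<longleftrightarrow> 1 < p \<and> 1 < q \<and> 1 / p + 1 / q = 1"

lemma conj_exps_sym: "conj_exps p q \<Longrightarrow> conj_exps q p"
  by (auto simp: conj_exps_def)

lemma conj_exps_mult: "conj_exps p q \<Longrightarrow> p * q = p + q"
  by (auto simp: conj_exps_def field_simps)

lemma conj_expsI:
  assumes "1 < p" "1 / p + 1 / q = (1::real)"
  shows "conj_exps p q"
proof -
  have "1 / p < 1" "1 / p > 0" using assms by auto
  hence *: "1 / q > 0" "1 / q < 1" using assms by linarith+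
  hence "q > 0" by (simp add: zero_less_divide_1_iff)
  with * have "q > 1" by (simp add: field_simps)
  thus ?thesis using assms by (simp add: conj_exps_def)
qed

lemma conj_exps_dual: "conj_exps p q \<Longrightarrow> dual_exp p = q"
  using conj_exps_mult[of p q] by (auto simp: conj_exps_def dual_exp_def field_simps)

text \<open>Young's inequality for |f| / A and |g| / B. Letting A and B tend to the norms from above
  avoids a separate treatment of vanishing norms.\<close>

lemma Lp_Holder_aux:
  assumes pq: "conj_exps p q" and f: "f \<in> Lp p" and g: "g \<in> Lp q"
  shows Lp_Holder_in: "f * g \<in> Lp 1" and Lp_Holder: "Lp_norm 1 (f * g) \<le> Lp_norm p f * Lp_norm q g"
proof -
  have pq1: "p > 1" "q > 1" "1 / p + 1 / q = 1" using pq by (auto simp: conj_exps_def)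
  define R where "R = (\<lambda>A B t. A * B * (cmod (ev f t) powr p / A powr p / p + cmod (ev g t) powr q / B powr q / q))"
  have intR: "integrable circle (R A B)" for A B
    using f g unfolding R_def Lp_iff by auto
  have le: "AE t in circle. cmod (ev (f * g) t) \<le> R A B t" if AB: "A > 0" "B > 0" for A B
    using ev_mult[of f g]
  proof eventually_elim
    case (elim t)
    have "cmod (ev (f * g) t) = A * B * ((cmod (ev f t) / A) * (cmod (ev g t) / B))"
      using elim AB by (simp add: norm_mult)
    also have "\<dots> \<le> A * B * ((cmod (ev f t) / A) powr p / p + (cmod (ev g t) / B) powr q / q)"
      using AB pq1 by (intro mult_left_mono Youngs_inequality) auto
    also have "\<dots> = R A B t"
      using AB by (simp add: R_def powr_divide)
    finally show ?case .
  qed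
  show 1: "f * g \<in> Lp 1"
    unfolding Lp_1_iff
  proof (rule Bochner_Integration.integrable_bound[OF intR[of 1 1]])
    show "AE t in circle. cmod (ev (f * g) t) \<le> norm (R 1 1 t)"
      using le[of 1 1] by auto
  qed simp
  have main: "Lp_norm 1 (f * g) \<le> A * B" if A: "A > Lp_norm p f" and B: "B > Lp_norm q g" for A B
  proof -
    have AB: "A > 0" "B > 0" using A B Lp_norm_nonneg[of p f] Lp_norm_nonneg[of q g] by linarith+
    have A': "(LINT t|circle. cmod (ev f t) powr p) / A powr p \<le> 1"
      using pq1 AB A by (subst Lp_norm_powr[symmetric]) (auto intro!: powr_mono2)
    have B': "(LINT t|circle. cmod (ev g t) powr q) / B powr q \<le> 1"
      using pq1 AB B by (subst Lp_norm_powr[symmetric]) (auto intro!: powr_mono2)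
    have "Lp_norm 1 (f * g) = (LINT t|circle. cmod (ev (f * g) t))"
      by (simp add: Lp_norm_eq)
    also have "\<dots> \<le> (LINT t|circle. R A B t)"
      using 1 AB by (intro integral_mono_AE intR le) (auto simp: Lp_1_iff)
    also have "\<dots> = A * B * ((LINT t|circle. cmod (ev f t) powr p) / A powr p / p
       + (LINT t|circle. cmod (ev g t) powr q) / B powr q / q)"
      unfolding R_def using f g by (simp add: Lp_iff)
    also have "\<dots> \<le> A * B * (1 / p + 1 / q)"
      using AB pq1 by (intro mult_left_mono add_mono divide_right_mono A' B') auto
    also have "\<dots> = A * B" using pq1 by simp
    finally show ?thesis .
  qed
  have "((\<lambda>e. (Lp_norm p f + e) * (Lp_norm q g + e)) \<longlongrightarrow> (Lp_norm p f + 0) * (Lp_norm q g + 0)) (at_right 0)"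
    by (intro tendsto_intros)
  hence lim: "((\<lambda>e. (Lp_norm p f + e) * (Lp_norm q g + e)) \<longlongrightarrow> Lp_norm p f * Lp_norm q g) (at_right 0)"
    by simp
  show "Lp_norm 1 (f * g) \<le> Lp_norm p f * Lp_norm q g"
    by (rule tendsto_lowerbound[OF lim])
       (auto simp: eventually_at_right_less main intro!: eventually_mono[OF eventually_at_right_less] main)
qed

lemma pairing_bound:
  assumes "conj_exps p q" "f \<in> Lp p" "g \<in> Lp q"
  shows "cmod (pairing f g) \<le> Lp_norm p f * Lp_norm q g"
proof -
  have "cmod (pairing f g) \<le> Lp_norm 1 (f * conj_fun g)"
    unfolding pairing_fourier using Lp_Holder_in[OF assms(1,2)] assms(3) by (intro fourier_bound) simp
  also have "\<dots> \<le> Lp_norm p f * Lp_norm q g"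
    using Lp_Holder[OF assms(1,2), of "conj_fun g"] assms(3) by simp
  finally show ?thesis .
qed

lemma pairing_add_left:
  assumes "conj_exps p q" "f \<in> Lp p" "g \<in> Lp p" "h \<in> Lp q"
  shows "pairing (f + g) h = pairing f h + pairing g h"
  unfolding pairing_fourier using assms Lp_Holder_in[OF assms(1)]
  by (simp add: distrib_right fourier_add)

lemma pairing_diff_left:
  assumes "conj_exps p q" "f \<in> Lp p" "g \<in> Lp p" "h \<in> Lp q"
  shows "pairing (f - g) h = pairing f h - pairing g h"
  unfolding pairing_fourier using assms Lp_Holder_in[OF assms(1)]
  by (simp add: left_diff_distrib fourier_diff)

lemma pairing_cnj: "pairing g f = cnj (pairing f g)"
  unfolding pairing_fourier using fourier_conj[of "f * conj_fun g" 0]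
  by (simp add: conj_simps mult.commute)

lemma pairing_cscale_left: "pairing (cscale z f) g = z * pairing f g"
  unfolding pairing_fourier by (simp add: cscale_mult_left fourier_cscale)

lemma pairing_cscale_right: "pairing f (cscale z g) = cnj z * pairing f g"
  unfolding pairing_fourier by (simp add: conj_simps cscale_mult_right fourier_cscale)

lemma pairing_diff_right:
  assumes "conj_exps p q" "f \<in> Lp p" "g \<in> Lp q" "h \<in> Lp q"
  shows "pairing f (g - h) = pairing f g - pairing f h"
  using pairing_diff_left[OF conj_exps_sym[OF assms(1)] assms(3,4,2)]
  by (metis pairing_cnj complex_cnj_diff)

lemma pairing_add_right:
  assumes "conj_exps p q" "f \<in> Lp p" "g \<in> Lp q" "h \<in> Lp q"
  shows "pairing f (g + h) = pairing f g + pairing f h"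
  using pairing_add_left[OF conj_exps_sym[OF assms(1)] assms(3,4,2)]
  by (metis pairing_cnj complex_cnj_add)

lemma pairing_0_left [simp]: "pairing 0 g = 0"
  by (simp add: pairing_fourier)

lemma pairing_0_right [simp]: "pairing g 0 = 0"
  by (simp add: pairing_fourier)

lemma Lp_norm_1_le:
  assumes "f \<in> Lp p" "p \<ge> 1"
  shows "Lp_norm 1 f \<le> Lp_norm p f"
proof (cases "p = 1")
  case False
  define q where "q = p / (p - 1)"
  have pq: "conj_exps p q" using assms False by (auto simp: conj_exps_def q_def field_simps)
  have "AE t in circle. cmod (ev 1 t) \<le> 1" using ev_1 by eventually_elim simp
  hence "Lp_norm q 1 \<le> 1" "1 \<in> Lp q"
    using pq by (auto intro!: bounded_Lp_norm bounded_in_Lp simp: conj_exps_def)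
  thus ?thesis using Lp_Holder[OF pq assms(1), of 1] mult_left_le[of "Lp_norm q 1" "Lp_norm p f"]
    by simp
qed simp

lemma Lp_norm_eq_0:
  assumes "f \<in> Lp p" "Lp_norm p f = 0" "p > 0"
  shows "f = 0"
proof (rule circfun_eqI)
  have "(LINT t|circle. cmod (ev f t) powr p) = 0"
    using Lp_norm_powr[OF assms(3), of f] assms by simp
  hence "AE t in circle. cmod (ev f t) powr p = 0"
    using assms(1) by (subst (asm) integral_nonneg_eq_0_iff_AE) (auto simp: Lp_iff)
  thus "AE t in circle. ev f t = ev 0 t"
    using ev_0 by eventually_elim simp
qed

text \<open>Norm bounds pass to almost everywhere limits without a dominating function; this is how
  the limit in \<open>Lp_complete\<close> is controlled.\<close>

lemma Lp_Fatou:
  assumes p: "p > 0" and f: "\<And>n. f n \<in> Lp p" and A: "\<And>n::nat. Lp_norm p (f n) \<le> A"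
    and lim: "AE t in circle. (\<lambda>n. ev (f n) t) \<longlonglongrightarrow> ev g t"
  shows "g \<in> Lp p" "Lp_norm p g \<le> A"
proof -
  have A0: "A \<ge> 0" using A[of 0] Lp_norm_nonneg order_trans by blast
  have "(\<integral>\<^sup>+t. ennreal (cmod (ev g t) powr p) \<partial>circle)
      = (\<integral>\<^sup>+t. liminf (\<lambda>n. ennreal (cmod (ev (f n) t) powr p)) \<partial>circle)"
  proof (rule nn_integral_cong_AE)
    show "AE t in circle. ennreal (cmod (ev g t) powr p) = liminf (\<lambda>n. ennreal (cmod (ev (f n) t) powr p))"
      using lim
    proof eventually_elim
      case (elim t)
      have "(\<lambda>n. ennreal (cmod (ev (f n) t) powr p)) \<longlonglongrightarrow> ennreal (cmod (ev g t) powr p)"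
        using p by (intro tendsto_ennrealI tendsto_powr' tendsto_norm elim tendsto_const) auto
      thus ?case by (intro lim_imp_Liminf[symmetric]) auto
    qed
  qed
  also have "\<dots> \<le> liminf (\<lambda>n. \<integral>\<^sup>+t. ennreal (cmod (ev (f n) t) powr p) \<partial>circle)"
    by (rule nn_integral_liminf) simp
  also have "\<dots> \<le> liminf (\<lambda>n::nat. ennreal (A powr p))"
  proof (rule Liminf_mono, rule always_eventually, rule allI)
    fix n
    have "(\<integral>\<^sup>+t. ennreal (cmod (ev (f n) t) powr p) \<partial>circle) = ennreal (Lp_norm p (f n) powr p)"
      using f[of n] p by (subst nn_integral_eq_integral) (auto simp: Lp_iff Lp_norm_powr)
    also have "\<dots> \<le> ennreal (A powr p)"
      using p A[of n] by (intro ennreal_leI powr_mono2) auto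
    finally show "(\<integral>\<^sup>+t. ennreal (cmod (ev (f n) t) powr p) \<partial>circle) \<le> ennreal (A powr p)" .
  qed
  also have "\<dots> = ennreal (A powr p)" by (simp add: Liminf_const)
  finally have le: "(\<integral>\<^sup>+t. ennreal (cmod (ev g t) powr p) \<partial>circle) \<le> ennreal (A powr p)" .
  have int: "integrable circle (\<lambda>t. cmod (ev g t) powr p)"
    using le by (intro integrableI_bounded) (auto simp: top.not_eq_extremum order.strict_trans1)
  thus "g \<in> Lp p" by (simp add: Lp_iff)
  have "ennreal (LINT t|circle. cmod (ev g t) powr p) \<le> ennreal (A powr p)"
    using le int by (subst (asm) nn_integral_eq_integral) auto
  hence "(LINT t|circle. cmod (ev g t) powr p) \<le> A powr p"
    by (subst (asm) ennreal_le_iff) auto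
  thus "Lp_norm p g \<le> A" using p A0 by (intro Lp_norm_leI)
qed

lemma L1_AE_norm:
  assumes "f \<in> Lp 1" "g \<in> Lp 1"
  shows "(LINT t|circle. cmod (ev f t - ev g t)) = Lp_norm 1 (f - g)"
  unfolding Lp_norm_eq powr_one by simp
    (rule ev_integral_cong, use ev_minus[of f g] in \<open>eventually_elim, simp\<close>, measurable)

text \<open>A Cauchy sequence in L^p is one in L^1, hence has a subsequence converging almost
  everywhere; its pointwise limit is the limit in L^p.\<close>

lemma Lp_complete:
  assumes p: "p \<ge> 1" and f: "\<And>n::nat. f n \<in> Lp p"
    and C: "\<And>e. e > 0 \<Longrightarrow> \<exists>N. \<forall>m\<ge>N. \<forall>n\<ge>N. Lp_norm p (f m - f n) < e"
  shows "\<exists>g\<in>Lp p. (\<lambda>n. Lp_norm p (f n - g)) \<longlonglongrightarrow> 0"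
proof -
  have f1: "f n \<in> Lp 1" for n using Lp_mono f p by blast
  have C1: "\<exists>N. \<forall>i\<ge>N. \<forall>j\<ge>N. (LINT t|circle. norm (ev (f i) t - ev (f j) t)) < e" if e: "e > 0" for e
  proof -
    obtain N where N: "\<And>m n. m \<ge> N \<Longrightarrow> n \<ge> N \<Longrightarrow> Lp_norm p (f m - f n) < e" using C[OF e] by blast
    have "(LINT t|circle. norm (ev (f i) t - ev (f j) t)) < e" if "i \<ge> N" "j \<ge> N" for i j
    proof -
      have "(LINT t|circle. norm (ev (f i) t - ev (f j) t)) = Lp_norm 1 (f i - f j)"
        by (rule L1_AE_norm) (use f1 in auto)
      also have "\<dots> \<le> Lp_norm p (f i - f j)" using f p by (intro Lp_norm_1_le Lp_diff)
      also have "\<dots> < e" by (rule N) (use that in auto)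
      finally show ?thesis .
    qed
    thus ?thesis by blast
  qed
  obtain r where r: "strict_mono r" "AE t in circle. Cauchy (\<lambda>i. ev (f (r i)) t)"
    by (rule cauchy_L1_AE_cauchy_subseq[of circle "\<lambda>n. ev (f n)"]) (use f1 C1 in \<open>auto simp: Lp_1_iff\<close>)
  define g where "g = abs_circfun (\<lambda>t. lim (\<lambda>i. ev (f (r i)) t))"
  have lim: "AE t in circle. (\<lambda>i. ev (f (r i)) t) \<longlonglongrightarrow> ev g t"
    using r(2) ev_abs_AE[of "\<lambda>t. lim (\<lambda>i. ev (f (r i)) t)"] unfolding g_def
    by (auto elim!: eventually_elim2 simp: Cauchy_convergent_iff convergent_LIMSEQ_iff)
  \<comment> \<open>Fatou's lemma along the subsequence, shifted by N so that all its indices lie in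
    the Cauchy range.\<close>
  have key: "f n - g \<in> Lp p \<and> Lp_norm p (f n - g) \<le> e"
    if N: "\<And>m n. m \<ge> N \<Longrightarrow> n \<ge> N \<Longrightarrow> Lp_norm p (f m - f n) < e" and n: "n \<ge> N" for N n e
  proof -
    have "AE t in circle. \<forall>k. ev (f n - f (r (k + N))) t = ev (f n) t - ev (f (r (k + N))) t"
      by (subst AE_all_countable) (use ev_minus in blast)
    hence l: "AE t in circle. (\<lambda>k. ev (f n - f (r (k + N))) t) \<longlonglongrightarrow> ev (f n - g) t"
      using lim ev_minus[of "f n" g]
    proof eventually_elim
      case (elim t)
      have "(\<lambda>k. ev (f (r (k + N))) t) \<longlonglongrightarrow> ev g t" using elim(2) by (rule LIMSEQ_ignore_initial_segment)
      thus ?case unfolding elim(3) using elim(1) by (simp add: tendsto_diff)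
    qed
    have rN: "r (k + N) \<ge> N" for k using seq_suble[OF r(1), of "k + N"] by simp
    have b: "Lp_norm p (f n - f (r (k + N))) \<le> e" for k
      using N[OF n rN[of k]] by simp
    have d: "f n - f (r (k + N)) \<in> Lp p" for k using p f by (intro Lp_diff)
    show ?thesis using Lp_Fatou[OF _ d b l] p by simp
  qed
  obtain N1 where N1: "\<And>m n. m \<ge> N1 \<Longrightarrow> n \<ge> N1 \<Longrightarrow> Lp_norm p (f m - f n) < 1" using C[of 1] by auto
  have "f N1 - g \<in> Lp p" using key[of N1 1 N1] N1 by auto
  hence "f N1 - (f N1 - g) \<in> Lp p" by (rule Lp_diff[OF p f])
  hence "g \<in> Lp p" by simp
  moreover have "(\<lambda>n. Lp_norm p (f n - g)) \<longlonglongrightarrow> 0"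
  proof (rule LIMSEQ_I)
    fix e :: real assume "e > 0"
    then obtain N where N: "\<And>m n. m \<ge> N \<Longrightarrow> n \<ge> N \<Longrightarrow> Lp_norm p (f m - f n) < e / 2"
      using C[of "e / 2"] by auto
    have "norm (Lp_norm p (f n - g) - 0) < e" if "n \<ge> N" for n
      using key[OF N that] \<open>e > 0\<close> by auto
    thus "\<exists>N. \<forall>n\<ge>N. norm (Lp_norm p (f n - g) - 0) < e" by blast
  qed
  ultimately show ?thesis by blast
qed

section \<open>Mean values of holomorphic functions and trigonometric polynomials\<close>

lemma circle_integral_interval:
  fixes g :: "complex \<Rightarrow> complex"
  assumes g: "continuous_on (sphere 0 1) g" and [measurable]: "g \<in> borel_measurable borel"
  shows "(LINT t|circle. g t) = (1 / (2 * pi)) *\<^sub>R integral {0..2*pi} (\<lambda>x. g (cis x))"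
proof -
  have cc: "continuous_on {0..2*pi} (\<lambda>x. g (cis x))"
    by (rule continuous_on_compose2[OF g]) (auto intro: continuous_intros)
  have um: "uniform_measure lborel {0..2*pi} = density lborel (\<lambda>x. ennreal (indicator {0..2*pi} x / (2 * pi)))"
    unfolding uniform_measure_def
    by (intro arg_cong[where f = "density lborel"] ext)
       (auto simp: indicator_def divide_ennreal[symmetric] ennreal_1[symmetric] simp del: ennreal_1)
  have "(LINT t|circle. g t) = (LINT x|uniform_measure lborel {0..2*pi}. g (cis x))"
    unfolding circle_def by (subst integral_distr) auto
  also have "\<dots> = (LINT x|lborel. (indicator {0..2*pi} x / (2 * pi)) *\<^sub>R g (cis x))"
    unfolding um by (subst integral_density) auto
  also have "\<dots> = (1 / (2 * pi)) *\<^sub>R (LINT x:{0..2*pi}|lborel. g (cis x))"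
    unfolding set_lebesgue_integral_def by (subst integral_scaleR_right[symmetric]) (simp add: field_simps)
  also have "(LINT x:{0..2*pi}|lborel. g (cis x)) = integral {0..2*pi} (\<lambda>x. g (cis x))"
    by (rule set_borel_integral_eq_integral) (rule borel_integrable_atLeastAtMost'[OF cc])
  finally show ?thesis .
qed

text \<open>Cauchy's integral formula at the centre: along t = cis x the factor i t coming from dt
  cancels the denominator.\<close>

lemma circle_mean_value:
  assumes g: "g holomorphic_on cball 0 1" and [measurable]: "g \<in> borel_measurable borel"
  shows "(LINT t|circle. g t) = g 0"
proof -
  have "((\<lambda>u. g u / (u - 0)) has_contour_integral (2 * of_real pi * \<i> * g 0)) (circlepath 0 1)"
    by (rule Cauchy_integral_circlepath_simple[OF g]) simp
  hence "((\<lambda>t. g (cis t) / cis t * \<i> * cis t) has_integral (2 * of_real pi * \<i> * g 0)) {0..2*pi}"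
    unfolding circlepath_def by (subst (asm) has_contour_integral_part_circlepath_iff) auto
  hence "((\<lambda>t. g (cis t) * \<i>) has_integral (2 * of_real pi * \<i> * g 0)) {0..2*pi}"
    by simp
  from has_integral_mult_left[OF this, of "- \<i>"]
  have "((\<lambda>t. g (cis t)) has_integral (2 * of_real pi * g 0)) {0..2*pi}"
    by (simp add: algebra_simps)
  hence "integral {0..2*pi} (\<lambda>x. g (cis x)) = 2 * of_real pi * g 0"
    by (rule integral_unique)
  moreover have "continuous_on (sphere 0 1) g"
    using holomorphic_on_imp_continuous_on[OF g] by (rule continuous_on_subset) auto
  ultimately show ?thesis
    by (subst circle_integral_interval) (auto simp: scaleR_conv_of_real)
qed

text \<open>A shift reduces every coefficient to a mean. Positive powers have mean 0 by the mean
  value property, negative ones by conjugation.\<close>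

lemma fourier_tvar_powi: "fourier (tvar powi k) n = (if n = k then 1 else 0)"
proof -
  have pos: "fourier (tvar powi k) 0 = 0" if "k > 0" for k
  proof -
    have "fourier (tvar powi k) 0 = (LINT t|circle. t powi k)"
      unfolding fourier_0 by (rule ev_integral_cong) (use ev_tvar_powi in auto)
    also have "\<dots> = 0 powi k"
      using that by (intro circle_mean_value) (auto simp: power_int_def intro!: holomorphic_intros)
    finally show ?thesis using that by simp
  qed
  have "fourier (tvar powi k) n = fourier (1 * tvar powi (k - n)) 0"
    using fourier_shift[of 1 k n] fourier_shift[of 1 "k - n" 0] by simp
  also have "\<dots> = (if n = k then 1 else 0)"
  proof -
    consider "n = k" | "k - n > 0" | "n - k > 0" by linarith
    thus ?thesis
    proof cases
      case 1
      have "fourier 1 0 = (LINT t|circle. 1)" unfolding fourier_0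
        by (rule ev_integral_cong) (use ev_1 in auto)
      thus ?thesis using 1 by simp
    next
      case 2 thus ?thesis using pos[of "k - n"] by auto
    next
      case 3 thus ?thesis using pos[of "n - k"] fourier_conj[of "tvar powi (n - k)" 0] by auto
    qed
  qed
  finally show ?thesis .
qed

definition TP :: "circfun set" where
  "TP = circ.span (range (\<lambda>k::int. tvar powi k))"

lemma TP_powi [simp]: "tvar powi k \<in> TP"
  unfolding TP_def by (rule circ.span_base) auto

lemma TP_1 [simp]: "1 \<in> TP"
  using TP_powi[of 0] by simp

lemma TP_add: "f \<in> TP \<Longrightarrow> g \<in> TP \<Longrightarrow> f + g \<in> TP"
  unfolding TP_def by (rule circ.span_add)

lemma TP_diff: "f \<in> TP \<Longrightarrow> g \<in> TP \<Longrightarrow> f - g \<in> TP"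
  unfolding TP_def by (rule circ.span_diff)

lemma TP_cscale: "f \<in> TP \<Longrightarrow> cscale z f \<in> TP"
  unfolding TP_def by (rule circ.span_scale)

lemma TP_0 [simp]: "0 \<in> TP"
  unfolding TP_def by (rule circ.span_zero)

lemma TP_sum: "(\<And>i. i \<in> I \<Longrightarrow> f i \<in> TP) \<Longrightarrow> sum f I \<in> TP"
  unfolding TP_def by (rule circ.span_sum)

lemma TP_induct [consumes 1, case_names zero step]:
  assumes "f \<in> TP" "P 0" "\<And>z k g. g \<in> TP \<Longrightarrow> P g \<Longrightarrow> P (cscale z (tvar powi k) + g)"
  shows "P f"
proof -
  have "f \<in> TP \<and> P f"
    using assms(1) unfolding TP_def
  proof (induction rule: circ.span_induct_alt)
    case base thus ?case using assms(2) TP_0 by (simp add: TP_def)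
  next
    case (step c x y)
    then obtain k where "x = tvar powi k" by auto
    thus ?case using step assms(3)[of y c k] TP_add[of "cscale c x" y] TP_cscale[of x c] TP_powi[of k]
      by (auto simp: TP_def)
  qed
  thus ?thesis by simp
qed

lemma TP_mult:
  assumes "f \<in> TP" "g \<in> TP" shows "f * g \<in> TP"
proof -
  have *: "tvar powi k * g \<in> TP" for k
    using assms(2)
  proof (induction rule: TP_induct)
    case (step z l g)
    have "tvar powi k * (cscale z (tvar powi l) + g) = cscale z (tvar powi (k + l)) + tvar powi k * g"
      by (simp add: distrib_left cscale_mult_right tvar_powi_add)
    thus ?case using step by (auto intro!: TP_add TP_cscale)
  qed auto
  show ?thesis using assms(1)
    by (induction rule: TP_induct) (auto simp: distrib_right cscale_mult_left intro!: TP_add TP_cscale *)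
qed

lemma TP_Linf: "f \<in> TP \<Longrightarrow> f \<in> Linf"
  by (induction rule: TP_induct)
     (auto intro!: Linf_add Linf_cscale simp: Linf_cscale[of 1 0, simplified])

lemma TP_Lp: "f \<in> TP \<Longrightarrow> p > 0 \<Longrightarrow> f \<in> Lp p"
  using TP_Linf Linf_in_Lp by blast

lemma TP_conj: "f \<in> TP \<Longrightarrow> conj_fun f \<in> TP"
  by (induction rule: TP_induct) (auto simp: conj_fun_add conj_fun_cscale intro!: TP_add TP_cscale)

text \<open>The symmetric range of exponents makes the Riesz projection act by dropping the negative
  half, see \<open>Pproj_TP_expand\<close>.\<close>

lemma TP_expand:
  assumes "f \<in> TP"
  shows "\<exists>N c. f = (\<Sum>k\<in>{-int N..int N}. cscale (c k) (tvar powi k))"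
  using assms
proof (induction rule: TP_induct)
  case zero
  show ?case by (rule exI[of _ 0], rule exI[of _ "\<lambda>_. 0"]) simp
next
  case (step z n g)
  then obtain N c where g: "g = (\<Sum>k\<in>{-int N..int N}. cscale (c k) (tvar powi k))" by blast
  define N' where "N' = max N (nat \<bar>n\<bar>)"
  have 1: "g = (\<Sum>k\<in>{-int N'..int N'}. if k \<in> {-int N..int N} then cscale (c k) (tvar powi k) else 0)"
    unfolding g by (rule sum.mono_neutral_cong_left) (auto simp: N'_def)
  have "cscale z (tvar powi n) = (\<Sum>k\<in>{n}. cscale z (tvar powi k))" by simp
  also have "\<dots> = (\<Sum>k\<in>{-int N'..int N'}. if k = n then cscale z (tvar powi k) else 0)"
    by (rule sum.mono_neutral_cong_left) (auto simp: N'_def)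
  also have "\<dots> = (\<Sum>k\<in>{-int N'..int N'}. cscale (if k = n then z else 0) (tvar powi k))"
    by (rule sum.cong) auto
  finally have 2: "cscale z (tvar powi n) = \<dots>" .
  have "g = (\<Sum>k\<in>{-int N'..int N'}. cscale (if k \<in> {-int N..int N} then c k else 0) (tvar powi k))"
    by (subst 1, rule sum.cong) auto
  hence "cscale z (tvar powi n) + g = (\<Sum>k\<in>{-int N'..int N'}.
     cscale ((if k = n then z else 0) + (if k \<in> {-int N..int N} then c k else 0)) (tvar powi k))"
    by (subst 2) (simp only: cscale_left_add sum.distrib)
  thus ?case by (intro exI)
qed

lemma fourier_trig_sum:
  assumes "finite K"
  shows "fourier (\<Sum>k\<in>K. cscale (c k) (tvar powi k)) n = (if n \<in> K then c n else 0)"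
proof -
  have "fourier (\<Sum>k\<in>K. cscale (c k) (tvar powi k)) n = (\<Sum>k\<in>K. fourier (cscale (c k) (tvar powi k)) n)"
    by (rule fourier_sum) (auto intro!: TP_Lp TP_cscale)
  also have "\<dots> = (\<Sum>k\<in>K. if k = n then c n else 0)"
    by (rule sum.cong) (auto simp: fourier_cscale fourier_tvar_powi)
  finally show ?thesis using assms by simp
qed

text \<open>On the circle cnj t = 1 / t, so a real linear function of t is a combination of t and
  t^-1, and real polynomials restrict to trigonometric ones. This makes the Stone-Weierstrass
  theorem available.\<close>

lemma TP_real_poly:
  assumes "real_polynomial_function (r :: complex \<Rightarrow> real)"
  shows "abs_circfun (\<lambda>t. complex_of_real (r t)) \<in> TP"
proof -
  have meas: "r \<in> borel_measurable borel" if "real_polynomial_function r" for r :: "complex \<Rightarrow> real"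
    using that by (intro borel_measurable_continuous_onI continuous_on_polymonial_function)
      (simp add: real_polynomial_function_eq)
  show ?thesis using assms
  proof (induction rule: real_polynomial_function.induct)
    case (linear f)
    note bl = linear
    interpret bounded_linear f by (rule bl)
    let ?a = "complex_of_real (f 1)" and ?b = "complex_of_real (f \<i>)"
    let ?g = "cscale ((?a - \<i> * ?b) / 2) (tvar powi 1) + cscale ((?a + \<i> * ?b) / 2) (tvar powi (-1))"
    have m [measurable]: "(\<lambda>t. complex_of_real (f t)) \<in> borel_measurable borel"
      using meas[of f] real_polynomial_function.intros(1)[OF bl] by measurable
    have "abs_circfun (\<lambda>t. complex_of_real (f t)) = ?g"
    proof (rule circfun_eqI)
      show "AE t in circle. ev (abs_circfun (\<lambda>t. complex_of_real (f t))) t = ev ?g t"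
        using ev_abs_AE[OF m] AE_circle_norm
         ev_plus[of "cscale ((?a - \<i> * ?b) / 2) (tvar powi 1)" "cscale ((?a + \<i> * ?b) / 2) (tvar powi (-1))"]
         ev_cscale[of "(?a - \<i> * ?b) / 2" "tvar powi 1"] ev_cscale[of "(?a + \<i> * ?b) / 2" "tvar powi (-1)"]
         ev_tvar_powi[of 1] ev_tvar_powi[of "-1"]
      proof eventually_elim
        case (elim t)
        have "t = Re t *\<^sub>R 1 + Im t *\<^sub>R \<i>" by (simp add: complex_eq_iff)
        hence "f t = Re t * f 1 + Im t * f \<i>" by (metis add scaleR real_scaleR_def)
        moreover have "inverse t = cnj t" using elim(2) by (simp add: cnj_unit)
        ultimately show ?case using elim
          by (simp add: complex_eq_iff power_int_minus field_simps)
      qed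
    qed
    thus ?case by (auto intro!: TP_add TP_cscale TP_powi simp del: power_int_1_right power_int_minus1_right)
  next
    case (const c)
    have "abs_circfun (\<lambda>t. complex_of_real c) = cscale (of_real c) 1"
      by (rule circfun_eqI)
         (use ev_abs_AE[OF borel_measurable_const[of "complex_of_real c"]] ev_cscale[of "of_real c" 1] ev_1 in \<open>eventually_elim, simp\<close>)
    thus ?case by (auto intro!: TP_cscale)
  next
    case (add f g)
    note [measurable] = meas[OF add(1)] meas[OF add(2)]
    have m: "(\<lambda>t. complex_of_real (f t)) \<in> borel_measurable borel" "(\<lambda>t. complex_of_real (g t)) \<in> borel_measurable borel"
      "(\<lambda>t. complex_of_real (f t + g t)) \<in> borel_measurable borel" by measurable
    have "abs_circfun (\<lambda>t. complex_of_real (f t + g t)) = abs_circfun (\<lambda>t. of_real (f t)) + abs_circfun (\<lambda>t. of_real (g t))"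
      by (rule circfun_eqI)
         (use m[THEN ev_abs_AE] ev_plus[of "abs_circfun (\<lambda>t. of_real (f t))" "abs_circfun (\<lambda>t. of_real (g t))"]
           in \<open>eventually_elim, simp\<close>)
    thus ?case using add by (auto intro: TP_add)
  next
    case (mult f g)
    note [measurable] = meas[OF mult(1)] meas[OF mult(2)]
    have m: "(\<lambda>t. complex_of_real (f t)) \<in> borel_measurable borel" "(\<lambda>t. complex_of_real (g t)) \<in> borel_measurable borel"
      "(\<lambda>t. complex_of_real (f t * g t)) \<in> borel_measurable borel" by measurable
    have "abs_circfun (\<lambda>t. complex_of_real (f t * g t)) = abs_circfun (\<lambda>t. of_real (f t)) * abs_circfun (\<lambda>t. of_real (g t))"
      by (rule circfun_eqI)
         (use m[THEN ev_abs_AE] ev_mult[of "abs_circfun (\<lambda>t. of_real (f t))" "abs_circfun (\<lambda>t. of_real (g t))"]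
           in \<open>eventually_elim, simp\<close>)
    thus ?case using mult by (auto intro: TP_mult)
  qed
qed

text \<open>Both the class w and the function r are returned: uniform estimates need values at every
  point of the circle, algebra needs the class.\<close>

lemma TP_approx_real:
  fixes u :: "complex \<Rightarrow> real"
  assumes "continuous_on (sphere 0 1) u" "e > 0"
  obtains w r where "w \<in> TP" "\<And>t. cmod t = 1 \<Longrightarrow> \<bar>u t - r t\<bar> < e"
    "AE t in circle. ev w t = complex_of_real (r t)" "r \<in> borel_measurable borel"
proof -
  obtain r where r: "real_polynomial_function r" "\<And>t. t \<in> sphere 0 1 \<Longrightarrow> \<bar>u t - r t\<bar> < e"
    using Stone_Weierstrass_real_polynomial_function[OF _ assms] by (metis compact_sphere)
  have m [measurable]: "r \<in> borel_measurable borel"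
    using r(1) by (intro borel_measurable_continuous_onI continuous_on_polymonial_function)
      (simp add: real_polynomial_function_eq)
  show ?thesis
    by (rule that[of "abs_circfun (\<lambda>t. complex_of_real (r t))" r])
       (use r m in \<open>auto intro!: TP_real_poly ev_abs_AE\<close>)
qed

section \<open>Integrable functions are determined by their Fourier coefficients\<close>

definition bump :: "complex set \<Rightarrow> nat \<Rightarrow> complex \<Rightarrow> real" where
  "bump C n t = max 0 (1 - real n * infdist t C)"

lemma bump_bounds: "0 \<le> bump C n t" "bump C n t \<le> 1"
  by (auto simp: bump_def infdist_nonneg)

lemma bump_continuous [continuous_intros]: "continuous_on S (bump C n)"
  unfolding bump_def by (intro continuous_intros)

lemma bump_measurable [measurable]: "bump C n \<in> borel_measurable borel"
  by (intro borel_measurable_continuous_onI continuous_intros)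

lemma bump_tendsto:
  assumes "closed C" "C \<noteq> {}"
  shows "(\<lambda>n. bump C n t) \<longlonglongrightarrow> indicator C t"
proof (cases "t \<in> C")
  case True
  thus ?thesis by (simp add: bump_def)
next
  case False
  hence pos: "infdist t C > 0" using assms infdist_pos_not_in_closed by blast
  obtain N where N: "real N * infdist t C > 1" using pos reals_Archimedean3 by blast
  have "\<forall>\<^sub>F n in sequentially. bump C n t = 0"
    using eventually_ge_at_top[of N]
  proof eventually_elim
    case (elim n)
    have "real N * infdist t C \<le> real n * infdist t C" using elim pos by (intro mult_right_mono) auto
    thus ?case using N by (simp add: bump_def)
  qed
  thus ?thesis using False by (simp add: tendsto_eventually)
qed

text \<open>A finite complex measure \<open>f \<cdot> |dt|\<close> that annihilates trigonometric polynomials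
  annihilates continuous functions, hence closed sets, hence all Borel sets.\<close>

lemma fourier_eq_0_imp_0:
  assumes f: "f \<in> Lp 1" and z: "\<And>n. fourier f n = 0"
  shows "f = 0"
proof (rule circfun_eqI)
  have intf: "integrable circle (ev f)" using f by (simp add: Lp_1_iff)
  have tp: "fourier (f * w) 0 = 0" if "w \<in> TP" for w
    using that
  proof (induction rule: TP_induct)
    case (step c k g)
    have "fourier (f * (cscale c (tvar powi k) + g)) 0 = c * fourier (f * tvar powi k) 0 + fourier (f * g) 0"
      unfolding distrib_left cscale_mult_right
      by (subst fourier_add)
         (auto simp: fourier_cscale intro!: cscale_in_Lp Linf_mult_in_Lp[OF _ f, of _ , unfolded mult.commute[of _ f]] TP_Linf step)
    thus ?case using step by (simp add: fourier_shift z)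
  qed auto
  have cont: "(LINT t|circle. ev f t * of_real (u t)) = 0"
    if u: "continuous_on (sphere 0 1) u" and um [measurable]: "u \<in> borel_measurable borel" for u :: "complex \<Rightarrow> real"
  proof -
    define M where "M = (LINT t|circle. cmod (ev f t))"
    have M0: "M \<ge> 0" by (simp add: M_def)
    have "\<exists>B. \<forall>t\<in>sphere 0 1. norm (u t) \<le> B"
      using compact_imp_bounded[OF compact_continuous_image[OF u compact_sphere]]
      by (auto simp: bounded_iff)
    then obtain B where "\<forall>t\<in>sphere 0 1. norm (u t) \<le> B" by blast
    hence B: "\<And>t. cmod t = 1 \<Longrightarrow> norm (u t) \<le> B" by auto
    have iu: "integrable circle (\<lambda>t. ev f t * of_real (u t))"
      by (rule L1_mult_ev[OF f, of _ B]) (use AE_circle_norm B in \<open>auto elim!: eventually_mono\<close>)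
    have "cmod (LINT t|circle. ev f t * of_real (u t)) \<le> e * M" if e: "e > 0" for e
    proof -
      obtain w r where w: "w \<in> TP" "\<And>t. cmod t = 1 \<Longrightarrow> \<bar>u t - r t\<bar> < e"
        "AE t in circle. ev w t = complex_of_real (r t)" and [measurable]: "r \<in> borel_measurable borel"
        using TP_approx_real[OF u e] by blast
      have "0 = fourier (f * w) 0" using tp[OF w(1)] by simp
      also have "\<dots> = (LINT t|circle. ev f t * of_real (r t))"
        unfolding fourier_0 by (rule ev_integral_cong)
          (use w(3) ev_mult[of f w] in \<open>eventually_elim, simp\<close>, measurable)
      finally have 0: "(LINT t|circle. ev f t * of_real (r t)) = 0" by simp
      have "\<exists>C. AE t in circle. cmod (ev w t) \<le> C" using TP_Linf[OF w(1)] by (simp add: Linf_iff)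
      then obtain C where C: "AE t in circle. cmod (ev w t) \<le> C" by blast
      have ir: "integrable circle (\<lambda>t. ev f t * of_real (r t))"
        by (rule L1_mult_ev[OF f, of _ C]) (use C w(3) in \<open>auto elim!: eventually_elim2\<close>)
      have "(LINT t|circle. ev f t * of_real (u t)) = (LINT t|circle. ev f t * of_real (u t) - ev f t * of_real (r t))"
        using iu ir 0 by simp
      also have "cmod \<dots> \<le> (LINT t|circle. cmod (ev f t * of_real (u t) - ev f t * of_real (r t)))"
        by (rule integral_norm_bound)
      also have "\<dots> \<le> (LINT t|circle. e * cmod (ev f t))"
      proof (rule integral_mono_AE)
        show "AE t in circle. cmod (ev f t * of_real (u t) - ev f t * of_real (r t)) \<le> e * cmod (ev f t)"
          using AE_circle_norm
        proof eventually_elim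
          case (elim t)
          have "cmod (ev f t * of_real (u t) - ev f t * of_real (r t)) = cmod (ev f t) * \<bar>u t - r t\<bar>"
            by (simp add: right_diff_distrib[symmetric] norm_mult flip: of_real_diff)
          also have "\<dots> \<le> cmod (ev f t) * e" using w(2)[OF elim] by (intro mult_left_mono) auto
          finally show ?case by (simp add: mult.commute)
        qed
      qed (use iu ir intf in auto)
      finally show ?thesis by (simp add: M_def)
    qed
    note le = this
    have "cmod (LINT t|circle. ev f t * of_real (u t)) \<le> 0 + e" if "e > 0" for e
    proof -
      have "cmod (LINT t|circle. ev f t * of_real (u t)) \<le> e / (M + 1) * M"
        using that M0 by (intro le) auto
      also have "\<dots> \<le> e" using that M0 by (simp add: field_simps)
      finally show ?thesis by simp
    qed
    hence "cmod (LINT t|circle. ev f t * of_real (u t)) \<le> 0"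
      by (rule field_le_epsilon)
    thus ?thesis by simp
  qed
  have cl: "set_lebesgue_integral circle C (ev f) = 0" if C: "closed C" for C
  proof (cases "C = {}")
    case False
    have "(\<lambda>n. LINT t|circle. ev f t * of_real (bump C n t)) \<longlonglongrightarrow> (LINT t|circle. ev f t * of_real (indicator C t))"
    proof (rule integral_dominated_convergence)
      show "integrable circle (\<lambda>t. cmod (ev f t))" using intf by auto
      show "(\<lambda>t. ev f t * of_real (indicator C t)) \<in> borel_measurable circle"
        using borel_closed[OF C] by measurable
      show "AE t in circle. (\<lambda>n. ev f t * of_real (bump C n t)) \<longlonglongrightarrow> ev f t * of_real (indicator C t)"
        by (intro AE_I2 tendsto_intros bump_tendsto C False)
      show "AE t in circle. cmod (ev f t * of_real (bump C n t)) \<le> cmod (ev f t)" for n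
        by (intro AE_I2) (simp add: norm_mult bump_bounds mult_left_le)
    qed measurable
    moreover have "(LINT t|circle. ev f t * of_real (bump C n t)) = 0" for n
      by (rule cont) (auto intro: continuous_intros)
    ultimately have "(LINT t|circle. ev f t * of_real (indicator C t)) = 0"
      by (simp add: LIMSEQ_const_iff)
    thus ?thesis unfolding set_lebesgue_integral_def
      by (simp add: scaleR_conv_of_real mult.commute)
  qed (simp add: set_lebesgue_integral_def)
  have si: "set_integrable circle A (ev f)" if "A \<in> sets borel" for A
    unfolding set_integrable_def using that intf by (intro integrable_mult_indicator) auto
  have all: "set_lebesgue_integral circle A (ev f) = 0" if A: "A \<in> sets borel" for A
  proof -
    have sb: "sigma_sets UNIV (Collect closed) = sets (borel :: complex measure)"
      by (simp add: borel_eq_closed)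
    have "Int_stable (Collect closed :: complex set set)"
      by (auto simp: Int_stable_def)
    moreover have "Collect closed \<subseteq> Pow (UNIV :: complex set)" by simp
    moreover have "A \<in> sigma_sets UNIV (Collect closed)" using A sb by simp
    ultimately show ?thesis
    proof (induction rule: sigma_sets_induct_disjoint)
      case (compl B)
      hence B: "B \<in> sets borel" using sb by simp
      have "set_lebesgue_integral circle (B \<union> (UNIV - B)) (ev f)
         = set_lebesgue_integral circle B (ev f) + set_lebesgue_integral circle (UNIV - B) (ev f)"
        using B by (intro set_integral_Un si) auto
      moreover have "set_lebesgue_integral circle UNIV (ev f) = 0" by (rule cl) simp
      ultimately show ?case using compl by simp
    next
      case (union B)
      hence B: "B i \<in> sets borel" for i using sb by auto
      have "set_lebesgue_integral circle (\<Union>i. B i) (ev f) = (\<Sum>i. set_lebesgue_integral circle (B i) (ev f))"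
        by (rule lebesgue_integral_countable_add) (use union B in \<open>auto simp: disjoint_family_on_def intro!: si\<close>)
      thus ?case using union by simp
    qed (use cl in auto)
  qed
  show "AE t in circle. ev f t = ev 0 t"
    using circle.density_zero[OF intf] all ev_0 by (auto elim!: eventually_elim2)
qed

lemma fourier_unique:
  assumes "f \<in> Lp 1" "g \<in> Lp 1" "\<And>n. fourier f n = fourier g n"
  shows "f = g"
  using fourier_eq_0_imp_0[of "f - g"] assms by (simp add: Lp_diff fourier_diff)

section \<open>Best approximation\<close>

text \<open>The mean value theorem on the two halves of [a, b]: the derivative p x^(p - 1) is
  strictly larger on the right half.\<close>

lemma powr_midpoint_strict_aux:
  fixes a b p :: real
  assumes "p > 1" "0 \<le> a" "a < b"
  shows "((a + b) / 2) powr p < (a powr p + b powr p) / 2"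
proof -
  define m where "m = (a + b) / 2"
  have m: "a < m" "m < b" "m - a = b - m" using assms by (auto simp: m_def field_simps)
  have c: "continuous_on {x..y} (\<lambda>t. t powr p)" if "0 \<le> x" for x y
    using assms that by (intro continuous_on_powr' continuous_intros) auto
  have d: "((\<lambda>t. t powr p) has_real_derivative p * x powr (p - 1)) (at x)" if "0 < x" for x
    using that by (auto intro!: derivative_eq_intros)
  have "\<exists>z. a < z \<and> z < m \<and> m powr p - a powr p = (m - a) * (p * z powr (p - 1))"
  proof -
    obtain l z where z: "a < z" "z < m" "((\<lambda>t. t powr p) has_real_derivative l) (at z)"
      "m powr p - a powr p = (m - a) * l"
      using MVT[OF m(1) c[OF assms(2)]] d assms(2) real_differentiable_def
      by (metis le_less_trans)
    have "l = p * z powr (p - 1)" using DERIV_unique[OF z(3) d] z assms by simp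
    thus ?thesis using z by blast
  qed
  then obtain z where z: "a < z" "z < m" "m powr p - a powr p = (m - a) * (p * z powr (p - 1))" by blast
  have "\<exists>w. m < w \<and> w < b \<and> b powr p - m powr p = (b - m) * (p * w powr (p - 1))"
  proof -
    have m0: "0 \<le> m" using m assms by linarith
    obtain l w where w: "m < w" "w < b" "((\<lambda>t. t powr p) has_real_derivative l) (at w)"
      "b powr p - m powr p = (b - m) * l"
      using MVT[OF m(2) c[OF m0]] d m0 real_differentiable_def
      by (metis le_less_trans)
    have "l = p * w powr (p - 1)" using DERIV_unique[OF w(3) d] w m0 by simp
    thus ?thesis using w by blast
  qed
  then obtain w where w: "m < w" "w < b" "b powr p - m powr p = (b - m) * (p * w powr (p - 1))" by blast
  have "z powr (p - 1) < w powr (p - 1)" using z w assms by (intro powr_less_mono2) auto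
  hence "(m - a) * (p * z powr (p - 1)) < (b - m) * (p * w powr (p - 1))"
    unfolding m(3) using assms m by (intro mult_strict_left_mono) auto
  thus ?thesis using z(3) w(3) by (simp add: m_def)
qed

lemma powr_midpoint_strict:
  fixes a b p :: real
  assumes "p > 1" "0 \<le> a" "0 \<le> b" "a \<noteq> b"
  shows "((a + b) / 2) powr p < (a powr p + b powr p) / 2"
  using powr_midpoint_strict_aux[of p a b] powr_midpoint_strict_aux[of p b a] assms
  by (cases "a < b") (auto simp: add.commute)

lemma powr_midpoint:
  fixes a b p :: real
  assumes "p > 1" "0 \<le> a" "0 \<le> b"
  shows "((a + b) / 2) powr p \<le> (a powr p + b powr p) / 2"
  using powr_midpoint_strict[OF assms] by (cases "a = b") auto

lemma cmod_midpoint: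
  assumes "p > 1"
  shows "cmod ((x + y) / 2) powr p \<le> (cmod x powr p + cmod y powr p) / 2"
proof -
  have "cmod ((x + y) / 2) powr p \<le> ((cmod x + cmod y) / 2) powr p"
    using assms by (intro powr_mono2) (auto simp: norm_divide norm_triangle_ineq)
  also have "\<dots> \<le> (cmod x powr p + cmod y powr p) / 2"
    using assms by (intro powr_midpoint) auto
  finally show ?thesis .
qed

text \<open>For different moduli the real power is strictly convex; for equal moduli the
  parallelogram law makes the midpoint strictly shorter.\<close>

lemma cmod_midpoint_strict:
  assumes "p > 1" "x \<noteq> y"
  shows "cmod ((x + y) / 2) powr p < (cmod x powr p + cmod y powr p) / 2"
proof (cases "cmod x = cmod y")
  case False
  have "cmod ((x + y) / 2) powr p \<le> ((cmod x + cmod y) / 2) powr p"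
    using assms by (intro powr_mono2) (auto simp: norm_divide norm_triangle_ineq)
  also have "\<dots> < (cmod x powr p + cmod y powr p) / 2"
    using assms False by (intro powr_midpoint_strict) auto
  finally show ?thesis .
next
  case True
  have "cmod (x + y) ^ 2 + cmod (x - y) ^ 2 = 2 * cmod x ^ 2 + 2 * cmod y ^ 2"
    by (simp add: cmod_power2) (simp add: power2_eq_square algebra_simps)
  hence "cmod (x + y) ^ 2 + cmod (x - y) ^ 2 = 4 * cmod x ^ 2" using True by simp
  moreover have "cmod (x - y) ^ 2 > 0" using assms by simp
  ultimately have "cmod (x + y) ^ 2 < 4 * cmod x ^ 2" by linarith
  hence "cmod (x + y) ^ 2 < (2 * cmod x) ^ 2" by (simp add: power_mult_distrib)
  hence "cmod (x + y) < 2 * cmod x" by (rule power_less_imp_less_base) simp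
  hence "cmod ((x + y) / 2) < cmod x" by (simp add: norm_divide)
  hence "cmod ((x + y) / 2) powr p < cmod x powr p" using assms by (intro powr_less_mono2) auto
  thus ?thesis using True by simp
qed

text \<open>A quantitative form of strict convexity of \<open>|z|\<^sup>p\<close>, obtained from compactness and homogeneity.\<close>

lemma powr_uniform_convex:
  fixes p e :: real
  assumes p: "p > 1" and e: "e > 0"
  obtains K where "K \<ge> 0" "\<And>x y :: complex. cmod (x - y) powr p \<le> e * (cmod x powr p + cmod y powr p)
     + K * (cmod x powr p + cmod y powr p - 2 * cmod ((x + y) / 2) powr p)"
proof -
  define \<phi> where "\<phi> = (\<lambda>z::complex \<times> complex. cmod (fst z) powr p + cmod (snd z) powr p - 2 * cmod ((fst z + snd z) / 2) powr p)"
  have cphi: "continuous_on UNIV \<phi>"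
    unfolding \<phi>_def using p by (intro continuous_intros continuous_on_powr') auto
  define S where "S = {z::complex \<times> complex. cmod (fst z) powr p + cmod (snd z) powr p = 1 \<and> cmod (fst z - snd z) powr p \<ge> e}"
  have "closed S"
    unfolding S_def using p
    by (intro closed_Collect_conj closed_Collect_eq closed_Collect_le continuous_intros continuous_on_powr') auto
  moreover have "bounded S"
  proof -
    have "S \<subseteq> cball 0 1 \<times> cball 0 1"
    proof
      fix z assume z: "z \<in> S"
      have "cmod (fst z) powr p \<le> 1 powr p" "cmod (snd z) powr p \<le> 1 powr p"
        using z by (auto simp: S_def) (smt (verit) powr_ge_zero)+
      hence "cmod (fst z) \<le> 1" "cmod (snd z) \<le> 1"
        using p powr_less_mono2[of p 1 "cmod (fst z)"] powr_less_mono2[of p 1 "cmod (snd z)"]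
        by (auto simp: not_le[symmetric])
      thus "z \<in> cball 0 1 \<times> cball 0 1" by (cases z) auto
    qed
    thus ?thesis by (rule bounded_subset[OF bounded_Times[OF bounded_cball bounded_cball]])
  qed
  ultimately have "compact S" using compact_eq_bounded_closed by blast
  have pos: "\<phi> z > 0" if "z \<in> S" for z
  proof -
    have "fst z \<noteq> snd z" using that e by (auto simp: S_def)
    from cmod_midpoint_strict[OF p this] show ?thesis by (simp add: \<phi>_def)
  qed
  obtain d where d: "d > 0" "\<And>z. z \<in> S \<Longrightarrow> \<phi> z \<ge> d"
  proof (cases "S = {}")
    case False
    obtain z where "z \<in> S" "\<And>y. y \<in> S \<Longrightarrow> \<phi> z \<le> \<phi> y"
      using continuous_attains_inf[OF \<open>compact S\<close> False continuous_on_subset[OF cphi subset_UNIV]] by blast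
    thus ?thesis using that[of "\<phi> z"] pos by blast
  qed (use that[of 1] in auto)
  \<comment> \<open>d bounds the convexity defect \<phi> from below on the normalised pairs that are
    far apart; 2 powr p comes from the crude bound of |x - y|^p by the sum of the p-th
    powers.\<close>
  have main: "cmod (x - y) powr p \<le> e * (cmod x powr p + cmod y powr p) + (2 powr p / d) * \<phi> (x, y)" for x y
  proof -
    define s where "s = cmod x powr p + cmod y powr p"
    have phi0: "\<phi> (x, y) \<ge> 0" using cmod_midpoint[OF p, of x y] by (simp add: \<phi>_def)
    have s0: "s \<ge> 0" by (simp add: s_def)
    show ?thesis
    proof (cases "cmod (x - y) powr p \<le> e * s")
      case True
      thus ?thesis using phi0 d(1) by (simp add: s_def add_increasing2)
    next
      case False
      hence "s \<noteq> 0" using p by (auto simp: s_def add_nonneg_eq_0_iff)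
      hence s: "s > 0" using s0 by simp
      \<comment> \<open>Scaling by r makes the p-th powers of the two moduli sum to 1.\<close>
      define r where "r = s powr (- 1 / p)"
      have r: "r > 0" using s by (simp add: r_def)
      have rp: "r powr p = 1 / s" unfolding r_def powr_powr using s p by (simp add: powr_minus_divide)
      let ?X = "of_real r * x" and ?Y = "of_real r * y"
      have hom: "cmod (of_real r * z) powr p = cmod z powr p / s" for z
        using r rp by (simp add: norm_mult powr_mult)
      have "(?X, ?Y) \<in> S"
        unfolding S_def mem_Collect_eq fst_conv snd_conv right_diff_distrib[symmetric] hom
          add_divide_distrib[symmetric] s_def[symmetric]
        using False s by (simp add: pos_le_divide_eq)
      hence "d \<le> \<phi> (?X, ?Y)" by (rule d)
      also have "\<dots> = \<phi> (x, y) / s"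
        using hom[of x] hom[of y] hom[of "(x + y) / 2"]
        by (simp add: \<phi>_def distrib_left add_divide_distrib diff_divide_distrib)
      finally have ds: "d * s \<le> \<phi> (x, y)" using s by (simp add: field_simps)
      have "cmod (x - y) powr p \<le> (2 * ((cmod x + cmod y) / 2)) powr p"
        using p norm_triangle_ineq4[of x y] by (intro powr_mono2) (auto simp: field_simps)
      also have "\<dots> = 2 powr p * ((cmod x + cmod y) / 2) powr p" by (subst powr_mult) auto
      also have "\<dots> \<le> 2 powr p * (s / 2)"
        using powr_midpoint[OF p, of "cmod x" "cmod y"] by (intro mult_left_mono) (auto simp: s_def)
      also have "\<dots> \<le> 2 powr p * s" using s by simp
      also have "\<dots> \<le> 2 powr p * (\<phi> (x, y) / d)"
        using ds d(1) by (intro mult_left_mono) (auto simp: field_simps)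
      finally show ?thesis using e s by (simp add: s_def add_increasing)
    qed
  qed
  show ?thesis
    by (rule that[of "2 powr p / d"]) (use d main in \<open>auto simp: \<phi>_def\<close>)
qed

text \<open>The limit must be taken in \<open>Lp p\<close>: the integral of a non-integrable
  function is 0 by convention, so a function outside L^p would pass for the limit of any sequence in
  L^p.\<close>

definition Lp_closed :: "real \<Rightarrow> circfun set \<Rightarrow> bool" where
  "Lp_closed p M \<longleftrightarrow> (\<forall>f g. (\<forall>n::nat. f n \<in> M) \<and> g \<in> Lp p \<and> (\<lambda>n. Lp_norm p (f n - g)) \<longlonglongrightarrow> 0 \<longrightarrow> g \<in> M)"

lemma Lp_norm_tendsto_0_imp_Cauchy:
  assumes "p \<ge> 1" "\<And>n. f n \<in> Lp p" "g \<in> Lp p" "(\<lambda>n::nat. Lp_norm p (f n - g)) \<longlonglongrightarrow> 0" "e > 0"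
  shows "\<exists>N. \<forall>m\<ge>N. \<forall>n\<ge>N. Lp_norm p (f m - f n) < e"
proof -
  obtain N where N: "\<And>n. n \<ge> N \<Longrightarrow> Lp_norm p (f n - g) < e / 2"
    using LIMSEQ_D[OF assms(4), of "e / 2"] assms(5) by auto
  have "Lp_norm p (f m - f n) < e" if "m \<ge> N" "n \<ge> N" for m n
    using Lp_norm_triangle3[OF assms(1,2,3,2), of m n] N[OF that(1)] N[OF that(2)]
      Lp_norm_minus_commute[of p g "f n"] assms(1) by simp
  thus ?thesis by blast
qed

text \<open>A minimising sequence is Cauchy by uniform convexity, and M is closed.\<close>

lemma Lp_nearest_point:
  assumes p: "p > 1" and M: "circ.subspace M" "M \<subseteq> Lp p" "Lp_closed p M" and g: "g \<in> Lp p"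
  obtains m where "m \<in> M" "\<And>m'. m' \<in> M \<Longrightarrow> Lp_norm p (g - m) \<le> Lp_norm p (g - m')"
proof -
  define D where "D = (\<lambda>m. Lp_norm p (g - m)) ` M"
  define d where "d = Inf D"
  have ne: "D \<noteq> {}" using circ.subspace_0[OF M(1)] by (auto simp: D_def)
  have bdd: "bdd_below D" by (auto simp: D_def intro!: bdd_belowI[of _ 0])
  have dle: "d \<le> Lp_norm p (g - m)" if "m \<in> M" for m
    unfolding d_def by (rule cInf_lower[OF _ bdd]) (use that in \<open>auto simp: D_def\<close>)
  have d0: "d \<ge> 0" unfolding d_def by (rule cInf_greatest[OF ne]) (auto simp: D_def)
  have "\<exists>m\<in>M. Lp_norm p (g - m) < d + 1 / real (Suc n)" for n
    using cInf_lessD[OF ne, of "d + 1 / real (Suc n)"] by (auto simp: D_def d_def)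
  then obtain m where m: "\<And>n. m n \<in> M" "\<And>n. Lp_norm p (g - m n) < d + 1 / real (Suc n)" by metis
  have mL: "m n \<in> Lp p" for n using m M by auto
  have C: "\<exists>N. \<forall>i\<ge>N. \<forall>j\<ge>N. Lp_norm p (m i - m j) < e" if e: "e > 0" for e
  proof -
    \<comment> \<open>With all distances at most d + 1, the term with \<open>e1\<close> contributes
      at most a quarter of \<open>e powr p\<close>; N is chosen below so that the term with K
      contributes less than half of it.\<close>
    define e1 where "e1 = e powr p / (8 * (d + 1) powr p)"
    have e1: "e1 > 0" using e d0 by (simp add: e1_def)
    obtain K where K: "K \<ge> 0" "\<And>x y :: complex. cmod (x - y) powr p \<le> e1 * (cmod x powr p + cmod y powr p)
      + K * (cmod x powr p + cmod y powr p - 2 * cmod ((x + y) / 2) powr p)"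
      using powr_uniform_convex[OF p e1] by blast
    have "(\<lambda>n. 2 * K * ((d + 1 / real (Suc n)) powr p - d powr p)) \<longlonglongrightarrow> 2 * K * ((d + 0) powr p - d powr p)"
      using p d0 by (intro tendsto_intros tendsto_powr' LIMSEQ_Suc[OF lim_1_over_n]) auto
    hence "(\<lambda>n. 2 * K * ((d + 1 / real (Suc n)) powr p - d powr p)) \<longlonglongrightarrow> 0" by simp
    moreover have ep: "e powr p / 2 > 0" using e by simp
    ultimately have "\<forall>\<^sub>F n in sequentially. 2 * K * ((d + 1 / real (Suc n)) powr p - d powr p) < e powr p / 2"
      by (rule order_tendstoD)
    then obtain N where N: "2 * K * ((d + 1 / real (Suc N)) powr p - d powr p) < e powr p / 2"
      by (auto simp: eventually_sequentially)
    have "Lp_norm p (m i - m j) < e" if ij: "i \<ge> N" "j \<ge> N" for i j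
    proof -
      define \<eta> where "\<eta> = 1 / real (Suc N)"
      have eta: "\<eta> > 0" "\<eta> \<le> 1" by (auto simp: \<eta>_def)
      let ?x = "g - m i" and ?y = "g - m j" and ?z = "g - cscale (1/2) (m i + m j)"
      have zM: "cscale (1/2) (m i + m j) \<in> M"
        using M(1) m by (intro circ.subspace_scale circ.subspace_add)
      have xyz: "?x \<in> Lp p" "?y \<in> Lp p" "?z \<in> Lp p"
        using p g mL zM M(2) by (auto intro!: Lp_diff)
      have xn: "Lp_norm p ?x \<le> d + \<eta>" "Lp_norm p ?y \<le> d + \<eta>"
        using m(2)[of i] m(2)[of j] frac_le[of 1 1 "real (Suc N)" "real (Suc i)"] frac_le[of 1 1 "real (Suc N)" "real (Suc j)"] ij
        by (auto simp: \<eta>_def)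
      have xp: "Lp_norm p ?x powr p \<le> (d + \<eta>) powr p" "Lp_norm p ?y powr p \<le> (d + \<eta>) powr p"
        using xn p by (auto intro!: powr_mono2)
      \<comment> \<open>The midpoint of two elements of M lies in M, so it cannot be closer to g
        than d. This is what makes the integrated convexity defect small.\<close>
      have zp: "Lp_norm p ?z powr p \<ge> d powr p" using dle[OF zM] p d0 by (intro powr_mono2) auto
      have "(LINT t|circle. cmod (ev (m i - m j) t) powr p) \<le>
        (LINT t|circle. e1 * (cmod (ev ?x t) powr p + cmod (ev ?y t) powr p)
           + K * (cmod (ev ?x t) powr p + cmod (ev ?y t) powr p - 2 * cmod (ev ?z t) powr p))"
      proof (rule integral_mono_AE)
        show "AE t in circle. cmod (ev (m i - m j) t) powr p \<le> e1 * (cmod (ev ?x t) powr p + cmod (ev ?y t) powr p)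
           + K * (cmod (ev ?x t) powr p + cmod (ev ?y t) powr p - 2 * cmod (ev ?z t) powr p)"
          using ev_minus[of "m i" "m j"] ev_minus[of g "m i"] ev_minus[of g "m j"]
            ev_minus[of g "cscale (1/2) (m i + m j)"] ev_cscale[of "1/2" "m i + m j"] ev_plus[of "m i" "m j"]
        proof eventually_elim
          case (elim t)
          have "ev (m i - m j) t = - (ev ?x t - ev ?y t)"
            unfolding elim(1) elim(2) elim(3) by simp
          moreover have "ev ?z t = (ev ?x t + ev ?y t) / 2"
            unfolding elim(2-6) by (simp add: field_simps)
          ultimately
          show ?case using K(2)[of "ev ?x t" "ev ?y t"] by (simp only: norm_minus_cancel)
        qed
      qed (use xyz mL p Lp_diff[of p "m i" "m j"] in \<open>auto simp: Lp_iff\<close>)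
      also have "\<dots> = e1 * (Lp_norm p ?x powr p + Lp_norm p ?y powr p)
         + K * (Lp_norm p ?x powr p + Lp_norm p ?y powr p - 2 * Lp_norm p ?z powr p)"
        using xyz p by (simp add: Lp_iff Lp_norm_powr)
      also have "\<dots> \<le> e1 * ((d + \<eta>) powr p + (d + \<eta>) powr p) + K * ((d + \<eta>) powr p + (d + \<eta>) powr p - 2 * d powr p)"
        using xp zp e1 K(1) by (intro add_mono mult_left_mono diff_mono) auto
      also have "\<dots> \<le> e1 * (2 * (d + 1) powr p) + 2 * K * ((d + \<eta>) powr p - d powr p)"
        using e1 eta d0 p by (auto simp: algebra_simps intro!: mult_left_mono powr_mono2)
      also have "\<dots> < e powr p / 4 + e powr p / 2"
        using N d0 unfolding \<eta>_def[symmetric] by (simp add: e1_def)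
      also have "\<dots> \<le> e powr p" using ep by simp
      finally have lt: "Lp_norm p (m i - m j) powr p < e powr p"
        using p by (subst Lp_norm_powr) auto
      show ?thesis
      proof (rule ccontr)
        assume "\<not> ?thesis"
        hence "e powr p \<le> Lp_norm p (m i - m j) powr p" using e p by (intro powr_mono2) auto
        thus False using lt by simp
      qed
    qed
    thus ?thesis by blast
  qed
  obtain l where l: "l \<in> Lp p" "(\<lambda>n. Lp_norm p (m n - l)) \<longlonglongrightarrow> 0"
    using Lp_complete[OF _ mL C] p by auto
  have lM: "l \<in> M" using M(3) m(1) l by (auto simp: Lp_closed_def)
  have "Lp_norm p (g - l) \<le> d"
  proof (rule LIMSEQ_le_const)
    show "(\<lambda>n. (d + 1 / real (Suc n)) + Lp_norm p (m n - l)) \<longlonglongrightarrow> d"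
      using tendsto_add[OF tendsto_add[OF tendsto_const LIMSEQ_Suc[OF lim_1_over_n]] l(2), of d] by simp
    show "\<exists>N. \<forall>n\<ge>N. Lp_norm p (g - l) \<le> d + 1 / real (Suc n) + Lp_norm p (m n - l)"
      using Lp_norm_triangle3[OF less_imp_le[OF p] g mL l(1)] m(2) by (meson add_mono less_imp_le order_trans order_refl)
  qed
  thus ?thesis using that[OF lM] dle by (meson order_trans)
qed

text \<open>Up to the factor p this is the gradient of |z|^p. It induces the duality map from L^p to
  L^q; the factor z gives the value 0 at z = 0, also for p < 2.\<close>

definition dualmap :: "real \<Rightarrow> complex \<Rightarrow> complex" where
  "dualmap p z = of_real (cmod z powr (p - 2)) * z"

lemma norm_dualmap: "cmod (dualmap p z) = cmod z powr (p - 1)"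
proof (cases "z = 0")
  case False
  have "cmod (dualmap p z) = cmod z powr (p - 2) * cmod z powr 1"
    by (simp add: dualmap_def norm_mult)
  also have "\<dots> = cmod z powr (p - 1)" by (simp only: powr_add[symmetric]) simp
  finally show ?thesis .
qed (simp add: dualmap_def)

lemma dualmap_measurable [measurable]: "dualmap p \<in> borel_measurable borel"
  unfolding dualmap_def by measurable

lemma dualmap_mult_cnj: "z * cnj (dualmap p z) = of_real (cmod z powr p)"
proof (cases "z = 0")
  case False
  have "z * cnj (dualmap p z) = of_real (cmod z powr (p - 2)) * (z * cnj z)"
    by (simp add: dualmap_def)
  also have "\<dots> = of_real (cmod z powr (p - 2) * cmod z powr 2)"
    by (simp add: complex_norm_square[symmetric] powr_numeral)
  also have "cmod z powr (p - 2) * cmod z powr 2 = cmod z powr p"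
    by (simp only: powr_add[symmetric]) simp
  finally show ?thesis .
qed (simp add: dualmap_def)

lemma isCont_dualmap:
  assumes "p > 1" shows "isCont (dualmap p) z"
proof (cases "z = 0")
  case False
  thus ?thesis unfolding dualmap_def by (intro continuous_intros) auto
next
  case True
  have "((\<lambda>z. cmod z powr (p - 1)) \<longlongrightarrow> 0 powr (p - 1)) (at 0)"
    using assms by (intro tendsto_powr' tendsto_norm_zero tendsto_intros) auto
  hence "((\<lambda>z. cmod (dualmap p z)) \<longlongrightarrow> 0) (at 0)" by (simp add: norm_dualmap)
  hence "(dualmap p \<longlongrightarrow> 0) (at 0)" by (rule tendsto_norm_zero_cancel)
  thus ?thesis unfolding True isCont_def by (simp add: dualmap_def)
qed

text \<open>The convex function |z|^p lies above its tangent at x. In this form it is Young's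
  inequality for |z| and |x|^(p - 1), because (p - 1) q = p.\<close>

lemma dualmap_subgradient:
  assumes pq: "conj_exps p q"
  shows "cmod x powr p - p * Re (cnj (dualmap p x) * (x - z)) \<le> cmod z powr p"
proof -
  have pq1: "p > 1" "q > 1" "1 / p + 1 / q = 1" using pq by (auto simp: conj_exps_def)
  have pq2: "(p - 1) * q = p" using conj_exps_mult[OF pq] by (simp add: algebra_simps)
  have "Re (cnj (dualmap p x) * z) \<le> cmod z * cmod x powr (p - 1)"
    using complex_Re_le_cmod[of "cnj (dualmap p x) * z"] by (simp add: norm_mult norm_dualmap mult.commute)
  also have "\<dots> \<le> cmod z powr p / p + (cmod x powr (p - 1)) powr q / q"
    using pq1 by (intro Youngs_inequality) auto
  finally have "p * Re (cnj (dualmap p x) * z) \<le> p * (cmod z powr p / p + cmod x powr p / q)"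
    using pq1 pq2 by (intro mult_left_mono) (auto simp: powr_powr)
  also have "p * (cmod z powr p / p + cmod x powr p / q) = cmod z powr p + (p / q) * cmod x powr p"
    using pq1(1) by (simp add: distrib_left)
  also have "p / q = p - 1" using pq2 pq1 by (simp add: field_simps)
  finally have 1: "p * Re (cnj (dualmap p x) * z) \<le> cmod z powr p + (p - 1) * cmod x powr p" .
  have "Re (cnj (dualmap p x) * x) = cmod x powr p"
    using dualmap_mult_cnj[of x p] by (simp add: mult.commute)
  hence "Re (cnj (dualmap p x) * (x - z)) = cmod x powr p - Re (cnj (dualmap p x) * z)"
    by (simp add: right_diff_distrib)
  thus ?thesis using 1 by (simp add: algebra_simps)
qed

definition dualfun :: "real \<Rightarrow> circfun \<Rightarrow> circfun" where
  "dualfun p f = abs_circfun (\<lambda>t. dualmap p (ev f t))"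

lemma ev_dualfun: "AE t in circle. ev (dualfun p f) t = dualmap p (ev f t)"
  unfolding dualfun_def by (rule ev_abs_AE) measurable

lemma dualfun_Lp:
  assumes pq: "conj_exps p q" and f: "f \<in> Lp p"
  shows "dualfun p f \<in> Lp q" "Lp_norm q (dualfun p f) powr q = Lp_norm p f powr p"
    "pairing f (dualfun p f) = of_real (Lp_norm p f powr p)"
proof -
  have pq1: "p > 1" "q > 1" using pq by (auto simp: conj_exps_def)
  have pq2: "(p - 1) * q = p" using conj_exps_mult[OF pq] by (simp add: algebra_simps)
  have e: "AE t in circle. cmod (ev (dualfun p f) t) powr q = cmod (ev f t) powr p"
    using ev_dualfun[of p f] by eventually_elim (simp add: norm_dualmap powr_powr pq2)
  show "dualfun p f \<in> Lp q"
    using f unfolding Lp_iff by (subst ev_integrable_cong[OF e]) auto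
  show "Lp_norm q (dualfun p f) powr q = Lp_norm p f powr p"
    using pq1 by (simp add: Lp_norm_powr) (rule ev_integral_cong[OF e], auto)
  have "pairing f (dualfun p f) = (LINT t|circle. complex_of_real (cmod (ev f t) powr p))"
    unfolding pairing_eq
    by (rule ev_integral_cong) (use ev_dualfun[of p f] in \<open>eventually_elim, simp add: dualmap_mult_cnj\<close>, measurable)
  thus "pairing f (dualfun p f) = of_real (Lp_norm p f powr p)"
    using pq1 by (simp add: Lp_norm_powr)
qed

lemma Re_mult_of_real_mult: "Re (c * (of_real e * m)) = e * Re (c * m)"
  by (simp add: algebra_simps)

text \<open>The duality map of a vector of minimal norm in a coset of \<open>M\<close> annihilates \<open>M\<close>.
  This replaces Hahn--Banach and the Riesz representation of functionals.\<close>

lemma Lp_min_norm_orthogonal: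
  assumes pq: "conj_exps p q" and M: "circ.subspace M" "M \<subseteq> Lp p" and k: "k \<in> Lp p"
    and min: "\<And>m. m \<in> M \<Longrightarrow> Lp_norm p k \<le> Lp_norm p (k + m)" and m: "m \<in> M"
  shows "pairing m (dualfun p k) = 0"
proof -
  have pq1: "p > 1" "q > 1" using pq by (auto simp: conj_exps_def)
  have h: "dualfun p k \<in> Lp q" by (rule dualfun_Lp[OF pq k])
  have ge: "Re (pairing m (dualfun p k)) \<ge> 0" if m: "m \<in> M" for m
  proof -
    have mL: "m \<in> Lp p" using m M by auto
    \<comment> \<open>The slope is taken at k + m / (n + 1) and not at k: there the subgradient
      inequality and the minimality of k determine its sign for every n, and the sign survives the
      limit.\<close>
    define W where "W = (\<lambda>n t. cnj (dualmap p (ev k t + ev m t / of_nat (Suc n))) * ev m t)"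
    define B where "B = (\<lambda>t. 2 powr p * (1/2 * (cmod (ev k t) powr p / 1 powr p) + 1/2 * (cmod (ev m t) powr p / 1 powr p)))"
    have intB: "integrable circle B" using k mL by (simp add: B_def Lp_iff)
    have [measurable]: "W n \<in> borel_measurable borel" for n unfolding W_def by measurable
    have WB: "cmod (W n t) \<le> B t" for n t
    proof -
      have "cmod (ev m t / of_nat (Suc n)) = cmod (ev m t) / real (Suc n)"
        unfolding norm_divide norm_of_nat ..
      also have "\<dots> \<le> cmod (ev m t) / 1" by (rule divide_left_mono) auto
      finally have "cmod (ev k t + ev m t / of_nat (Suc n)) \<le> cmod (ev k t) + cmod (ev m t)"
        by (intro order_trans[OF norm_triangle_ineq] add_left_mono) simp
      hence "cmod (W n t) \<le> (cmod (ev k t) + cmod (ev m t)) powr (p - 1) * (cmod (ev k t) + cmod (ev m t)) powr 1"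
        unfolding W_def using pq1 by (auto simp: norm_mult norm_dualmap intro!: mult_mono powr_mono2)
      also have "\<dots> = (cmod (ev k t) + cmod (ev m t)) powr p" by (simp only: powr_add[symmetric]) simp
      also have "\<dots> \<le> B t"
        using powr_add_le[of p "cmod (ev k t)" "cmod (ev m t)" 1 1] pq1 by (simp add: B_def)
      finally show ?thesis .
    qed
    have intW: "integrable circle (W n)" for n
      by (rule Bochner_Integration.integrable_bound[OF intB]) (use WB in \<open>auto intro!: AE_I2 order_trans[OF WB abs_ge_self]\<close>)
    have pos: "Re (LINT t|circle. W n t) \<ge> 0" for n
    proof -
      let ?e = "1 / real (Suc n)"
      let ?x = "k + cscale (of_real ?e) m"
      have emM: "cscale (of_real ?e) m \<in> M" by (rule circ.subspace_scale[OF M(1) m])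
      have x: "?x \<in> Lp p" using pq1 k emM M(2) by (intro Lp_add) auto
      have "Lp_norm p ?x powr p - p * ?e * Re (LINT t|circle. W n t)
         = (LINT t|circle. cmod (ev ?x t) powr p - p * ?e * Re (W n t))"
        using x pq1 intW[of n] by (simp add: Lp_iff Lp_norm_powr)
      also have "\<dots> \<le> (LINT t|circle. cmod (ev k t) powr p)"
      proof (rule integral_mono_AE)
        show "AE t in circle. cmod (ev ?x t) powr p - p * ?e * Re (W n t) \<le> cmod (ev k t) powr p"
          using ev_plus[of k "cscale (of_real ?e) m"] ev_cscale[of "of_real ?e" m]
        proof eventually_elim
          case (elim t)
          have x: "ev ?x t = ev k t + ev m t / of_nat (Suc n)"
            using elim by (simp del: of_nat_Suc)
          have "ev ?x t - ev k t = of_real ?e * ev m t" using elim by simp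
          hence "Re (cnj (dualmap p (ev ?x t)) * (ev ?x t - ev k t)) = ?e * Re (W n t)"
            unfolding W_def x[symmetric] by (simp only: Re_mult_of_real_mult)
          thus ?case using dualmap_subgradient[OF pq, of "ev ?x t" "ev k t"] by simp
        qed
      qed (use x k intW[of n] in \<open>auto simp: Lp_iff\<close>)
      also have "\<dots> = Lp_norm p k powr p" using pq1 by (simp add: Lp_norm_powr)
      also have "\<dots> \<le> Lp_norm p ?x powr p" using min[OF emM] pq1 by (intro powr_mono2) auto
      finally have "p * ?e * Re (LINT t|circle. W n t) \<ge> 0" by simp
      moreover have "p * ?e > 0" using pq1 by simp
      ultimately show ?thesis using zero_le_mult_iff by (metis less_le_not_le)
    qed
    have "(\<lambda>n. LINT t|circle. W n t) \<longlonglongrightarrow> (LINT t|circle. cnj (dualmap p (ev k t)) * ev m t)"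
    proof (rule integral_dominated_convergence[OF _ _ intB])
      show "AE t in circle. (\<lambda>n. W n t) \<longlonglongrightarrow> cnj (dualmap p (ev k t)) * ev m t"
      proof (rule AE_I2)
        fix t
        have "(\<lambda>n. ev m t / of_nat (Suc n)) \<longlonglongrightarrow> 0"
          using tendsto_mult[OF tendsto_const[of "ev m t"] tendsto_of_real[OF LIMSEQ_Suc[OF lim_1_over_n]]]
          by simp
        hence "(\<lambda>n. ev k t + ev m t / of_nat (Suc n)) \<longlonglongrightarrow> ev k t + 0" by (intro tendsto_intros)
        hence "(\<lambda>n. dualmap p (ev k t + ev m t / of_nat (Suc n))) \<longlonglongrightarrow> dualmap p (ev k t)"
          using isCont_tendsto_compose[OF isCont_dualmap[OF pq1(1)]] by simp
        thus "(\<lambda>n. W n t) \<longlonglongrightarrow> cnj (dualmap p (ev k t)) * ev m t"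
          unfolding W_def by (intro tendsto_intros)
      qed
      show "AE t in circle. cmod (W n t) \<le> B t" for n using WB by auto
    qed measurable
    hence "(\<lambda>n. Re (LINT t|circle. W n t)) \<longlonglongrightarrow> Re (LINT t|circle. cnj (dualmap p (ev k t)) * ev m t)"
      by (rule tendsto_Re)
    hence "Re (LINT t|circle. cnj (dualmap p (ev k t)) * ev m t) \<ge> 0"
      by (rule LIMSEQ_le_const) (use pos in auto)
    also have "(LINT t|circle. cnj (dualmap p (ev k t)) * ev m t) = pairing m (dualfun p k)"
      unfolding pairing_eq by (rule ev_integral_cong)
        (use ev_dualfun[of p k] in \<open>eventually_elim, simp\<close>, measurable)
    finally show ?thesis .
  qed
  have sc: "cscale z m \<in> M" for z by (rule circ.subspace_scale[OF M(1) m])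
  have sc': "Re (z * pairing m (dualfun p k)) \<ge> 0" for z
    using ge[OF sc[of z]] unfolding pairing_cscale_left .
  \<comment> \<open>The multiples of m by 1, -1, i and -i bound the real and the imaginary part from
    both sides.\<close>
  from sc'[of 1] sc'[of "-1"] sc'[of "\<i>"] sc'[of "-\<i>"]
  show ?thesis by (simp add: complex_eq_iff)
qed

text \<open>The separating functional is explicit: the duality map of g minus its nearest point in
  M.\<close>

lemma Lp_separation:
  assumes pq: "conj_exps p q" and M: "circ.subspace M" "M \<subseteq> Lp p" "Lp_closed p M"
    and g: "g \<in> Lp p" "g \<notin> M"
  obtains h where "h \<in> Lp q" "\<And>m. m \<in> M \<Longrightarrow> pairing m h = 0" "pairing g h \<noteq> 0"
proof -
  have p: "p > 1" using pq by (auto simp: conj_exps_def)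
  obtain m0 where m0: "m0 \<in> M" "\<And>m'. m' \<in> M \<Longrightarrow> Lp_norm p (g - m0) \<le> Lp_norm p (g - m')"
    using Lp_nearest_point[OF p M g(1)] by blast
  define k where "k = g - m0"
  have m0L: "m0 \<in> Lp p" using m0 M by auto
  have k: "k \<in> Lp p" unfolding k_def using p g m0L by (intro Lp_diff) auto
  have orth: "pairing m (dualfun p k) = 0" if "m \<in> M" for m
  proof (rule Lp_min_norm_orthogonal[OF pq M(1,2) k _ that])
    fix m assume "m \<in> M"
    hence "m0 - m \<in> M" using m0(1) M(1) by (intro circ.subspace_diff)
    from m0(2)[OF this] show "Lp_norm p k \<le> Lp_norm p (k + m)" by (simp add: k_def algebra_simps)
  qed
  have h: "dualfun p k \<in> Lp q" by (rule dualfun_Lp[OF pq k])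
  have "k \<noteq> 0" using g(2) m0(1) by (auto simp: k_def)
  hence "Lp_norm p k \<noteq> 0" using Lp_norm_eq_0[OF k] p by auto
  hence "pairing k (dualfun p k) \<noteq> 0" using dualfun_Lp(3)[OF pq k] by simp
  moreover have "pairing g (dualfun p k) = pairing k (dualfun p k)"
    using pairing_diff_left[OF pq g(1) m0L h] orth[OF m0(1)] by (simp add: k_def)
  ultimately show ?thesis using that[OF h orth] by simp
qed

section \<open>Closures of subspaces and density of the trigonometric polynomials\<close>

definition Lp_closure :: "real \<Rightarrow> circfun set \<Rightarrow> circfun set" where
  "Lp_closure p M = {f \<in> Lp p. \<forall>e>0. \<exists>w\<in>M. Lp_norm p (f - w) < e}"

lemma Lp_closure_subspace:
  assumes p: "p \<ge> 1" and M: "circ.subspace M" "M \<subseteq> Lp p"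
  shows "circ.subspace (Lp_closure p M)"
proof (rule circ.subspaceI)
  show "0 \<in> Lp_closure p M" using circ.subspace_0[OF M(1)] by (auto simp: Lp_closure_def intro!: bexI[of _ 0])
next
  fix f g assume fg: "f \<in> Lp_closure p M" "g \<in> Lp_closure p M"
  hence L: "f \<in> Lp p" "g \<in> Lp p" by (auto simp: Lp_closure_def)
  show "f + g \<in> Lp_closure p M"
    unfolding Lp_closure_def
  proof (safe intro!: Lp_add p L)
    fix e :: real assume "e > 0"
    hence e2: "e / 2 > 0" by simp
    obtain u where u: "u \<in> M" "Lp_norm p (f - u) < e / 2"
      using fg(1) e2 unfolding Lp_closure_def by blast
    obtain v where v: "v \<in> M" "Lp_norm p (g - v) < e / 2"
      using fg(2) e2 unfolding Lp_closure_def by blast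
    note uv = u v
    have "Lp_norm p ((f - u) + (g - v)) \<le> Lp_norm p (f - u) + Lp_norm p (g - v)"
      using uv M L p by (intro Lp_norm_add Lp_diff) auto
    hence "Lp_norm p ((f + g) - (u + v)) < e" using uv by (simp add: algebra_simps)
    moreover have "u + v \<in> M" using uv by (intro circ.subspace_add[OF M(1)])
    ultimately show "\<exists>w\<in>M. Lp_norm p (f + g - w) < e" by blast
  qed
next
  fix z f assume f: "f \<in> Lp_closure p M"
  hence L: "f \<in> Lp p" by (auto simp: Lp_closure_def)
  show "cscale z f \<in> Lp_closure p M"
    unfolding Lp_closure_def
  proof (safe intro!: cscale_in_Lp L)
    fix e :: real assume "e > 0"
    hence "e / (cmod z + 1) > 0" by (simp add: add_nonneg_pos)
    then obtain u where u: "u \<in> M" "Lp_norm p (f - u) < e / (cmod z + 1)"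
      using f by (auto simp: Lp_closure_def)
    have "Lp_norm p (cscale z f - cscale z u) = cmod z * Lp_norm p (f - u)"
      using p by (simp add: cscale_diff[symmetric] Lp_norm_cscale)
    also have "\<dots> \<le> (cmod z + 1) * Lp_norm p (f - u)" by (intro mult_right_mono) auto
    also have "\<dots> < e"
      using u(2) pos_less_divide_eq[of "cmod z + 1" "Lp_norm p (f - u)" e] by (simp add: add_nonneg_pos mult.commute)
    finally show "\<exists>w\<in>M. Lp_norm p (cscale z f - w) < e"
      using u(1) circ.subspace_scale[OF M(1)] by blast
  qed
qed

lemma Lp_closure_closed:
  assumes p: "p \<ge> 1" and M: "M \<subseteq> Lp p"
  shows "Lp_closed p (Lp_closure p M)"
  unfolding Lp_closed_def
proof safe
  fix f g assume f: "\<forall>n::nat. f n \<in> Lp_closure p M" and g: "g \<in> Lp p"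
    and l: "(\<lambda>n. Lp_norm p (f n - g)) \<longlonglongrightarrow> 0"
  show "g \<in> Lp_closure p M"
    unfolding Lp_closure_def
  proof (safe intro!: g)
    fix e :: real assume e: "e > 0"
    then obtain n where n: "Lp_norm p (f n - g) < e / 2" using LIMSEQ_D[OF l, of "e / 2"] by force
    have e2: "e / 2 > 0" using e by simp
    obtain w where w: "w \<in> M" "Lp_norm p (f n - w) < e / 2"
      using f e2 unfolding Lp_closure_def by blast
    have "Lp_norm p (g - w) \<le> Lp_norm p (g - f n) + Lp_norm p (f n - w)"
      using g f w M p by (intro Lp_norm_triangle3) (auto simp: Lp_closure_def)
    thus "\<exists>w\<in>M. Lp_norm p (g - w) < e"
      using n w Lp_norm_minus_commute[of p "f n" g] p by (intro bexI[of _ w]) auto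
  qed
qed

lemma Lp_closure_superset: "M \<subseteq> Lp p \<Longrightarrow> M \<subseteq> Lp_closure p M"
proof
  fix x assume "M \<subseteq> Lp p" "x \<in> M"
  thus "x \<in> Lp_closure p M" by (auto simp: Lp_closure_def intro!: bexI[of _ x])
qed

text \<open>A function separating f from the closure of \<open>TP\<close> would annihilate every
  power of t, so all its Fourier coefficients would vanish.\<close>

lemma TP_dense:
  assumes p: "p > 1" and f: "f \<in> Lp p" and e: "e > 0"
  shows "\<exists>w\<in>TP. Lp_norm p (f - w) < e"
proof -
  define q where "q = p / (p - 1)"
  have pq: "conj_exps p q" using p by (auto simp: conj_exps_def q_def field_simps)
  have TPs: "circ.subspace TP" unfolding TP_def by (rule circ.subspace_span)
  have TPL: "TP \<subseteq> Lp p" using TP_Lp p by auto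
  have "f \<in> Lp_closure p TP"
  proof (rule ccontr)
    assume nf: "f \<notin> Lp_closure p TP"
    obtain h where h: "h \<in> Lp q" "\<And>m. m \<in> Lp_closure p TP \<Longrightarrow> pairing m h = 0" "pairing f h \<noteq> 0"
      using Lp_separation[OF pq Lp_closure_subspace[OF _ TPs TPL] _ Lp_closure_closed[OF _ TPL] f nf] p
      by (auto simp: Lp_closure_def)
    have "fourier h n = 0" for n
    proof -
      have "pairing (tvar powi n) h = 0" by (rule h(2)[OF subsetD[OF Lp_closure_superset[OF TPL] TP_powi]])
      hence "fourier (conj_fun h * tvar powi n) 0 = 0" by (simp add: pairing_fourier mult.commute)
      thus ?thesis by (simp add: fourier_shift fourier_conj)
    qed
    hence "h = 0" using h(1) pq by (intro fourier_eq_0_imp_0 Lp_mono[OF h(1)]) (auto simp: conj_exps_def)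
    thus False using h(3) by simp
  qed
  thus ?thesis using e by (auto simp: Lp_closure_def)
qed

section \<open>The Riesz projection\<close>

text \<open>x0 is the midpoint of pi / (2 p) and pi / 2. Up to x0 the cosine is bounded below, and A
  is large enough; beyond x0 the angle p x stays in (pi / 2, pi] because p \<le> 2, so cos (p x)
  \<le> - c and B = 1 / c suffices.\<close>

lemma cos_power_bound:
  assumes p: "1 < p" "p \<le> 2"
  obtains A B where "A \<ge> 0" "B \<ge> 0"
    "\<And>x. \<bar>x\<bar> < pi / 2 \<Longrightarrow> 1 \<le> A * cos x powr p - B * cos (p * x)"
proof -
  define x0 where "x0 = (pi / 2) * ((1 / p + 1) / 2)"
  have pp: "1 / p < 1" "1 / p > 0" using p by auto
  have x0: "0 < x0" "x0 < pi / 2"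
    using pp mult_strict_left_mono[of "(1 / p + 1) / 2" 1 "pi / 2"]
    by (simp_all add: x0_def add_pos_pos)
  have px0: "pi / 2 < p * x0" "p * x0 < pi"
  proof -
    have "p * x0 = (pi / 2) * ((1 + p) / 2)" using p by (simp add: x0_def field_simps)
    moreover have "pi / 2 * 1 < (pi / 2) * ((1 + p) / 2)" using p by (intro mult_strict_left_mono) auto
    ultimately show "pi / 2 < p * x0" by linarith
    have "p * x0 \<le> 2 * x0" using p x0 by (intro mult_right_mono) auto
    thus "p * x0 < pi" using x0 by linarith
  qed
  define c where "c = - cos (p * x0)"
  have c: "c > 0"
  proof -
    have "cos (p * x0) < cos (pi / 2)" using px0 by (intro cos_monotone_0_pi) auto
    thus ?thesis by (simp add: c_def)
  qed
  define B where "B = 1 / c"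
  define A where "A = (1 + B) / cos x0 powr p"
  have cx0: "cos x0 > 0" using x0 by (intro cos_gt_zero_pi) auto
  have AB: "A \<ge> 0" "B \<ge> 0" using c cx0 by (auto simp: A_def B_def)
  have main: "1 \<le> A * cos x powr p - B * cos (p * x)" if x: "0 \<le> x" "x < pi / 2" for x
  proof (cases "x < x0")
    case True
    have "cos x0 \<le> cos x" using x True x0 by (intro cos_monotone_0_pi_le) auto
    hence "cos x0 powr p \<le> cos x powr p" using p cx0 by (intro powr_mono2) auto
    hence "A * cos x0 powr p \<le> A * cos x powr p" using AB by (intro mult_left_mono) auto
    moreover have "A * cos x0 powr p = 1 + B" using cx0 by (simp add: A_def)
    moreover have "B * cos (p * x) \<le> B * 1" using AB by (intro mult_left_mono) auto
    ultimately show ?thesis by linarith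
  next
    case False
    have "p * x \<le> 2 * x" using p x by (intro mult_right_mono) auto
    hence "p * x \<le> pi" using x by simp
    moreover have "p * x0 \<le> p * x" using False p by (intro mult_left_mono) auto
    ultimately have "cos (p * x) \<le> cos (p * x0)" using px0 x0 p by (intro cos_monotone_0_pi_le) auto
    hence "B * cos (p * x) \<le> B * (- c)" using AB by (intro mult_left_mono) (auto simp: c_def)
    also have "B * (- c) = -1" using c by (simp add: B_def)
    finally have "B * cos (p * x) \<le> - 1" .
    moreover have "A * cos x powr p \<ge> 0" using AB by simp
    ultimately show ?thesis by linarith
  qed
  show ?thesis
  proof (rule that[OF AB])
    fix x :: real assume "\<bar>x\<bar> < pi / 2"
    thus "1 \<le> A * cos x powr p - B * cos (p * x)"
      using main[of x] main[of "-x"] by (cases "x \<ge> 0") auto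
  qed
qed

text \<open>The cosine bound in polar coordinates. The last term is the real part of the holomorphic
  power w^p, so after composition with an analytic function its mean is the value at the
  centre.\<close>

lemma right_halfplane_bound:
  assumes p: "1 < p" "p \<le> 2"
  obtains A B where "A \<ge> 0" "B \<ge> 0"
    "\<And>w. Re w > 0 \<Longrightarrow> cmod w powr p \<le> A * Re w powr p - B * Re (exp (of_real p * Ln w))"
proof -
  obtain A B where AB: "A \<ge> 0" "B \<ge> 0"
    "\<And>x. \<bar>x\<bar> < pi / 2 \<Longrightarrow> 1 \<le> A * cos x powr p - B * cos (p * x)"
    using cos_power_bound[OF p] by blast
  have "cmod w powr p \<le> A * Re w powr p - B * Re (exp (of_real p * Ln w))" if w: "Re w > 0" for w
  proof -
    define x where "x = Im (Ln w)"
    have w0: "w \<noteq> 0" using w by auto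
    have x: "\<bar>x\<bar> < pi / 2" unfolding x_def using Re_Ln_pos_lt_imp[OF w] .
    have r: "exp (Re (Ln w)) = cmod w" using w0 by (simp add: Re_Ln)
    have Rw: "Re w = cmod w * cos x"
      using arg_cong[OF exp_Ln[OF w0], of Re] unfolding Re_exp r x_def by simp
    have "cos x > 0" using x by (intro cos_gt_zero_pi) auto
    hence 1: "Re w powr p = cmod w powr p * cos x powr p" unfolding Rw by (simp add: powr_mult)
    have "Re (exp (of_real p * Ln w)) = exp (p * Re (Ln w)) * cos (p * x)"
      by (simp add: Re_exp x_def)
    also have "exp (p * Re (Ln w)) = cmod w powr p"
      using w0 by (simp add: powr_def Re_Ln)
    finally have 2: "Re (exp (of_real p * Ln w)) = cmod w powr p * cos (p * x)" .
    have "cmod w powr p * 1 \<le> cmod w powr p * (A * cos x powr p - B * cos (p * x))"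
      by (intro mult_left_mono AB x) auto
    thus ?thesis unfolding 1 2 by (simp add: algebra_simps)
  qed
  thus ?thesis using that AB by blast
qed

lemma circle_integrable_continuous:
  fixes g :: "complex \<Rightarrow> 'a :: {banach, second_countable_topology}"
  assumes g: "continuous_on (sphere 0 1) g" and m: "g \<in> borel_measurable borel"
  shows "integrable circle g"
proof -
  have "\<exists>B. \<forall>t\<in>sphere 0 1. norm (g t) \<le> B"
    using compact_imp_bounded[OF compact_continuous_image[OF g compact_sphere]]
    by (auto simp: bounded_iff)
  then obtain B where "\<forall>t\<in>sphere 0 1. norm (g t) \<le> B" by blast
  hence "AE t in circle. norm (g t) \<le> norm B"
    using AE_circle_norm by (auto elim!: eventually_mono intro: order_trans[OF _ abs_ge_self])
  thus ?thesis
    by (rule Bochner_Integration.integrable_bound[of circle "\<lambda>_. B", rotated 2]) (use m in simp_all)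
qed

text \<open>Only the values of g on the closed disc are controlled; the cut-off makes the function
  Borel measurable and changes nothing on the circle.\<close>

lemma circle_mean_value':
  assumes g: "g holomorphic_on cball 0 1"
  shows "integrable circle (\<lambda>z. indicator (cball 0 1) z *\<^sub>R g z)"
    "(LINT t|circle. indicator (cball 0 1) t *\<^sub>R g t) = g (0::complex)"
proof -
  have m: "(\<lambda>z. indicator (cball 0 1) z *\<^sub>R g z) \<in> borel_measurable borel"
    by (rule borel_measurable_continuous_on_indicator)
       (use holomorphic_on_imp_continuous_on[OF g] in auto)
  have h: "(\<lambda>z. indicator (cball 0 1) z *\<^sub>R g z) holomorphic_on cball 0 1"
    by (rule holomorphic_transform[OF g]) auto
  show "(LINT t|circle. indicator (cball 0 1) t *\<^sub>R g t) = g 0"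
    using circle_mean_value[OF h m] by simp
  show "integrable circle (\<lambda>z. indicator (cball 0 1) z *\<^sub>R g z)"
    by (rule circle_integrable_continuous[OF _ m])
       (rule continuous_on_subset[OF holomorphic_on_imp_continuous_on[OF h]], auto)
qed

lemma analytic_poly_bound:
  fixes b :: "nat \<Rightarrow> complex"
  assumes AB: "A \<ge> 0" "B \<ge> 0"
    "\<And>w. Re w > 0 \<Longrightarrow> cmod w powr p \<le> A * Re w powr p - B * Re (exp (of_real p * Ln w))"
   and p: "p > 1"
   and b0: "Im (b 0) = 0"
   and F: "F = (\<lambda>z. \<Sum>k\<le>N. b k * z ^ k)"
   and pos: "\<And>t. cmod t = 1 \<Longrightarrow> Re (F t) > 0"
  shows "(LINT t|circle. cmod (F t) powr p) \<le> A * (LINT t|circle. Re (F t) powr p)"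
proof -
  have Fhol: "F holomorphic_on S" for S unfolding F by (intro holomorphic_intros)
  have Fcont: "continuous_on S F" for S using Fhol by (rule holomorphic_on_imp_continuous_on)
  have Fm [measurable]: "F \<in> borel_measurable borel" by (intro borel_measurable_continuous_onI Fcont)
  have "\<exists>x\<in>sphere 0 1. \<forall>y\<in>sphere 0 1. Re (F x) \<le> Re (F y)"
    by (rule continuous_attains_inf) (auto intro!: continuous_intros Fcont)
  then obtain t0 where t0: "t0 \<in> sphere 0 1" "\<And>t. t \<in> sphere 0 1 \<Longrightarrow> Re (F t0) \<le> Re (F t)" by blast
  define \<delta> where "\<delta> = Re (F t0)"
  have \<delta>: "\<delta> > 0" using t0(1) pos by (simp add: \<delta>_def)
  \<comment> \<open>The maximum modulus principle for exp (- F) carries the positive minimum of Re F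
    from the circle into the disc.\<close>
  have disc: "Re (F z) > 0" if z: "cmod z \<le> 1" for z
  proof (cases "cmod z = 1")
    case False
    have "norm (exp (- F z)) \<le> exp (- \<delta>)"
    proof (rule maximum_modulus_frontier[where S = "ball 0 1" and f = "\<lambda>z. exp (- F z)" and \<xi> = z])
      show "(\<lambda>z. exp (- F z)) holomorphic_on interior (ball 0 1)" by (intro holomorphic_intros Fhol)
      show "continuous_on (closure (ball 0 1)) (\<lambda>z. exp (- F z))" by (intro continuous_intros Fcont)
      show "norm (exp (- F w)) \<le> exp (- \<delta>)" if "w \<in> frontier (ball 0 1)" for w
        using t0(2)[of w] that by (simp add: norm_exp_eq_Re \<delta>_def)
    qed (use z False in auto)
    hence "Re (F z) \<ge> \<delta>" by (simp add: norm_exp_eq_Re)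
    thus ?thesis using \<delta> by simp
  qed (use pos in auto)
  define g where "g = (\<lambda>z. exp (of_real p * Ln (F z)))"
  have ghol: "g holomorphic_on cball 0 1"
    unfolding g_def
  proof (intro holomorphic_intros Fhol)
    fix z :: complex assume "z \<in> cball 0 1"
    thus "F z \<notin> \<real>\<^sub>\<le>\<^sub>0" using disc[of z] by (auto simp: complex_nonpos_Reals_iff)
  qed
  have "F 0 = b 0" unfolding F by (simp add: sum.atMost_shift)
  hence F0: "Im (F 0) = 0" "Re (F 0) > 0" using b0 disc[of 0] by auto
  hence F0': "F 0 = of_real (Re (F 0))" by (simp add: complex_eq_iff)
  have "Ln (F 0) = of_real (ln (Re (F 0)))" by (subst F0') (use F0 Ln_of_real in auto)
  hence "g 0 = of_real (exp (p * ln (Re (F 0))))" by (simp add: g_def exp_of_real[symmetric])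
  hence g0: "Re (g 0) \<ge> 0" by simp
  have i1: "integrable circle (\<lambda>t. Re (F t) powr p)"
    by (rule circle_integrable_continuous) (use p pos in \<open>force intro!: continuous_on_powr' continuous_intros Fcont simp: less_imp_le\<close>, measurable)
  have i2: "integrable circle (\<lambda>t. cmod (F t) powr p)"
    by (rule circle_integrable_continuous, rule continuous_on_powr') (use p in \<open>auto intro!: continuous_intros Fcont\<close>)
  define g1 where "g1 = (\<lambda>t. indicator (cball 0 1) t *\<^sub>R g t)"
  have mv: "integrable circle (\<lambda>t. Re (g1 t))" "(LINT t|circle. Re (g1 t)) = Re (g 0)"
    using circle_mean_value'[OF ghol] unfolding g1_def[symmetric] by (auto simp: integral_Re)
  have "(LINT t|circle. cmod (F t) powr p) \<le>
     (LINT t|circle. A * Re (F t) powr p - B * Re (g1 t))"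
  proof (rule integral_mono_AE)
    show "AE t in circle. cmod (F t) powr p \<le> A * Re (F t) powr p - B * Re (g1 t)"
      using AE_circle_norm
    proof eventually_elim
      case (elim t)
      have "t \<in> cball 0 1" using elim by simp
      thus ?case using AB(3)[OF pos[OF elim]] by (simp add: g_def g1_def)
    qed
  qed (use i1 i2 mv(1) in simp_all)
  also have "\<dots> = A * (LINT t|circle. Re (F t) powr p) - B * Re (g 0)"
    using i1 mv by simp
  also have "\<dots> \<le> A * (LINT t|circle. Re (F t) powr p)" using AB g0 by simp
  finally show ?thesis .
qed

text \<open>The angles in the open interval where g is negative form an open set of measure zero,
  hence none exist; the two endpoints follow by continuity.\<close>

lemma AE_circle_nonneg_imp:
  fixes g :: "complex \<Rightarrow> real"
  assumes g: "continuous_on UNIV g" and ae: "AE t in circle. g t \<ge> 0" and t: "cmod t = 1"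
  shows "g t \<ge> 0"
proof -
  have [measurable]: "g \<in> borel_measurable borel" by (intro borel_measurable_continuous_onI g)
  have neg: "negligible {x \<in> {0..2*pi}. \<not> g (cis x) \<ge> 0}"
    using ae by (subst (asm) AE_circle_iff) auto
  have c: "continuous_on A (\<lambda>x. g (cis x))" for A
    by (rule continuous_on_compose2[OF g]) (auto intro: continuous_intros)
  let ?U = "{x \<in> {0<..<2*pi}. g (cis x) < 0}"
  have "open ?U"
  proof -
    have "?U = {0<..<2*pi} \<inter> {x. g (cis x) < 0}" by auto
    thus ?thesis using open_Int[OF open_greaterThanLessThan open_Collect_less[OF c continuous_on_const]] by simp
  qed
  moreover have "negligible ?U" by (rule negligible_subset[OF neg]) auto
  ultimately have U: "?U = {}" using open_not_negligible by blast
  have "g (cis x) \<ge> 0" if x: "x \<in> {0..2*pi}" for x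
  proof (rule continuous_ge_on_closure[where S = "{0<..<2*pi}" and f = "\<lambda>x. g (cis x)"])
    show "continuous_on (closure {0<..<2 * pi}) (\<lambda>x. g (cis x))" by (rule c)
    show "x \<in> closure {0<..<2 * pi}" using x by simp
    fix x assume x: "x \<in> {0<..<2 * pi}"
    have "x \<notin> ?U" using U by blast
    thus "0 \<le> g (cis x)" using x by auto
  qed
  moreover obtain x where "t = cis x" "x \<in> {0..2*pi}"
  proof
    show "t = cis (Arg2pi t)" using complex_norm_eq_1_exp[of t] t by (simp add: cis_conv_exp)
    show "Arg2pi t \<in> {0..2*pi}" using Arg2pi_ge_0 Arg2pi_lt_2pi[of t] by (auto simp: less_imp_le)
  qed
  ultimately show ?thesis by blast
qed

section \<open>The inequality of M. Riesz for trigonometric polynomials\<close>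

lemma Pproj_eqI:
  assumes "g \<in> Lp 1" "\<And>n. fourier g n = (if n \<ge> 0 then fourier f n else 0)"
  shows "Pproj f = g"
  unfolding Pproj_def
proof (rule the_equality)
  fix h assume "h \<in> Lp 1 \<and> (\<forall>n. fourier h n = (if n \<ge> 0 then fourier f n else 0))"
  thus "h = g" using assms by (intro fourier_unique) auto
qed (use assms in auto)

lemma fourier_trig_mult:
  assumes g: "g \<in> Lp 1"
  shows "fourier ((\<Sum>k\<in>K. cscale (c k) (tvar powi k)) * g) n = (\<Sum>k\<in>K. c k * fourier g (n - k))"
proof -
  have e: "(\<Sum>k\<in>K. cscale (c k) (tvar powi k)) * g = (\<Sum>k\<in>K. cscale (c k) (g * tvar powi k))"
    unfolding sum_distrib_right by (rule sum.cong) (auto simp: cscale_mult_left cscale_mult_right mult.commute)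
  have "cscale (c k) (g * tvar powi k) \<in> Lp 1" for k
    using Linf_mult_in_Lp[OF tvar_powi_Linf g, of k] by (intro cscale_in_Lp) (simp add: mult.commute)
  thus ?thesis unfolding e by (simp add: fourier_sum fourier_cscale fourier_shift)
qed

lemma Pproj_TP_expand:
  assumes "f = (\<Sum>k\<in>{-int N..int N}. cscale (c k) (tvar powi k))"
  shows "Pproj f = (\<Sum>k\<in>{0..int N}. cscale (c k) (tvar powi k))"
  by (rule Pproj_eqI) (auto simp: assms fourier_trig_sum intro!: TP_Lp TP_sum TP_cscale)

lemma Pproj_TP:
  assumes "f \<in> TP"
  shows "Pproj f \<in> TP" "fourier (Pproj f) n = (if n \<ge> 0 then fourier f n else 0)"
proof -
  obtain N c where f: "f = (\<Sum>k\<in>{-int N..int N}. cscale (c k) (tvar powi k))"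
    using TP_expand[OF assms] by blast
  show "Pproj f \<in> TP" unfolding Pproj_TP_expand[OF f] by (intro TP_sum TP_cscale TP_powi)
  show "fourier (Pproj f) n = (if n \<ge> 0 then fourier f n else 0)"
    unfolding Pproj_TP_expand[OF f] unfolding f by (simp add: fourier_trig_sum)
qed

lemma Pproj_TP_add: "f \<in> TP \<Longrightarrow> g \<in> TP \<Longrightarrow> Pproj (f + g) = Pproj f + Pproj g"
  by (rule Pproj_eqI) (auto simp: Pproj_TP fourier_add TP_Lp intro!: TP_Lp TP_add)

lemma Pproj_TP_diff: "f \<in> TP \<Longrightarrow> g \<in> TP \<Longrightarrow> Pproj (f - g) = Pproj f - Pproj g"
  by (rule Pproj_eqI) (auto simp: Pproj_TP fourier_diff TP_Lp intro!: TP_Lp TP_diff)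

lemma Pproj_TP_cscale: "f \<in> TP \<Longrightarrow> Pproj (cscale z f) = cscale z (Pproj f)"
  by (rule Pproj_eqI) (auto simp: Pproj_TP fourier_cscale TP_Lp intro!: TP_Lp TP_cscale)

text \<open>Analytic polynomials are orthogonal to antianalytic ones of mean 0. This symmetry gives
  the contraction on L^2 and the transfer from p to q.\<close>

lemma pairing_TP_P:
  assumes f: "f \<in> TP" and g: "g \<in> TP"
  shows "pairing (Pproj f) g = pairing f (Pproj g)"
proof -
  have orth: "pairing u (conj_fun v) = 0"
    if u: "u \<in> TP" "\<And>n. n < 0 \<Longrightarrow> fourier u n = 0" and v: "v \<in> TP" "\<And>n. n \<le> 0 \<Longrightarrow> fourier v n = 0" for u v
  proof -
    obtain N c where c: "u = (\<Sum>k\<in>{-int N..int N}. cscale (c k) (tvar powi k))"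
      using TP_expand[OF u(1)] by blast
    have ck: "c k = 0" if "k \<in> {-int N..int N}" "k < 0" for k
      using u(2)[OF that(2)] that(1) unfolding c by (simp add: fourier_trig_sum)
    have "pairing u (conj_fun v) = (\<Sum>k\<in>{-int N..int N}. c k * fourier v (0 - k))"
      unfolding pairing_fourier conj_fun_conj by (subst c, rule fourier_trig_mult) (rule TP_Lp[OF v(1)], simp)
    also have "\<dots> = 0"
    proof (rule sum.neutral, rule ballI)
      fix k assume "k \<in> {-int N..int N}"
      thus "c k * fourier v (0 - k) = 0" using ck[of k] v(2)[of "-k"] by (cases "k < 0") auto
    qed
    finally show ?thesis .
  qed
  have 1: "pairing (Pproj f) (g - Pproj g) = 0" if "f \<in> TP" "g \<in> TP" for f g
  proof -
    have "pairing (Pproj f) (conj_fun (conj_fun (g - Pproj g))) = 0"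
      using that by (intro orth TP_conj TP_diff)
        (auto simp: Pproj_TP fourier_conj fourier_diff TP_Lp)
    thus ?thesis by simp
  qed
  have two: "conj_exps 2 2" by (simp add: conj_exps_def)
  have L: "f \<in> Lp 2" "g \<in> Lp 2" "Pproj f \<in> Lp 2" "Pproj g \<in> Lp 2"
    using f g Pproj_TP(1) by (auto intro: TP_Lp)
  have "pairing (Pproj f) g = pairing (Pproj f) (Pproj g)"
    using 1[OF f g] pairing_diff_right[OF two L(3,2,4)] by simp
  moreover have "pairing (f - Pproj f) (Pproj g) = 0"
    using 1[OF g f] pairing_cnj[of "Pproj g" "f - Pproj f"] by simp
  ultimately show ?thesis using pairing_diff_left[OF two L(1,3,4)] by simp
qed

lemma Lp_1 [simp]: "p > 0 \<Longrightarrow> 1 \<in> Lp p"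
  by (rule Linf_in_Lp) auto

lemma Lp_norm_2_sq: "f \<in> Lp 2 \<Longrightarrow> of_real ((Lp_norm 2 f)\<^sup>2) = pairing f f"
proof -
  assume "f \<in> Lp 2"
  have "pairing f f = (LINT t|circle. complex_of_real (cmod (ev f t) powr 2))"
    unfolding pairing_eq by (rule ev_integral_cong) (auto simp: complex_norm_square[symmetric] powr_numeral)
  also have "\<dots> = of_real (LINT t|circle. cmod (ev f t) powr 2)"
    by (rule integral_complex_of_real)
  also have "(LINT t|circle. cmod (ev f t) powr 2) = Lp_norm 2 f powr 2"
    by (rule Lp_norm_powr[symmetric]) simp
  finally show ?thesis by simp
qed

lemma Pproj_TP_contraction:
  assumes f: "f \<in> TP"
  shows "Lp_norm 2 (Pproj f) \<le> Lp_norm 2 f"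
proof -
  have two: "conj_exps 2 2" by (simp add: conj_exps_def)
  have L: "f \<in> Lp 2" "Pproj f \<in> Lp 2"
    using f Pproj_TP(1) by (auto intro: TP_Lp)
  have PP: "Pproj (Pproj f) = Pproj f"
    using f by (intro Pproj_eqI) (auto simp: Pproj_TP TP_Lp)
  have "pairing (Pproj f) (Pproj f) = pairing f (Pproj f)"
    using pairing_TP_P[OF f Pproj_TP(1)[OF f]] PP by simp
  hence "(Lp_norm 2 (Pproj f))\<^sup>2 = cmod (pairing f (Pproj f))"
    using Lp_norm_2_sq[OF L(2)] by (metis norm_of_real abs_of_nonneg zero_le_power2)
  also have "\<dots> \<le> Lp_norm 2 f * Lp_norm 2 (Pproj f)" by (rule pairing_bound[OF two L])
  finally have le: "Lp_norm 2 (Pproj f) * Lp_norm 2 (Pproj f) \<le> Lp_norm 2 f * Lp_norm 2 (Pproj f)"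
    by (simp add: power2_eq_square)
  show ?thesis
  proof (cases "Lp_norm 2 (Pproj f) = 0")
    case False
    hence "Lp_norm 2 (Pproj f) > 0" using Lp_norm_nonneg[of 2 "Pproj f"] by linarith
    thus ?thesis using le by (rule mult_right_le_imp_le[rotated])
  qed simp
qed

lemma Lp_norm_mono_AE:
  assumes "AE t in circle. cmod (ev f t) \<le> cmod (ev g t)" "g \<in> Lp p" "p > 0"
  shows "f \<in> Lp p" "Lp_norm p f \<le> Lp_norm p g"
proof -
  have le: "AE t in circle. cmod (ev f t) powr p \<le> cmod (ev g t) powr p"
    using assms(1) by eventually_elim (use assms(3) in \<open>auto intro: powr_mono2\<close>)
  show 1: "f \<in> Lp p" unfolding Lp_iff
    by (rule Bochner_Integration.integrable_bound[OF assms(2)[unfolded Lp_iff]]) (use le in auto)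
  have "(LINT t|circle. cmod (ev f t) powr p) \<le> (LINT t|circle. cmod (ev g t) powr p)"
    using 1 assms(2) le by (intro integral_mono_AE) (auto simp: Lp_iff)
  thus "Lp_norm p f \<le> Lp_norm p g"
    unfolding Lp_norm_eq using assms(3) by (intro powr_mono2) auto
qed

text \<open>Where |f| \<le> e use e^p, elsewhere |f|^p \<le> e^(p - 2) |f|^2. It handles an error
  term for which only the contraction on L^2 is available so far.\<close>

lemma Lp_norm_small_of_L2:
  assumes f: "f \<in> TP" and p: "1 < p" "p \<le> 2" and e: "e > 0" and le: "Lp_norm 2 f \<le> e"
  shows "Lp_norm p f \<le> 2 * e"
proof -
  have pt: "x powr p \<le> e powr p + e powr (p - 2) * x powr 2" if "x \<ge> 0" for x
  proof (cases "x \<le> e")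
    case True
    hence "x powr p \<le> e powr p" using that p by (intro powr_mono2) auto
    thus ?thesis by (simp add: add_increasing2)
  next
    case False
    have "x powr p = x powr (p - 2) * x powr 2" by (simp only: powr_add[symmetric]) simp
    also have "\<dots> \<le> e powr (p - 2) * x powr 2"
      using False e p by (intro mult_right_mono powr_mono2') auto
    finally show ?thesis by (simp add: add_increasing)
  qed
  have L: "f \<in> Lp 2" "f \<in> Lp p" using f p by (auto intro: TP_Lp)
  have "(LINT t|circle. cmod (ev f t) powr p) \<le> (LINT t|circle. e powr p + e powr (p - 2) * cmod (ev f t) powr 2)"
    using L pt by (intro integral_mono_AE AE_I2) (auto simp: Lp_iff)
  also have "\<dots> = e powr p + e powr (p - 2) * (LINT t|circle. cmod (ev f t) powr 2)"
    using L by (simp add: Lp_iff)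
  also have "(LINT t|circle. cmod (ev f t) powr 2) = Lp_norm 2 f powr 2"
    by (rule Lp_norm_powr[symmetric]) simp
  also have "e powr p + e powr (p - 2) * Lp_norm 2 f powr 2 \<le> e powr p + e powr (p - 2) * e powr 2"
    using le by (intro add_left_mono mult_left_mono powr_mono2) auto
  also have "e powr (p - 2) * e powr 2 = e powr p" by (simp only: powr_add[symmetric]) simp
  also have "e powr p + e powr p \<le> 2 powr p * e powr p"
    using p powr_mono[of 1 p 2] by (simp add: mult_right_mono)
  also have "\<dots> = (2 * e) powr p" using e by (simp add: powr_mult)
  finally show ?thesis using p e by (intro Lp_norm_leI) auto
qed

lemma cscale_1_Lp: "p > 0 \<Longrightarrow> cscale z 1 \<in> Lp p" and Lp_norm_cscale_1: "p > 0 \<Longrightarrow> Lp_norm p (cscale z 1) \<le> cmod z"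
proof -
  have "AE t in circle. cmod (ev (cscale z 1) t) \<le> cmod z"
    using ev_cscale[of z 1] ev_1 by eventually_elim simp
  thus "p > 0 \<Longrightarrow> cscale z 1 \<in> Lp p" "p > 0 \<Longrightarrow> Lp_norm p (cscale z 1) \<le> cmod z"
    using bounded_in_Lp bounded_Lp_norm by auto
qed

text \<open>The coefficients of a real function are conjugate symmetric, so 2 P u - u_0 and its
  conjugate add up to 2 u. The completion is given as an ordinary polynomial, so that it is
  holomorphic in the disc.\<close>

lemma real_TP_completion:
  assumes u: "u \<in> TP" and r: "AE t in circle. ev u t = complex_of_real (r t)"
  obtains N and b :: "nat \<Rightarrow> complex" where
    "AE t in circle. ev (cscale 2 (Pproj u) - cscale (fourier u 0) 1) t = (\<Sum>k\<le>N. b k * t ^ k)"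
    "AE t in circle. Re (\<Sum>k\<le>N. b k * t ^ k) = r t" "b 0 = fourier u 0" "Im (b 0) = 0"
proof -
  have "conj_fun u = u"
    by (rule circfun_eqI) (use ev_conj[of u] r in \<open>eventually_elim, simp\<close>)
  hence fc: "fourier u (- n) = cnj (fourier u n)" for n using fourier_conj[of u "-n"] by simp
  define c0 where "c0 = fourier u 0"
  have c0: "cnj c0 = c0" using fc[of 0] by (simp add: c0_def)
  obtain N c where uc: "u = (\<Sum>k\<in>{-int N..int N}. cscale (c k) (tvar powi k))"
    using TP_expand[OF u] by blast
  have uL: "u \<in> Lp 1" using u by (auto intro: TP_Lp)
  let ?v = "Pproj u"
  have v: "?v \<in> TP" by (rule Pproj_TP[OF u])
  define G where "G = cscale 2 ?v - cscale c0 1"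
  have G: "G \<in> TP" using v by (auto simp: G_def intro!: TP_diff TP_cscale)
  have uu: "u + u = G + conj_fun G"
  proof (rule fourier_unique)
    show "fourier (u + u) n = fourier (G + conj_fun G) n" for n
    proof -
      have fG: "fourier G n = 2 * (if n \<ge> 0 then fourier u n else 0) - c0 * (if n = 0 then 1 else 0)" for n
        unfolding G_def using TP_Lp[OF v, of 1] fourier_tvar_powi[of 0]
        by (subst fourier_diff) (auto simp: fourier_cscale Pproj_TP[OF u] intro!: cscale_1_Lp cscale_in_Lp)
      have "fourier (u + u) n = fourier u n + fourier u n" by (rule fourier_add[OF uL uL])
      moreover have "fourier (G + conj_fun G) n = fourier G n + cnj (fourier G (- n))"
        using TP_Lp[OF G, of 1] by (subst fourier_add) (auto simp: fourier_conj)
      ultimately show ?thesis using fc[of n] c0 by (auto simp: fG c0_def)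
    qed
  qed (use TP_Lp[OF TP_add[OF u u], of 1] TP_Lp[OF TP_add[OF G TP_conj[OF G]], of 1] in auto)
  have ReG: "AE t in circle. Re (ev G t) = r t"
    using r ev_plus[of u u] ev_plus[of G "conj_fun G"] ev_conj[of G]
  proof eventually_elim
    case (elim t)
    have "ev u t + ev u t = ev G t + cnj (ev G t)" using elim uu by simp
    thus ?case using elim by (simp add: complex_eq_iff)
  qed
  define b where "b = (\<lambda>k::nat. (if k = 0 then 2 * c 0 - c0 else 2 * c (int k)))"
  have vc: "?v = (\<Sum>k\<in>{0..int N}. cscale (c k) (tvar powi k))" by (rule Pproj_TP_expand[OF uc])
  have c00: "c 0 = c0" unfolding c0_def uc by (simp add: fourier_trig_sum)
  define F where "F = (\<lambda>z. \<Sum>k\<le>N. b k * z ^ k)"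
  have GF: "AE t in circle. ev G t = F t"
  proof -
    have "AE t in circle. \<forall>k\<in>{0..int N}. ev (cscale (c k) (tvar powi k)) t = c k * t powi k"
    proof (rule AE_finite_allI)
      fix k show "AE t in circle. ev (cscale (c k) (tvar powi k)) t = c k * t powi k"
        using ev_cscale[of "c k" "tvar powi k"] ev_tvar_powi[of k] by eventually_elim simp
    qed simp
    thus ?thesis
      using ev_minus[of "cscale 2 ?v" "cscale c0 1"] ev_cscale[of 2 ?v] ev_cscale[of c0 1] ev_1
        ev_sum[of "\<lambda>k. cscale (c k) (tvar powi k)" "{0..int N}"]
      unfolding G_def[symmetric] vc[symmetric]
    proof eventually_elim
      case (elim t)
      have "ev ?v t = (\<Sum>k\<in>{0..int N}. c k * t powi k)" using elim by simp
      also have "\<dots> = (\<Sum>k\<in>int ` {..N}. c k * t powi k)"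
        by (rule sum.cong) (simp_all add: atMost_atLeast0 image_int_atLeastAtMost)
      also have "\<dots> = (\<Sum>k\<le>N. c (int k) * t ^ k)" by (subst sum.reindex) auto
      finally have "ev G t = (\<Sum>k\<le>N. 2 * c (int k) * t ^ k) - c0"
        using elim by (simp add: sum_distrib_left mult.assoc)
      also have "\<dots> = F t"
        unfolding F_def b_def by (simp add: sum.atMost_shift)
      finally show ?case .
    qed
  qed
  have "AE t in circle. Re (F t) = r t" using GF ReG by eventually_elim simp
  moreover have b0: "b 0 = c0" using c00 by (simp add: b_def)
  moreover have "Im (b 0) = 0" using c0 unfolding b0 by (simp add: complex_eq_iff)
  ultimately show ?thesis
    using that[of b N] GF unfolding F_def G_def c0_def by blast
qed

text \<open>M. Riesz's inequality for a nonnegative trigonometric polynomial \<open>u\<close>: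
  \<open>G = 2 P u - u\<^sub>0\<close> is analytic with \<open>Re G = u\<close>, and \<open>G + e\<close> maps the disc to the right half plane.\<close>

lemma Riesz_nonneg:
  assumes p: "1 < p" "p \<le> 2"
  obtains C where "C \<ge> 0" "\<And>u r. u \<in> TP \<Longrightarrow> (AE t in circle. ev u t = complex_of_real (r t) \<and> r t \<ge> 0)
      \<Longrightarrow> Lp_norm p (Pproj u) \<le> C * Lp_norm p u"
proof -
  obtain A B where AB: "A \<ge> 0" "B \<ge> 0"
    "\<And>w. Re w > 0 \<Longrightarrow> cmod w powr p \<le> A * Re w powr p - B * Re (exp (of_real p * Ln w))"
    using right_halfplane_bound[OF p] by blast
  define A' where "A' = A powr (1 / p)"
  have main: "Lp_norm p (Pproj u) \<le> (A' + 1) * Lp_norm p u"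
    if u: "u \<in> TP" and r: "AE t in circle. ev u t = complex_of_real (r t) \<and> r t \<ge> 0" for u r
  proof -
    define c0 where "c0 = fourier u 0"
    have uL: "u \<in> Lp p" "u \<in> Lp 1" using u p by (auto intro: TP_Lp)
    let ?v = "Pproj u"
    have v: "?v \<in> TP" "?v \<in> Lp p" using Pproj_TP(1)[OF u] p by (auto intro: TP_Lp)
    define G where "G = cscale 2 ?v - cscale c0 1"
    have G: "G \<in> TP" "G \<in> Lp p" using v p by (auto simp: G_def intro!: TP_diff TP_cscale TP_Lp)
    have "AE t in circle. ev u t = of_real (r t)" using r by eventually_elim simp
    then obtain N b where b: "AE t in circle. ev G t = (\<Sum>k\<le>N. b k * t ^ k)"
      "AE t in circle. Re (\<Sum>k\<le>N. b k * t ^ k) = r t" "b 0 = c0" "Im (b 0) = 0"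
      using real_TP_completion[OF u, of r] unfolding G_def c0_def by blast
    define F where "F = (\<lambda>z. \<Sum>k\<le>N. b k * z ^ k)"
    have GF: "AE t in circle. ev G t = F t" using b(1) by (simp add: F_def)
    have ReG: "AE t in circle. Re (ev G t) = r t" using b(1,2) by eventually_elim simp
    have Fcont: "continuous_on UNIV F" unfolding F_def by (intro continuous_intros)
    have Fpos: "Re (F t) \<ge> 0" if "cmod t = 1" for t
    proof (rule AE_circle_nonneg_imp[OF _ _ that])
      show "AE t in circle. 0 \<le> Re (F t)" using ReG GF r by eventually_elim auto
    qed (intro continuous_intros Fcont)
    have Gn: "Lp_norm p G \<le> A' * Lp_norm p u"
    proof (rule field_le_epsilon)
      fix e' :: real assume e': "e' > 0"
      \<comment> \<open>Adding e to u costs A' e, removing it from G costs another e.\<close>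
      define e where "e = e' / (A' + 1)"
      have A'0: "A' \<ge> 0" by (simp add: A'_def)
      have e: "e > 0" using e' A'0 by (simp add: e_def add_nonneg_pos)
      define b' where "b' = (\<lambda>k::nat. b k + (if k = 0 then of_real e else 0))"
      have F': "(\<lambda>z. F z + of_real e) = (\<lambda>z. \<Sum>k\<le>N. b' k * z ^ k)"
        by (rule ext) (simp add: F_def b'_def sum.atMost_shift algebra_simps)
      have "(LINT t|circle. cmod (F t + of_real e) powr p) \<le> A * (LINT t|circle. Re (F t + of_real e) powr p)"
        by (rule analytic_poly_bound[OF AB p(1) _ F'])
           (use b(4) Fpos e in \<open>auto simp: b'_def add_nonneg_pos\<close>)
      moreover have "(LINT t|circle. cmod (F t + of_real e) powr p) = Lp_norm p (G + cscale (of_real e) 1) powr p"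
      proof -
        have [measurable]: "F \<in> borel_measurable borel" by (intro borel_measurable_continuous_onI Fcont)
        show ?thesis using p by (subst Lp_norm_powr, simp)
          (rule ev_integral_cong, use GF ev_plus[of G "cscale (of_real e) 1"] ev_cscale[of "of_real e" 1] ev_1 in \<open>eventually_elim, simp\<close>, measurable)
      qed
      moreover have "(LINT t|circle. Re (F t + of_real e) powr p) = Lp_norm p (u + cscale (of_real e) 1) powr p"
      proof -
        have [measurable]: "F \<in> borel_measurable borel" by (intro borel_measurable_continuous_onI Fcont)
        show ?thesis using p by (subst Lp_norm_powr, simp)
          (rule ev_integral_cong, use GF ReG r ev_plus[of u "cscale (of_real e) 1"] ev_cscale[of "of_real e" 1] ev_1 in \<open>eventually_elim, simp add: e less_imp_le flip: of_real_add\<close>, measurable)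
      qed
      ultimately have "Lp_norm p (G + cscale (of_real e) 1) powr p \<le> A * Lp_norm p (u + cscale (of_real e) 1) powr p"
        by simp
      also have "\<dots> = (A' * Lp_norm p (u + cscale (of_real e) 1)) powr p"
        using AB p by (simp add: powr_mult A'_def powr_powr)
      finally have 1: "Lp_norm p (G + cscale (of_real e) 1) \<le> A' * Lp_norm p (u + cscale (of_real e) 1)"
        using p A'0 powr_less_mono2[of p "A' * Lp_norm p (u + cscale (of_real e) 1)" "Lp_norm p (G + cscale (of_real e) 1)"]
          Lp_norm_nonneg[of p "u + cscale (of_real e) 1"]
        by (intro leI notI) auto
      have ce: "cscale (of_real e) 1 \<in> Lp p" "Lp_norm p (cscale (of_real e) 1) \<le> e"
        using cscale_1_Lp[of p "of_real e"] Lp_norm_cscale_1[of p "of_real e"] p e by auto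
      have "Lp_norm p G \<le> Lp_norm p (G + cscale (of_real e) 1) + Lp_norm p (cscale (of_real e) 1)"
        using Lp_norm_diff[of p "G + cscale (of_real e) 1" "cscale (of_real e) 1"] p G ce by (simp add: Lp_add)
      also have "\<dots> \<le> A' * (Lp_norm p u + e) + e"
        using 1 ce(2) Lp_norm_add[of p u "cscale (of_real e) 1"] p uL ce A'0
        by (intro add_mono) (auto intro!: order_trans[OF 1] mult_left_mono)
      also have "\<dots> = A' * Lp_norm p u + (A' + 1) * e" by (simp add: algebra_simps)
      also have "(A' + 1) * e = e'" using A'0 by (simp add: e_def add_nonneg_eq_0_iff)
      finally show "Lp_norm p G \<le> A' * Lp_norm p u + e'" .
    qed
    have "cmod c0 \<le> Lp_norm p u"
      using fourier_bound[OF uL(2), of 0] Lp_norm_1_le[OF uL(1)] p by (simp add: c0_def)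
    hence cc: "Lp_norm p (cscale c0 1) \<le> Lp_norm p u" using Lp_norm_cscale_1[of p c0] p by simp
    have "cscale 2 ?v = G + cscale c0 1" by (simp add: G_def)
    hence "2 * Lp_norm p ?v = Lp_norm p (G + cscale c0 1)"
      using Lp_norm_cscale[of p 2 ?v] p by simp
    moreover have "Lp_norm p ?v \<le> 2 * Lp_norm p ?v" by simp
    ultimately have "Lp_norm p ?v \<le> Lp_norm p (G + cscale c0 1)" by linarith
    also have "\<dots> \<le> Lp_norm p G + Lp_norm p (cscale c0 1)"
      using p G by (intro Lp_norm_add cscale_1_Lp) auto
    also have "\<dots> \<le> A' * Lp_norm p u + Lp_norm p u" using Gn cc by simp
    finally show ?thesis by (simp add: algebra_simps)
  qed
  show ?thesis
    by (rule that[of "A' + 1"]) (use main in \<open>auto simp: A'_def\<close>)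
qed

text \<open>The positive and negative parts of the real and imaginary parts of f are only
  continuous. Each is replaced by a nonnegative trigonometric polynomial; what remains of f is
  uniformly small and is estimated in L^2.\<close>

lemma Riesz_TP_le2:
  assumes p: "1 < p" "p \<le> 2"
  obtains C where "C \<ge> 0" "\<And>f. f \<in> TP \<Longrightarrow> Lp_norm p (Pproj f) \<le> C * Lp_norm p f"
proof -
  have p1: "p \<ge> 1" and p0: "p > 0" using p by auto
  obtain C where C: "C \<ge> 0" "\<And>u r. u \<in> TP \<Longrightarrow> (AE t in circle. ev u t = complex_of_real (r t) \<and> r t \<ge> 0)
      \<Longrightarrow> Lp_norm p (Pproj u) \<le> C * Lp_norm p u" using Riesz_nonneg[OF p] by blast
  have main: "Lp_norm p (Pproj f) \<le> 4 * C * Lp_norm p f" if f: "f \<in> TP" for f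
  proof (rule field_le_epsilon)
    fix e :: real assume e: "e > 0"
    \<comment> \<open>The four parts contribute 2 C \<delta> each, and the remainder of size 8
      \<delta> contributes 16 \<delta>.\<close>
    define \<delta> where "\<delta> = e / (8 * C + 16)"
    have \<delta>: "\<delta> > 0" using e C by (simp add: \<delta>_def add_nonneg_pos)
    obtain N c where fc: "f = (\<Sum>k\<in>{-int N..int N}. cscale (c k) (tvar powi k))"
      using TP_expand[OF f] by blast
    define h where "h = (\<lambda>t. \<Sum>k\<in>{-int N..int N}. c k * t powi k)"
    have hm [measurable]: "h \<in> borel_measurable borel" unfolding h_def by measurable
    have hc: "continuous_on (sphere 0 1) h" unfolding h_def by (intro continuous_intros) auto
    have fh: "AE t in circle. ev f t = h t"
    proof -
      have "AE t in circle. \<forall>k\<in>{-int N..int N}. ev (cscale (c k) (tvar powi k)) t = c k * t powi k"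
      proof (rule AE_finite_allI)
        fix k show "AE t in circle. ev (cscale (c k) (tvar powi k)) t = c k * t powi k"
          using ev_cscale[of "c k" "tvar powi k"] ev_tvar_powi[of k] by eventually_elim simp
      qed simp
      thus ?thesis using ev_sum[of "\<lambda>k. cscale (c k) (tvar powi k)" "{-int N..int N}"]
        unfolding fc[symmetric] by eventually_elim (simp add: h_def)
    qed
    have fL: "f \<in> Lp p" using f p0 by (rule TP_Lp)
    have part: "\<exists>v\<in>TP. (AE t in circle. cmod (ev v t - of_real (u t)) \<le> 2 * \<delta>) \<and>
       Lp_norm p (Pproj v) \<le> C * (Lp_norm p f + 2 * \<delta>)"
      if u: "continuous_on (sphere 0 1) u" "\<And>t. u t \<ge> 0" "\<And>t. u t \<le> cmod (h t)"
       and um [measurable]: "u \<in> borel_measurable borel" for u :: "complex \<Rightarrow> real"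
    proof -
      obtain w r where w: "w \<in> TP" "\<And>t. cmod t = 1 \<Longrightarrow> \<bar>u t - r t\<bar> < \<delta>"
        "AE t in circle. ev w t = complex_of_real (r t)" and [measurable]: "r \<in> borel_measurable borel"
        using TP_approx_real[OF u(1) \<delta>] by blast
      \<comment> \<open>The approximation may dip \<delta> below u \<ge> 0; lifting it by \<delta>
        restores nonnegativity.\<close>
      let ?v = "w + cscale (of_real \<delta>) 1"
      have v: "?v \<in> TP" using w(1) by (intro TP_add TP_cscale TP_1)
      have evv: "AE t in circle. ev ?v t = of_real (r t + \<delta>)"
        using w(3) ev_plus[of w "cscale (of_real \<delta>) 1"] ev_cscale[of "of_real \<delta>" 1] ev_1
        by eventually_elim simp
      define U where "U = abs_circfun (\<lambda>t. complex_of_real (u t))"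
      have evU: "AE t in circle. ev U t = of_real (u t)" unfolding U_def by (rule ev_abs_AE) measurable
      have "AE t in circle. cmod (ev U t) \<le> cmod (ev f t)"
        using evU fh by eventually_elim (simp add: u)
      note U = Lp_norm_mono_AE[OF this fL p0]
      have d: "AE t in circle. cmod (ev ?v t - of_real (u t)) \<le> 2 * \<delta>"
        using evv AE_circle_norm
      proof eventually_elim
        case (elim t)
        have "ev ?v t - of_real (u t) = of_real (r t + \<delta> - u t)" using elim by simp
        also have "cmod \<dots> = \<bar>r t + \<delta> - u t\<bar>" by (rule norm_of_real)
        also have "\<dots> \<le> 2 * \<delta>" using w(2)[OF elim(2)] by simp
        finally show ?case .
      qed
      have "AE t in circle. cmod (ev (?v - U) t) \<le> 2 * \<delta>"
        using d evU ev_minus[of ?v U] by eventually_elim simp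
      note dU = bounded_Lp_norm[OF this p0]
      have vL: "?v \<in> Lp p" using v p0 by (rule TP_Lp)
      have "Lp_norm p ?v \<le> Lp_norm p f + 2 * \<delta>"
        using Lp_norm_triangle_sub[OF p1 vL U(1)] U(2) dU by simp
      hence "C * Lp_norm p ?v \<le> C * (Lp_norm p f + 2 * \<delta>)" using C by (intro mult_left_mono) auto
      moreover have "AE t in circle. ev ?v t = of_real (r t + \<delta>) \<and> r t + \<delta> \<ge> 0"
        using evv AE_circle_norm
      proof eventually_elim
        case (elim t)
        show ?case using elim(1) w(2)[OF elim(2)] u(2)[of t] by auto
      qed
      ultimately have "Lp_norm p (Pproj ?v) \<le> C * (Lp_norm p f + 2 * \<delta>)"
        using C(2)[OF v] by fastforce
      thus ?thesis using v d by blast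
    qed
    obtain v1 where v1: "v1 \<in> TP" "AE t in circle. cmod (ev v1 t - of_real (max 0 (Re (h t)))) \<le> 2 * \<delta>"
      "Lp_norm p (Pproj v1) \<le> C * (Lp_norm p f + 2 * \<delta>)"
      using part[of "\<lambda>t. max 0 (Re (h t))"] hc abs_Re_le_cmod[of "h _"]
      by (force intro!: continuous_intros order_trans[OF abs_ge_self abs_Re_le_cmod])
    obtain v2 where v2: "v2 \<in> TP" "AE t in circle. cmod (ev v2 t - of_real (max 0 (- Re (h t)))) \<le> 2 * \<delta>"
      "Lp_norm p (Pproj v2) \<le> C * (Lp_norm p f + 2 * \<delta>)"
      using part[of "\<lambda>t. max 0 (- Re (h t))"] hc
      by (force intro!: continuous_intros order_trans[OF abs_ge_minus_self abs_Re_le_cmod])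
    obtain v3 where v3: "v3 \<in> TP" "AE t in circle. cmod (ev v3 t - of_real (max 0 (Im (h t)))) \<le> 2 * \<delta>"
      "Lp_norm p (Pproj v3) \<le> C * (Lp_norm p f + 2 * \<delta>)"
      using part[of "\<lambda>t. max 0 (Im (h t))"] hc
      by (force intro!: continuous_intros order_trans[OF abs_ge_self abs_Im_le_cmod])
    obtain v4 where v4: "v4 \<in> TP" "AE t in circle. cmod (ev v4 t - of_real (max 0 (- Im (h t)))) \<le> 2 * \<delta>"
      "Lp_norm p (Pproj v4) \<le> C * (Lp_norm p f + 2 * \<delta>)"
      using part[of "\<lambda>t. max 0 (- Im (h t))"] hc
      by (force intro!: continuous_intros order_trans[OF abs_ge_minus_self abs_Im_le_cmod])
    define v where "v = (v1 - v2) + cscale \<i> (v3 - v4)"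
    have v: "v \<in> TP" unfolding v_def by (intro TP_add TP_diff TP_cscale v1 v2 v3 v4)
    have "AE t in circle. cmod (ev (f - v) t) \<le> 8 * \<delta>"
      using v1(2) v2(2) v3(2) v4(2) fh ev_minus[of f v] ev_plus[of "v1 - v2" "cscale \<i> (v3 - v4)"]
       ev_minus[of v1 v2] ev_minus[of v3 v4] ev_cscale[of \<i> "v3 - v4"]
      unfolding v_def[symmetric]
    proof eventually_elim
      case (elim t)
      define x1 where "x1 = complex_of_real (max 0 (Re (h t)))"
      define x2 where "x2 = complex_of_real (max 0 (- Re (h t)))"
      define x3 where "x3 = complex_of_real (max 0 (Im (h t)))"
      define x4 where "x4 = complex_of_real (max 0 (- Im (h t)))"
      define a1 where "a1 = ev v1 t - x1"
      define a2 where "a2 = ev v2 t - x2"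
      define a3 where "a3 = ev v3 t - x3"
      define a4 where "a4 = ev v4 t - x4"
      have h: "h t = (x1 - x2) + \<i> * (x3 - x4)"
        by (simp add: complex_eq_iff max_def x1_def x2_def x3_def x4_def)
      have "ev (f - v) t = h t - ((ev v1 t - ev v2 t) + \<i> * (ev v3 t - ev v4 t))"
        by (simp only: elim(5-10))
      hence "ev (f - v) t = (a2 - a1) + \<i> * (a4 - a3)"
        unfolding h a1_def a2_def a3_def a4_def by (simp add: algebra_simps)
      hence "cmod (ev (f - v) t) \<le> (cmod a2 + cmod a1) + (cmod a4 + cmod a3)"
        by (auto intro!: norm_triangle_le add_mono norm_triangle_ineq4 simp: norm_mult)
      thus ?case using elim(1-4) unfolding a1_def a2_def a3_def a4_def x1_def x2_def x3_def x4_def by linarith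
    qed
    hence "Lp_norm 2 (f - v) \<le> 8 * \<delta>" by (rule bounded_Lp_norm) simp
    hence "Lp_norm 2 (Pproj (f - v)) \<le> 8 * \<delta>"
      using Pproj_TP_contraction[OF TP_diff[OF f v]] by linarith
    hence r: "Lp_norm p (Pproj (f - v)) \<le> 2 * (8 * \<delta>)"
      using f v \<delta> by (intro Lp_norm_small_of_L2 p Pproj_TP TP_diff) auto
    have PL: "Pproj w \<in> Lp p" if "w \<in> TP" for w using Pproj_TP(1)[OF that] p0 by (rule TP_Lp)
    have "Pproj v = (Pproj v1 - Pproj v2) + cscale \<i> (Pproj v3 - Pproj v4)"
      unfolding v_def using v1(1) v2(1) v3(1) v4(1)
      by (simp add: Pproj_TP_add Pproj_TP_diff Pproj_TP_cscale TP_diff TP_cscale)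
    also have "Lp_norm p \<dots> \<le> (Lp_norm p (Pproj v1) + Lp_norm p (Pproj v2)) + (Lp_norm p (Pproj v3) + Lp_norm p (Pproj v4))"
      using PL v1(1) v2(1) v3(1) v4(1) p
      by (intro order_trans[OF Lp_norm_add] add_mono) (auto simp: Lp_norm_cscale intro!: Lp_norm_diff Lp_diff cscale_in_Lp)
    finally have Pv: "Lp_norm p (Pproj v) \<le> 4 * (C * (Lp_norm p f + 2 * \<delta>))"
      using v1(3) v2(3) v3(3) v4(3) by linarith
    have "Lp_norm p (Pproj f) \<le> Lp_norm p (Pproj f - Pproj v) + Lp_norm p (Pproj v)"
      using PL f v by (intro Lp_norm_triangle_sub p1) auto
    also have "Pproj f - Pproj v = Pproj (f - v)" using f v by (simp add: Pproj_TP_diff)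
    also have "Lp_norm p (Pproj (f - v)) + Lp_norm p (Pproj v) \<le> 2 * (8 * \<delta>) + 4 * (C * (Lp_norm p f + 2 * \<delta>))"
      by (rule add_mono[OF r Pv])
    also have "\<dots> = 4 * C * Lp_norm p f + \<delta> * (8 * C + 16)" by (simp add: algebra_simps)
    also have "\<delta> * (8 * C + 16) = e" using C by (simp add: \<delta>_def)
    finally show "Lp_norm p (Pproj f) \<le> 4 * C * Lp_norm p f + e" .
  qed
  show ?thesis by (rule that[of "4 * C"]) (use C main in auto)
qed

text \<open>P is symmetric, so pairing P f with its duality map moves P to the other factor, where
  the bound for p applies. That factor is first approximated by a trigonometric polynomial.\<close>

lemma Riesz_TP_dual:
  assumes pq: "conj_exps p q" and C: "C \<ge> 0" "\<And>f. f \<in> TP \<Longrightarrow> Lp_norm p (Pproj f) \<le> C * Lp_norm p f"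
    and f: "f \<in> TP"
  shows "Lp_norm q (Pproj f) \<le> C * Lp_norm q f"
proof -
  note qp = conj_exps_sym[OF pq]
  have p: "p > 1" "q > 1" using pq by (auto simp: conj_exps_def)
  define h where "h = Pproj f"
  have hT: "h \<in> TP" unfolding h_def by (rule Pproj_TP[OF f])
  have L: "f \<in> Lp q" "h \<in> Lp q" using f hT p by (auto intro: TP_Lp)
  define G where "G = dualfun q h"
  have G: "G \<in> Lp p" "Lp_norm p G powr p = Lp_norm q h powr q" "pairing h G = of_real (Lp_norm q h powr q)"
    unfolding G_def using dualfun_Lp[OF qp L(2)] by auto
  have main: "Lp_norm q h powr q \<le> C * Lp_norm q f * Lp_norm p G + e * (C * Lp_norm q f + Lp_norm q h)" if e: "e > 0" for e
  proof -
    obtain g where g: "g \<in> TP" "Lp_norm p (G - g) < e" using TP_dense[OF p(1) G(1) e] by blast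
    have gL: "g \<in> Lp p" "Pproj g \<in> Lp p" using g p Pproj_TP(1) by (auto intro: TP_Lp)
    have gn: "Lp_norm p g \<le> Lp_norm p G + e"
      using Lp_norm_triangle_sub[of p g G] g gL G(1) p Lp_norm_minus_commute[of p g G] by simp
    have "cmod (pairing h g) = cmod (pairing f (Pproj g))"
      unfolding h_def using pairing_TP_P[OF f g(1)] by simp
    also have "\<dots> \<le> Lp_norm q f * Lp_norm p (Pproj g)" by (rule pairing_bound[OF qp L(1) gL(2)])
    also have "\<dots> \<le> Lp_norm q f * (C * (Lp_norm p G + e))"
      using C(2)[OF g(1)] gn C(1) by (intro mult_left_mono order_trans[OF C(2)[OF g(1)]]) auto
    finally have 1: "cmod (pairing h g) \<le> Lp_norm q f * (C * (Lp_norm p G + e))" .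
    have "cmod (pairing h (G - g)) \<le> Lp_norm q h * Lp_norm p (G - g)"
      using G(1) gL p by (intro pairing_bound[OF qp L(2)] Lp_diff) auto
    also have "\<dots> \<le> Lp_norm q h * e" using g by (intro mult_left_mono) auto
    finally have 2: "cmod (pairing h (G - g)) \<le> Lp_norm q h * e" .
    have "Lp_norm q h powr q = cmod (pairing h G)" using G(3) by simp
    also have "pairing h G = pairing h g + pairing h (G - g)"
      using pairing_diff_right[OF qp L(2) G(1) gL(1)] by simp
    also have "cmod \<dots> \<le> Lp_norm q f * (C * (Lp_norm p G + e)) + Lp_norm q h * e"
      by (rule order_trans[OF norm_triangle_ineq add_mono[OF 1 2]])
    finally show ?thesis by (simp add: algebra_simps)
  qed
  have le: "Lp_norm q h powr q \<le> C * Lp_norm q f * Lp_norm p G"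
  proof (rule field_le_epsilon)
    fix e :: real assume e: "e > 0"
    define K where "K = C * Lp_norm q f + Lp_norm q h + 1"
    have K: "K > 0" using C by (simp add: K_def add_nonneg_pos)
    have "Lp_norm q h powr q \<le> C * Lp_norm q f * Lp_norm p G + (e / K) * (C * Lp_norm q f + Lp_norm q h)"
      using e K by (intro main) auto
    also have "(e / K) * (C * Lp_norm q f + Lp_norm q h) \<le> (e / K) * K"
      using e K by (intro mult_left_mono) (auto simp: K_def)
    also have "(e / K) * K = e" using K by simp
    finally show "Lp_norm q h powr q \<le> C * Lp_norm q f * Lp_norm p G + e" by simp
  qed
  show ?thesis
  proof (cases "Lp_norm q h = 0")
    case True
    thus ?thesis using C by (simp add: h_def)
  next
    case False
    hence pos: "Lp_norm q h > 0" using Lp_norm_nonneg[of q h] by linarith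
    have "Lp_norm p G = (Lp_norm p G powr p) powr (1 / p)" using p by (simp add: powr_powr)
    also have "\<dots> = Lp_norm q h powr (q - 1)"
    proof -
      have "q / p = q - 1" using conj_exps_mult[OF pq] p by (simp add: field_simps)
      thus ?thesis unfolding G(2) powr_powr by simp
    qed
    finally have Gn: "Lp_norm p G = Lp_norm q h powr (q - 1)" .
    have "Lp_norm q h powr q = Lp_norm q h powr 1 * Lp_norm q h powr (q - 1)"
      by (simp only: powr_add[symmetric]) simp
    hence "Lp_norm q h * Lp_norm q h powr (q - 1) \<le> C * Lp_norm q f * Lp_norm q h powr (q - 1)"
      using le Gn pos by simp
    moreover have "Lp_norm q h powr (q - 1) > 0" using pos by simp
    ultimately show ?thesis unfolding h_def[symmetric] by (rule mult_right_le_imp_le)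
  qed
qed

lemma Riesz_TP:
  assumes p: "1 < p"
  obtains C where "C \<ge> 0" "\<And>f. f \<in> TP \<Longrightarrow> Lp_norm p (Pproj f) \<le> C * Lp_norm p f"
proof (cases "p \<le> 2")
  case True
  thus ?thesis using Riesz_TP_le2[OF p True] that by blast
next
  case False
  define q where "q = p / (p - 1)"
  have pq: "conj_exps q p" and q: "1 < q" "q \<le> 2"
    using p False by (auto simp: conj_exps_def q_def field_simps)
  obtain C where C: "C \<ge> 0" "\<And>f. f \<in> TP \<Longrightarrow> Lp_norm q (Pproj f) \<le> C * Lp_norm q f"
    using Riesz_TP_le2[OF q] by blast
  show ?thesis using that[OF C(1)] Riesz_TP_dual[OF pq C] by blast
qed

lemma fourier_tendsto:
  assumes p: "p \<ge> 1" and f: "\<And>n. f n \<in> Lp p" "g \<in> Lp p" "(\<lambda>n::nat. Lp_norm p (f n - g)) \<longlonglongrightarrow> 0"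
  shows "(\<lambda>n. fourier (f n) k) \<longlonglongrightarrow> fourier g k"
proof (rule Lim_transform_bound[where g = "\<lambda>n. Lp_norm p (f n - g)", THEN LIM_zero_cancel, OF _ f(3)])
  have "cmod (fourier (f n) k - fourier g k) \<le> Lp_norm p (f n - g)" for n
  proof -
    have d: "f n - g \<in> Lp p" using f p by (intro Lp_diff)
    have "fourier (f n) k - fourier g k = fourier (f n - g) k"
      using Lp_mono[OF f(1) p] Lp_mono[OF f(2) p] by (simp add: fourier_diff)
    also have "cmod \<dots> \<le> Lp_norm 1 (f n - g)" using Lp_mono[OF d p] by (rule fourier_bound)
    also have "\<dots> \<le> Lp_norm p (f n - g)" by (rule Lp_norm_1_le[OF d p])
    finally show ?thesis .
  qed
  thus "\<forall>\<^sub>F n in sequentially. cmod (fourier (f n) k - fourier g k) \<le> norm (Lp_norm p (f n - g))"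
    by simp
qed

text \<open>For polynomials approximating f the projections form a Cauchy sequence. Its limit has
  the coefficients required of P f, and those determine it.\<close>

lemma Pproj_Lp_aux:
  assumes p: "1 < p"
  obtains C where "C \<ge> 0" "\<And>f. f \<in> Lp p \<Longrightarrow> Pproj f \<in> Lp p \<and> Lp_norm p (Pproj f) \<le> C * Lp_norm p f
     \<and> (\<forall>n. fourier (Pproj f) n = (if n \<ge> 0 then fourier f n else 0))"
proof -
  have p1: "p \<ge> 1" "p > 0" using p by auto
  obtain C where C: "C \<ge> 0" "\<And>f. f \<in> TP \<Longrightarrow> Lp_norm p (Pproj f) \<le> C * Lp_norm p f"
    using Riesz_TP[OF p] by blast
  have "Pproj f \<in> Lp p \<and> Lp_norm p (Pproj f) \<le> C * Lp_norm p f
     \<and> (\<forall>n. fourier (Pproj f) n = (if n \<ge> 0 then fourier f n else 0))" if f: "f \<in> Lp p" for f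
  proof -
    have "\<exists>w\<in>TP. Lp_norm p (f - w) < 1 / real (Suc n)" for n
      by (rule TP_dense[OF p f]) simp
    then obtain w where w: "\<And>n. w n \<in> TP" "\<And>n. Lp_norm p (f - w n) < 1 / real (Suc n)" by metis
    have wL: "w n \<in> Lp p" "Pproj (w n) \<in> Lp p" for n
      using TP_Lp[OF w(1) p1(2)] TP_Lp[OF Pproj_TP(1)[OF w(1)] p1(2)] by auto
    have lim: "(\<lambda>n. Lp_norm p (w n - f)) \<longlonglongrightarrow> 0"
    proof (rule tendsto_sandwich[OF _ _ tendsto_const LIMSEQ_Suc[OF lim_1_over_n]])
      show "\<forall>\<^sub>F n in sequentially. Lp_norm p (w n - f) \<le> 1 / real (Suc n)"
        using w(2) Lp_norm_minus_commute[OF p1(2), of f] by (auto intro!: always_eventually less_imp_le)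
    qed auto
    have "\<exists>N. \<forall>m\<ge>N. \<forall>n\<ge>N. Lp_norm p (Pproj (w m) - Pproj (w n)) < e" if e: "e > 0" for e
    proof -
      have "e / (C + 1) > 0" using e C by (simp add: add_nonneg_pos)
      then obtain N where N: "\<And>m n. m \<ge> N \<Longrightarrow> n \<ge> N \<Longrightarrow> Lp_norm p (w m - w n) < e / (C + 1)"
        using Lp_norm_tendsto_0_imp_Cauchy[OF p1(1) wL(1) f lim] by blast
      have "Lp_norm p (Pproj (w m) - Pproj (w n)) < e" if "m \<ge> N" "n \<ge> N" for m n
      proof -
        have "Lp_norm p (Pproj (w m) - Pproj (w n)) \<le> C * Lp_norm p (w m - w n)"
          using C(2)[OF TP_diff[OF w(1) w(1)], of m n] w(1) by (simp add: Pproj_TP_diff)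
        also have "\<dots> \<le> (C + 1) * Lp_norm p (w m - w n)" by (intro mult_right_mono) auto
        also have "\<dots> < e" using N[OF that] C
          pos_less_divide_eq[of "C + 1" "Lp_norm p (w m - w n)" e] by (simp add: mult.commute)
        finally show ?thesis .
      qed
      thus ?thesis by blast
    qed
    from Lp_complete[OF p1(1) wL(2) this]
    obtain g where g: "g \<in> Lp p" "(\<lambda>n. Lp_norm p (Pproj (w n) - g)) \<longlonglongrightarrow> 0" by blast
    have fg: "fourier g n = (if n \<ge> 0 then fourier f n else 0)" for n
    proof (rule LIMSEQ_unique)
      show "(\<lambda>k. fourier (Pproj (w k)) n) \<longlonglongrightarrow> fourier g n"
        by (rule fourier_tendsto[OF p1(1) wL(2) g])
      show "(\<lambda>k. fourier (Pproj (w k)) n) \<longlonglongrightarrow> (if n \<ge> 0 then fourier f n else 0)"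
        using fourier_tendsto[OF p1(1) wL(1) f lim, of n] Pproj_TP(2)[OF w(1)] by simp
    qed
    have Pg: "Pproj f = g" by (rule Pproj_eqI[OF Lp_mono[OF g(1) p1(1)] fg])
    have "Lp_norm p g \<le> C * Lp_norm p f"
    proof (rule LIMSEQ_le_const)
      have "(\<lambda>n. Lp_norm p (Pproj (w n) - g) + C * (Lp_norm p (w n - f) + Lp_norm p f)) \<longlonglongrightarrow> 0 + C * (0 + Lp_norm p f)"
        by (intro tendsto_intros g lim)
      thus "(\<lambda>n. Lp_norm p (Pproj (w n) - g) + C * (Lp_norm p (w n - f) + Lp_norm p f)) \<longlonglongrightarrow> C * Lp_norm p f" by simp
      have "Lp_norm p g \<le> Lp_norm p (Pproj (w n) - g) + C * (Lp_norm p (w n - f) + Lp_norm p f)" for n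
      proof -
        have "Lp_norm p g \<le> Lp_norm p (g - Pproj (w n)) + Lp_norm p (Pproj (w n))"
          by (rule Lp_norm_triangle_sub[OF p1(1) g(1) wL(2)])
        also have "Lp_norm p (Pproj (w n)) \<le> C * (Lp_norm p (w n - f) + Lp_norm p f)"
          by (rule order_trans[OF C(2)[OF w(1)]]) (intro mult_left_mono C Lp_norm_triangle_sub p1 wL f)
        finally show ?thesis using Lp_norm_minus_commute[OF p1(2), of g] by simp
      qed
      thus "\<exists>N. \<forall>n\<ge>N. Lp_norm p g \<le> Lp_norm p (Pproj (w n) - g) + C * (Lp_norm p (w n - f) + Lp_norm p f)" by blast
    qed
    thus ?thesis using g(1) fg unfolding Pg by blast
  qed
  thus ?thesis using that[OF C(1)] by blast
qed

section \<open>The complementary projections on L^p\<close>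

lemma Pproj_Lp: "1 < p \<Longrightarrow> f \<in> Lp p \<Longrightarrow> Pproj f \<in> Lp p"
  using Pproj_Lp_aux by metis

lemma Pproj_bound: "1 < p \<Longrightarrow> \<exists>C\<ge>0. \<forall>f\<in>Lp p. Lp_norm p (Pproj f) \<le> C * Lp_norm p f"
  using Pproj_Lp_aux by metis

lemma fourier_Pproj: "1 < p \<Longrightarrow> f \<in> Lp p \<Longrightarrow> fourier (Pproj f) n = (if n \<ge> 0 then fourier f n else 0)"
  using Pproj_Lp_aux by metis

lemma fourier_Qproj: "1 < p \<Longrightarrow> f \<in> Lp p \<Longrightarrow> fourier (Qproj f) n = (if n \<ge> 0 then 0 else fourier f n)"
  unfolding Qproj_def using Pproj_Lp[of p f] Lp_mono[of _ p] by (subst fourier_diff) (auto simp: fourier_Pproj)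

lemma Qproj_Lp: "1 < p \<Longrightarrow> f \<in> Lp p \<Longrightarrow> Qproj f \<in> Lp p"
  unfolding Qproj_def by (intro Lp_diff Pproj_Lp) auto

lemma Pproj_plus_Qproj: "Pproj f + Qproj f = f"
  by (simp add: Qproj_def)

lemma Pproj_add: "1 < p \<Longrightarrow> f \<in> Lp p \<Longrightarrow> g \<in> Lp p \<Longrightarrow> Pproj (f + g) = Pproj f + Pproj g"
  using Lp_mono[of _ p] Pproj_Lp[of p]
  by (intro Pproj_eqI) (auto simp: fourier_add fourier_Pproj intro!: Lp_add)

lemma Pproj_diff: "1 < p \<Longrightarrow> f \<in> Lp p \<Longrightarrow> g \<in> Lp p \<Longrightarrow> Pproj (f - g) = Pproj f - Pproj g"
  using Lp_mono[of _ p] Pproj_Lp[of p]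
  by (intro Pproj_eqI) (auto simp: fourier_diff fourier_Pproj intro!: Lp_diff)

lemma Pproj_cscale: "1 < p \<Longrightarrow> f \<in> Lp p \<Longrightarrow> Pproj (cscale z f) = cscale z (Pproj f)"
  using Lp_mono[of _ p] Pproj_Lp[of p]
  by (intro Pproj_eqI) (auto simp: fourier_cscale fourier_Pproj intro!: cscale_in_Lp)

lemma Pproj_0 [simp]: "Pproj 0 = 0"
  by (rule Pproj_eqI) auto

section \<open>Hardy spaces\<close>

lemma Hp_Lp: "f \<in> Hp p \<Longrightarrow> f \<in> Lp p"
  by (simp add: Hp_def)

lemma Hp_fourier: "f \<in> Hp p \<Longrightarrow> n < 0 \<Longrightarrow> fourier f n = 0"
  by (simp add: Hp_def)

lemma Hp_0 [simp]: "0 \<in> Hp p"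
  by (simp add: Hp_def)

lemma Hp_add: "1 \<le> p \<Longrightarrow> f \<in> Hp p \<Longrightarrow> g \<in> Hp p \<Longrightarrow> f + g \<in> Hp p"
  using Lp_mono[of _ p] by (auto simp: Hp_def fourier_add Lp_add)

lemma Hp_diff: "1 \<le> p \<Longrightarrow> f \<in> Hp p \<Longrightarrow> g \<in> Hp p \<Longrightarrow> f - g \<in> Hp p"
  using Lp_mono[of _ p] by (auto simp: Hp_def fourier_diff Lp_diff)

lemma Hp_cscale: "f \<in> Hp p \<Longrightarrow> cscale z f \<in> Hp p"
  by (auto simp: Hp_def fourier_cscale cscale_in_Lp)

lemma Pproj_Hp: "1 < p \<Longrightarrow> f \<in> Lp p \<Longrightarrow> Pproj f \<in> Hp p"
  by (auto simp: Hp_def Pproj_Lp fourier_Pproj)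

lemma Pproj_id: "1 \<le> p \<Longrightarrow> f \<in> Hp p \<Longrightarrow> Pproj f = f"
  by (rule Pproj_eqI) (auto simp: Hp_def intro: Lp_mono)

lemma Pproj_eq_0: "(\<And>n. n \<ge> 0 \<Longrightarrow> fourier f n = 0) \<Longrightarrow> Pproj f = 0"
  by (rule Pproj_eqI) auto

lemma Pproj_eq_0_iff:
  "1 < p \<Longrightarrow> f \<in> Lp p \<Longrightarrow> Pproj f = 0 \<longleftrightarrow> (\<forall>n\<ge>0. fourier f n = 0)"
  using Pproj_eq_0[of f] fourier_Pproj[of p f] by (metis fourier_zero)

lemma Hp_closed: "1 \<le> p \<Longrightarrow> Lp_closed p (Hp p)"
  unfolding Lp_closed_def
proof safe
  fix f g assume p: "1 \<le> p" and f: "\<forall>n::nat. f n \<in> Hp p" and g: "g \<in> Lp p"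
    and l: "(\<lambda>n. Lp_norm p (f n - g)) \<longlonglongrightarrow> 0"
  have "fourier g k = 0" if "k < 0" for k
    using fourier_tendsto[OF p _ g l, of k] f that by (auto simp: Hp_def LIMSEQ_const_iff)
  thus "g \<in> Hp p" using g by (simp add: Hp_def)
qed

definition AP :: "circfun set" where
  "AP = {f \<in> TP. \<forall>n<0. fourier f n = 0}"

lemma AP_expand:
  assumes "f \<in> AP"
  shows "\<exists>N c. f = (\<Sum>k\<in>{0..int N}. cscale (c k) (tvar powi k))"
proof -
  have f: "f \<in> TP" "\<And>n. n < 0 \<Longrightarrow> fourier f n = 0" using assms by (auto simp: AP_def)
  obtain N c where fc: "f = (\<Sum>k\<in>{-int N..int N}. cscale (c k) (tvar powi k))"
    using TP_expand[OF f(1)] by blast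
  have "Pproj f = f" using f by (intro Pproj_eqI) (auto intro: TP_Lp)
  hence "f = (\<Sum>k\<in>{0..int N}. cscale (c k) (tvar powi k))" using Pproj_TP_expand[OF fc] by simp
  thus ?thesis by (intro exI)
qed

lemma AP_Hp: "f \<in> AP \<Longrightarrow> 0 < p \<Longrightarrow> f \<in> Hp p"
  by (auto simp: AP_def Hp_def TP_Lp)

lemma AP_dense:
  assumes p: "1 < p" and f: "f \<in> Hp p" and e: "e > 0"
  shows "\<exists>w\<in>AP. Lp_norm p (f - w) < e"
proof -
  obtain C where C: "C \<ge> 0" "\<And>f. f \<in> Lp p \<Longrightarrow> Lp_norm p (Pproj f) \<le> C * Lp_norm p f"
    using Pproj_bound[OF p] by blast
  have fL: "f \<in> Lp p" using f by (rule Hp_Lp)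
  have "e / (C + 1) > 0" using e C by (simp add: add_nonneg_pos)
  then obtain w where w: "w \<in> TP" "Lp_norm p (f - w) < e / (C + 1)" using TP_dense[OF p fL] by blast
  have wL: "w \<in> Lp p" using w p by (auto intro: TP_Lp)
  have "f - Pproj w = Pproj (f - w)" using Pproj_id[OF _ f] p by (simp add: Pproj_diff[OF p fL wL])
  hence "Lp_norm p (f - Pproj w) \<le> C * Lp_norm p (f - w)"
    using C(2)[of "f - w"] Lp_diff[of p f w] fL wL p by simp
  also have "\<dots> \<le> (C + 1) * Lp_norm p (f - w)" by (intro mult_right_mono) auto
  also have "\<dots> < e" using w(2) C
    pos_less_divide_eq[of "C + 1" "Lp_norm p (f - w)" e] by (simp add: mult.commute)
  finally show ?thesis using Pproj_TP[OF w(1)] by (intro bexI[of _ "Pproj w"]) (auto simp: AP_def)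
qed

lemma AP_mult_fourier:
  assumes w: "w \<in> AP" and g: "g \<in> Lp 1" "\<And>n. n < m \<Longrightarrow> fourier g n = 0"
  shows "n < m \<Longrightarrow> fourier (w * g) n = 0" "fourier (w * g) m = fourier w 0 * fourier g m"
proof -
  obtain N c where wc: "w = (\<Sum>k\<in>{0..int N}. cscale (c k) (tvar powi k))" using AP_expand[OF w] by blast
  have e: "fourier (w * g) n = (\<Sum>k\<in>{0..int N}. c k * fourier g (n - k))" for n
    unfolding wc by (rule fourier_trig_mult[OF g(1)])
  show "n < m \<Longrightarrow> fourier (w * g) n = 0" unfolding e by (rule sum.neutral) (use g(2) in auto)
  have "fourier (w * g) m = (\<Sum>k\<in>{0..int N}. if k = 0 then c 0 * fourier g m else 0)"
    unfolding e by (rule sum.cong) (use g(2) in auto)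
  also have "\<dots> = c 0 * fourier g m" by simp
  also have "c 0 = fourier w 0" unfolding wc by (simp add: fourier_trig_sum)
  finally show "fourier (w * g) m = fourier w 0 * fourier g m" .
qed

text \<open>The coefficients of a product are convolutions; this is clear when f is an analytic
  polynomial and passes to the limit by Hoelder's inequality. The order m is kept general because
  both m = 0 (analytic) and m = 1 (analytic of mean 0) are used constantly.\<close>

lemma Hp_Hq_mult:
  assumes pq: "conj_exps p q" and f: "f \<in> Hp p" and g: "g \<in> Lp q" "\<And>n. n < m \<Longrightarrow> fourier g n = 0"
  shows "f * g \<in> Lp 1" "n < m \<Longrightarrow> fourier (f * g) n = 0" "fourier (f * g) m = fourier f 0 * fourier g m"
proof -
  have p: "p > 1" "q > 1" using pq by (auto simp: conj_exps_def)
  have fL: "f \<in> Lp p" using f by (rule Hp_Lp)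
  have g1: "g \<in> Lp 1" using Lp_mono[OF g(1)] p by simp
  show "f * g \<in> Lp 1" by (rule Lp_Holder_in[OF pq fL g(1)])
  have "\<exists>w\<in>AP. Lp_norm p (f - w) < 1 / real (Suc n)" for n
    by (rule AP_dense[OF p(1) f]) simp
  then obtain w where w: "\<And>n. w n \<in> AP" "\<And>n. Lp_norm p (f - w n) < 1 / real (Suc n)" by metis
  have wL: "w n \<in> Lp p" for n using AP_Hp[OF w(1), of p n] p Hp_Lp by auto
  have lim: "(\<lambda>n. Lp_norm p (w n - f)) \<longlonglongrightarrow> 0"
  proof (rule tendsto_sandwich[OF _ _ tendsto_const LIMSEQ_Suc[OF lim_1_over_n]])
    show "\<forall>\<^sub>F n in sequentially. Lp_norm p (w n - f) \<le> 1 / real (Suc n)"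
      using w(2) Lp_norm_minus_commute[of p f] p by (auto intro!: always_eventually less_imp_le)
  qed auto
  have limg: "(\<lambda>n. Lp_norm 1 (w n * g - f * g)) \<longlonglongrightarrow> 0"
  proof (rule tendsto_sandwich[OF _ _ tendsto_const])
    show "(\<lambda>n. Lp_norm p (w n - f) * Lp_norm q g) \<longlonglongrightarrow> 0" using tendsto_mult_left_zero[OF lim] .
    show "\<forall>\<^sub>F n in sequentially. Lp_norm 1 (w n * g - f * g) \<le> Lp_norm p (w n - f) * Lp_norm q g"
      using Lp_Holder[OF pq Lp_diff[OF _ wL fL] g(1)] p by (simp add: left_diff_distrib)
  qed auto
  have lf: "(\<lambda>k. fourier (w k * g) n) \<longlonglongrightarrow> fourier (f * g) n" for n
    by (rule fourier_tendsto[OF order_refl _ _ limg]) (auto intro!: Lp_Holder_in[OF pq] wL fL g)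
  show "n < m \<Longrightarrow> fourier (f * g) n = 0"
    using lf[of n] AP_mult_fourier(1)[OF w(1) g1 g(2)] by (simp add: LIMSEQ_const_iff)
  have "(\<lambda>k. fourier (w k) 0 * fourier g m) \<longlonglongrightarrow> fourier f 0 * fourier g m"
    using fourier_tendsto[OF _ wL fL lim] p by (intro tendsto_intros) auto
  thus "fourier (f * g) m = fourier f 0 * fourier g m"
    using lf[of m] LIMSEQ_unique by (simp add: AP_mult_fourier(2)[OF w(1) g1 g(2)])
qed

section \<open>Bounded analytic functions as multipliers\<close>

definition Hinf :: "circfun set" where
  "Hinf = {f \<in> Linf. \<forall>n<0. fourier f n = 0}"

lemma Hinf_Hp: "f \<in> Hinf \<Longrightarrow> 0 < p \<Longrightarrow> f \<in> Hp p"
  by (auto simp: Hinf_def Hp_def Linf_in_Lp)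

lemma Hinf_Linf: "f \<in> Hinf \<Longrightarrow> f \<in> Linf"
  by (simp add: Hinf_def)

lemma Hinf_mult_Hp:
  assumes p: "1 < p" and g: "g \<in> Hinf" and f: "f \<in> Hp p"
  shows "g * f \<in> Hp p"
proof -
  define q where "q = p / (p - 1)"
  have pq: "conj_exps q p" using p by (auto simp: conj_exps_def q_def field_simps)
  have "g \<in> Hp q" using g pq by (auto intro: Hinf_Hp simp: conj_exps_def)
  from Hp_Hq_mult(2)[OF pq this Hp_Lp[OF f] Hp_fourier[OF f]]
  show ?thesis using Linf_mult_in_Lp[OF Hinf_Linf[OF g] Hp_Lp[OF f]] p by (auto simp: Hp_def)
qed

lemma Hinf_mult: "f \<in> Hinf \<Longrightarrow> g \<in> Hinf \<Longrightarrow> f * g \<in> Hinf"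
  using Hinf_mult_Hp[of 2 f g] Hinf_Hp[of g 2] Linf_mult[of f g]
  by (auto simp: Hinf_def Hp_def)

lemma Hinf_1 [simp]: "1 \<in> Hinf"
  using fourier_tvar_powi[of 0] by (auto simp: Hinf_def)

lemma Hinf_power: "f \<in> Hinf \<Longrightarrow> f ^ n \<in> Hinf"
  by (induction n) (auto intro: Hinf_mult)

lemma Hinf_tvar_powi: "k \<ge> 0 \<Longrightarrow> tvar powi k \<in> Hinf"
  by (auto simp: Hinf_def fourier_tvar_powi)

lemma pairing_Pproj:
  assumes pq: "conj_exps p q" and f: "f \<in> Lp p" and g: "g \<in> Hp q"
  shows "pairing (Pproj f) g = pairing f g"
proof -
  have p: "p > 1" "q > 1" using pq by (auto simp: conj_exps_def)
  have Q: "Qproj f \<in> Lp p" by (rule Qproj_Lp[OF p(1) f])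
  have Qc: "fourier (conj_fun (Qproj f)) n = 0" if "n < 1" for n
    using that by (simp add: fourier_conj fourier_Qproj[OF p(1) f])
  have "fourier (g * conj_fun (Qproj f)) 0 = 0"
    by (rule Hp_Hq_mult(2)[OF conj_exps_sym[OF pq] g _ Qc]) (use Q in auto)
  hence "pairing g (Qproj f) = 0" by (simp add: pairing_fourier)
  hence "pairing (Qproj f) g = 0" using pairing_cnj[of "Qproj f" g] by simp
  thus ?thesis unfolding Qproj_def
    using pairing_diff_left[OF pq f Pproj_Lp[OF p(1) f] Hp_Lp[OF g]] by simp
qed

lemma pairing_Pproj_right:
  assumes pq: "conj_exps p q" and f: "f \<in> Hp p" and g: "g \<in> Lp q"
  shows "pairing f (Pproj g) = pairing f g"
  using pairing_Pproj[OF conj_exps_sym[OF pq] g f] by (metis pairing_cnj)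

lemma entire_Hinf:
  assumes F: "F holomorphic_on UNIV"
  shows "abs_circfun F \<in> Hinf" "fourier (abs_circfun F) 0 = F 0" "AE t in circle. ev (abs_circfun F) t = F t"
proof -
  have Fc: "continuous_on S F" for S using holomorphic_on_imp_continuous_on[OF F] continuous_on_subset by blast
  have Fm [measurable]: "F \<in> borel_measurable borel" by (intro borel_measurable_continuous_onI Fc)
  show e: "AE t in circle. ev (abs_circfun F) t = F t" by (rule ev_abs_AE) measurable
  have "\<exists>B. \<forall>t\<in>sphere 0 1. norm (F t) \<le> B"
    using compact_imp_bounded[OF compact_continuous_image[OF Fc compact_sphere]]
    by (auto simp: bounded_iff)
  then obtain B where "\<forall>t\<in>sphere 0 1. norm (F t) \<le> B" by blast
  hence "AE t in circle. cmod (ev (abs_circfun F) t) \<le> B"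
    using AE_circle_norm e by (auto elim!: eventually_elim2)
  hence 1: "abs_circfun F \<in> Linf" by (auto simp: Linf_iff)
  \<comment> \<open>Since 0 ^ 0 = 1, one formula covers the mean and the vanishing negative
    coefficients.\<close>
  have 2: "fourier (abs_circfun F) (- int n) = F 0 * 0 ^ n" for n
  proof -
    have "fourier (abs_circfun F) (- int n) = (LINT t|circle. F t * t ^ n)"
      unfolding fourier_eq by (rule ev_integral_cong) (use e in \<open>eventually_elim, simp\<close>, measurable)
    also have "\<dots> = F 0 * 0 ^ n"
      by (rule circle_mean_value) (auto intro!: holomorphic_intros holomorphic_on_subset[OF F])
    finally show ?thesis .
  qed
  show "fourier (abs_circfun F) 0 = F 0" using 2[of 0] by simp
  have "fourier (abs_circfun F) n = 0" if "n < 0" for n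
    using 2[of "nat (-n)"] that by simp
  thus "abs_circfun F \<in> Hinf" using 1 by (simp add: Hinf_def)
qed

text \<open>If \<open>g\<close> vanishes on \<open>K\<close>, then \<open>g exp(n F)\<close> with \<open>Re F\<close> close to the indicator of \<open>K\<close>
  has bounded norm, while its mean value is \<open>g(0) exp(n F(0))\<close> with \<open>Re F(0)\<close> close to the measure of \<open>K\<close>.\<close>

lemma mean_bound_exp:
  assumes p: "1 < p" and g: "g \<in> Hp p" and u: "u \<in> TP"
    and r: "AE t in circle. ev u t = complex_of_real (r t)" and rm [measurable]: "r \<in> borel_measurable borel"
    and rb: "AE t in circle. r t \<le> 2"
  shows "cmod (fourier g 0) * exp (real n * (LINT t|circle. r t)) \<le> (LINT t|circle. cmod (ev g t) * exp (real n * r t))"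
proof -
  obtain N and b :: "nat \<Rightarrow> complex" where b: "AE t in circle. Re (\<Sum>k\<le>N. b k * t ^ k) = r t" "b 0 = fourier u 0" "Im (b 0) = 0"
    using real_TP_completion[OF u r] by blast
  define F where "F = (\<lambda>z. exp (of_nat n * (\<Sum>k\<le>N. b k * z ^ k)))"
  have F: "F holomorphic_on UNIV" unfolding F_def by (intro holomorphic_intros)
  note h = entire_Hinf[OF F]
  let ?h = "abs_circfun F"
  define q where "q = p / (p - 1)"
  have pq: "conj_exps q p" using p by (auto simp: conj_exps_def q_def field_simps)
  have hq: "?h \<in> Hp q" using pq by (intro Hinf_Hp h) (auto simp: conj_exps_def)
  note m = Hp_Hq_mult[OF pq hq Hp_Lp[OF g] Hp_fourier[OF g]]
  have "b 0 = (LINT t|circle. complex_of_real (r t))"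
    unfolding b(2) fourier_0 by (rule ev_integral_cong) (use r in auto)
  hence b0: "b 0 = of_real (LINT t|circle. r t)" by simp
  have F0: "F 0 = exp (of_nat n * b 0)" by (simp add: F_def sum.atMost_shift)
  have "cmod (F 0) = exp (real n * (LINT t|circle. r t))"
    unfolding F0 b0 by (simp add: norm_exp_eq_Re)
  hence "cmod (fourier g 0) * exp (real n * (LINT t|circle. r t)) = cmod (fourier (?h * g) 0)"
    using m(3) h(2) by (simp add: norm_mult mult.commute)
  also have "\<dots> \<le> Lp_norm 1 (?h * g)" by (rule fourier_bound[OF m(1)])
  also have "\<dots> = (LINT t|circle. cmod (ev (?h * g) t))" by (simp add: Lp_norm_eq)
  also have "\<dots> = (LINT t|circle. cmod (ev g t) * exp (real n * r t))"
  proof (rule ev_integral_cong)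
    show "AE t in circle. cmod (ev (?h * g) t) = cmod (ev g t) * exp (real n * r t)"
      using ev_mult[of ?h g] h(3) b(1)
      by eventually_elim (simp add: norm_mult F_def norm_exp_eq_Re)
  qed measurable
  finally show ?thesis .
qed

text \<open>With r k tending to the indicator of K, the factor exp (n r) tends to 1 off K, and on K
  it multiplies g = 0. So |g_0| exp (n \<mu>) stays below the L^1 norm of g for all n, where \<mu> >
  0 is the measure of K.\<close>

lemma mean_0_of_vanishing:
  assumes p: "1 < p" and g: "g \<in> Hp p" and K: "compact K" "measure circle K > 0"
    and v: "AE t in circle. t \<in> K \<longrightarrow> ev g t = 0"
  shows "fourier g 0 = 0"
proof -
  have Kc: "closed K" "K \<noteq> {}" using K compact_imp_closed by auto
  have [measurable]: "K \<in> sets borel" using Kc by (intro borel_closed)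
  have gL: "g \<in> Lp 1" using Lp_mono[OF Hp_Lp[OF g]] p by simp
  have "\<exists>w r. w \<in> TP \<and> (\<forall>t. cmod t = 1 \<longrightarrow> \<bar>bump K k t - r t\<bar> < 1 / real (Suc k)) \<and>
    (AE t in circle. ev w t = complex_of_real (r t)) \<and> r \<in> borel_measurable borel" for k
    by (rule TP_approx_real[OF bump_continuous, of "1 / real (Suc k)" K k]) auto
  then obtain w r where w: "\<And>k. w k \<in> TP" "\<And>k t. cmod t = 1 \<Longrightarrow> \<bar>bump K k t - r k t\<bar> < 1 / real (Suc k)"
    "\<And>k. AE t in circle. ev (w k) t = complex_of_real (r k t)" and [measurable]: "\<And>k. r k \<in> borel_measurable borel"
    by metis
  have rb: "r k t \<le> 2" "r k t \<ge> - 1" "r k t \<ge> indicator K t - 1 / real (Suc k)" if "cmod t = 1" for k t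
  proof -
    have "1 / real (Suc k) \<le> 1" by simp
    moreover have "indicator K t \<le> bump K k t"
      using bump_bounds[of K k t] by (auto simp: indicator_def bump_def)
    ultimately show "r k t \<le> 2" "r k t \<ge> - 1" "r k t \<ge> indicator K t - 1 / real (Suc k)"
      using w(2)[OF that, of k] bump_bounds[of K k t] by linarith+
  qed
  have rint: "integrable circle (r k)" for k
  proof (rule Bochner_Integration.integrable_bound[of circle "\<lambda>_. 2 :: real"])
    show "AE t in circle. norm (r k t) \<le> norm (2 :: real)"
      using AE_circle_norm
    proof eventually_elim
      case (elim t)
      show ?case using rb(1,2)[OF elim, of k] by simp
    qed
  qed auto
  define \<mu> where "\<mu> = measure circle K"
  have key: "cmod (fourier g 0) * exp (real n * \<mu>) \<le> Lp_norm 1 g" for n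
  proof -
    have lim1: "(\<lambda>k. cmod (fourier g 0) * exp (real n * (\<mu> - 1 / real (Suc k)))) \<longlonglongrightarrow> cmod (fourier g 0) * exp (real n * (\<mu> - 0))"
      by (intro tendsto_intros LIMSEQ_Suc[OF lim_1_over_n])
    have lim2: "(\<lambda>k. LINT t|circle. cmod (ev g t) * exp (real n * r k t)) \<longlonglongrightarrow>
       (LINT t|circle. cmod (ev g t) * exp (real n * indicator K t))"
    proof (rule integral_dominated_convergence)
      show "integrable circle (\<lambda>t. cmod (ev g t) * exp (real n * 2))" using gL by (simp add: Lp_1_iff)
      show "AE t in circle. (\<lambda>k. cmod (ev g t) * exp (real n * r k t)) \<longlonglongrightarrow> cmod (ev g t) * exp (real n * indicator K t)"
        using AE_circle_norm
      proof eventually_elim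
        case (elim t)
        have "(\<lambda>k. bump K k t - r k t) \<longlonglongrightarrow> 0"
          by (rule Lim_null_comparison[OF _ LIMSEQ_Suc[OF lim_1_over_n]])
             (use w(2)[OF elim] in \<open>auto intro!: always_eventually less_imp_le\<close>)
        from tendsto_diff[OF bump_tendsto[OF Kc, of t] this]
        have "(\<lambda>k. r k t) \<longlonglongrightarrow> indicator K t" by simp
        thus ?case by (intro tendsto_intros)
      qed
      show "AE t in circle. norm (cmod (ev g t) * exp (real n * r k t)) \<le> cmod (ev g t) * exp (real n * 2)" for k
        using AE_circle_norm
        by eventually_elim (auto intro!: mult_left_mono rb)
    qed measurable
    have "(LINT t|circle. cmod (ev g t) * exp (real n * indicator K t)) = (LINT t|circle. cmod (ev g t))"
      by (rule ev_integral_cong) (use v in \<open>eventually_elim, auto simp: indicator_def\<close>, measurable)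
    hence lim2': "(\<lambda>k. LINT t|circle. cmod (ev g t) * exp (real n * r k t)) \<longlonglongrightarrow> Lp_norm 1 g"
      using lim2 by (simp add: Lp_norm_eq)
    have le: "cmod (fourier g 0) * exp (real n * (\<mu> - 1 / real (Suc k))) \<le> (LINT t|circle. cmod (ev g t) * exp (real n * r k t))" for k
    proof -
      have ik: "integrable circle (indicator K :: complex \<Rightarrow> real)"
        by (intro integrable_real_indicator) (auto simp: circle.emeasure_eq_measure)
      have "\<mu> - 1 / real (Suc k) = (LINT t|circle. indicator K t - 1 / real (Suc k))"
        using ik by (subst Bochner_Integration.integral_diff) (auto simp: \<mu>_def)
      also have "\<dots> \<le> (LINT t|circle. r k t)"
      proof (rule integral_mono_AE)
        show "AE t in circle. indicator K t - 1 / real (Suc k) \<le> r k t"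
          using AE_circle_norm by eventually_elim (rule rb(3))
      qed (use ik rint in auto)
      finally have "cmod (fourier g 0) * exp (real n * (\<mu> - 1 / real (Suc k))) \<le> cmod (fourier g 0) * exp (real n * (LINT t|circle. r k t))"
        by (intro mult_left_mono) (auto intro!: mult_left_mono)
      also have "\<dots> \<le> (LINT t|circle. cmod (ev g t) * exp (real n * r k t))"
        by (rule mean_bound_exp[OF p g w(1) w(3)]) (use AE_circle_norm in \<open>auto elim!: eventually_mono intro!: rb\<close>)
      finally show ?thesis .
    qed
    show ?thesis using LIMSEQ_le[OF lim1 lim2'] le by simp
  qed
  show ?thesis
  proof (rule ccontr)
    assume "fourier g 0 \<noteq> 0"
    hence pos: "cmod (fourier g 0) > 0" by simp
    have "\<mu> > 0" using K by (simp add: \<mu>_def)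
    then obtain n where n: "real n * \<mu> > Lp_norm 1 g / cmod (fourier g 0)" using reals_Archimedean3 by blast
    have "real n * \<mu> < exp (real n * \<mu>)" using exp_ge_add_one_self[of "real n * \<mu>"] by linarith
    hence "Lp_norm 1 g / cmod (fourier g 0) < exp (real n * \<mu>)" using n by linarith
    hence "Lp_norm 1 g < cmod (fourier g 0) * exp (real n * \<mu>)" using pos by (simp add: field_simps)
    thus False using key[of n] by simp
  qed
qed

lemma Hp_shift_down:
  assumes f: "f \<in> Hp p" "p > 0" and z: "\<And>i. 0 \<le> i \<Longrightarrow> i < int n \<Longrightarrow> fourier f i = 0"
  shows "f * tvar powi (- int n) \<in> Hp p"
proof -
  have "fourier f i = 0" if "i < int n" for i using z[of i] Hp_fourier[OF f(1), of i] that by (cases "i < 0") auto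
  moreover have "f * tvar powi (- int n) \<in> Lp p"
    using Linf_mult_in_Lp[OF tvar_powi_Linf Hp_Lp[OF f(1)] f(2)] by (simp add: mult.commute)
  ultimately show ?thesis by (simp add: Hp_def fourier_shift)
qed

text \<open>By inner regularity a zero set of positive measure contains a compact set of positive
  measure. The mean of f vanishes, then that of f / t, and so on through all coefficients.\<close>

lemma Hp_nonzero_AE:
  assumes p: "1 < p" and f: "f \<in> Hp p" "f \<noteq> 0"
  shows "AE t in circle. ev f t \<noteq> 0"
proof (rule ccontr)
  assume nae: "\<not> (AE t in circle. ev f t \<noteq> 0)"
  define Z where "Z = {t. ev f t = 0}"
  have Zm: "Z \<in> sets borel"
  proof -
    have "Z = ev f -` {0} \<inter> space borel" by (auto simp: Z_def)
    thus ?thesis using measurable_sets[OF ev_measurable, of "{0}" f] by simp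
  qed
  have "emeasure circle Z \<noteq> 0"
  proof
    assume "emeasure circle Z = 0"
    hence "Z \<in> null_sets circle" using Zm by (auto intro!: null_setsI)
    from AE_not_in[OF this] nae show False by (auto simp: Z_def)
  qed
  moreover have "emeasure circle Z = (SUP K \<in> {K. K \<subseteq> Z \<and> compact K}. emeasure circle K)"
    by (rule inner_regular) (use Zm in \<open>auto simp: circle.emeasure_space_1[simplified]\<close>)
  ultimately have "\<exists>K\<in>{K. K \<subseteq> Z \<and> compact K}. emeasure circle K \<noteq> 0"
    using SUP_eq_const[of "{K. K \<subseteq> Z \<and> compact K}" "emeasure circle" 0] by (metis (mono_tags, lifting) SUP_bot_conv(1) bot_ennreal)
  then obtain K where K: "K \<subseteq> Z" "compact K" "emeasure circle K \<noteq> 0" by blast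
  have mK: "measure circle K > 0"
    using K(3) by (simp add: circle.emeasure_eq_measure zero_less_measure_iff)
  have "fourier f (int n) = 0" for n
  proof (induction n rule: less_induct)
    case (less n)
    have z: "fourier f i = 0" if "0 \<le> i" "i < int n" for i
      using less[of "nat i"] that by simp
    have "fourier (f * tvar powi (- int n)) 0 = 0"
    proof (rule mean_0_of_vanishing[OF p Hp_shift_down[OF f(1) _ z] K(2) mK])
      show "AE t in circle. t \<in> K \<longrightarrow> ev (f * tvar powi - int n) t = 0"
        using ev_mult[of f "tvar powi - int n"] by eventually_elim (use K(1) in \<open>auto simp: Z_def\<close>)
    qed (use p in auto)
    thus ?case by (simp add: fourier_shift)
  qed
  hence "fourier f n = 0" for n
    using Hp_fourier[OF f(1), of n] by (cases "n < 0") (auto simp: not_less dest!: zero_le_imp_eq_int)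
  hence "f = 0" using Lp_mono[OF Hp_Lp[OF f(1)]] p by (intro fourier_eq_0_imp_0) auto
  thus False using f(2) by simp
qed

section \<open>Toeplitz operators and their adjoints\<close>

lemma pairing_Hp_unique:
  assumes pq: "conj_exps p q" and h: "h1 \<in> Hp q" "h2 \<in> Hp q"
    and eq: "\<And>f. f \<in> Hp p \<Longrightarrow> pairing f h1 = pairing f h2"
  shows "h1 = h2"
proof (rule fourier_unique)
  have p: "p > 1" "q > 1" using pq by (auto simp: conj_exps_def)
  show "h1 \<in> Lp 1" "h2 \<in> Lp 1" using Lp_mono[OF Hp_Lp] h p by auto
  have pf: "pairing (tvar powi n) h = cnj (fourier h n)" for h n
    by (simp add: pairing_fourier mult.commute[of "tvar powi n"] fourier_shift fourier_conj)
  show "fourier h1 n = fourier h2 n" for n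
  proof (cases "n < 0")
    case True thus ?thesis using h by (simp add: Hp_fourier)
  next
    case False
    hence "tvar powi n \<in> Hp p" using p by (intro Hinf_Hp Hinf_tvar_powi) auto
    from eq[OF this] show ?thesis by (simp add: pf)
  qed
qed

lemma Hp_annihilator_0:
  assumes pq: "conj_exps p q" and h: "h \<in> Hp q" and eq: "\<And>f. f \<in> Hp p \<Longrightarrow> pairing f h = 0"
  shows "h = 0"
  by (rule pairing_Hp_unique[OF pq h]) (use eq in auto)

lemma adj_opI:
  assumes pq: "conj_exps p q" and h: "h \<in> Hp q" and eq: "\<And>f. f \<in> Hp p \<Longrightarrow> pairing (A f) g = pairing f h"
  shows "adj_op p A g = h"
  unfolding adj_op_def conj_exps_dual[OF pq]
proof (rule the_equality)
  fix h' assume "h' \<in> Hp q \<and> (\<forall>f\<in>Hp p. pairing (A f) g = pairing f h')"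
  thus "h' = h" using eq h by (intro pairing_Hp_unique[OF pq]) auto
qed (use h eq in auto)

lemma coker_opI:
  assumes pq: "conj_exps p q" and h: "\<And>g. g \<in> Hp q \<Longrightarrow> A' g \<in> Hp q"
    and eq: "\<And>f g. f \<in> Hp p \<Longrightarrow> g \<in> Hp q \<Longrightarrow> pairing (A f) g = pairing f (A' g)"
  shows "coker_op p A = ker_op q A'"
proof -
  have "adj_op p A g = A' g" if "g \<in> Hp q" for g
    by (rule adj_opI[OF pq h[OF that] eq[OF _ that]])
  thus ?thesis by (auto simp: coker_op_def ker_op_def conj_exps_dual[OF pq])
qed

lemma toep_Hp: "1 < p \<Longrightarrow> a \<in> Linf \<Longrightarrow> f \<in> Lp p \<Longrightarrow> toep a f \<in> Hp p"
  unfolding toep_def by (intro Pproj_Hp Linf_mult_in_Lp) auto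

lemma toep_add: "1 < p \<Longrightarrow> a \<in> Linf \<Longrightarrow> f \<in> Lp p \<Longrightarrow> g \<in> Lp p \<Longrightarrow> toep a (f + g) = toep a f + toep a g"
  unfolding toep_def distrib_left by (rule Pproj_add) (auto intro: Linf_mult_in_Lp)

lemma toep_diff: "1 < p \<Longrightarrow> a \<in> Linf \<Longrightarrow> f \<in> Lp p \<Longrightarrow> g \<in> Lp p \<Longrightarrow> toep a (f - g) = toep a f - toep a g"
  unfolding toep_def right_diff_distrib by (rule Pproj_diff) (auto intro: Linf_mult_in_Lp)

lemma toep_cscale: "1 < p \<Longrightarrow> a \<in> Linf \<Longrightarrow> f \<in> Lp p \<Longrightarrow> toep a (cscale z f) = cscale z (toep a f)"
  unfolding toep_def cscale_mult_right by (rule Pproj_cscale) (auto intro: Linf_mult_in_Lp)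

lemma toep_0 [simp]: "toep a 0 = 0"
  by (simp add: toep_def)

lemma toep_bound:
  assumes p: "1 < p" and a: "a \<in> Linf"
  shows "\<exists>C\<ge>0. \<forall>f\<in>Lp p. Lp_norm p (toep a f) \<le> C * Lp_norm p f"
proof -
  obtain D where D: "D \<ge> 0" "AE t in circle. cmod (ev a t) \<le> D" using Linf_bound[OF a] by blast
  obtain C where C: "C \<ge> 0" "\<And>f. f \<in> Lp p \<Longrightarrow> Lp_norm p (Pproj f) \<le> C * Lp_norm p f"
    using Pproj_bound[OF p] by blast
  have "Lp_norm p (toep a f) \<le> (C * D) * Lp_norm p f" if f: "f \<in> Lp p" for f
  proof -
    have "Lp_norm p (toep a f) \<le> C * Lp_norm p (a * f)"
      unfolding toep_def using p by (intro C Linf_mult_Lp(1)[OF D(2) f]) auto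
    also have "\<dots> \<le> C * (D * Lp_norm p f)"
      using p by (intro mult_left_mono C Linf_mult_Lp(2)[OF D(2) f]) auto
    finally show ?thesis by simp
  qed
  thus ?thesis using C D by (intro exI[of _ "C * D"]) auto
qed

lemma pairing_mult_conj: "pairing (a * f) g = pairing f (conj_fun a * g)"
  by (simp add: pairing_fourier conj_simps mult_ac)

lemma toep_adjoint:
  assumes pq: "conj_exps p q" and a: "a \<in> Linf" and f: "f \<in> Hp p" and g: "g \<in> Hp q"
  shows "pairing (toep a f) g = pairing f (toep (conj_fun a) g)"
proof -
  have p: "p > 1" "q > 1" using pq by (auto simp: conj_exps_def)
  have "pairing (toep a f) g = pairing (a * f) g"
    unfolding toep_def using p a Hp_Lp[OF f] by (intro pairing_Pproj[OF pq _ g] Linf_mult_in_Lp) auto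
  also have "\<dots> = pairing f (conj_fun a * g)" by (rule pairing_mult_conj)
  also have "\<dots> = pairing f (toep (conj_fun a) g)"
    unfolding toep_def using p a Hp_Lp[OF g]
    by (intro pairing_Pproj_right[OF pq f, symmetric] Linf_mult_in_Lp) auto
  finally show ?thesis .
qed

lemma coker_toep:
  assumes pq: "conj_exps p q" and a: "a \<in> Linf"
  shows "coker_op p (toep a) = ker_op q (toep (conj_fun a))"
  using pq by (intro coker_opI[OF pq] toep_adjoint[OF pq a] toep_Hp) (use a in \<open>auto simp: Hp_Lp conj_exps_def\<close>)

lemma toep_Hinf: "1 < p \<Longrightarrow> b \<in> Hinf \<Longrightarrow> f \<in> Hp p \<Longrightarrow> toep b f = b * f"
  unfolding toep_def by (rule Pproj_id[of p]) (auto intro: Hinf_mult_Hp)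

text \<open>An antianalytic factor keeps Q u antianalytic of mean 0, so discarding Q u before the
  multiplication loses nothing. Hence T(a) T(b) = T(a b) for antianalytic a.\<close>

lemma Pproj_anti_mult:
  assumes p: "1 < p" and a: "conj_fun a \<in> Hinf" and u: "u \<in> Lp p"
  shows "Pproj (a * Pproj u) = Pproj (a * u)"
proof -
  have aL: "a \<in> Linf" using Hinf_Linf[OF a] by simp
  have Q: "Qproj u \<in> Lp p" by (rule Qproj_Lp[OF p u])
  define q where "q = p / (p - 1)"
  have qp: "conj_exps q p" using p by (auto simp: conj_exps_def q_def field_simps)
  have "conj_fun a \<in> Hp q" using a qp by (auto intro: Hinf_Hp simp: conj_exps_def)
  from Hp_Hq_mult(2)[OF qp this, of "conj_fun (Qproj u)" 1]
  have 1: "fourier (conj_fun a * conj_fun (Qproj u)) n = 0" if "n < 1" for n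
    using that Q by (simp add: fourier_conj fourier_Qproj[OF p u])
  have "Pproj (a * Qproj u) = 0"
  proof (rule Pproj_eq_0)
    fix n :: int assume "n \<ge> 0"
    hence "cnj (fourier (conj_fun (a * Qproj u)) (- n)) = 0" using 1[of "-n"] by (simp add: conj_simps)
    thus "fourier (a * Qproj u) n = 0" by (simp add: fourier_conj)
  qed
  moreover have "Pproj (a * u) = Pproj (a * Pproj u + a * Qproj u)"
    by (simp add: distrib_left[symmetric] Pproj_plus_Qproj)
  ultimately show ?thesis
    using p aL Q Pproj_Lp[OF p u] by (simp add: Pproj_add[OF p] Linf_mult_in_Lp)
qed

lemma toep_mult_anti:
  assumes "1 < p" "conj_fun a \<in> Hinf" "b \<in> Linf" "f \<in> Lp p"
  shows "toep a (toep b f) = toep (a * b) f"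
  unfolding toep_def mult.assoc using assms by (intro Pproj_anti_mult[of p]) (auto intro: Linf_mult_in_Lp)

lemma toep_1: "1 < p \<Longrightarrow> f \<in> Hp p \<Longrightarrow> toep 1 f = f"
  by (simp add: toep_def Pproj_id[of p])

lemma ker_toep_iff: "1 < p \<Longrightarrow> a \<in> Linf \<Longrightarrow> f \<in> ker_op p (toep a) \<longleftrightarrow> f \<in> Hp p \<and> (\<forall>n\<ge>0. fourier (a * f) n = 0)"
  unfolding ker_op_def toep_def using Pproj_eq_0_iff[of p "a * f"] Linf_mult_in_Lp[of a f p] by (auto simp: Hp_Lp)

lemma invertible_LinfD:
  assumes "invertible_Linf a"
  shows "a \<in> Linf" "inverse a \<in> Linf" "a * inverse a = 1"
proof -
  obtain a' where a: "a \<in> Linf" "a' \<in> Linf" "a * a' = 1" using assms by (auto simp: invertible_Linf_def)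
  have "inverse a = a'" by (rule circ_inverse_unique[OF a(3)])
  thus "a \<in> Linf" "inverse a \<in> Linf" "a * inverse a = 1" using a by auto
qed

text \<open>The product d f (cnj h) has no coefficients n \<ge> 0, because d f has none, and none
  with n \<le> 0, because of cnj d h. So it is 0, while nonzero f and h vanish only on null
  sets.\<close>

lemma Coburn:
  assumes pq: "conj_exps p q" and d: "d \<in> Linf" "d * inverse d = 1"
    and f: "f \<in> ker_op p (toep d)" and h: "h \<in> ker_op q (toep (conj_fun d))"
  shows "f = 0 \<or> h = 0"
proof (rule ccontr)
  assume "\<not> ?thesis"
  hence nz: "f \<noteq> 0" "h \<noteq> 0" by auto
  have p: "p > 1" "q > 1" using pq by (auto simp: conj_exps_def)
  note qp = conj_exps_sym[OF pq]
  have f': "f \<in> Hp p" "\<And>n. n \<ge> 0 \<Longrightarrow> fourier (d * f) n = 0" using f ker_toep_iff[OF p(1) d(1)] by auto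
  have h': "h \<in> Hp q" "\<And>n. n \<ge> 0 \<Longrightarrow> fourier (conj_fun d * h) n = 0" using h ker_toep_iff[OF p(2), of "conj_fun d"] d(1) by auto
  have L: "d * f \<in> Lp p" "conj_fun d * h \<in> Lp q" using Linf_mult_in_Lp[OF d(1) Hp_Lp[OF f'(1)]] Linf_mult_in_Lp[OF _ Hp_Lp[OF h'(1)], of "conj_fun d"] d(1) p by auto
  define u where "u = d * f * conj_fun h"
  have 1: "fourier u n = 0" if "n \<ge> 0" for n
  proof -
    have "fourier (h * conj_fun (d * f)) (- n) = 0"
      by (rule Hp_Hq_mult(2)[OF qp h'(1), where m = 1]) (use L(1) f'(2) that in \<open>auto simp: fourier_conj\<close>)
    hence "fourier (conj_fun (h * conj_fun (d * f))) n = 0" by (simp add: fourier_conj)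
    thus ?thesis by (simp add: u_def conj_simps mult_ac)
  qed
  have 2: "u \<in> Lp 1" "\<And>n. n < 1 \<Longrightarrow> fourier u n = 0"
  proof -
    have e: "u = f * conj_fun (conj_fun d * h)" by (simp add: u_def conj_simps mult_ac)
    have z: "fourier (conj_fun (conj_fun d * h)) n = 0" if "n < 1" for n
      using h'(2)[of "-n"] that by (simp only: fourier_conj) simp
    have L2: "conj_fun (conj_fun d * h) \<in> Lp q" using L(2) by (simp only: Lp_conj)
    show "u \<in> Lp 1" unfolding e by (rule Hp_Hq_mult(1)[OF pq f'(1) L2 z])
    show "fourier u n = 0" if "n < 1" for n unfolding e by (rule Hp_Hq_mult(2)[OF pq f'(1) L2 z that])
  qed
  have "u = 0"
  proof (rule fourier_eq_0_imp_0[OF 2(1)])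
    show "fourier u n = 0" for n using 1[of n] 2(2)[of n] by (cases "n \<ge> 0") auto
  qed
  have "AE t in circle. False"
    using Hp_nonzero_AE[OF p(1) f'(1) nz(1)] Hp_nonzero_AE[OF p(2) h'(1) nz(2)] d(2)[unfolded circ_nz_iff]
      ev_mult[of "d * f" "conj_fun h"] ev_mult[of d f] ev_conj[of h] ev_0
    unfolding u_def[symmetric] \<open>u = 0\<close> by eventually_elim auto
  thus False by simp
qed

text \<open>The test function is the projected and normalised duality map of h. The projection back
  to H^p is what the constant K = C + 1 pays for.\<close>

lemma Hp_norming:
  assumes pq: "conj_exps p q"
  obtains K where "K > 0" "\<And>h. h \<in> Hp q \<Longrightarrow> \<exists>x\<in>Hp p. Lp_norm p x \<le> 1 \<and> Lp_norm q h / K \<le> cmod (pairing x h)"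
proof -
  note qp = conj_exps_sym[OF pq]
  have p: "p > 1" "q > 1" using pq by (auto simp: conj_exps_def)
  obtain C where C: "C \<ge> 0" "\<And>f. f \<in> Lp p \<Longrightarrow> Lp_norm p (Pproj f) \<le> C * Lp_norm p f"
    using Pproj_bound[OF p(1)] by blast
  define K where "K = C + 1"
  have K: "K > 0" using C by (simp add: K_def)
  have "\<exists>x\<in>Hp p. Lp_norm p x \<le> 1 \<and> Lp_norm q h / K \<le> cmod (pairing x h)" if h: "h \<in> Hp q" for h
  proof (cases "Lp_norm q h = 0")
    case True thus ?thesis by (intro bexI[of _ 0]) auto
  next
    case False
    define N where "N = Lp_norm q h"
    have N: "N > 0" using False Lp_norm_nonneg[of q h] unfolding N_def by linarith
    define G where "G = dualfun q h"
    have G: "G \<in> Lp p" "Lp_norm p G powr p = N powr q" "pairing h G = of_real (N powr q)"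
      unfolding G_def N_def using dualfun_Lp[OF qp Hp_Lp[OF h]] by auto
    have "Lp_norm p G = (Lp_norm p G powr p) powr (1 / p)" using p by (simp add: powr_powr)
    also have "\<dots> = N powr (q - 1)"
    proof -
      have "q / p = q - 1" using conj_exps_mult[OF pq] p by (simp add: field_simps)
      thus ?thesis unfolding G(2) powr_powr by simp
    qed
    finally have Gn: "Lp_norm p G = N powr (q - 1)" .
    define M where "M = N powr (q - 1)"
    have M: "M > 0" using N by (simp add: M_def)
    let ?x = "cscale (of_real (1 / (K * M))) (Pproj G)"
    have "Lp_norm p ?x = 1 / (K * M) * Lp_norm p (Pproj G)"
      using p K M by (simp add: Lp_norm_cscale norm_divide norm_mult)
    also have "\<dots> \<le> 1 / (K * M) * (K * M)"
    proof (rule mult_left_mono)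
      have "Lp_norm p (Pproj G) \<le> C * M" using C(2)[OF G(1)] by (simp add: Gn M_def)
      also have "\<dots> \<le> K * M" using M by (intro mult_right_mono) (auto simp: K_def)
      finally show "Lp_norm p (Pproj G) \<le> K * M" .
    qed (use K M in auto)
    also have "\<dots> = 1" using K M by simp
    finally have 1: "Lp_norm p ?x \<le> 1" .
    have "pairing (Pproj G) h = cnj (pairing h G)"
      using pairing_Pproj[OF pq G(1) h] pairing_cnj[of G h] by simp
    hence "pairing ?x h = of_real (1 / (K * M) * N powr q)"
      by (simp add: pairing_cscale_left G(3))
    hence "cmod (pairing ?x h) = \<bar>1 / (K * M) * N powr q\<bar>" by (simp only: norm_of_real)
    also have "\<dots> = 1 / (K * M) * N powr q" using K M by simp
    also have "N powr q = N * M"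
      using powr_add[of N 1 "q - 1"] N by (simp add: M_def)
    finally have "cmod (pairing ?x h) = N / K" using M by simp
    thus ?thesis using 1 Pproj_Hp[OF p(1) G(1)] by (intro bexI[of _ ?x]) (auto simp: N_def intro: Hp_cscale)
  qed
  thus ?thesis using that K by blast
qed

text \<open>The uniform boundedness principle, by Sokal's gliding argument: unit vectors \<open>y n\<close> that
  nearly norm \<open>h n\<close> are added with weights \<open>r\<^sup>n\<close> and signs that prevent cancellation.\<close>

lemma bounded_below_adjoint:
  assumes pq: "conj_exps p q" and onto: "E ` Hp p = Hp p"
    and E'sc: "\<And>z h. h \<in> Hp q \<Longrightarrow> E' (cscale z h) = cscale z (E' h)"
    and E'Hp: "\<And>h. h \<in> Hp q \<Longrightarrow> E' h \<in> Hp q"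
    and adj: "\<And>f h. f \<in> Hp p \<Longrightarrow> h \<in> Hp q \<Longrightarrow> pairing (E f) h = pairing f (E' h)"
  shows "\<exists>c\<ge>0. \<forall>h\<in>Hp q. Lp_norm q h \<le> c * Lp_norm q (E' h)"
proof (rule ccontr)
  assume neg: "\<not> ?thesis"
  have p: "p > 1" "q > 1" and p1: "p \<ge> 1" "p > 0" "q > 0" using pq by (auto simp: conj_exps_def)
  obtain K where K: "K > 0" "\<And>h. h \<in> Hp q \<Longrightarrow> \<exists>x\<in>Hp p. Lp_norm p x \<le> 1 \<and> Lp_norm q h / K \<le> cmod (pairing x h)"
    using Hp_norming[OF pq] by blast
  define r where "r = 1 / (2 * K + 1)"
  \<comment> \<open>r makes the tail of the geometric series half of the n-th term once the norming
    loss 1 / K is counted; R is chosen next so that weight times norm, (r R)^n = 2^n, still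
    grows.\<close>
  have r: "0 < r" "r < 1" "r / (1 - r) = 1 / (2 * K)" using K(1) by (auto simp: r_def field_simps)
  define R where "R = 2 / r"
  have R: "R > 0" "r * R = 2" using r by (auto simp: R_def)
  have "\<exists>h\<in>Hp q. Lp_norm q h = R ^ n \<and> Lp_norm q (E' h) \<le> 1" for n
  proof -
    have "\<exists>h\<in>Hp q. Lp_norm q h > R ^ n * Lp_norm q (E' h)"
    proof -
      have "R ^ n \<ge> 0" using R(1) by simp
      hence "\<not> (\<forall>h\<in>Hp q. Lp_norm q h \<le> R ^ n * Lp_norm q (E' h))" using neg by blast
      thus ?thesis by (auto simp: not_le)
    qed
    then obtain h where h: "h \<in> Hp q" "Lp_norm q h > R ^ n * Lp_norm q (E' h)" by blast
    define s where "s = R ^ n / Lp_norm q h"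
    have pos: "Lp_norm q h > 0"
      by (rule le_less_trans[OF _ h(2)]) (use R(1) in simp)
    have s: "s > 0" using pos R by (simp add: s_def)
    have "Lp_norm q (cscale (of_real s) h) = R ^ n"
      using s pos p1 by (simp add: Lp_norm_cscale) (simp add: s_def)
    moreover have "Lp_norm q (E' (cscale (of_real s) h)) = s * Lp_norm q (E' h)"
      using s p1 by (simp add: E'sc[OF h(1)] Lp_norm_cscale)
    moreover have "s * Lp_norm q (E' h) \<le> 1"
      using h(2) pos by (simp add: s_def field_simps)
    ultimately show ?thesis using Hp_cscale[OF h(1)] by (intro bexI[of _ "cscale (of_real s) h"]) auto
  qed
  then obtain h where h: "\<And>n. h n \<in> Hp q" "\<And>n. Lp_norm q (h n) = R ^ n" "\<And>n. Lp_norm q (E' (h n)) \<le> 1" by metis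
  obtain y where y: "\<And>n. y n \<in> Hp p" "\<And>n. Lp_norm p (y n) \<le> 1" "\<And>n. Lp_norm q (h n) / K \<le> cmod (pairing (y n) (h n))"
    using K(2)[OF h(1)] by metis
  \<comment> \<open>For any numbers a and b one of |a + b|, |a - b| is at least |b|;
    \<open>sg\<close> picks such a sign.\<close>
  define sg where "sg = (\<lambda>n x. if cmod (pairing (x + cscale (of_real (r ^ n)) (y n)) (h n)) \<ge> r ^ n * cmod (pairing (y n) (h n))
     then 1 else - 1 :: complex)"
  define X where "X = rec_nat 0 (\<lambda>n x. x + cscale (sg n x * of_real (r ^ n)) (y n))"
  have X0: "X 0 = 0" and XS: "X (Suc n) = X n + cscale (sg n (X n) * of_real (r ^ n)) (y n)" for n
    by (auto simp: X_def)
  have sg1: "cmod (sg n x) = 1" for n x by (simp add: sg_def)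
  have XH: "X n \<in> Hp p" for n
    by (induction n) (auto simp: X0 XS intro!: Hp_add Hp_cscale y p1)
  have XL: "X n \<in> Lp p" for n using Hp_Lp[OF XH] .
  have step: "Lp_norm p (X (Suc n) - X n) \<le> r ^ n" for n
  proof -
    have "Lp_norm p (X (Suc n) - X n) = r ^ n * Lp_norm p (y n)"
      using p1 r by (simp add: XS Lp_norm_cscale norm_mult sg1 norm_power)
    also have "\<dots> \<le> r ^ n * 1" using r y by (intro mult_left_mono) auto
    finally show ?thesis by simp
  qed
  have dist: "Lp_norm p (X (n + k) - X n) \<le> (r ^ n - r ^ (n + k)) / (1 - r)" for n k
  proof (induction k)
    case (Suc k)
    have "Lp_norm p (X (n + Suc k) - X n) \<le> Lp_norm p (X (n + Suc k) - X (n + k)) + Lp_norm p (X (n + k) - X n)"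
      by (rule Lp_norm_triangle3[OF p1(1) XL XL XL])
    also have "\<dots> \<le> r ^ (n + k) + (r ^ n - r ^ (n + k)) / (1 - r)"
      using step[of "n + k"] Suc by simp
    also have "\<dots> = (r ^ n - r ^ (n + Suc k)) / (1 - r)"
      using r(2) by (simp add: field_simps)
    finally show ?case .
  qed simp
  have dist': "Lp_norm p (X m - X n) \<le> r ^ n / (1 - r)" if "m \<ge> n" for m n
  proof -
    have "Lp_norm p (X m - X n) \<le> (r ^ n - r ^ m) / (1 - r)" using dist[of n "m - n"] that by simp
    also have "\<dots> \<le> r ^ n / (1 - r)" using r by (intro divide_right_mono) auto
    finally show ?thesis .
  qed
  have "\<exists>N. \<forall>m\<ge>N. \<forall>n\<ge>N. Lp_norm p (X m - X n) < e" if e: "e > 0" for e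
  proof -
    have "(\<lambda>n. r ^ n / (1 - r)) \<longlonglongrightarrow> 0 / (1 - r)" using r by (intro tendsto_intros LIMSEQ_power_zero) auto
    hence "(\<lambda>n. r ^ n / (1 - r)) \<longlonglongrightarrow> 0" by simp
    from order_tendstoD(2)[OF this e] obtain N where N: "\<And>n. n \<ge> N \<Longrightarrow> r ^ n / (1 - r) < e"
      by (auto simp: eventually_sequentially)
    have "Lp_norm p (X m - X n) < e" if "m \<ge> N" "n \<ge> N" for m n
    proof (cases "m \<ge> n")
      case True thus ?thesis using dist'[OF True] N[OF that(2)] by simp
    next
      case False
      thus ?thesis using dist'[of m n] N[OF that(1)] Lp_norm_minus_commute[OF p1(2), of "X m"] by simp
    qed
    thus ?thesis by blast
  qed
  from Lp_complete[OF p1(1) XL this] obtain x where x: "x \<in> Lp p" "(\<lambda>n. Lp_norm p (X n - x)) \<longlonglongrightarrow> 0" by blast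
  have xH: "x \<in> Hp p" using Hp_closed[OF p1(1)] XH x unfolding Lp_closed_def by blast
  have xd: "Lp_norm p (X n - x) \<le> r ^ n / (1 - r)" for n
  proof (rule LIMSEQ_le_const)
    show "(\<lambda>m. r ^ n / (1 - r) + Lp_norm p (X m - x)) \<longlonglongrightarrow> r ^ n / (1 - r)"
      using tendsto_add[OF tendsto_const x(2)] by simp
    have "Lp_norm p (X n - x) \<le> r ^ n / (1 - r) + Lp_norm p (X m - x)" if "m \<ge> n" for m
      using Lp_norm_triangle3[OF p1(1) XL XL x(1), of n m] dist'[OF that] Lp_norm_minus_commute[OF p1(2), of "X n"] by simp
    thus "\<exists>N. \<forall>m\<ge>N. Lp_norm p (X n - x) \<le> r ^ n / (1 - r) + Lp_norm p (X m - x)" by blast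
  qed
  have big: "2 ^ n / K \<le> cmod (pairing (X (Suc n)) (h n))" for n
  proof -
    define a where "a = pairing (X n) (h n)"
    define b where "b = of_real (r ^ n) * pairing (y n) (h n)"
    have hL: "h n \<in> Lp q" using Hp_Lp[OF h(1)] .
    have pr: "pairing (X n + cscale z (y n)) (h n) = a + z * pairing (y n) (h n)" for z
      unfolding a_def using pairing_add_left[OF pq XL cscale_in_Lp[OF Hp_Lp[OF y(1)]] hL]
      by (simp add: pairing_cscale_left)
    have bn: "cmod b = r ^ n * cmod (pairing (y n) (h n))" using r by (simp add: b_def norm_mult norm_power)
    have "cmod b \<le> cmod (pairing (X (Suc n)) (h n))"
    proof (cases "cmod (a + b) \<ge> cmod b")
      case True
      hence "sg n (X n) = 1" unfolding sg_def pr using bn by (simp add: b_def)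
      thus ?thesis using True unfolding XS pr by (simp add: b_def)
    next
      case False
      hence "sg n (X n) = - 1" unfolding sg_def pr using bn by (simp add: b_def)
      hence e: "pairing (X (Suc n)) (h n) = a - b" unfolding XS pr by (simp add: b_def)
      have "2 * cmod b = cmod ((a + b) - (a - b))" by (simp add: norm_mult)
      also have "\<dots> \<le> cmod (a + b) + cmod (a - b)" by (rule norm_triangle_ineq4)
      finally show ?thesis using False e by simp
    qed
    moreover have "2 ^ n / K \<le> cmod b"
    proof -
      have "2 ^ n / K = r ^ n * (Lp_norm q (h n) / K)"
        unfolding h(2) R(2)[symmetric] by (simp add: power_mult_distrib)
      also have "\<dots> \<le> cmod b" unfolding bn using y(3) r by (intro mult_left_mono) auto
      finally show ?thesis .
    qed
    ultimately show ?thesis by simp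
  qed
  obtain f where f: "f \<in> Hp p" "x = E f" using xH onto by blast
  have le: "2 ^ n \<le> 2 * K * Lp_norm p f" for n
  proof -
    have hL: "h n \<in> Lp q" using Hp_Lp[OF h(1)] .
    have "cmod (pairing (X (Suc n) - x) (h n)) \<le> Lp_norm p (X (Suc n) - x) * Lp_norm q (h n)"
      using x(1) XL p1 by (intro pairing_bound[OF pq _ hL] Lp_diff) auto
    also have "\<dots> \<le> r ^ Suc n / (1 - r) * R ^ n"
      unfolding h(2) using R by (intro mult_right_mono xd) auto
    also have "\<dots> = r / (1 - r) * (r * R) ^ n" by (simp add: power_mult_distrib)
    also have "\<dots> = 2 ^ n / (2 * K)" unfolding r(3) R(2) by simp
    finally have 1: "cmod (pairing (X (Suc n) - x) (h n)) \<le> 2 ^ n / (2 * K)" .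
    have "pairing (X (Suc n)) (h n) = pairing (X (Suc n) - x) (h n) + pairing x (h n)"
      using pairing_diff_left[OF pq XL x(1) hL] by simp
    hence "2 ^ n / K \<le> cmod (pairing (X (Suc n) - x) (h n)) + cmod (pairing x (h n))"
      using big[of n] norm_triangle_ineq order_trans by metis
    hence "2 ^ n / K \<le> 2 ^ n / (2 * K) + cmod (pairing x (h n))" using 1 by linarith
    moreover have "cmod (pairing x (h n)) \<le> Lp_norm p f"
    proof -
      have "cmod (pairing x (h n)) = cmod (pairing f (E' (h n)))" using adj[OF f(1) h(1)] f(2) by simp
      also have "\<dots> \<le> Lp_norm p f * Lp_norm q (E' (h n))"
        using f(1) E'Hp[OF h(1)] by (intro pairing_bound[OF pq] Hp_Lp)
      also have "\<dots> \<le> Lp_norm p f * 1" by (intro mult_left_mono h) auto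
      finally show ?thesis by simp
    qed
    ultimately have "2 ^ n / K \<le> 2 ^ n / (2 * K) + Lp_norm p f" by linarith
    thus ?thesis using K(1) by (simp add: field_simps)
  qed
  obtain n where "2 * K * Lp_norm p f < 2 ^ n" using real_arch_pow[of 2 "2 * K * Lp_norm p f"] by auto
  thus False using le[of n] by simp
qed

text \<open>The lower bound turns a convergent sequence of images into a Cauchy sequence of
  preimages.\<close>

lemma Lp_closed_range:
  assumes p: "1 < p" and A: "\<And>f. f \<in> Hp p \<Longrightarrow> A f \<in> Hp p"
    and diff: "\<And>f g. f \<in> Hp p \<Longrightarrow> g \<in> Hp p \<Longrightarrow> A (f - g) = A f - A g"
    and D: "\<And>f. f \<in> Hp p \<Longrightarrow> Lp_norm p (A f) \<le> D * Lp_norm p f"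
    and c: "c \<ge> 0" "\<And>f. f \<in> Hp p \<Longrightarrow> Lp_norm p f \<le> c * Lp_norm p (A f)"
  shows "Lp_closed p (A ` Hp p)"
  unfolding Lp_closed_def
proof safe
  fix f g assume f: "\<forall>n::nat. f n \<in> A ` Hp p" and g: "g \<in> Lp p" and l: "(\<lambda>n. Lp_norm p (f n - g)) \<longlonglongrightarrow> 0"
  have p1: "p \<ge> 1" "p > 0" using p by auto
  obtain h where h: "\<And>n. h n \<in> Hp p" "\<And>n. f n = A (h n)" using f unfolding image_iff by metis
  have hL: "h n \<in> Lp p" for n using Hp_Lp[OF h(1)] .
  have fL: "f n \<in> Lp p" for n using h A Hp_Lp by auto
  have "\<exists>N. \<forall>m\<ge>N. \<forall>n\<ge>N. Lp_norm p (h m - h n) < e" if e: "e > 0" for e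
  proof -
    have "e / (c + 1) > 0" using e c by simp
    then obtain N where N: "\<And>m n. m \<ge> N \<Longrightarrow> n \<ge> N \<Longrightarrow> Lp_norm p (f m - f n) < e / (c + 1)"
      using Lp_norm_tendsto_0_imp_Cauchy[OF p1(1) fL g l] by blast
    have "Lp_norm p (h m - h n) < e" if "m \<ge> N" "n \<ge> N" for m n
    proof -
      have "Lp_norm p (h m - h n) \<le> c * Lp_norm p (f m - f n)"
        using c(2)[OF Hp_diff[OF p1(1) h(1) h(1)], of m n] by (simp add: diff h)
      also have "\<dots> \<le> (c + 1) * Lp_norm p (f m - f n)" by (intro mult_right_mono) auto
      also have "\<dots> < e" using N[OF that] c(1)
          pos_less_divide_eq[of "c + 1" "Lp_norm p (f m - f n)" e] by (simp add: mult.commute)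
      finally show ?thesis .
    qed
    thus ?thesis by blast
  qed
  from Lp_complete[OF p1(1) hL this] obtain x where x: "x \<in> Lp p" "(\<lambda>n. Lp_norm p (h n - x)) \<longlonglongrightarrow> 0" by blast
  have xH: "x \<in> Hp p" using Hp_closed[OF p1(1)] h(1) x unfolding Lp_closed_def by blast
  have AxL: "A x \<in> Lp p" using A[OF xH] by (rule Hp_Lp)
  have "Lp_norm p (g - A x) \<le> 0"
  proof (rule LIMSEQ_le_const)
    have "(\<lambda>n. Lp_norm p (f n - g) + D * Lp_norm p (h n - x)) \<longlonglongrightarrow> 0 + D * 0"
      by (intro tendsto_intros l x)
    thus "(\<lambda>n. Lp_norm p (f n - g) + D * Lp_norm p (h n - x)) \<longlonglongrightarrow> 0" by simp
    have "Lp_norm p (g - A x) \<le> Lp_norm p (f n - g) + D * Lp_norm p (h n - x)" for n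
    proof -
      have "Lp_norm p (g - A x) \<le> Lp_norm p (g - f n) + Lp_norm p (f n - A x)"
        by (rule Lp_norm_triangle3[OF p1(1) g fL AxL])
      also have "f n - A x = A (h n - x)" by (simp add: diff h xH)
      finally show ?thesis
        using D[OF Hp_diff[OF p1(1) h(1) xH], of n] Lp_norm_minus_commute[OF p1(2), of g] by simp
    qed
    thus "\<exists>N. \<forall>n\<ge>N. Lp_norm p (g - A x) \<le> Lp_norm p (f n - g) + D * Lp_norm p (h n - x)" by blast
  qed
  hence "Lp_norm p (g - A x) = 0" using Lp_norm_nonneg[of p "g - A x"] by linarith
  hence "g - A x = 0" using Lp_norm_eq_0[OF Lp_diff[OF p1(1) g AxL]] p1 by blast
  thus "g \<in> A ` Hp p" using xH by auto
qed

text \<open>The separating function found in L^q may be projected to H^q without changing its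
  pairings with H^p.\<close>

lemma Hp_onto:
  assumes pq: "conj_exps p q" and M: "circ.subspace M" "M \<subseteq> Hp p" "Lp_closed p M"
    and ann: "\<And>h. h \<in> Hp q \<Longrightarrow> (\<And>m. m \<in> M \<Longrightarrow> pairing m h = 0) \<Longrightarrow> h = 0"
  shows "M = Hp p"
proof (rule ccontr)
  assume "M \<noteq> Hp p"
  then obtain g where g: "g \<in> Hp p" "g \<notin> M" using M(2) by blast
  have q: "q > 1" using pq by (auto simp: conj_exps_def)
  have MLp: "M \<subseteq> Lp p" using M(2) Hp_Lp by blast
  obtain h where h: "h \<in> Lp q" "\<And>m. m \<in> M \<Longrightarrow> pairing m h = 0" "pairing g h \<noteq> 0"
    using Lp_separation[OF pq M(1) MLp M(3) Hp_Lp[OF g(1)] g(2)] by blast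
  have pr: "pairing m (Pproj h) = pairing m h" if "m \<in> Hp p" for m
    by (rule pairing_Pproj_right[OF pq that h(1)])
  have "Pproj h = 0"
    by (rule ann[OF Pproj_Hp[OF q h(1)]]) (use pr h(2) M(2) in auto)
  thus False using pr[OF g(1)] h(3) by simp
qed

text \<open>Rank and nullity for one functional. Linearity is required on W only, since Fourier
  coefficients are additive only on integrable functions.\<close>

lemma circ_dim_kernel:
  assumes W: "circ.subspace W" "fin_dim W" and v: "v \<in> W" "e v \<noteq> (0::complex)"
    and e: "\<And>f g. f \<in> W \<Longrightarrow> g \<in> W \<Longrightarrow> e (f - g) = e f - e g" "\<And>z f. f \<in> W \<Longrightarrow> e (cscale z f) = z * e f"
  shows "circ.dim W = Suc (circ.dim {f \<in> W. e f = 0})"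
proof -
  let ?W = "{f \<in> W. e f = 0}"
  obtain B where B: "B \<subseteq> ?W" "circ.independent B" "?W \<subseteq> circ.span B" "card B = circ.dim ?W"
    by (rule circ.basis_exists)
  obtain T where T: "finite T" "W \<subseteq> circ.span T" using W(2) by (auto simp: fin_dim_def)
  have finB: "finite B" using circ.independent_span_bound[OF T(1) B(2)] B(1) T(2) by blast
  have sW: "circ.subspace ?W"
  proof (rule circ.subspaceI)
    have "e (0 - 0) = e 0 - e 0" using circ.subspace_0[OF W(1)] by (intro e(1))
    thus "0 \<in> ?W" using circ.subspace_0[OF W(1)] by simp
    show "cscale z x \<in> ?W" if "x \<in> ?W" for z x using that e(2) circ.subspace_scale[OF W(1)] by auto
    show "x + y \<in> ?W" if "x \<in> ?W" "y \<in> ?W" for x y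
    proof -
      have m: "cscale (-1) y \<in> W" by (rule circ.subspace_scale[OF W(1)]) (use that in auto)
      have "e (x - cscale (-1) y) = e x - e (cscale (-1) y)" using that m by (intro e(1)) auto
      moreover have "x - cscale (-1) y = x + y" by (simp add: cscale_m1)
      ultimately show ?thesis using that e(2)[of y "-1"] circ.subspace_add[OF W(1)] by auto
    qed
  qed
  have spB: "circ.span B \<subseteq> ?W" using B(1) sW by (rule circ.span_minimal)
  have vB: "v \<notin> circ.span B" using spB v by auto
  have ind: "circ.independent (insert v B)" by (rule circ.independent_insertI[OF vB B(2)])
  have "W \<subseteq> circ.span (insert v B)"
  proof
    fix x assume x: "x \<in> W"
    define k where "k = e x / e v"
    have "e (x - cscale k v) = 0" using x v e circ.subspace_scale[OF W(1)] by (simp add: k_def)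
    hence "x - cscale k v \<in> ?W" using x v W(1) by (auto intro: circ.subspace_diff circ.subspace_scale)
    thus "x \<in> circ.span (insert v B)" using B(3) unfolding circ.span_insert by blast
  qed
  hence "circ.dim W = card (insert v B)"
    using ind B(1) v by (intro circ.dim_unique) auto
  moreover have "v \<notin> B" using vB circ.span_base by blast
  ultimately show ?thesis using finB B(4) by simp
qed

lemma fin_dim_subset: "fin_dim V \<Longrightarrow> W \<subseteq> V \<Longrightarrow> fin_dim W"
  by (auto simp: fin_dim_def)

lemma fin_dim_dim_0: "fin_dim V \<Longrightarrow> circ.dim V = 0 \<Longrightarrow> f \<in> V \<Longrightarrow> f = 0"
proof -
  assume V: "fin_dim V" "circ.dim V = 0" "f \<in> V"
  obtain B where B: "B \<subseteq> V" "circ.independent B" "V \<subseteq> circ.span B" "card B = circ.dim V"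
    by (rule circ.basis_exists)
  obtain T where T: "finite T" "V \<subseteq> circ.span T" using V(1) by (auto simp: fin_dim_def)
  have "finite B" using circ.independent_span_bound[OF T(1) B(2)] B(1) T(2) by blast
  hence "B = {}" using B(4) V(2) by simp
  thus ?thesis using B(3) V(3) by auto
qed

lemma circ_dim_0 [simp]: "circ.dim {0} = 0"
  by (rule circ.dim_unique[of "{}"]) (auto simp: circ.independent_empty)

lemma circ_dim_pos_ex:
  assumes "circ.subspace V" "circ.dim V \<noteq> 0"
  shows "\<exists>f\<in>V. f \<noteq> 0"
proof (rule ccontr)
  assume "\<not> ?thesis"
  hence "V = {0}" using circ.subspace_0[OF assms(1)] by blast
  hence "circ.dim V = 0" by (simp only: circ_dim_0)
  thus False using assms(2) by contradiction
qed

lemma ker_toep_subspace: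
  assumes p: "1 < p" and a: "a \<in> Linf"
  shows "circ.subspace (ker_op p (toep a))"
  using p a by (intro circ.subspaceI)
    (auto simp: ker_op_def toep_add[OF p a] toep_cscale[OF p a] Hp_Lp intro: Hp_add Hp_cscale)

text \<open>With \<open>W j\<close> the part of the kernel of \<open>T(d)\<close> vanishing to order \<open>j\<close> at the origin: as long as
  \<open>W j\<close> is nontrivial it contains a function of exact order \<open>j\<close>, because division by \<open>t\<close>
  preserves the kernel. So \<open>dim (W j) = k - j\<close>, and solutions of \<open>T(d) f = g\<close>
  can be corrected to vanish to order \<open>k\<close>.\<close>

lemma toep_shift_bij:
  assumes p: "1 < p" and d: "d \<in> Linf" and fin: "fin_dim (ker_op p (toep d))"
    and dim: "circ.dim (ker_op p (toep d)) = k" and onto: "toep d ` Hp p = Hp p"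
  shows "ker_op p (toep (d * tvar powi int k)) = {0}" "toep (d * tvar powi int k) ` Hp p = Hp p"
proof -
  have p1: "p \<ge> 1" "p > 0" using p by auto
  let ?V = "ker_op p (toep d)"
  define W where "W = (\<lambda>j. {f \<in> ?V. \<forall>i. 0 \<le> i \<and> i < int j \<longrightarrow> fourier f i = 0})"
  have VH: "f \<in> ?V \<Longrightarrow> f \<in> Hp p" for f by (simp add: ker_op_def)
  have L1: "f \<in> Hp p \<Longrightarrow> f \<in> Lp 1" for f using Lp_mono[OF Hp_Lp p1(1)] .
  have Vsub: "circ.subspace ?V" by (rule ker_toep_subspace[OF p d])
  have Wsub: "circ.subspace (W j)" for j
    using Vsub by (auto simp: W_def circ.subspace_def fourier_add fourier_cscale L1 VH)
  have Wfin: "fin_dim (W j)" for j by (rule fin_dim_subset[OF fin]) (auto simp: W_def)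
  have ex: "\<exists>v\<in>W j. fourier v (int j) \<noteq> 0" if ne: "f \<in> W j" "f \<noteq> 0" for f j
  proof -
    have fV: "f \<in> ?V" and fz: "\<And>i. 0 \<le> i \<Longrightarrow> i < int j \<Longrightarrow> fourier f i = 0" using ne by (auto simp: W_def)
    have fH: "f \<in> Hp p" by (rule VH[OF fV])
    have "\<exists>n. fourier f (int n) \<noteq> 0"
    proof (rule ccontr)
      assume "\<not> ?thesis"
      hence "fourier f n = 0" for n
        using Hp_fourier[OF fH, of n] by (cases "n < 0") (auto simp: not_less dest!: zero_le_imp_eq_int)
      thus False using ne(2) fourier_eq_0_imp_0[OF L1[OF fH]] by blast
    qed
    \<comment> \<open>n is the exact order of f at the origin; division by t^(n - j) lowers it to
      j.\<close>
    then obtain n where n: "fourier f (int n) \<noteq> 0" "\<And>i. i < n \<Longrightarrow> fourier f (int i) = 0"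
      using exists_least_iff[of "\<lambda>n. fourier f (int n) \<noteq> 0"] by auto
    have nj: "n \<ge> j" using n(1) fz[of "int n"] by (cases "n < j") auto
    define g where "g = f * tvar powi (- int (n - j))"
    have gH: "g \<in> Hp p" unfolding g_def
    proof (rule Hp_shift_down[OF fH p1(2)])
      fix i assume "0 \<le> i" "i < int (n - j)"
      thus "fourier f i = 0" using n(2)[of "nat i"] by simp
    qed
    have "fourier (d * g) i = 0" if "i \<ge> 0" for i
    proof -
      have "d * g = (d * f) * tvar powi (- int (n - j))" by (simp add: g_def mult_ac)
      thus ?thesis using fV that ker_toep_iff[OF p d] by (simp add: fourier_shift)
    qed
    hence gV: "g \<in> ?V" using gH by (simp add: ker_toep_iff[OF p d])
    have fg: "fourier g i = fourier f (i + int (n - j))" for i by (simp add: g_def fourier_shift)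
    have "fourier g i = 0" if "0 \<le> i" "i < int j" for i
    proof -
      have "i + int (n - j) = int (nat i + (n - j))" "nat i + (n - j) < n" using that nj by auto
      thus ?thesis unfolding fg using n(2)[of "nat i + (n - j)"] by metis
    qed
    hence "g \<in> W j" using gV by (simp add: W_def)
    moreover have "fourier g (int j) \<noteq> 0"
      using n(1) nj unfolding fg of_nat_add[symmetric] by simp
    ultimately show ?thesis by blast
  qed
  have WS: "W (Suc j) = {f \<in> W j. fourier f (int j) = 0}" for j
  proof -
    have "i < int (Suc j) \<longleftrightarrow> i < int j \<or> i = int j" for i by auto
    thus ?thesis unfolding W_def by auto
  qed
  have Wdim: "circ.dim (W j) = k - j" if "j \<le> k" for j
    using that
  proof (induction j)
    case 0
    have "W 0 = ?V" by (auto simp: W_def)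
    thus ?case using dim by simp
  next
    case (Suc j)
    hence "circ.dim (W j) = k - j" "k - j \<noteq> 0" by auto
    hence "circ.dim (W j) \<noteq> 0" by linarith
    then obtain f where "f \<in> W j" "f \<noteq> 0" using circ_dim_pos_ex[OF Wsub] by blast
    then obtain v where v: "v \<in> W j" "fourier v (int j) \<noteq> 0" using ex by blast
    have "circ.dim (W j) = Suc (circ.dim (W (Suc j)))"
      unfolding WS by (rule circ_dim_kernel[where e = "\<lambda>f. fourier f (int j)", OF Wsub Wfin v]) (auto simp: fourier_diff fourier_cscale L1 VH W_def)
    thus ?case using Suc by simp
  qed
  have E: "toep d (tvar powi int k * f) = toep (d * tvar powi int k) f" for f
    by (simp add: toep_def mult.assoc)
  have tH: "tvar powi int k * f \<in> Hp p" if "f \<in> Hp p" for f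
    using that by (intro Hinf_mult_Hp p Hinf_tvar_powi) auto
  show "ker_op p (toep (d * tvar powi int k)) = {0}"
  proof -
    have "f = 0" if f: "f \<in> Hp p" "toep (d * tvar powi int k) f = 0" for f
    proof -
      let ?g = "tvar powi int k * f"
      have gV: "?g \<in> ?V" using tH[OF f(1)] f(2) E by (simp add: ker_op_def)
      have fg: "fourier ?g i = fourier f (i - int k)" for i unfolding mult.commute[of _ f] by (rule fourier_shift)
      have "fourier ?g i = 0" if "i < int k" for i unfolding fg using that Hp_fourier[OF f(1)] by simp
      hence "?g \<in> W k" using gV by (simp add: W_def)
      hence g0: "?g = 0" using fin_dim_dim_0[OF Wfin] Wdim[of k] by simp
      have "fourier f i = 0" for i using fg[of "i + int k"] unfolding g0 by simp
      thus "f = 0" by (rule fourier_eq_0_imp_0[OF L1[OF f(1)]])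
    qed
    thus ?thesis by (auto simp: ker_op_def)
  qed
  have solve: "\<exists>f\<in>Hp p. toep d f = g \<and> (\<forall>i. 0 \<le> i \<and> i < int j \<longrightarrow> fourier f i = 0)" if "g \<in> Hp p" "j \<le> k" for g j
    using that(2)
  proof (induction j)
    case 0
    have "g \<in> toep d ` Hp p" using onto that(1) by simp
    thus ?case by force
  next
    case (Suc j)
    then obtain f where f: "f \<in> Hp p" "toep d f = g" "\<And>i. 0 \<le> i \<Longrightarrow> i < int j \<Longrightarrow> fourier f i = 0" by auto
    have "circ.dim (W j) \<noteq> 0" using Wdim[of j] Suc.prems by simp
    then obtain u where "u \<in> W j" "u \<noteq> 0" using circ_dim_pos_ex[OF Wsub] by blast
    then obtain v where v: "v \<in> W j" "fourier v (int j) \<noteq> 0" using ex by blast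
    have vH: "v \<in> Hp p" "toep d v = 0" "\<And>i. 0 \<le> i \<Longrightarrow> i < int j \<Longrightarrow> fourier v i = 0"
      using v(1) by (auto simp: W_def ker_op_def)
    let ?z = "fourier f (int j) / fourier v (int j)"
    let ?f = "f - cscale ?z v"
    have ff: "fourier ?f i = fourier f i - ?z * fourier v i" for i
      using f vH L1 by (simp add: fourier_diff fourier_cscale cscale_in_Lp)
    have "?f \<in> Hp p" using f vH p1 by (intro Hp_diff Hp_cscale)
    moreover have "toep d ?f = g"
      using f vH by (simp add: toep_diff[OF p d] toep_cscale[OF p d] Hp_Lp cscale_in_Lp)
    moreover have "fourier ?f i = 0" if "0 \<le> i" "i < int (Suc j)" for i
    proof (cases "i = int j")
      case True thus ?thesis using v(2) by (simp add: ff)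
    next
      case False thus ?thesis using that f(3) vH(3) by (simp add: ff)
    qed
    ultimately show ?case by blast
  qed
  show "toep (d * tvar powi int k) ` Hp p = Hp p"
  proof safe
    fix f assume "f \<in> Hp p"
    thus "toep (d * tvar powi int k) f \<in> Hp p" using d by (intro toep_Hp p Linf_mult Hp_Lp tvar_powi_Linf)
  next
    fix g assume "g \<in> Hp p"
    then obtain f where f: "f \<in> Hp p" "toep d f = g" "\<And>i. 0 \<le> i \<Longrightarrow> i < int k \<Longrightarrow> fourier f i = 0"
      using solve[of g k] by auto
    have 1: "f * tvar powi (- int k) \<in> Hp p" by (rule Hp_shift_down[OF f(1) p1(2) f(3)])
    have "tvar powi int k * (f * tvar powi (- int k)) = f"
      using circ_powi_inv[OF tvar_inverse, of "int k"] by (simp add: mult_ac)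
    hence "toep (d * tvar powi int k) (f * tvar powi (- int k)) = g" using E f(2) by metis
    thus "g \<in> toep (d * tvar powi int k) ` Hp p" using 1 by (metis imageI)
  qed
qed

lemma toep_image_subspace:
  assumes p: "1 < p" and d: "d \<in> Linf"
  shows "circ.subspace (toep d ` Hp p)"
proof (rule circ.subspaceI)
  show "0 \<in> toep d ` Hp p" by (rule image_eqI[of _ _ 0]) auto
  show "x + y \<in> toep d ` Hp p" if "x \<in> toep d ` Hp p" "y \<in> toep d ` Hp p" for x y
    using that p by (auto simp: toep_add[OF p d, symmetric] Hp_Lp intro!: imageI Hp_add)
  show "cscale z x \<in> toep d ` Hp p" if "x \<in> toep d ` Hp p" for z x
    using that p by (auto simp: toep_cscale[OF p d, symmetric] Hp_Lp intro!: imageI Hp_cscale)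
qed

text \<open>Positive index gives a nonzero kernel, so the adjoint is injective by Coburn's lemma.
  Since the range is closed, T(d) is onto.\<close>

lemma fredholm_toep_pos:
  assumes pq: "conj_exps p q" and d: "invertible_Linf d" and fr: "fredholm p (toep d)"
    and ind: "ind p (toep d) = int k" and k: "k \<ge> 1"
  shows "ker_op q (toep (conj_fun d)) = {0}" "toep d ` Hp p = Hp p" "circ.dim (ker_op p (toep d)) = k"
proof -
  have p: "p > 1" "q > 1" using pq by (auto simp: conj_exps_def)
  note dL = invertible_LinfD[OF d]
  have ck: "coker_op p (toep d) = ker_op q (toep (conj_fun d))" by (rule coker_toep[OF pq dL(1)])
  have "circ.dim (ker_op p (toep d)) \<noteq> 0" using ind k by (auto simp: ind_def)
  then obtain f where f: "f \<in> ker_op p (toep d)" "f \<noteq> 0"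
    using circ_dim_pos_ex[OF ker_toep_subspace[OF p(1) dL(1)]] by blast
  show 1: "ker_op q (toep (conj_fun d)) = {0}"
    using Coburn[OF pq dL(1,3) f(1)] f(2) by (auto simp: ker_op_def)
  show "circ.dim (ker_op p (toep d)) = k" using ind by (simp add: ind_def ck 1)
  show "toep d ` Hp p = Hp p"
  proof (rule Hp_onto[OF pq toep_image_subspace[OF p(1) dL(1)]])
    show sub: "toep d ` Hp p \<subseteq> Hp p" using toep_Hp[OF p(1) dL(1)] Hp_Lp by blast
    show "Lp_closed p (toep d ` Hp p)"
      unfolding Lp_closed_def
    proof safe
      fix f g assume f: "\<forall>n::nat. f n \<in> toep d ` Hp p" and g: "g \<in> Lp p" "(\<lambda>n. Lp_norm p (f n - g)) \<longlonglongrightarrow> 0"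
      have "g \<in> Hp p" using Hp_closed[of p] f g p sub unfolding Lp_closed_def by (meson less_imp_le subsetD)
      thus "g \<in> toep d ` Hp p" using fr f g unfolding fredholm_def closed_range_def by blast
    qed
  next
    fix h assume h: "h \<in> Hp q" "\<And>m. m \<in> toep d ` Hp p \<Longrightarrow> pairing m h = 0"
    have "toep (conj_fun d) h = 0"
    proof (rule Hp_annihilator_0[OF pq])
      show "toep (conj_fun d) h \<in> Hp q" using h dL(1) p by (intro toep_Hp Hp_Lp) auto
      show "pairing f (toep (conj_fun d) h) = 0" if "f \<in> Hp p" for f
        using toep_adjoint[OF pq dL(1) that h(1)] h(2) that by auto
    qed
    thus "h = 0" using h(1) 1 by (auto simp: ker_op_def)
  qed
qed

text \<open>T(d t^k) is bijective on H^p; surjectivity bounds its adjoint from below, which gives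
  closed range, and injectivity makes that range dense. The Fredholm property and index of T(cnj d)
  follow.\<close>

lemma fredholm_adjoint:
  assumes pq: "conj_exps p q" and d: "invertible_Linf d" and fr: "fredholm p (toep d)"
    and ind: "ind p (toep d) = int k" and k: "k \<ge> 1"
  shows "\<exists>c\<ge>0. \<forall>h\<in>Hp q. Lp_norm q h \<le> c * Lp_norm q (toep (conj_fun d * tvar powi (- int k)) h)"
    "toep (conj_fun d * tvar powi (- int k)) ` Hp q = Hp q"
    "fredholm q (toep (conj_fun d))" "ind q (toep (conj_fun d)) = - int k"
proof -
  have p: "p > 1" "q > 1" using pq by (auto simp: conj_exps_def)
  note dL = invertible_LinfD[OF d] and qp = conj_exps_sym[OF pq]
  note pos = fredholm_toep_pos[OF assms]
  have fin: "fin_dim (ker_op p (toep d))" using fr by (simp add: fredholm_def)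
  note bij = toep_shift_bij[OF p(1) dL(1) fin pos(3,2)]
  let ?E = "toep (d * tvar powi int k)" and ?e = "conj_fun d * tvar powi (- int k)"
  have eL: "d * tvar powi int k \<in> Linf" "?e \<in> Linf"
    using dL(1) by (auto intro!: Linf_mult simp del: power_int_of_nat)
  have ce: "conj_fun (d * tvar powi int k) = ?e" "conj_fun ?e = d * tvar powi int k"
    by (simp_all only: conj_fun_mult conj_tvar_powi conj_fun_conj minus_minus)
  have adj: "pairing (?E f) h = pairing f (toep ?e h)" if "f \<in> Hp p" "h \<in> Hp q" for f h
    using toep_adjoint[OF pq eL(1) that] by (simp only: ce)
  have eH: "toep ?e h \<in> Hp q" if "h \<in> Hp q" for h using that by (intro toep_Hp p eL Hp_Lp)
  show ex: "\<exists>c\<ge>0. \<forall>h\<in>Hp q. Lp_norm q h \<le> c * Lp_norm q (toep ?e h)"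
    by (rule bounded_below_adjoint[OF pq bij(2) _ eH adj]) (auto intro: toep_cscale[OF p(2) eL(2)] Hp_Lp)
  then obtain c where c: "c \<ge> 0" "\<And>h. h \<in> Hp q \<Longrightarrow> Lp_norm q h \<le> c * Lp_norm q (toep ?e h)" by blast
  obtain D where D: "\<And>f. f \<in> Lp q \<Longrightarrow> Lp_norm q (toep ?e f) \<le> D * Lp_norm q f"
    using toep_bound[OF p(2) eL(2)] by blast
  show "toep ?e ` Hp q = Hp q"
  proof (rule Hp_onto[OF qp toep_image_subspace[OF p(2) eL(2)]])
    show "toep ?e ` Hp q \<subseteq> Hp q" using eH by blast
    show "Lp_closed q (toep ?e ` Hp q)"
      by (rule Lp_closed_range[OF p(2) eH _ D c]) (auto intro: toep_diff[OF p(2) eL(2)] Hp_Lp)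
  next
    fix f assume f: "f \<in> Hp p" "\<And>m. m \<in> toep ?e ` Hp q \<Longrightarrow> pairing m f = 0"
    have "?E f = 0"
    proof (rule Hp_annihilator_0[OF qp])
      show "?E f \<in> Hp p" using f by (intro toep_Hp p eL Hp_Lp)
      show "pairing h (?E f) = 0" if "h \<in> Hp q" for h
        using f(2)[of "toep ?e h"] adj[OF f(1) that] that pairing_cnj by (metis imageI complex_cnj_zero)
    qed
    thus "f = 0" using bij(1) f(1) by (auto simp: ker_op_def)
  qed
  have ck: "coker_op q (toep (conj_fun d)) = ker_op p (toep d)"
    using coker_toep[OF qp, of "conj_fun d"] dL(1) by simp
  show "ind q (toep (conj_fun d)) = - int k" by (simp add: ind_def ck pos)
  have cdL: "conj_fun d \<in> Linf" using dL by simp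
  have tL: "tvar powi (- int k) \<in> Linf" by simp
  obtain D1 where D1: "\<And>f. f \<in> Lp q \<Longrightarrow> Lp_norm q (toep (conj_fun d) f) \<le> D1 * Lp_norm q f"
    using toep_bound[OF p(2) cdL] by blast
  obtain D2 where D2: "D2 \<ge> 0" "\<And>f. f \<in> Lp q \<Longrightarrow> Lp_norm q (toep (tvar powi (- int k)) f) \<le> D2 * Lp_norm q f"
    using toep_bound[OF p(2) tL] by blast
  have dH: "toep (conj_fun d) h \<in> Hp q" if "h \<in> Hp q" for h using that by (intro toep_Hp p cdL Hp_Lp)
  have "Lp_closed q (toep (conj_fun d) ` Hp q)"
  proof (rule Lp_closed_range[OF p(2) dH])
    show "c * D2 \<ge> 0" using c D2 by simp
    show "Lp_norm q f \<le> c * D2 * Lp_norm q (toep (conj_fun d) f)" if f: "f \<in> Hp q" for f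
    proof -
      \<comment> \<open>t^-k is antianalytic, so the lower bound for T(cnj d t^-k) descends to T(cnj
        d).\<close>
      have "toep (tvar powi (- int k)) (toep (conj_fun d) f) = toep ?e f"
      proof -
        have "conj_fun (tvar powi (- int k)) \<in> Hinf"
          unfolding conj_tvar_powi minus_minus by (rule Hinf_tvar_powi) simp
        from toep_mult_anti[OF p(2) this cdL Hp_Lp[OF f]] show ?thesis by (simp add: mult.commute)
      qed
      hence "Lp_norm q (toep ?e f) \<le> D2 * Lp_norm q (toep (conj_fun d) f)"
        using D2(2)[OF Hp_Lp[OF dH[OF f]]] by simp
      hence "c * Lp_norm q (toep ?e f) \<le> c * (D2 * Lp_norm q (toep (conj_fun d) f))"
        using c by (intro mult_left_mono)
      thus ?thesis using c(2)[OF f] by simp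
    qed
  qed (auto intro: toep_diff[OF p(2) cdL] Hp_Lp D1)
  hence "closed_range q (toep (conj_fun d))"
    unfolding Lp_closed_def closed_range_def using Hp_Lp by blast
  moreover have "fin_dim {0}" unfolding fin_dim_def by (rule exI[of _ "{}"]) auto
  ultimately show "fredholm q (toep (conj_fun d))"
    using fin by (simp add: fredholm_def ck pos)
qed

section \<open>The shift\<close>

locale alpha_shift =
  fixes \<beta> :: complex
  assumes \<beta>: "1 < cmod \<beta>"
begin

abbreviation "\<xi> \<equiv> chi \<beta>"
abbreviation "cpa \<equiv> comp_alpha \<beta>"
abbreviation "J \<equiv> J_alpha \<beta>"
abbreviation "L \<equiv> lam \<beta>"

lemma \<beta>_nz: "\<beta> \<noteq> 0" "cnj \<beta> \<noteq> 0"
  using \<beta> by auto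

text \<open>\<open>L\<close> is imaginary; the sign of its square is the one that gives \<chi>
  \<chi>_\<alpha> = 1 in \<open>cpa_chi\<close>.\<close>

lemma L_sq: "L * L = 1 - cnj \<beta> * \<beta>"
proof -
  have "(cmod \<beta>)\<^sup>2 - 1 \<ge> 0" using \<beta> by simp
  hence "sqrt ((cmod \<beta>)\<^sup>2 - 1) * sqrt ((cmod \<beta>)\<^sup>2 - 1) = (cmod \<beta>)\<^sup>2 - 1" by (rule real_sqrt_mult_self[THEN trans, OF abs_of_nonneg])
  moreover have "L * L = (\<i> * \<i>) * complex_of_real (sqrt ((cmod \<beta>)\<^sup>2 - 1) * sqrt ((cmod \<beta>)\<^sup>2 - 1))"
    unfolding lam_def of_real_mult by (simp only: mult_ac)
  ultimately have "L * L = - complex_of_real ((cmod \<beta>)\<^sup>2 - 1)" by (simp only:) simp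
  also have "\<dots> = 1 - cnj \<beta> * \<beta>"
    by (simp only: of_real_diff complex_norm_square of_real_1) (simp add: mult.commute)
  finally show ?thesis .
qed

lemma L_nz: "L \<noteq> 0"
proof -
  have "(cmod \<beta>)\<^sup>2 > 1" using \<beta> by (simp add: one_less_power)
  thus ?thesis by (simp add: lam_def)
qed

lemma cnj_L: "cnj L = - L"
  by (simp add: lam_def)

section \<open>Composition with the shift\<close>

lemma ev_cpa: "AE t in circle. ev (cpa f) t = ev f (alpha \<beta> t)"
proof -
  have "ev f \<circ> alpha \<beta> \<in> borel_measurable borel"
    by (rule measurable_comp[OF alpha_measurable]) simp
  from ev_abs_AE[OF this] show ?thesis by (simp add: comp_alpha_def)
qed

lemma AE_alpha: "(AE t in circle. P t) \<Longrightarrow> Measurable.pred borel P \<Longrightarrow> AE t in circle. P (alpha \<beta> t)"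
  using AE_circle_alpha[OF \<beta>] by blast

lemma cpa_mult: "cpa (f * g) = cpa f * cpa g"
proof (rule circfun_eqI)
  have "AE t in circle. ev (f * g) (alpha \<beta> t) = ev f (alpha \<beta> t) * ev g (alpha \<beta> t)"
    by (rule AE_alpha[OF ev_mult]) measurable
  thus "AE t in circle. ev (cpa (f * g)) t = ev (cpa f * cpa g) t"
    using ev_cpa[of f] ev_cpa[of g] ev_cpa[of "f * g"] ev_mult[of "cpa f" "cpa g"] by eventually_elim simp
qed

lemma cpa_add: "cpa (f + g) = cpa f + cpa g"
proof (rule circfun_eqI)
  have "AE t in circle. ev (f + g) (alpha \<beta> t) = ev f (alpha \<beta> t) + ev g (alpha \<beta> t)"
    by (rule AE_alpha[OF ev_plus]) measurable
  thus "AE t in circle. ev (cpa (f + g)) t = ev (cpa f + cpa g) t"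
    using ev_cpa[of f] ev_cpa[of g] ev_cpa[of "f + g"] ev_plus[of "cpa f" "cpa g"] by eventually_elim simp
qed

lemma cpa_cscale: "cpa (cscale z f) = cscale z (cpa f)"
proof (rule circfun_eqI)
  have "AE t in circle. ev (cscale z f) (alpha \<beta> t) = z * ev f (alpha \<beta> t)"
    by (rule AE_alpha[OF ev_cscale]) measurable
  thus "AE t in circle. ev (cpa (cscale z f)) t = ev (cscale z (cpa f)) t"
    using ev_cpa[of f] ev_cpa[of "cscale z f"] ev_cscale[of z "cpa f"] by eventually_elim simp
qed

lemma cpa_inverse: "cpa (inverse f) = inverse (cpa f)"
proof (rule circfun_eqI)
  have "AE t in circle. ev (inverse f) (alpha \<beta> t) = inverse (ev f (alpha \<beta> t))"
    by (rule AE_alpha[OF ev_inverse]) measurable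
  thus "AE t in circle. ev (cpa (inverse f)) t = ev (inverse (cpa f)) t"
    using ev_cpa[of f] ev_cpa[of "inverse f"] ev_inverse[of "cpa f"] by eventually_elim simp
qed

lemma cpa_conj: "cpa (conj_fun f) = conj_fun (cpa f)"
proof (rule circfun_eqI)
  have "AE t in circle. ev (conj_fun f) (alpha \<beta> t) = cnj (ev f (alpha \<beta> t))"
    by (rule AE_alpha[OF ev_conj]) measurable
  thus "AE t in circle. ev (cpa (conj_fun f)) t = ev (conj_fun (cpa f)) t"
    using ev_cpa[of f] ev_cpa[of "conj_fun f"] ev_conj[of "cpa f"] by eventually_elim simp
qed

lemma cpa_1 [simp]: "cpa 1 = 1"
proof (rule circfun_eqI)
  have "AE t in circle. ev 1 (alpha \<beta> t) = 1"
    by (rule AE_alpha[OF ev_1]) measurable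
  thus "AE t in circle. ev (cpa 1) t = ev 1 t"
    using ev_cpa[of 1] ev_1 by eventually_elim simp
qed

lemma cpa_0 [simp]: "cpa 0 = 0"
  using cpa_cscale[of 0 0] by simp

lemma cpa_diff: "cpa (f - g) = cpa f - cpa g"
  using cpa_add[of f "cscale (-1) g"] cpa_cscale[of "-1" g] by (simp add: cscale_m1)

lemma cpa_power: "cpa (f ^ n) = cpa f ^ n"
  by (induction n) (auto simp: cpa_mult)

lemma cpa_powi: "cpa (f powi n) = cpa f powi n"
  by (auto simp: power_int_def cpa_power cpa_inverse)

lemma cpa_cpa [simp]: "cpa (cpa f) = f"
proof (rule circfun_eqI)
  have [measurable]: "(\<lambda>t. ev f (alpha \<beta> t)) \<in> borel_measurable borel"
    by (rule measurable_compose[OF alpha_measurable]) simp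
  have "AE t in circle. ev (cpa f) (alpha \<beta> t) = ev f (alpha \<beta> (alpha \<beta> t))"
    by (rule AE_alpha[OF ev_cpa]) measurable
  thus "AE t in circle. ev (cpa (cpa f)) t = ev f t"
    using ev_cpa[of "cpa f"] AE_circle_norm
    by eventually_elim (simp add: alpha_on_circle(3)[OF \<beta>])
qed

section \<open>The function \<chi> and its relatives in the disc\<close>

lemma ev_chi: "AE t in circle. ev \<xi> t = (cnj \<beta> * t - 1) / L"
  unfolding chi_def by (simp add: ev_abs_AE)

lemma chi_nz: "cmod t = 1 \<Longrightarrow> cnj \<beta> * t - 1 \<noteq> 0"
  using alpha_on_circle(1)[OF \<beta>] by simp

lemma chi_inverse: "\<xi> * inverse \<xi> = 1"
  unfolding circ_nz_iff using ev_chi AE_circle_norm by eventually_elim (auto simp: L_nz alpha_on_circle(1)[OF \<beta>])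

lemma chi_eq: "\<xi> = cscale (cnj \<beta> / L) (tvar powi 1) - cscale (1 / L) 1"
proof (rule circfun_eqI)
  show "AE t in circle. ev \<xi> t = ev (cscale (cnj \<beta> / L) (tvar powi 1) - cscale (1 / L) 1) t"
    using ev_chi ev_minus[of "cscale (cnj \<beta> / L) (tvar powi 1)" "cscale (1 / L) 1"] ev_1
      ev_cscale[of "cnj \<beta> / L" "tvar powi 1"] ev_cscale[of "1 / L" 1] ev_tvar_powi[of 1]
    by eventually_elim (simp add: diff_divide_distrib)
qed

lemma chi_TP: "\<xi> \<in> TP"
  unfolding chi_eq by (intro TP_diff TP_cscale TP_powi TP_1)

lemma fourier_chi: "fourier \<xi> n = (if n = 1 then cnj \<beta> / L else if n = 0 then - 1 / L else 0)"
  unfolding chi_eq using fourier_tvar_powi[of 0 n] fourier_tvar_powi[of 1 n]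
  by (subst fourier_diff) (auto simp: fourier_cscale intro!: cscale_in_Lp Linf_in_Lp[OF tvar_Linf])

lemma chi_Hinf: "\<xi> \<in> Hinf"
  using TP_Linf[OF chi_TP] by (simp add: Hinf_def fourier_chi)

lemma chi_Linf [simp]: "\<xi> \<in> Linf"
  by (rule TP_Linf[OF chi_TP])

lemma inverse_chi_Linf [simp]: "inverse \<xi> \<in> Linf"
proof -
  have "AE t in circle. cmod (ev (inverse \<xi>) t) \<le> cmod L / (cmod \<beta> - 1)"
    using ev_inverse[of \<xi>] ev_chi AE_circle_norm
  proof eventually_elim
    case (elim t)
    have "cmod \<beta> - 1 \<le> cmod (cnj \<beta> * t - 1)"
      using norm_triangle_ineq2[of "cnj \<beta> * t" 1] elim by (simp add: norm_mult)
    hence "cmod L / cmod (cnj \<beta> * t - 1) \<le> cmod L / (cmod \<beta> - 1)"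
      using \<beta> by (intro divide_left_mono) (auto intro!: mult_pos_pos simp: less_le_trans[of 0 "cmod \<beta> - 1"])
    thus ?case using elim by (simp add: norm_divide)
  qed
  thus ?thesis by (auto simp: Linf_iff)
qed

lemma cpa_chi: "cpa \<xi> = inverse \<xi>"
proof (rule circfun_eqI)
  have "AE t in circle. ev \<xi> (alpha \<beta> t) = (cnj \<beta> * alpha \<beta> t - 1) / L"
    by (rule AE_alpha[OF ev_chi]) measurable
  thus "AE t in circle. ev (cpa \<xi>) t = ev (inverse \<xi>) t"
    using ev_cpa[of \<xi>] ev_inverse[of \<xi>] ev_chi AE_circle_norm
  proof eventually_elim
    case (elim t)
    have d: "cnj \<beta> * t - 1 \<noteq> 0" using chi_nz elim by simp
    have "cnj \<beta> * alpha \<beta> t - 1 = (1 - cnj \<beta> * \<beta>) / (cnj \<beta> * t - 1)"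
      using d by (simp add: alpha_def divide_simps) (simp add: algebra_simps)
    also have "\<dots> = L * L / (cnj \<beta> * t - 1)" by (simp only: L_sq)
    finally have "ev (cpa \<xi>) t = (L * L / (cnj \<beta> * t - 1)) / L" using elim by simp
    moreover have "ev (inverse \<xi>) t = L / (cnj \<beta> * t - 1)" using elim by simp
    ultimately show ?case using L_nz by simp
  qed
qed

text \<open>On the circle this is - L t / (\<beta> - t), analytic in the disc because |\<beta>| > 1,
  with a simple zero at the origin.\<close>

definition "hh = conj_fun (inverse \<xi>)"

text \<open>The class of \<alpha> itself. As \<alpha> maps the disc to its exterior, the conjugate
  extends analytically.\<close>

definition "aa = cpa tvar"

lemma conj_chi: "tvar * conj_fun \<xi> = cscale (1 / L) (tvar powi 1) - cscale (\<beta> / L) 1"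
proof (rule circfun_eqI)
  show "AE t in circle. ev (tvar * conj_fun \<xi>) t = ev (cscale (1 / L) (tvar powi 1) - cscale (\<beta> / L) 1) t"
    using ev_chi ev_minus[of "cscale (1 / L) (tvar powi 1)" "cscale (\<beta> / L) 1"] ev_1
      ev_cscale[of "1 / L" "tvar powi 1"] ev_cscale[of "\<beta> / L" 1] ev_tvar_powi[of 1]
      ev_mult[of tvar "conj_fun \<xi>"] ev_conj[of \<xi>] ev_tvar AE_circle_norm
  proof eventually_elim
    case (elim t)
    have t: "cnj t = inverse t" "t \<noteq> 0" using elim by (auto simp: cnj_unit)
    have "ev (tvar * conj_fun \<xi>) t = t * cnj ((cnj \<beta> * t - 1) / L)" using elim by simp
    also have "\<dots> = t * (\<beta> * inverse t - 1) / (- L)" by (simp add: t(1) cnj_L)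
    also have "t * (\<beta> * inverse t - 1) = \<beta> - t" using t(2) by (simp add: field_simps)
    also have "(\<beta> - t) / (- L) = 1 / L * t - \<beta> / L * 1" by (simp add: diff_divide_distrib)
    finally show ?case using elim by simp
  qed
qed

lemma aa_eq: "aa = tvar * conj_fun \<xi> * inverse \<xi>"
proof (rule circfun_eqI)
  have "AE t in circle. ev tvar (alpha \<beta> t) = alpha \<beta> t"
    by (rule AE_alpha[OF ev_tvar]) measurable
  thus "AE t in circle. ev aa t = ev (tvar * conj_fun \<xi> * inverse \<xi>) t"
    unfolding aa_def
    using ev_cpa[of tvar] ev_chi ev_mult[of "tvar * conj_fun \<xi>" "inverse \<xi>"] ev_inverse[of \<xi>]
      ev_mult[of tvar "conj_fun \<xi>"] ev_conj[of \<xi>] ev_tvar AE_circle_norm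
  proof eventually_elim
    case (elim t)
    have t: "cnj t = inverse t" "t \<noteq> 0" using elim by (auto simp: cnj_unit)
    have d: "cnj \<beta> * t - 1 \<noteq> 0" using chi_nz elim by simp
    have "ev (tvar * conj_fun \<xi> * inverse \<xi>) t = t * (cnj ((cnj \<beta> * t - 1) / L)) * inverse ((cnj \<beta> * t - 1) / L)"
      using elim by simp
    also have "\<dots> = t * (\<beta> * inverse t - 1) / (- L) * (L / (cnj \<beta> * t - 1))"
      by (simp add: t(1) cnj_L)
    also have "\<dots> = - (t * (\<beta> * inverse t - 1)) / (cnj \<beta> * t - 1)"
      using L_nz by simp
    also have "t * (\<beta> * inverse t - 1) = \<beta> - t" using t(2) by (simp add: field_simps)
    finally show ?case using elim by (simp add: alpha_def)
  qed
qed

lemma hh_chi: "hh * conj_fun \<xi> = 1"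
  using arg_cong[OF chi_inverse, of conj_fun] by (simp add: hh_def conj_simps mult.commute)

lemma hh_Linf [simp]: "hh \<in> Linf"
  by (simp add: hh_def)

lemma mult_tvar_Lp1: "f \<in> Lp 1 \<Longrightarrow> f * tvar \<in> Lp 1"
  using Linf_mult_in_Lp[OF tvar_Linf, of f 1] by (simp add: mult.commute)

text \<open>Compare coefficients in hh (t cnj \<chi>) = t, where t cnj \<chi> is a polynomial of
  degree one.\<close>

lemma hh_rec: "fourier hh (n - 1) - \<beta> * fourier hh n = (if n = 1 then L else 0)"
proof -
  have hL: "hh \<in> Lp 1" by (rule Linf_in_Lp) auto
  have "hh * (tvar * conj_fun \<xi>) = tvar" using hh_chi by (simp add: mult_ac)
  hence "fourier (hh * (tvar * conj_fun \<xi>)) n = (if n = 1 then 1 else 0)"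
    using fourier_tvar_powi[of 1 n] by simp
  moreover have "hh * (tvar * conj_fun \<xi>) = cscale (1 / L) (hh * tvar powi 1) - cscale (\<beta> / L) hh"
    unfolding conj_chi by (simp add: right_diff_distrib cscale_mult_right)
  moreover have "fourier (cscale (1 / L) (hh * tvar powi 1) - cscale (\<beta> / L) hh) n
      = 1 / L * fourier hh (n - 1) - \<beta> / L * fourier hh n"
    using hL mult_tvar_Lp1[OF hL]
    by (subst fourier_diff) (auto simp: fourier_cscale fourier_shift[of hh 1, simplified] intro!: cscale_in_Lp)
  ultimately have "1 / L * fourier hh (n - 1) - \<beta> / L * fourier hh n = (if n = 1 then 1 else 0)" by simp
  hence "L * (1 / L * fourier hh (n - 1) - \<beta> / L * fourier hh n) = L * (if n = 1 then 1 else 0)" by simp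
  thus ?thesis using L_nz by (simp add: right_diff_distrib split: if_splits)
qed

text \<open>The recursion forces geometric growth towards \<open>-\<infinity>\<close>, so boundedness kills the coefficients.\<close>

lemma fourier_hh_nonpos: "n \<le> 0 \<Longrightarrow> fourier hh n = 0"
proof -
  have hL: "hh \<in> Lp 1" by (rule Linf_in_Lp) auto
  have e: "fourier hh (- int k) = \<beta> ^ k * fourier hh 0" for k
  proof (induction k)
    case (Suc k)
    have "fourier hh (- int k - 1) = \<beta> * fourier hh (- int k)" using hh_rec[of "- int k"] by simp
    moreover have "- int k - 1 = - int (Suc k)" by simp
    ultimately show ?case using Suc by simp
  qed simp
  have "fourier hh 0 = 0"
  proof (rule ccontr)
    assume nz: "fourier hh 0 \<noteq> 0"
    obtain k where k: "Lp_norm 1 hh / cmod (fourier hh 0) < cmod \<beta> ^ k" using real_arch_pow[OF \<beta>] by blast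
    hence "Lp_norm 1 hh < cmod (fourier hh (- int k))" using nz by (simp add: e norm_mult norm_power field_simps)
    thus False using fourier_bound[OF hL, of "- int k"] by simp
  qed
  thus "n \<le> 0 \<Longrightarrow> fourier hh n = 0" using e[of "nat (- n)"] by simp
qed

lemma fourier_hh_pos: "fourier hh (int (Suc n)) = - L / \<beta> ^ Suc n"
proof (induction n)
  case 0
  have "- (\<beta> * fourier hh 1) = L" using hh_rec[of 1] fourier_hh_nonpos[of 0] by simp
  hence "\<beta> * fourier hh 1 = - L" by (metis minus_minus)
  thus ?case using \<beta>_nz by (simp add: field_simps)
next
  case (Suc n)
  have "fourier hh (int (Suc n)) = \<beta> * fourier hh (int (Suc (Suc n)))"
    using hh_rec[of "int (Suc (Suc n))"] by simp
  thus ?case using Suc \<beta>_nz by (simp add: field_simps del: of_nat_Suc)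
qed

lemma hh_Hinf: "hh \<in> Hinf"
  by (simp add: Hinf_def fourier_hh_nonpos)

text \<open>\<open>hh\<close> with its zero divided out: - L / (\<beta> - t) on the circle, an
  analytic function without zeros in the disc, whose conjugate is t \<chi>^-1.\<close>

definition "om = hh * tvar powi (- 1)"

lemma om_Hinf: "om \<in> Hinf"
  using Linf_mult[of hh "tvar powi (-1)"] by (simp add: om_def Hinf_def fourier_shift fourier_hh_nonpos del: power_int_minus1_right)

lemma fourier_om_0: "fourier om 0 = - L / \<beta>"
  using fourier_hh_pos[of 0] by (simp add: om_def fourier_shift del: power_int_minus1_right)

lemma conj_om: "conj_fun om = tvar * inverse \<xi>"
  by (simp add: om_def hh_def conj_simps mult.commute del: power_int_minus1_right)

lemma conj_aa: "conj_fun aa = om * \<xi>"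
  unfolding aa_eq om_def hh_def by (simp add: conj_simps mult_ac)

lemma conj_aa_Hinf: "conj_fun aa \<in> Hinf"
  unfolding conj_aa by (intro Hinf_mult om_Hinf chi_Hinf)

lemma fourier_Hinf_mult_0: "f \<in> Hinf \<Longrightarrow> g \<in> Hinf \<Longrightarrow> fourier (f * g) 0 = fourier f 0 * fourier g 0"
  using Hp_Hq_mult(3)[of 2 2 f g 0] Hinf_Hp[of f 2] Hinf_Hp[of g 2]
  by (auto simp: conj_exps_def Hp_def)

lemma fourier_Hinf_power_0: "f \<in> Hinf \<Longrightarrow> fourier (f ^ n) 0 = fourier f 0 ^ n"
  using fourier_tvar_powi[of 0 0] by (induction n) (auto simp: fourier_Hinf_mult_0 Hinf_power)

lemma fourier_conj_aa: "fourier (conj_fun aa) 0 = 1 / \<beta>"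
  unfolding conj_aa using L_nz \<beta>_nz by (simp add: fourier_Hinf_mult_0 om_Hinf chi_Hinf fourier_om_0 fourier_chi)

text \<open>The Jacobian of \<open>\<alpha>\<close> on the circle.\<close>

definition "ww = inverse \<xi> * hh"

text \<open>Partial fractions: an antianalytic and an analytic term, from which the coefficients can
  be read off.\<close>

lemma ww_eq: "ww = cscale (1 / L) (inverse \<xi>) - cscale (\<beta> / L) om"
proof (rule circfun_eqI)
  show "AE t in circle. ev ww t = ev (cscale (1 / L) (inverse \<xi>) - cscale (\<beta> / L) om) t"
    unfolding ww_def
    using ev_minus[of "cscale (1 / L) (inverse \<xi>)" "cscale (\<beta> / L) om"] ev_cscale[of "1 / L" "inverse \<xi>"]
      ev_cscale[of "\<beta> / L" om] ev_mult[of "inverse \<xi>" hh] ev_inverse[of \<xi>] ev_chi AE_circle_norm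
      ev_mult[of hh "tvar powi (- 1)"] ev_tvar_powi[of "-1"] ev_conj[of "inverse \<xi>"]
    unfolding om_def[symmetric] hh_def[symmetric]
  proof eventually_elim
    case (elim t)
    have t: "cnj t = inverse t" "t \<noteq> 0" using elim by (auto simp: cnj_unit)
    have d: "cnj \<beta> * t - 1 \<noteq> 0" using chi_nz elim by simp
    have d': "\<beta> * inverse t - 1 \<noteq> 0" using arg_cong[of _ _ cnj] d t by (metis complex_cnj_zero complex_cnj_diff complex_cnj_mult complex_cnj_cnj complex_cnj_one)
    hence d2: "\<beta> - t \<noteq> 0" using t(2) by (auto simp: field_simps)
    have c: "ev (inverse \<xi>) t = L / (cnj \<beta> * t - 1)" using elim by (simp add: field_simps)
    have h: "ev hh t = - L / (\<beta> * inverse t - 1)" using elim c by (simp add: cnj_L t(1))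
    have h': "ev hh t = - L * t / (\<beta> - t)" unfolding h using t(2) d' d2 by (simp add: field_simps)
    have "ev (inverse \<xi> * hh) t = L / (cnj \<beta> * t - 1) * (- L * t / (\<beta> - t))" using elim c h' by simp
    also have "\<dots> = - (1 - cnj \<beta> * \<beta>) * t / ((cnj \<beta> * t - 1) * (\<beta> - t))"
      unfolding L_sq[symmetric] by simp
    also have "\<dots> = 1 / (cnj \<beta> * t - 1) + \<beta> / (\<beta> - t)"
      using d d2 by (simp add: divide_simps) (simp add: algebra_simps)
    also have "\<dots> = 1 / L * ev (inverse \<xi>) t - \<beta> / L * (ev hh t * inverse t)"
      unfolding c h' using L_nz t(2) by (simp add: field_simps)
    finally show ?case using elim by (simp add: power_int_minus)
  qed
qed

lemma fourier_ww_pos: "fourier (tvar powi int n * ww) 0 = cnj (1 / \<beta> ^ n)"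
proof -
  have i: "inverse \<xi> \<in> Lp 1" "om \<in> Lp 1" using om_Hinf by (auto intro!: Linf_in_Lp simp: Hinf_def)
  have w: "ww \<in> Lp 1" unfolding ww_def by (intro Linf_in_Lp Linf_mult) auto
  have "fourier (tvar powi int n * ww) 0 = fourier ww (- int n)"
    using fourier_shift[of ww "int n" 0] by (simp add: mult.commute)
  also have "\<dots> = 1 / L * fourier (inverse \<xi>) (- int n) - \<beta> / L * fourier om (- int n)"
    unfolding ww_eq using i by (subst fourier_diff) (auto simp: fourier_cscale intro!: cscale_in_Lp)
  also have "fourier (inverse \<xi>) (- int n) = cnj (fourier hh (int n))"
    unfolding hh_def fourier_conj by simp
  also have "fourier om (- int n) = fourier hh (1 - int n)"
    by (simp add: om_def fourier_shift del: power_int_minus1_right)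
  also have "1 / L * cnj (fourier hh (int n)) - \<beta> / L * fourier hh (1 - int n) = cnj (1 / \<beta> ^ n)"
  proof (cases n)
    case 0
    thus ?thesis using fourier_hh_pos[of 0] fourier_hh_nonpos[of 0] L_nz \<beta>_nz by simp
  next
    case (Suc k)
    hence "fourier hh (1 - int n) = 0" by (intro fourier_hh_nonpos) simp
    thus ?thesis using fourier_hh_pos[of k] L_nz unfolding Suc by (simp add: cnj_L del: of_nat_Suc)
  qed
  finally show ?thesis .
qed

lemma conj_ww: "conj_fun ww = ww"
  by (simp add: ww_def hh_def conj_simps mult.commute)

lemma ww_Linf [simp]: "ww \<in> Linf"
  unfolding ww_def by (intro Linf_mult) auto

text \<open>The change of variables for monomials, by computing both sides: cnj \<alpha> is bounded
  analytic with mean 1 / \<beta>, and means of such functions multiply.\<close>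

lemma fourier_cpa_tvar_powi: "fourier (cpa (tvar powi n)) 0 = fourier (tvar powi n * ww) 0"
proof -
  have pos: "fourier (cpa (tvar powi int n)) 0 = fourier (tvar powi int n * ww) 0" for n
  proof -
    have "conj_fun (cpa (tvar powi int n)) = conj_fun aa ^ n"
      by (simp add: cpa_power aa_def conj_simps)
    hence "fourier (conj_fun (cpa (tvar powi int n))) 0 = (1 / \<beta>) ^ n"
      using fourier_Hinf_power_0[OF conj_aa_Hinf] fourier_conj_aa by simp
    hence "cnj (fourier (cpa (tvar powi int n)) 0) = 1 / \<beta> ^ n" by (simp only: fourier_conj minus_zero power_one_over)
    hence "fourier (cpa (tvar powi int n)) 0 = cnj (1 / \<beta> ^ n)" by (metis complex_cnj_cnj)
    thus ?thesis by (simp only: fourier_ww_pos)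
  qed
  show ?thesis
  proof (cases "n \<ge> 0")
    case True thus ?thesis using pos[of "nat n"] by simp
  next
    case False
    define k where "k = nat (- n)"
    have n: "tvar powi n = conj_fun (tvar powi int k)" using False by (simp only: conj_tvar_powi k_def) simp
    have "conj_fun (tvar powi int k) * ww = conj_fun (tvar powi int k * ww)"
      by (simp only: conj_fun_mult conj_ww)
    thus ?thesis unfolding n cpa_conj using pos[of k] by (simp only: fourier_conj minus_zero)
  qed
qed

lemma cpa_Linf: "f \<in> Linf \<Longrightarrow> cpa f \<in> Linf"
proof -
  assume "f \<in> Linf"
  then obtain C where C: "AE t in circle. cmod (ev f t) \<le> C" by (auto simp: Linf_iff)
  have "AE t in circle. cmod (ev f (alpha \<beta> t)) \<le> C" by (rule AE_alpha[OF C]) measurable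
  hence "AE t in circle. cmod (ev (cpa f) t) \<le> C" using ev_cpa[of f] by eventually_elim simp
  thus "cpa f \<in> Linf" by (auto simp: Linf_iff)
qed

lemma fourier_cpa_TP: "w \<in> TP \<Longrightarrow> fourier (cpa w) 0 = fourier (w * ww) 0"
proof (induction rule: TP_induct)
  case (step z k g)
  have gl: "cpa g \<in> Lp 1" "cpa (tvar powi k) \<in> Lp 1" "g * ww \<in> Lp 1" "tvar powi k * ww \<in> Lp 1"
    using TP_Linf[OF step(1)] by (auto intro!: Linf_in_Lp cpa_Linf Linf_mult)
  show ?case using step gl
    by (simp add: cpa_add cpa_cscale distrib_right cscale_mult_left fourier_add cscale_in_Lp fourier_cscale fourier_cpa_tvar_powi)
qed simp

text \<open>A pointwise version of \<open>ww\<close>, the function |\<chi>|^-2; a measure density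
  has to be an actual real function.\<close>

definition "wt t = (cmod L)\<^sup>2 / (cmod (cnj \<beta> * t - 1))\<^sup>2"

lemma wt_measurable [measurable]: "wt \<in> borel_measurable borel"
  unfolding wt_def by measurable

lemma wt_nonneg: "wt t \<ge> 0"
  by (simp add: wt_def)

lemma ev_ww: "AE t in circle. ev ww t = of_real (wt t)"
  unfolding ww_def
  using ev_mult[of "inverse \<xi>" hh] ev_inverse[of \<xi>] ev_chi ev_conj[of "inverse \<xi>"]
  unfolding hh_def[symmetric]
proof eventually_elim
  case (elim t)
  have "ev (inverse \<xi> * hh) t = L / (cnj \<beta> * t - 1) * cnj (L / (cnj \<beta> * t - 1))"
    using elim by (simp only: inverse_divide)
  also have "\<dots> = of_real ((cmod (L / (cnj \<beta> * t - 1)))\<^sup>2)" by (simp only: complex_norm_square)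
  also have "\<dots> = of_real (wt t)" by (simp add: wt_def norm_divide power_divide)
  finally show ?case .
qed

lemma alpha_continuous: "continuous_on (sphere 0 1) (alpha \<beta>)"
  unfolding alpha_def using chi_nz by (intro continuous_intros) auto

lemma alpha_sphere: "cmod t = 1 \<Longrightarrow> cmod (alpha \<beta> t) = 1"
  using alpha_on_circle(2)[OF \<beta>] .

lemma wt_continuous: "continuous_on (sphere 0 1) wt"
  unfolding wt_def using chi_nz by (intro continuous_intros) auto

text \<open>The identity for trigonometric polynomials extends by uniform approximation, as the
  weight has finite total mass.\<close>

lemma cov_continuous:
  fixes u :: "complex \<Rightarrow> real"
  assumes u: "continuous_on (sphere 0 1) u" and um [measurable]: "u \<in> borel_measurable borel"
  shows "(LINT t|circle. u (alpha \<beta> t)) = (LINT t|circle. u t * wt t)"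
proof -
  note [measurable] = alpha_measurable
  have i1: "integrable circle (\<lambda>t. u (alpha \<beta> t))"
    by (rule circle_integrable_continuous) (auto intro!: continuous_on_compose2[OF u alpha_continuous] simp: alpha_sphere)
  have i2: "integrable circle (\<lambda>t. u t * wt t)"
    by (rule circle_integrable_continuous) (auto intro!: continuous_intros u wt_continuous)
  have i3: "integrable circle wt"
    by (rule circle_integrable_continuous) (auto intro!: wt_continuous)
  define D where "D = (LINT t|circle. u (alpha \<beta> t)) - (LINT t|circle. u t * wt t)"
  define W where "W = (LINT t|circle. wt t)"
  have W0: "W \<ge> 0" unfolding W_def by (simp add: wt_nonneg)
  have "\<bar>D\<bar> \<le> 0 + e" if e: "e > 0" for e
  proof -
    \<comment> \<open>The left side changes by at most \<delta>, the right side by at most \<delta>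
      W.\<close>
    define \<delta> where "\<delta> = e / (1 + W)"
    have \<delta>: "\<delta> > 0" using e W0 by (simp add: \<delta>_def add_pos_nonneg)
    obtain w r where w: "w \<in> TP" "\<And>t. cmod t = 1 \<Longrightarrow> \<bar>u t - r t\<bar> < \<delta>"
      "AE t in circle. ev w t = complex_of_real (r t)" and rm [measurable]: "r \<in> borel_measurable borel"
      using TP_approx_real[OF u \<delta>] by blast
    have ra: "AE t in circle. ev (cpa w) t = of_real (r (alpha \<beta> t))"
    proof -
      have "AE t in circle. ev w (alpha \<beta> t) = of_real (r (alpha \<beta> t))" by (rule AE_alpha[OF w(3)]) measurable
      thus ?thesis using ev_cpa[of w] by eventually_elim simp
    qed
    have wL: "cpa w \<in> Lp 1" "w * ww \<in> Lp 1" using TP_Linf[OF w(1)] by (auto intro!: Linf_in_Lp cpa_Linf Linf_mult)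
    have rw: "AE t in circle. ev (w * ww) t = of_real (r t * wt t)"
      using w(3) ev_mult[of w ww] ev_ww by eventually_elim simp
    have j1: "integrable circle (\<lambda>t. r (alpha \<beta> t))"
    proof -
      have "integrable circle (\<lambda>t. complex_of_real (r (alpha \<beta> t)))"
        using wL(1)[unfolded Lp_1_iff] ra by (subst ev_integrable_cong[where G = "ev (cpa w)"]) (auto elim!: eventually_mono)
      thus ?thesis by (simp add: complex_of_real_integrable_eq)
    qed
    have j2: "integrable circle (\<lambda>t. r t * wt t)"
    proof -
      have "integrable circle (\<lambda>t. complex_of_real (r t * wt t))"
        using wL(2)[unfolded Lp_1_iff] rw by (subst ev_integrable_cong[where G = "ev (w * ww)"]) (auto elim!: eventually_mono)
      thus ?thesis by (simp only: complex_of_real_integrable_eq)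
    qed
    have "complex_of_real (LINT t|circle. r (alpha \<beta> t)) = fourier (cpa w) 0"
      unfolding fourier_0 integral_complex_of_real[symmetric]
      by (rule ev_integral_cong) (use ra in \<open>auto elim!: eventually_mono\<close>)
    also have "\<dots> = fourier (w * ww) 0" by (rule fourier_cpa_TP[OF w(1)])
    also have "\<dots> = complex_of_real (LINT t|circle. r t * wt t)"
      unfolding fourier_0 integral_complex_of_real[symmetric]
      by (rule ev_integral_cong) (use rw in \<open>auto elim!: eventually_mono\<close>)
    finally have eq: "(LINT t|circle. r (alpha \<beta> t)) = (LINT t|circle. r t * wt t)" by (simp only: of_real_eq_iff)
    have "D = (LINT t|circle. u (alpha \<beta> t) - r (alpha \<beta> t)) - (LINT t|circle. u t * wt t - r t * wt t)"
      unfolding D_def using i1 i2 j1 j2 eq by simp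
    hence "\<bar>D\<bar> \<le> \<bar>LINT t|circle. u (alpha \<beta> t) - r (alpha \<beta> t)\<bar> + \<bar>LINT t|circle. u t * wt t - r t * wt t\<bar>"
      by linarith
    also have "\<bar>LINT t|circle. u (alpha \<beta> t) - r (alpha \<beta> t)\<bar> \<le> (LINT t|circle. \<delta>)"
    proof (rule order_trans[OF integral_abs_bound integral_mono_AE])
      show "AE t in circle. \<bar>u (alpha \<beta> t) - r (alpha \<beta> t)\<bar> \<le> \<delta>"
        using AE_circle_norm by eventually_elim (auto intro!: less_imp_le w(2) alpha_sphere)
    qed (use i1 j1 in auto)
    also have "\<bar>LINT t|circle. u t * wt t - r t * wt t\<bar> \<le> (LINT t|circle. \<delta> * wt t)"
    proof (rule order_trans[OF integral_abs_bound integral_mono_AE])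
      show "AE t in circle. \<bar>u t * wt t - r t * wt t\<bar> \<le> \<delta> * wt t"
        using AE_circle_norm
      proof eventually_elim
        case (elim t)
        have "\<bar>u t * wt t - r t * wt t\<bar> = \<bar>u t - r t\<bar> * wt t"
          using wt_nonneg[of t] by (simp add: left_diff_distrib[symmetric] abs_mult)
        thus ?case using w(2)[OF elim] wt_nonneg[of t] by (simp add: mult_right_mono)
      qed
    qed (use i2 j2 i3 in auto)
    also have "(LINT t|circle. \<delta>) + (LINT t|circle. \<delta> * wt t) = \<delta> * (1 + W)"
      by (simp add: W_def distrib_left)
    also have "\<dots> = e" using W0 by (simp add: \<delta>_def)
    finally show ?thesis by simp
  qed
  hence "\<bar>D\<bar> \<le> 0" by (rule field_le_epsilon)
  thus ?thesis by (simp add: D_def)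
qed

text \<open>Continuous cut-offs converging to the indicator of a closed set give equality on closed
  sets, which generate the Borel sets and are stable under intersection.\<close>

lemma distr_alpha: "distr circle borel (alpha \<beta>) = density circle (\<lambda>t. ennreal (wt t))"
proof (rule measure_eqI_generator_eq[where E = "Collect closed" and \<Omega> = UNIV and A = "\<lambda>_. UNIV"])
  note [measurable] = alpha_measurable
  have sb: "sigma_sets UNIV (Collect closed) = sets (borel :: complex measure)"
    by (simp add: borel_eq_closed)
  show "sets (distr circle borel (alpha \<beta>)) = sigma_sets UNIV (Collect closed)"
    "sets (density circle (\<lambda>t. ennreal (wt t))) = sigma_sets UNIV (Collect closed)" using sb by auto
  show "Int_stable (Collect closed :: complex set set)" by (auto simp: Int_stable_def)
  show "emeasure (distr circle borel (alpha \<beta>)) UNIV \<noteq> \<infinity>" for i :: nat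
    by (subst emeasure_distr) (auto simp: circle.emeasure_eq_measure)
  fix C :: "complex set" assume "C \<in> Collect closed"
  hence C: "closed C" by simp
  have Cm [measurable]: "C \<in> sets borel" using borel_closed[OF C] .
  show "emeasure (distr circle borel (alpha \<beta>)) C = emeasure (density circle (\<lambda>t. ennreal (wt t))) C"
  proof (cases "C = {}")
    case False
    have iw: "integrable circle wt"
      by (rule circle_integrable_continuous) (auto intro!: wt_continuous)
    have l1: "(\<lambda>n. LINT t|circle. bump C n (alpha \<beta> t)) \<longlonglongrightarrow> (LINT t|circle. indicator C (alpha \<beta> t))"
      by (rule integral_dominated_convergence[where w = "\<lambda>_. 1"])
         (auto simp: bump_bounds intro!: bump_tendsto C False)
    have l2: "(\<lambda>n. LINT t|circle. bump C n t * wt t) \<longlonglongrightarrow> (LINT t|circle. indicator C t * wt t)"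
      by (rule integral_dominated_convergence[where w = wt])
         (auto simp: bump_bounds wt_nonneg iw mult_left_le_one_le intro!: tendsto_intros bump_tendsto C False)
    have "(LINT t|circle. bump C n (alpha \<beta> t)) = (LINT t|circle. bump C n t * wt t)" for n
      by (rule cov_continuous) (auto intro: bump_continuous)
    hence eq: "(LINT t|circle. indicator C (alpha \<beta> t) :: real) = (LINT t|circle. indicator C t * wt t)"
      using l1 l2 LIMSEQ_unique by auto
    have vim: "alpha \<beta> -` C \<in> sets borel"
      using measurable_sets[OF alpha_measurable Cm] by simp
    have "emeasure (distr circle borel (alpha \<beta>)) C = ennreal (measure circle (alpha \<beta> -` C))"
      by (subst emeasure_distr) (auto simp: circle.emeasure_eq_measure)
    also have "measure circle (alpha \<beta> -` C) = (LINT t|circle. indicator (alpha \<beta> -` C) t)"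
      using vim by simp
    also have "\<dots> = (LINT t|circle. indicator C (alpha \<beta> t))" by (simp add: indicator_vimage)
    also have "ennreal \<dots> = (\<integral>\<^sup>+t. ennreal (indicator C t * wt t) \<partial>circle)"
      unfolding eq
      by (rule nn_integral_eq_integral[symmetric])
         (auto simp: wt_nonneg intro!: Bochner_Integration.integrable_bound[OF iw] simp: indicator_def)
    also have "\<dots> = emeasure (density circle (\<lambda>t. ennreal (wt t))) C"
      by (subst emeasure_density) (auto simp: ennreal_mult wt_nonneg mult.commute ennreal_indicator intro!: nn_integral_cong)
    finally show ?thesis .
  qed simp
qed auto

lemma cov_integral:
  fixes F :: "complex \<Rightarrow> complex"
  assumes [measurable]: "F \<in> borel_measurable borel"
  shows "(LINT t|circle. F (alpha \<beta> t)) = (LINT t|circle. of_real (wt t) * F t)"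
proof -
  note [measurable] = alpha_measurable
  have "(LINT t|circle. F (alpha \<beta> t)) = (LINT t|distr circle borel (alpha \<beta>). F t)"
    by (subst integral_distr) auto
  also have "\<dots> = (LINT t|circle. wt t *\<^sub>R F t)"
    unfolding distr_alpha by (subst integral_density) (auto simp: wt_nonneg)
  finally show ?thesis by (simp add: scaleR_conv_of_real)
qed

lemma fourier_cpa: "fourier (cpa f) 0 = fourier (f * ww) 0"
proof -
  note [measurable] = alpha_measurable
  have "fourier (cpa f) 0 = (LINT t|circle. ev f (alpha \<beta> t))"
    unfolding fourier_0 by (rule ev_integral_cong) (use ev_cpa in auto)
  also have "\<dots> = (LINT t|circle. of_real (wt t) * ev f t)" by (rule cov_integral) simp
  also have "\<dots> = fourier (f * ww) 0"
    unfolding fourier_0 by (rule ev_integral_cong)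
      (use ev_mult[of f ww] ev_ww in \<open>eventually_elim, simp add: mult.commute\<close>, measurable)
  finally show ?thesis .
qed

lemma cpa_Lp: "f \<in> Lp p \<Longrightarrow> cpa f \<in> Lp p"
proof -
  note [measurable] = alpha_measurable
  assume "f \<in> Lp p"
  have "\<exists>B. \<forall>t\<in>sphere 0 1. norm (wt t) \<le> B"
    using compact_imp_bounded[OF compact_continuous_image[OF wt_continuous compact_sphere]]
    by (auto simp: bounded_iff)
  then obtain B where B: "\<forall>t\<in>sphere 0 1. norm (wt t) \<le> B" by blast
  have "integrable circle (\<lambda>t. B * cmod (ev f t) powr p)" using \<open>f \<in> Lp p\<close> by (simp add: Lp_iff)
  hence "integrable circle (\<lambda>t. wt t *\<^sub>R cmod (ev f t) powr p)"
  proof (rule Bochner_Integration.integrable_bound)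
    show "AE t in circle. norm (wt t *\<^sub>R cmod (ev f t) powr p) \<le> norm (B * cmod (ev f t) powr p)"
      using AE_circle_norm
    proof eventually_elim
      case (elim t)
      have "\<bar>wt t\<bar> \<le> \<bar>B\<bar>" using B elim by force
      thus ?case by (simp add: abs_mult mult_right_mono)
    qed
  qed simp
  hence "integrable (distr circle borel (alpha \<beta>)) (\<lambda>t. cmod (ev f t) powr p)"
    unfolding distr_alpha by (subst integrable_density) (auto simp: wt_nonneg)
  hence "integrable circle (\<lambda>t. cmod (ev f (alpha \<beta> t)) powr p)"
    by (subst (asm) integrable_distr_eq) auto
  thus "cpa f \<in> Lp p" unfolding Lp_iff
    by (subst ev_integrable_cong[where G = "\<lambda>t. cmod (ev f (alpha \<beta> t)) powr p"]) (use ev_cpa[of f] in \<open>auto elim!: eventually_mono\<close>)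
qed

section \<open>The involution J on the Hardy spaces\<close>

lemma J_Lp: "p > 0 \<Longrightarrow> f \<in> Lp p \<Longrightarrow> J f \<in> Lp p"
  unfolding J_alpha_def by (intro Linf_mult_in_Lp cpa_Lp) auto

lemma J_J [simp]: "J (J f) = f"
  unfolding J_alpha_def cpa_mult cpa_inverse cpa_chi cpa_cpa circ_inverse_inverse mult.assoc[symmetric]
  by (simp only: mult.commute[of "inverse \<xi>"] chi_inverse mult_1)

lemma J_mult: "J (g * f) = cpa g * J f"
  by (simp add: J_alpha_def cpa_mult mult_ac)

lemma J_add: "J (f + g) = J f + J g"
  by (simp add: J_alpha_def cpa_add distrib_left)

lemma J_diff: "J (f - g) = J f - J g"
  by (simp add: J_alpha_def cpa_diff right_diff_distrib)

lemma J_cscale: "J (cscale z f) = cscale z (J f)"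
  by (simp add: J_alpha_def cpa_cscale cscale_mult_right)

lemma J_0 [simp]: "J 0 = 0"
  by (simp add: J_alpha_def)

lemma inverse_aa: "inverse aa = conj_fun aa"
  unfolding aa_def cpa_conj[symmetric] conj_tvar cpa_inverse ..

text \<open>The change of variables moves the shift off f: every coefficient of J f becomes the mean
  of f times an explicit function.\<close>

lemma fourier_J: "fourier (J f) n = fourier (f * (hh * aa powi (- n))) 0"
proof -
  have "fourier (J f) n = fourier (J f * tvar powi (- n)) 0" using fourier_shift[of "J f" "-n" 0] by simp
  also have "J f * tvar powi (- n) = cpa (\<xi> * f * aa powi (- n))"
    by (simp add: J_alpha_def cpa_mult cpa_chi cpa_powi aa_def mult_ac)
  also have "fourier \<dots> 0 = fourier (\<xi> * f * aa powi (- n) * ww) 0" by (rule fourier_cpa)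
  also have "\<xi> * f * aa powi (- n) * ww = (\<xi> * inverse \<xi>) * (f * (hh * aa powi (- n)))"
    by (simp add: ww_def mult_ac)
  finally show ?thesis by (simp add: chi_inverse)
qed

text \<open>For n \<ge> 0 the explicit function is hh (cnj \<alpha>)^n, analytic of mean 0, since 1
  / \<alpha> = cnj \<alpha> on the circle.\<close>

lemma J_Hp:
  assumes p: "1 < p" and f: "f \<in> Hp p" and n: "n \<ge> 0"
  shows "fourier (J f) n = 0"
proof -
  define q where "q = p / (p - 1)"
  have pq: "conj_exps p q" using p by (auto simp: conj_exps_def q_def field_simps)
  define g where "g = hh * conj_fun aa ^ nat n"
  have g: "g \<in> Hinf" unfolding g_def by (intro Hinf_mult Hinf_power hh_Hinf conj_aa_Hinf)
  have g0: "fourier g 0 = 0"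
    unfolding g_def by (simp add: fourier_Hinf_mult_0 hh_Hinf Hinf_power conj_aa_Hinf fourier_hh_nonpos)
  have "aa powi (- n) = conj_fun aa ^ nat n"
    using n by (cases "n = 0") (auto simp: power_int_def inverse_aa)
  hence "fourier (J f) n = fourier (f * g) 0" by (simp add: fourier_J g_def)
  also have "\<dots> = fourier f 0 * fourier g 0"
    using g pq by (intro Hp_Hq_mult(3)[OF pq f]) (auto simp: Hinf_def conj_exps_def intro: Linf_in_Lp)
  finally show ?thesis by (simp add: g0)
qed

text \<open>For n < 0 the conjugate of the explicit function is \<chi>^-1 (cnj \<alpha>)^-n. One
  factor cnj \<alpha> = om \<chi> cancels \<chi>^-1, so it is analytic and meets cnj f, which has
  mean 0.\<close>

lemma J_Q:
  assumes p: "1 < p" and f: "f \<in> Lp p" "\<And>n. n \<ge> 0 \<Longrightarrow> fourier f n = 0"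
  shows "J f \<in> Hp p"
proof -
  define q where "q = p / (p - 1)"
  have qp: "conj_exps q p" using p by (auto simp: conj_exps_def q_def field_simps)
  have "fourier (J f) n = 0" if n: "n < 0" for n
  proof -
    define k where "k = nat (- n) - 1"
    have nk: "- n = int (Suc k)" using n by (simp add: k_def)
    define g where "g = om * conj_fun aa ^ k"
    have g: "g \<in> Hinf" unfolding g_def by (intro Hinf_mult Hinf_power om_Hinf conj_aa_Hinf)
    have "conj_fun (hh * aa powi (- n)) = inverse \<xi> * conj_fun aa ^ Suc k"
      unfolding nk by (simp add: conj_simps hh_def del: of_nat_Suc power_Suc)
    also have "\<dots> = (\<xi> * inverse \<xi>) * g" by (simp add: g_def conj_aa mult_ac)
    finally have e: "conj_fun (hh * aa powi (- n)) = g" by (simp add: chi_inverse)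
    have "fourier (g * conj_fun f) 0 = 0"
    proof (rule Hp_Hq_mult(2)[OF qp, where m = 1])
      show "g \<in> Hp q" using g qp by (auto intro: Hinf_Hp simp: conj_exps_def)
    qed (use f in \<open>auto simp: fourier_conj\<close>)
    hence "fourier (conj_fun (f * (hh * aa powi (- n)))) 0 = 0"
      unfolding conj_fun_mult[of f] e by (simp add: mult.commute)
    thus ?thesis by (simp add: fourier_J fourier_conj)
  qed
  thus ?thesis using J_Lp[of p f] f(1) p by (simp add: Hp_def)
qed

lemma Qproj_J: "1 < p \<Longrightarrow> f \<in> Hp p \<Longrightarrow> Qproj (J f) = J f"
  unfolding Qproj_def using Pproj_eq_0[of "J f"] J_Hp[of p f] by simp

lemma hank_eq: "1 < p \<Longrightarrow> f \<in> Hp p \<Longrightarrow> hank \<beta> b f = Pproj (b * J f)"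
  by (simp add: hank_def Qproj_J)

lemma hank_Hp: "1 < p \<Longrightarrow> b \<in> Linf \<Longrightarrow> f \<in> Hp p \<Longrightarrow> hank \<beta> b f \<in> Hp p"
  by (simp add: hank_eq Pproj_Hp Linf_mult_in_Lp J_Lp Hp_Lp)

lemma hank_adjoint:
  assumes pq: "conj_exps p q" and b: "b \<in> Linf" and f: "f \<in> Hp p" and g: "g \<in> Hp q"
  shows "pairing (hank \<beta> b f) g = pairing f (hank \<beta> (conj_fun (cpa b)) g)"
proof -
  have p: "p > 1" "q > 1" using pq by (auto simp: conj_exps_def)
  have "pairing (hank \<beta> b f) g = pairing (b * J f) g"
    unfolding hank_eq[OF p(1) f] using p b Hp_Lp[OF f] by (intro pairing_Pproj[OF pq _ g] Linf_mult_in_Lp J_Lp) auto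
  also have "\<dots> = fourier (cpa (cpa b * \<xi> * f * conj_fun (cpa g))) 0"
    by (simp add: pairing_fourier J_alpha_def cpa_mult cpa_chi cpa_conj mult_ac)
  also have "\<dots> = fourier (cpa b * \<xi> * f * conj_fun (cpa g) * ww) 0" by (rule fourier_cpa)
  \<comment> \<open>The Jacobian \<open>ww\<close> consumes the factor \<chi> and supplies cnj
    \<chi>^-1, the factor that belongs to J g.\<close>
  also have "cpa b * \<xi> * f * conj_fun (cpa g) * ww = (\<xi> * inverse \<xi>) * (f * conj_fun (conj_fun (cpa b) * J g))"
    by (simp add: J_alpha_def ww_def hh_def conj_simps mult_ac)
  also have "fourier \<dots> 0 = pairing f (conj_fun (cpa b) * J g)"
    by (simp add: chi_inverse pairing_fourier)
  also have "\<dots> = pairing f (hank \<beta> (conj_fun (cpa b)) g)"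
    unfolding hank_eq[OF p(2) g] using p cpa_Linf[OF b] Hp_Lp[OF g]
    by (intro pairing_Pproj_right[OF pq f, symmetric] Linf_mult_in_Lp J_Lp) auto
  finally show ?thesis .
qed

text \<open>A residue at the zero 1 / cnj \<beta> of \<chi>. Comparing coefficients in f =
  (\<chi>^-1 f) \<chi> makes the power series telescope, with a remainder of order
  |\<beta>|^-N.\<close>

lemma disc_ext_chi:
  assumes f: "f \<in> Lp 1"
  shows "disc_ext f (1 / cnj \<beta>) = cnj \<beta> / L * fourier (inverse \<xi> * f) (- 1)"
proof -
  define b where "b = cnj \<beta>"
  have b0: "b \<noteq> 0" using \<beta>_nz by (simp add: b_def)
  define u where "u = inverse \<xi> * f"
  have u: "u \<in> Lp 1" unfolding u_def by (intro Linf_mult_in_Lp f) auto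
  have rec: "b / L * fourier u (n - 1) - 1 / L * fourier u n = fourier f n" for n
  proof -
    have "f = u * \<xi>" using chi_inverse by (simp add: u_def mult_ac)
    hence "f = cscale (b / L) (u * tvar powi 1) - cscale (1 / L) u"
      unfolding chi_eq b_def by (simp add: right_diff_distrib cscale_mult_right)
    moreover have "fourier (cscale (b / L) (u * tvar powi 1) - cscale (1 / L) u) n
       = b / L * fourier u (n - 1) - 1 / L * fourier u n"
      using u mult_tvar_Lp1[OF u]
      by (subst fourier_diff) (auto simp: fourier_cscale fourier_shift[of u 1, simplified] intro!: cscale_in_Lp)
    ultimately show ?thesis by simp
  qed
  have step: "b / L * fourier u (n - 1) = fourier f n + (1 / b) * (b / L * fourier u n)" for n
    using rec[of n] b0 by (simp add: algebra_simps)
  have part: "(\<Sum>n<N. fourier f (int n) * (1 / b) ^ n) = b / L * fourier u (- 1) - (1 / b) ^ N * (b / L * fourier u (int N - 1))" for N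
  proof (induction N)
    case (Suc N)
    have "(\<Sum>n<Suc N. fourier f (int n) * (1 / b) ^ n) = b / L * fourier u (- 1) - (1 / b) ^ N * (b / L * fourier u (int N - 1)) + fourier f (int N) * (1 / b) ^ N"
      using Suc by simp
    also have "b / L * fourier u (int N - 1) = fourier f (int N) + (1 / b) * (b / L * fourier u (int N))" by (rule step)
    finally have "(\<Sum>n<Suc N. fourier f (int n) * (1 / b) ^ n) = b / L * fourier u (- 1) - (1 / b) ^ N * (1 / b * (b / L * fourier u (int N)))"
      by (simp only: distrib_left) (simp add: mult.commute)
    thus ?case by (simp add: mult_ac)
  qed simp
  have "(\<lambda>N. (1 / b) ^ N * (b / L * fourier u (int N - 1))) \<longlonglongrightarrow> 0"
  proof (rule Lim_null_comparison)
    show "\<forall>\<^sub>F N in sequentially. norm ((1 / b) ^ N * (b / L * fourier u (int N - 1))) \<le> (1 / cmod b) ^ N * (cmod (b / L) * Lp_norm 1 u)"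
      using fourier_bound[OF u]
      by (intro always_eventually allI) (auto simp: norm_mult norm_power norm_divide intro!: mult_left_mono divide_right_mono)
    show "(\<lambda>N. (1 / cmod b) ^ N * (cmod (b / L) * Lp_norm 1 u)) \<longlonglongrightarrow> 0"
      using \<beta> by (intro tendsto_mult_left_zero LIMSEQ_power_zero) (simp add: b_def divide_less_eq)
  qed
  from tendsto_diff[OF tendsto_const[of "b / L * fourier u (- 1)"] this]
  have "(\<lambda>n. fourier f (int n) * (1 / b) ^ n) sums (b / L * fourier u (- 1))"
    unfolding sums_def part by simp
  thus ?thesis unfolding disc_ext_def u_def b_def by (simp add: sums_unique[symmetric])
qed

section \<open>Operators with matching symbols\<close>

text \<open>Equivalent to J (g f) = s f, but free of projections: since J f is antianalytic of mean
  0, the equation already puts f into the kernel of T(g).\<close>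

definition "eigsp q s g = {f \<in> Hp q. g * f = cscale s (J f)}"

text \<open>On the kernel of T(g) the operator \<open>Pa\<close> is f -> J (g f), an involution
  because g g_\<alpha> = 1. Half of identity plus s times an involution projects onto its
  s-eigenspace.\<close>

lemma im_Pa_eq:
  assumes q: "1 < q" and g: "g \<in> Linf" "g * cpa g = 1" and s: "s * s = 1"
  shows "im_Pa_s q \<beta> s g = eigsp q s g"
proof
  have gJ: "g * J (g * f) = J f" for f
    unfolding J_mult mult.assoc[symmetric] g(2) by simp
  show "im_Pa_s q \<beta> s g \<subseteq> eigsp q s g"
  proof
    fix x assume "x \<in> im_Pa_s q \<beta> s g"
    then obtain f where f: "f \<in> ker_op q (toep g)" and x: "x = cscale (1 / 2) (f + cscale s (Pa \<beta> g f))"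
      by (auto simp: im_Pa_s_def)
    have fH: "f \<in> Hp q" and fz: "\<And>n. n \<ge> 0 \<Longrightarrow> fourier (g * f) n = 0" using f ker_toep_iff[OF q g(1)] by auto
    have gf: "g * f \<in> Lp q" using q Hp_Lp[OF fH] g(1) by (intro Linf_mult_in_Lp) auto
    have Pf: "Pa \<beta> g f = J (g * f)"
      using Pproj_id[OF _ fH] Pproj_eq_0[OF fz] q by (simp add: Pa_def Qproj_def)
    have JH: "J (g * f) \<in> Hp q" by (rule J_Q[OF q gf fz])
    have "x \<in> Hp q" unfolding x Pf using q fH JH by (intro Hp_cscale Hp_add) auto
    moreover have "g * x = cscale s (J x)"
    proof -
      have l: "g * x = cscale (1 / 2) (g * f + cscale s (J f))"
        by (simp only: x Pf cscale_mult_right distrib_left gJ)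
      have r: "J x = cscale (1 / 2) (J f + cscale s (g * f))"
        by (simp only: x Pf J_cscale J_add J_J)
      have 1: "s * (1 / 2 * s) = 1 / 2" using s by (simp add: field_simps)
      have "cscale s (cscale (1 / 2) (J f + cscale s (g * f))) = cscale (s * (1 / 2)) (J f) + cscale (s * (1 / 2 * s)) (g * f)"
        unfolding cscale_add cscale_cscale by (simp only: mult.assoc)
      also have "\<dots> = cscale (1 / 2) (g * f + cscale s (J f))"
        unfolding 1 cscale_add cscale_cscale mult.commute[of s "1 / 2"] by (rule add.commute)
      finally show ?thesis unfolding l r ..
    qed
    ultimately show "x \<in> eigsp q s g" by (simp add: eigsp_def)
  qed
  show "eigsp q s g \<subseteq> im_Pa_s q \<beta> s g"
  proof
    fix f assume f: "f \<in> eigsp q s g"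
    hence fH: "f \<in> Hp q" and e: "g * f = cscale s (J f)" by (auto simp: eigsp_def)
    have fz: "\<And>n. n \<ge> 0 \<Longrightarrow> fourier (g * f) n = 0" using J_Hp[OF q fH] by (simp add: e fourier_cscale)
    have k: "f \<in> ker_op q (toep g)" using fH fz ker_toep_iff[OF q g(1)] by auto
    have "Pa \<beta> g f = J (g * f)"
      using Pproj_id[OF _ fH] Pproj_eq_0[OF fz] q by (simp add: Pa_def Qproj_def)
    hence "cscale s (Pa \<beta> g f) = f" by (simp add: e J_cscale s)
    hence "cscale (1 / 2) (f + cscale s (Pa \<beta> g f)) = cscale (1 / 2) (f + f)" by (simp only:)
    also have "\<dots> = f" unfolding cscale_add cscale_left_add[symmetric] by simp
    finally have e2: "cscale (1 / 2) (f + cscale s (Pa \<beta> g f)) = f" .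
    show "f \<in> im_Pa_s q \<beta> s g"
      unfolding im_Pa_s_def by (rule image_eqI[OF _ k]) (rule e2[symmetric])
  qed
qed

lemma matching_pairD:
  assumes "matching_pair \<beta> a b"
  shows "a \<in> Linf" "b \<in> Linf" "inverse a \<in> Linf" "inverse b \<in> Linf" "a * inverse a = 1" "b * inverse b = 1"
    "a * cpa a = b * cpa b"
proof -
  have m: "a \<in> Linf" "b \<in> Linf" "invertible_Linf a" "a * cpa a = b * cpa b"
    using assms by (auto simp: matching_pair_def)
  note ia = invertible_LinfD[OF m(3)]
  have "cpa a * inverse (cpa a) = 1" using arg_cong[OF ia(3), of cpa] by (simp add: cpa_mult cpa_inverse)
  hence "b * (cpa b * inverse a * cpa (inverse a)) = 1"
  proof -
    assume *: "cpa a * inverse (cpa a) = 1"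
    have "b * (cpa b * inverse a * cpa (inverse a)) = (b * cpa b) * (inverse a * inverse (cpa a))"
      by (simp add: cpa_inverse mult_ac)
    also have "\<dots> = (a * inverse a) * (cpa a * inverse (cpa a))"
      unfolding m(4)[symmetric] by (simp add: mult_ac)
    finally show ?thesis by (simp add: * ia(3))
  qed
  moreover have "cpa b * inverse a * cpa (inverse a) \<in> Linf" using m ia by (intro Linf_mult cpa_Linf)
  ultimately have "invertible_Linf b" using m(2) by (auto simp: invertible_Linf_def)
  from invertible_LinfD[OF this] ia m show "a \<in> Linf" "b \<in> Linf" "inverse a \<in> Linf" "inverse b \<in> Linf"
    "a * inverse a = 1" "b * inverse b = 1" "a * cpa a = b * cpa b" by auto
qed

lemma cancel_pair: "x * inverse x = (1::circfun) \<Longrightarrow> inverse x * x = 1"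
  by (simp add: mult.commute)

lemma cpa_nz: "x * inverse x = 1 \<Longrightarrow> cpa x * inverse (cpa x) = 1"
  unfolding cpa_inverse[symmetric] cpa_mult[symmetric] by simp

end

locale matching = alpha_shift +
  fixes q :: real and s :: complex and a b :: circfun
  assumes q: "1 < q" and s: "s * s = 1" and ab: "matching_pair \<beta> a b"
begin

abbreviation "c \<equiv> sub_c a b"
abbreviation "d \<equiv> sub_d \<beta> a b"
abbreviation "\<phi> \<equiv> phi q \<beta> s a b"

lemmas abD = matching_pairD[OF ab]

lemma sub_Linf: "c \<in> Linf" "d \<in> Linf"
  using abD cpa_Linf[of "inverse a"] by (auto simp: sub_c_def sub_d_def cpa_inverse intro!: Linf_mult)

lemma b_c: "b * c = a"
  using abD(6) by (simp add: sub_c_def mult.left_commute)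

lemma cpa_a_d: "cpa a * d = b"
  using cpa_nz[OF abD(5)] by (simp add: sub_d_def mult.left_commute)

lemma cc: "c * cpa c = 1"
proof -
  have "c * cpa c = (a * cpa a) * (inverse b * inverse (cpa b))"
    by (simp add: sub_c_def cpa_mult cpa_inverse mult_ac)
  also have "\<dots> = (b * inverse b) * (cpa b * inverse (cpa b))" unfolding abD(7) by (simp add: mult_ac)
  finally show ?thesis using abD(6) cpa_nz[OF abD(6)] by simp
qed

lemma dd: "d * cpa d = 1"
proof -
  have "d * cpa d = (b * cpa b) * (inverse (cpa a) * inverse a)"
    by (simp add: sub_d_def cpa_mult cpa_inverse mult_ac)
  also have "\<dots> = (a * inverse a) * (cpa a * inverse (cpa a))" unfolding abD(7)[symmetric] by (simp add: mult_ac)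
  finally show ?thesis using abD(5) cpa_nz[OF abD(5)] by simp
qed

definition "op f = toep a f + cscale s (hank \<beta> b f)"

text \<open>The function whose projection is \<open>op f\<close>; it keeps the antianalytic part
  that the projection discards.\<close>

definition "smb f = a * f + cscale s (b * J f)"

lemma smb_Lp: "f \<in> Hp q \<Longrightarrow> smb f \<in> Lp q"
  unfolding smb_def using q abD by (intro Lp_add cscale_in_Lp Linf_mult_in_Lp J_Lp) (auto simp: Hp_Lp)

lemma op_eq:
  assumes f: "f \<in> Hp q"
  shows "op f = Pproj (smb f)"
proof -
  have L: "a * f \<in> Lp q" "b * J f \<in> Lp q"
    using q Hp_Lp[OF f] abD(1,2) by (auto intro!: Linf_mult_in_Lp J_Lp)
  show ?thesis
    unfolding op_def smb_def toep_def Pproj_add[OF q L(1) cscale_in_Lp[OF L(2)]] Pproj_cscale[OF q L(2)] hank_eq[OF q f] ..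
qed

lemma ker_iff: "f \<in> ker_op q op \<longleftrightarrow> f \<in> Hp q \<and> (\<forall>n\<ge>0. fourier (smb f) n = 0)"
  unfolding ker_op_def using Pproj_eq_0_iff[OF q smb_Lp] by (auto simp: op_eq)

lemma smb_diff: "smb (f - g) = smb f - smb g"
  by (simp add: smb_def J_diff right_diff_distrib cscale_diff algebra_simps)

text \<open>J swaps the two summands of \<open>smb f\<close> up to the factors a_\<alpha> and
  b_\<alpha>; multiplication by d and the matching condition restore a and b.\<close>

lemma J_smb: "d * J (smb f) = cscale s (smb f)"
proof -
  have "d * J (smb f) = (cpa a * d) * J f + cscale s ((b * cpa b) * (inverse (cpa a) * f))"
    by (simp add: smb_def J_add J_mult J_cscale distrib_left cscale_mult_right sub_d_def mult_ac)
  also have "(b * cpa b) * (inverse (cpa a) * f) = (cpa a * inverse (cpa a)) * (a * f)"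
    unfolding abD(7)[symmetric] by (simp add: mult_ac)
  also have "cpa a * inverse (cpa a) = 1" by (rule cpa_nz[OF abD(5)])
  finally show ?thesis by (simp add: cpa_a_d smb_def cscale_add s add.commute)
qed

lemma J_smb_eigsp: "f \<in> ker_op q op \<Longrightarrow> J (smb f) \<in> eigsp q s d"
  using J_Q[OF q smb_Lp] by (auto simp: ker_iff eigsp_def J_smb)

lemma smb_0_iff: "smb f = 0 \<longleftrightarrow> c * f = cscale (- s) (J f)"
proof
  assume "smb f = 0"
  hence "inverse b * smb f = 0" by simp
  hence "c * f + cscale s ((b * inverse b) * J f) = 0"
    by (simp add: smb_def sub_c_def distrib_left cscale_mult_right mult_ac)
  thus "c * f = cscale (- s) (J f)" using abD(6) by (simp add: eq_neg_iff_add_eq_0)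
next
  assume "c * f = cscale (- s) (J f)"
  hence "b * (c * f) = b * cscale (- s) (J f)" by simp
  hence "a * f = - cscale s (b * J f)" by (simp add: mult.assoc[symmetric] b_c cscale_mult_right)
  thus "smb f = 0" by (simp add: smb_def)
qed

lemma eigsp_in_ker: "f \<in> eigsp q (- s) c \<Longrightarrow> f \<in> ker_op q op \<and> smb f = 0"
  using smb_0_iff[of f] by (auto simp: eigsp_def ker_iff)

text \<open>\<open>c f + s J f = a\<^sub>\<alpha>\<^sup>-\<^sup>1 g\<close> for \<open>f = \<phi> g\<close>; multiplied by \<open>b\<close>, this says that the symbol of \<open>f\<close> is \<open>d g = s J g\<close>.\<close>

lemma phi_properties:
  assumes R: "\<forall>u\<in>Hp q. toep_rinv q c u \<in> Hp q \<and> toep c (toep_rinv q c u) = u"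
    and f: "f \<in> eigsp q s d"
  shows "\<phi> f \<in> ker_op q op" "smb (\<phi> f) = cscale s (J f)"
proof -
  have fH: "f \<in> Hp q" and fe: "d * f = cscale s (J f)" using f by (auto simp: eigsp_def)
  define g where "g = inverse (cpa a) * f"
  have iaL: "inverse (cpa a) \<in> Linf" using cpa_Linf[OF abD(3)] by (simp add: cpa_inverse)
  have gL: "g \<in> Lp q" unfolding g_def using q iaL Hp_Lp[OF fH] by (intro Linf_mult_in_Lp) auto
  define h where "h = toep_rinv q c (toep (inverse (cpa a)) f)"
  have Pg: "toep (inverse (cpa a)) f = Pproj g" by (simp add: toep_def g_def)
  have hH: "h \<in> Hp q" and ch: "Pproj (c * h) = Pproj g"
    unfolding h_def Pg using bspec[OF R Pproj_Hp[OF q gL]] by (auto simp: toep_def)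
  have chL: "c * h \<in> Lp q" using q sub_Linf(1) Hp_Lp[OF hH] by (intro Linf_mult_in_Lp) auto
  have phi: "\<phi> f = cscale (1 / 2) (h - cscale s (J (Qproj (c * h))) + cscale s (J (Qproj g)))"
    using Pproj_id[OF _ hH] q by (simp add: phi_def Let_def h_def[symmetric] g_def[symmetric])
  have JQ: "J (Qproj u) \<in> Hp q" if "u \<in> Lp q" for u
    by (rule J_Q[OF q Qproj_Lp[OF q that]]) (simp add: fourier_Qproj[OF q that])
  have pH: "\<phi> f \<in> Hp q"
    unfolding phi using q hH JQ[OF gL] JQ[OF chL] by (intro Hp_cscale Hp_add Hp_diff) auto
  have Q1: "Qproj (c * h) = c * h - Pproj g" by (simp add: Qproj_def ch)
  have cJ: "c * J (c * u) = J u" for u unfolding J_mult mult.assoc[symmetric] cc by simp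
  \<comment> \<open>Passing from f to g = (a_\<alpha>)^-1 f turns the eigenvalue equation for d into
    one for c.\<close>
  have cJg: "cscale s (c * J g) = g"
  proof -
    have "b * (c * J g) = (a * inverse a) * J f"
      unfolding mult.assoc[symmetric] b_c by (simp add: g_def J_mult cpa_inverse mult.assoc)
    hence "b * cscale s (c * J g) = d * f" by (simp add: cscale_mult_right abD(5) fe)
    also have "\<dots> = b * g" by (simp add: sub_d_def g_def mult.assoc)
    finally have "inverse b * (b * cscale s (c * J g)) = inverse b * (b * g)" by simp
    thus ?thesis unfolding mult.assoc[symmetric] cancel_pair[OF abD(6)] by simp
  qed
  have two: "cscale (1 / 2) x + cscale (1 / 2) x = x" for x unfolding cscale_left_add[symmetric] by simp
  have main: "c * \<phi> f + cscale s (J (\<phi> f)) = g"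
  proof -
    have 1: "c * \<phi> f = cscale (1 / 2) (c * h - cscale s (J h) + g)"
    proof -
      have "c * (h - cscale s (J (Qproj (c * h))) + cscale s (J (Qproj g)))
        = c * h - cscale s (J h) + cscale s (c * J (Pproj g) + c * J (Qproj g))"
        unfolding Q1 J_diff distrib_left right_diff_distrib cscale_mult_right cJ cscale_diff cscale_add
        by (simp add: algebra_simps)
      also have "c * J (Pproj g) + c * J (Qproj g) = c * J g"
        by (simp add: distrib_left[symmetric] J_add[symmetric] Pproj_plus_Qproj)
      finally show ?thesis unfolding phi cscale_mult_right cJg by simp
    qed
    have 2: "cscale s (J (\<phi> f)) = cscale (1 / 2) (cscale s (J h) - Qproj (c * h) + Qproj g)"
      unfolding phi J_cscale J_add J_diff J_J cscale_cscale
      by (simp add: cscale_add cscale_diff s mult.commute)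
    have "c * \<phi> f + cscale s (J (\<phi> f)) = cscale (1 / 2) ((c * h - cscale s (J h) + g) + (cscale s (J h) - Qproj (c * h) + Qproj g))"
      unfolding 1 2 cscale_add ..
    \<comment> \<open>All terms in h cancel except P (c h), which equals P g by the choice of
      h.\<close>
    also have "(c * h - cscale s (J h) + g) + (cscale s (J h) - Qproj (c * h) + Qproj g) = g + (Pproj g + Qproj g)"
      unfolding Q1 by simp
    also have "cscale (1 / 2) (g + (Pproj g + Qproj g)) = g" unfolding Pproj_plus_Qproj cscale_add two ..
    finally show ?thesis .
  qed
  have "b * (c * \<phi> f + cscale s (J (\<phi> f))) = smb (\<phi> f)"
    by (simp add: smb_def distrib_left cscale_mult_right b_c flip: mult.assoc)
  hence "smb (\<phi> f) = b * g" unfolding main by simp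
  also have "\<dots> = d * f" by (simp add: sub_d_def g_def mult.assoc)
  finally show sp: "smb (\<phi> f) = cscale s (J f)" by (simp add: fe)
  show "\<phi> f \<in> ker_op q op"
    unfolding ker_iff sp using pH J_Hp[OF q fH] by (simp add: fourier_cscale)
qed

lemma eigsp_0: "0 \<in> eigsp q z g"
  by (simp add: eigsp_def)

lemma ker_op_decomposition:
  assumes R: "\<forall>u\<in>Hp q. toep_rinv q c u \<in> Hp q \<and> toep c (toep_rinv q c u) = u"
    and R0: "toep_rinv q c 0 = 0"
  shows "ker_op q op = set_sum (eigsp q (- s) c) (\<phi> ` eigsp q s d)"
    "eigsp q (- s) c \<inter> \<phi> ` eigsp q s d = {0}"
proof -
  note ph = phi_properties[OF R]
  have q1: "1 \<le> q" using q by simp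
  \<comment> \<open>The right inverse is built from a choice function, so its value at 0 has to be
    supplied separately; it puts 0 into the image of \<phi>.\<close>
  have phi0: "\<phi> 0 = 0" by (simp add: phi_def Let_def R0 Qproj_def)
  have kd: "x - y \<in> ker_op q op" "x + y \<in> ker_op q op" if "x \<in> ker_op q op" "y \<in> ker_op q op" for x y
  proof -
    have L1: "smb x \<in> Lp 1" "smb y \<in> Lp 1" using that Lp_mono[OF smb_Lp q1] by (auto simp: ker_iff)
    show "x - y \<in> ker_op q op" using that L1 q1 by (auto simp: ker_iff smb_diff fourier_diff intro: Hp_diff)
    have "smb (x + y) = smb x + smb y" by (simp add: smb_def J_add distrib_left cscale_add algebra_simps)
    thus "x + y \<in> ker_op q op" using that L1 q1 by (auto simp: ker_iff fourier_add intro: Hp_add)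
  qed
  show "ker_op q op = set_sum (eigsp q (- s) c) (\<phi> ` eigsp q s d)"
  proof
    show "ker_op q op \<subseteq> set_sum (eigsp q (- s) c) (\<phi> ` eigsp q s d)"
    proof
      fix f assume f: "f \<in> ker_op q op"
      \<comment> \<open>The factor s compensates the one in
        \<open>smb (\<phi> g) = cscale s (J g)\<close>, as s^2 = 1.\<close>
      define g where "g = cscale s (J (smb f))"
      have g: "g \<in> eigsp q s d"
        using J_smb_eigsp[OF f] by (auto simp: g_def eigsp_def cscale_mult_right J_cscale intro: Hp_cscale)
      have pk: "\<phi> g \<in> ker_op q op" by (rule ph(1)[OF g])
      have "smb (\<phi> g) = smb f" unfolding ph(2)[OF g] by (simp add: g_def J_cscale s)
      hence "smb (f - \<phi> g) = 0" by (simp add: smb_diff)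
      hence "f - \<phi> g \<in> eigsp q (- s) c"
        using kd(1)[OF f pk] by (simp add: smb_0_iff eigsp_def ker_iff)
      moreover have "f = (f - \<phi> g) + \<phi> g" by simp
      ultimately show "f \<in> set_sum (eigsp q (- s) c) (\<phi> ` eigsp q s d)"
        unfolding set_sum_def using g by blast
    qed
    show "set_sum (eigsp q (- s) c) (\<phi> ` eigsp q s d) \<subseteq> ker_op q op"
      using eigsp_in_ker ph(1) kd(2) by (auto simp: set_sum_def)
  qed
  show "eigsp q (- s) c \<inter> \<phi> ` eigsp q s d = {0}"
  proof
    show "{0} \<subseteq> eigsp q (- s) c \<inter> \<phi> ` eigsp q s d"
      using eigsp_0 phi0 by (auto intro!: image_eqI[of _ _ 0])
    show "eigsp q (- s) c \<inter> \<phi> ` eigsp q s d \<subseteq> {0}"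
    proof
      fix x assume "x \<in> eigsp q (- s) c \<inter> \<phi> ` eigsp q s d"
      then obtain g where g: "g \<in> eigsp q s d" "x = \<phi> g" and x: "x \<in> eigsp q (- s) c" by auto
      have "cscale s (J g) = 0" using ph(2)[OF g(1)] eigsp_in_ker[OF x] g(2) by simp
      hence "J (cscale s (J g)) = 0" by (simp only: J_0)
      hence "cscale s g = 0" unfolding J_cscale J_J .
      hence "cscale s (cscale s g) = 0" by (simp only: cscale_zero)
      hence "g = 0" unfolding cscale_cscale s cscale_1 .
      thus "x \<in> {0}" using g(2) phi0 by simp
    qed
  qed
qed

end

section \<open>Wiener--Hopf factorization\<close>

lemma Hp_bar_iff: "f \<in> Hp_bar p \<longleftrightarrow> conj_fun f \<in> Hp p"
proof -
  have "(\<forall>n>0. fourier f n = 0) \<longleftrightarrow> (\<forall>n<0. fourier (conj_fun f) n = 0)"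
    unfolding fourier_conj by (metis complex_cnj_zero_iff neg_0_less_iff_less neg_less_0_iff_less minus_minus)
  thus ?thesis by (simp add: Hp_bar_def Hp_def)
qed

lemma fourier_mean_mult:
  assumes pq: "conj_exps p q" and f: "f \<in> Hp p" and g: "g \<in> Hp q"
  shows "fourier (f * g) 0 = fourier f 0 * fourier g 0"
  using Hp_Hq_mult(3)[OF pq f Hp_Lp[OF g] Hp_fourier[OF g]] by simp

text \<open>The usual Liouville argument: gp / gp' = gm' / gm is both analytic and antianalytic,
  hence constant, and the normalisation of the minus factors makes it 1.\<close>

lemma wh_fact_unique:
  assumes pq: "conj_exps p q" and w: "wh_fact q g n gm gp" "wh_fact q g n' gm' gp'"
  shows "n = n'" "gp = gp'"
proof -
  note dq = conj_exps_dual[OF conj_exps_sym[OF pq]]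
  have p: "p > 1" "q > 1" using pq by (auto simp: conj_exps_def)
  have W: "g = gm * tvar powi (- n) * gp" "fourier gm 0 = 1" "gp * inverse gp = 1" "gm * inverse gm = 1"
    "gp \<in> Hp p" "inverse gp \<in> Hp q" "gm \<in> Hp_bar q" "inverse gm \<in> Hp_bar p"
    using w(1) by (auto simp: wh_fact_def dq)
  have W': "g = gm' * tvar powi (- n') * gp'" "fourier gm' 0 = 1" "gp' * inverse gp' = 1" "gm' * inverse gm' = 1"
    "gp' \<in> Hp p" "inverse gp' \<in> Hp q" "gm' \<in> Hp_bar q" "inverse gm' \<in> Hp_bar p"
    using w(2) by (auto simp: wh_fact_def dq)
  show n: "n = n'" using w by (auto simp: wh_fact_def)
  define T where "T = tvar powi (- n)"
  have T: "T * tvar powi n = 1" unfolding T_def using circ_powi_inv[OF tvar_inverse, of n] by (simp add: mult.commute)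
  have "gm * T * gp = gm' * T * gp'" using W(1) W'(1) n by (simp add: T_def)
  hence "(T * tvar powi n) * (gm * inverse gm) * (gp * inverse gp') = (T * tvar powi n) * (gp' * inverse gp') * (gm' * inverse gm)"
    by (metis (no_types, lifting) mult.assoc mult.commute)
  hence u: "gp * inverse gp' = gm' * inverse gm" by (simp add: T W W')
  define v where "v = gp * inverse gp'"
  have v1: "v \<in> Lp 1" "\<And>n. n < 0 \<Longrightarrow> fourier v n = 0"
    unfolding v_def using Hp_Hq_mult(1,2)[OF pq W(5) Hp_Lp[OF W'(6)] Hp_fourier[OF W'(6)]] by auto
  have cb: "conj_fun gm' \<in> Hp q" "conj_fun (inverse gm) \<in> Hp p" using W W' by (auto simp: Hp_bar_iff)
  have cv: "conj_fun v = conj_fun (inverse gm) * conj_fun gm'" unfolding v_def u by (simp add: conj_simps mult.commute)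
  have v2: "fourier (conj_fun v) n = 0" if "n < 0" for n
    unfolding cv using Hp_Hq_mult(2)[OF pq cb(2) Hp_Lp[OF cb(1)] Hp_fourier[OF cb(1)] that] by simp
  have "fourier (conj_fun v) 0 = fourier (conj_fun (inverse gm)) 0 * fourier (conj_fun gm') 0"
    unfolding cv by (rule fourier_mean_mult[OF pq cb(2,1)])
  also have "fourier (conj_fun gm') 0 = 1" using W'(2) by (simp add: fourier_conj)
  also have "fourier (conj_fun (inverse gm)) 0 = 1"
  proof -
    have cg: "conj_fun gm \<in> Hp q" using W by (simp add: Hp_bar_iff)
    have "conj_fun (inverse gm) * conj_fun gm = conj_fun (gm * inverse gm)" by (simp only: conj_fun_mult mult.commute)
    hence "conj_fun (inverse gm) * conj_fun gm = 1" using W(4) by simp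
    hence "fourier (conj_fun (inverse gm)) 0 * fourier (conj_fun gm) 0 = fourier 1 0"
      using fourier_mean_mult[OF pq cb(2) cg] by simp
    thus ?thesis using W(2) fourier_tvar_powi[of 0 0] by (simp add: fourier_conj)
  qed
  finally have v0: "fourier v 0 = 1" by (simp add: fourier_conj)
  have "v = 1"
  proof (rule fourier_unique[OF v1(1)])
    show "fourier v n = fourier 1 n" for n
      using v0 v1(2)[of n] v2[of "-n"] fourier_tvar_powi[of 0 n]
      by (cases n "0::int" rule: linorder_cases) (auto simp: fourier_conj)
  qed simp
  have "(gp * inverse gp') * gp' = gp * (gp' * inverse gp')" by (simp only: mult_ac)
  thus "gp = gp'" using \<open>v = 1\<close> W'(3) by (simp add: v_def)
qed

text \<open>The factorization of the adjoint symbol on \<open>H\<^sup>q\<close> swaps the two factors; its operator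
  \<open>B\<close> is the inverse of the adjoint of \<open>T(d t\<^sup>k)\<close>.\<close>

lemma wh_fact_adjoint:
  assumes pq: "conj_exps p q" and d: "invertible_Linf d" and k: "k \<ge> 1"
    and w: "wh_fact p d (int k) dm dp"
  defines "z \<equiv> cnj (fourier dp 0)"
  shows "z \<noteq> 0" "wh_fact q (conj_fun d) (- int k) (cscale (inverse z) (conj_fun dp)) (cscale z (conj_fun dm))"
proof -
  note qp = conj_exps_sym[OF pq]
  note dp = conj_exps_dual[OF pq] and dq = conj_exps_dual[OF qp]
  have p: "p > 1" "q > 1" "p > 0" "q > 0" using pq by (auto simp: conj_exps_def)
  note dL = invertible_LinfD[OF d]
  have W: "fredholm p (toep d)" "ind p (toep d) = int k" "d = dm * tvar powi (- int k) * dp" "fourier dm 0 = 1"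
    "dp * inverse dp = 1" "dm * inverse dm = 1"
    "dp \<in> Hp q" "inverse dp \<in> Hp p" "dm \<in> Hp_bar p" "inverse dm \<in> Hp_bar q"
    using w by (auto simp: wh_fact_def dp)
  have "fourier dp 0 * fourier (inverse dp) 0 = 1"
    using fourier_mean_mult[OF qp W(7,8)] W(5) fourier_tvar_powi[of 0 0] by simp
  thus z: "z \<noteq> 0" by (auto simp: z_def)
  \<comment> \<open>z is the mean of cnj dp; moving it to the other factor normalises the new minus
    factor.\<close>
  define gm where "gm = cscale (inverse z) (conj_fun dp)"
  define gp where "gp = cscale z (conj_fun dm)"
  have igm: "inverse gm = cscale z (conj_fun (inverse dp))"
    unfolding gm_def using z by (simp add: circ_inverse_cscale conj_simps)
  have igp: "inverse gp = cscale (inverse z) (conj_fun (inverse dm))"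
    unfolding gp_def using z by (simp add: circ_inverse_cscale conj_simps)
  note fa = fredholm_adjoint[OF pq d W(1,2) k]
  define e where "e = conj_fun d * tvar powi (- int k)"
  have eL: "e \<in> Linf" unfolding e_def using dL by (intro Linf_mult) auto
  have dfac: "conj_fun d = gm * tvar powi int k * gp"
  proof -
    have "conj_fun d = conj_fun dm * tvar powi int k * conj_fun dp"
      unfolding W(3) by (simp only: conj_fun_mult conj_tvar_powi minus_minus)
    also have "\<dots> = cscale (inverse z * z) (conj_fun dp * tvar powi int k * conj_fun dm)" using z by (simp add: mult_ac)
    finally show ?thesis by (simp only: gm_def gp_def cscale_mult_left cscale_mult_right cscale_cscale mult.commute)
  qed
  have efac: "e = gm * gp"
  proof -
    have "e = (tvar powi int k * tvar powi (- int k)) * (gm * gp)"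
      unfolding e_def dfac by (simp only: mult_ac)
    thus ?thesis by (simp only: circ_powi_inv[OF tvar_inverse] mult_1)
  qed
  have H: "gp \<in> Hp p" "inverse gp \<in> Hp q" "gm \<in> Hp_bar q" "inverse gm \<in> Hp_bar p"
    unfolding igp igm unfolding gp_def gm_def Hp_bar_iff conj_fun_cscale conj_fun_conj
    using W(7-10) by (auto simp: Hp_bar_iff intro: Hp_cscale)
  have nz: "gp * inverse gp = 1" "gm * inverse gm = 1"
  proof -
    have "gp * inverse gp = cscale (inverse z * z) (conj_fun (dm * inverse dm))"
      unfolding igp unfolding gp_def by (simp only: cscale_mult_left cscale_mult_right cscale_cscale conj_fun_mult)
    thus "gp * inverse gp = 1" using W(6) z by simp
    have "gm * inverse gm = cscale (z * inverse z) (conj_fun (dp * inverse dp))"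
      unfolding igm unfolding gm_def by (simp only: cscale_mult_left cscale_mult_right cscale_cscale conj_fun_mult)
    thus "gm * inverse gm = 1" using W(5) z by simp
  qed
  have m0: "fourier gm 0 = 1" using z by (simp add: gm_def fourier_cscale fourier_conj z_def)
  obtain c where c: "c \<ge> 0" "\<And>h. h \<in> Hp q \<Longrightarrow> Lp_norm q h \<le> c * Lp_norm q (toep e h)"
    using fa(1) unfolding e_def by blast
  have onto: "toep e ` Hp q = Hp q" unfolding e_def by (rule fa(2))
  have inj: "h1 = h2" if "h1 \<in> Hp q" "h2 \<in> Hp q" "toep e h1 = toep e h2" for h1 h2
  proof -
    have "toep e (h1 - h2) = 0" using that by (simp add: toep_diff[OF p(2) eL] Hp_Lp)
    moreover have "h1 - h2 \<in> Hp q" using that p by (intro Hp_diff) auto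
    ultimately have "Lp_norm q (h1 - h2) \<le> 0" using c(2) by fastforce
    hence "Lp_norm q (h1 - h2) = 0" using Lp_norm_nonneg[of q "h1 - h2"] by linarith
    hence "h1 - h2 = 0" using that p by (intro Lp_norm_eq_0[of _ q] Lp_diff) (auto simp: Hp_Lp)
    thus ?thesis by simp
  qed
  define B where "B = inv_into (Hp q) (toep e)"
  have BH: "B f \<in> Hp q" and TB: "toep e (B f) = f" if "f \<in> Hp q" for f
    unfolding B_def using that onto by (auto intro: inv_into_into f_inv_into_f)
  have Beq: "B f = x" if "x \<in> Hp q" "toep e x = f" for f x
    by (rule inj[OF BH that(1)]) (use that TB onto in auto)
  have bB: "bounded_op q B"
    unfolding bounded_op_def
  proof (intro conjI ballI allI)
    show "B f \<in> Hp q" if "f \<in> Hp q" for f by (rule BH[OF that])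
    show "B (f + g) = B f + B g" if "f \<in> Hp q" "g \<in> Hp q" for f g
      using that BH TB p by (intro Beq Hp_add) (auto simp: toep_add[OF p(2) eL] Hp_Lp)
    show "B (cscale w f) = cscale w (B f)" if "f \<in> Hp q" for w f
      using that BH TB p by (intro Beq Hp_cscale) (auto simp: toep_cscale[OF p(2) eL] Hp_Lp)
    show "\<exists>C. \<forall>f\<in>Hp q. Lp_norm q (B f) \<le> C * Lp_norm q f"
      using c(2)[OF BH] TB by (intro exI[of _ c]) auto
  qed
  have Bf: "B f = inverse gp * Pproj (inverse gm * f)" if f: "f \<in> circ.span (range (\<lambda>k::nat. tvar ^ k))" for f
  proof -
    have "f \<in> AP"
    proof -
      have sAP: "circ.subspace AP"
        by (auto simp: AP_def circ.subspace_def fourier_add fourier_cscale TP_Lp intro: TP_add TP_cscale)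
      have "range (\<lambda>k::nat. tvar ^ k) \<subseteq> AP"
      proof safe
        fix k :: nat
        show "tvar ^ k \<in> AP" using TP_powi[of "int k"] fourier_tvar_powi[of "int k"] by (simp add: AP_def)
      qed
      thus ?thesis using f circ.span_minimal[OF _ sAP] by blast
    qed
    then obtain N co where fc: "f = (\<Sum>k\<in>{0..int N}. cscale (co k) (tvar powi k))" using AP_expand by blast
    have fH: "f \<in> Hp q" using \<open>f \<in> AP\<close> p by (intro AP_Hp)
    have fT: "f \<in> TP" using \<open>f \<in> AP\<close> by (simp add: AP_def)
    have igL: "inverse gm \<in> Lp p" "inverse gm \<in> Lp 1" using H(4) Lp_mono[of _ p] p by (auto simp: Hp_bar_def)
    define u where "u = inverse gm * f"
    have uL: "u \<in> Lp p" unfolding u_def using Linf_mult_in_Lp[OF TP_Linf[OF fT] igL(1) p(3)] by (simp add: mult.commute)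
    \<comment> \<open>f has degree at most N and gm^-1 is antianalytic, so P u is a polynomial.
      Hence gp^-1 P u lies in H^q although gp^-1 may be unbounded.\<close>
    have uhi: "fourier u n = 0" if "n > int N" for n
    proof -
      have "fourier u n = (\<Sum>k\<in>{0..int N}. co k * fourier (inverse gm) (n - k))"
        unfolding u_def fc mult.commute[of "inverse gm"] by (rule fourier_trig_mult[OF igL(2)])
      also have "\<dots> = 0" by (rule sum.neutral) (use that H(4) in \<open>auto simp: Hp_bar_def\<close>)
      finally show ?thesis .
    qed
    define y where "y = (\<Sum>k\<in>{0..int N}. cscale (fourier u k) (tvar powi k))"
    have yT: "y \<in> TP" unfolding y_def by (intro TP_sum TP_cscale TP_powi)
    have yf: "fourier y n = (if n \<in> {0..int N} then fourier u n else 0)" for n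
      unfolding y_def by (rule fourier_trig_sum) simp
    have Py: "Pproj u = y" by (rule Pproj_eqI) (use yT uhi in \<open>auto simp: yf intro: TP_Lp\<close>)
    have yI: "y \<in> Hinf" using TP_Linf[OF yT] by (simp add: Hinf_def yf)
    have xH: "inverse gp * y \<in> Hp q" using Hinf_mult_Hp[OF p(2) yI H(2)] by (simp add: mult.commute)
    have "toep e (inverse gp * y) = f"
      unfolding toep_def
    proof (rule Pproj_eqI)
      show "f \<in> Lp 1" using fT by (rule TP_Lp) simp
      have "e * (inverse gp * y) = (gp * inverse gp) * (gm * y)" unfolding efac by (simp only: mult_ac)
      hence "e * (inverse gp * y) = gm * y" by (simp only: nz mult_1)
      moreover have "y = u - Qproj u" by (simp add: Qproj_def Py)
      hence "gm * y = gm * u - gm * Qproj u" by (simp only: right_diff_distrib)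
      moreover have "gm * u = (gm * inverse gm) * f" by (simp only: u_def mult_ac)
      hence "gm * u = f" by (simp only: nz mult_1)
      \<comment> \<open>gm Q u is antianalytic of mean 0, so T(e) sends gp^-1 P u to f, which
        identifies it as B f.\<close>
      ultimately have ee: "e * (inverse gp * y) = f - gm * Qproj u" by (simp only:)
      have gq: "conj_fun gm \<in> Hp q" using H(3) by (simp add: Hp_bar_iff)
      have Qc: "fourier (conj_fun (Qproj u)) n = 0" if "n < 1" for n
        using that by (simp add: fourier_conj fourier_Qproj[OF p(1) uL])
      have QL: "conj_fun (Qproj u) \<in> Lp p" using Qproj_Lp[OF p(1) uL] by simp
      have cL: "conj_fun (gm * Qproj u) \<in> Lp 1" "\<And>n. n < 1 \<Longrightarrow> fourier (conj_fun (gm * Qproj u)) n = 0"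
        unfolding conj_fun_mult using Hp_Hq_mult(1,2)[OF qp gq QL Qc] by auto
      have gL: "gm * Qproj u \<in> Lp 1" using cL(1) by (simp only: Lp_conj)
      have gz: "fourier (gm * Qproj u) n = 0" if "n \<ge> 0" for n
        using cL(2)[of "-n"] that by (simp only: fourier_conj) simp
      show "fourier f n = (if n \<ge> 0 then fourier (e * (inverse gp * y)) n else 0)" for n
        unfolding ee using TP_Lp[OF fT, of 1] gL gz Hp_fourier[OF fH] by (simp add: fourier_diff)
    qed
    thus ?thesis using Beq[OF xH] Py by (simp add: u_def)
  qed
  show "wh_fact q (conj_fun d) (- int k) (cscale (inverse z) (conj_fun dp)) (cscale z (conj_fun dm))"
    unfolding gm_def[symmetric] gp_def[symmetric] wh_fact_def dq
    using fa(3,4) dfac m0 nz H bB Bf by auto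
qed

context alpha_shift
begin

text \<open>By the residue formula and the change of variables the value becomes cnj \<beta> / L
  times the mean of gm (t \<chi>^-1)^(k + 1). Its conjugate is analytic, so the mean is
  multiplicative, and gm has mean 1.\<close>

lemma disc_ext_Jc:
  assumes pq: "conj_exps p q" and gm: "gm \<in> Hp_bar q" "fourier gm 0 = 1"
   and f: "f \<in> Hp q" and cf: "c * f = gm * conj_fun om ^ k * inverse \<xi>" and JL: "J (c * f) \<in> Lp 1"
  shows "disc_ext (J (c * f)) (1 / cnj \<beta>) = (L / cnj \<beta>) ^ k"
proof -
  have "disc_ext (J (c * f)) (1 / cnj \<beta>) = cnj \<beta> / L * fourier (inverse \<xi> * J (c * f)) (- 1)"
    by (rule disc_ext_chi[OF JL])
  also have "fourier (inverse \<xi> * J (c * f)) (- 1) = fourier (inverse \<xi> * J (c * f) * tvar powi 1) 0"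
    by (simp only: fourier_shift) simp
  also have "inverse \<xi> * J (c * f) * tvar powi 1 = cpa (\<xi> * \<xi> * (c * f) * aa)"
    by (simp add: J_alpha_def cpa_mult cpa_chi aa_def mult_ac)
  also have "fourier \<dots> 0 = fourier (\<xi> * \<xi> * (c * f) * aa * ww) 0" by (rule fourier_cpa)
  also have "\<xi> * \<xi> * (c * f) * aa * ww = (\<xi> * inverse \<xi>) * (\<xi> * inverse \<xi>) * (hh * conj_fun \<xi>) * (c * f * tvar)"
    by (simp add: aa_eq ww_def mult_ac)
  also have "\<dots> = gm * conj_fun om ^ Suc k"
    by (simp add: chi_inverse hh_chi cf conj_om mult_ac)
  also have "fourier \<dots> 0 = cnj (fourier (conj_fun gm * om ^ Suc k) 0)"
    using fourier_conj[of "conj_fun gm * om ^ Suc k" 0] by (simp add: conj_simps)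
  also have "fourier (conj_fun gm * om ^ Suc k) 0 = fourier (conj_fun gm) 0 * fourier (om ^ Suc k) 0"
    using pq gm Hinf_power[OF om_Hinf, of "Suc k"]
    by (intro fourier_mean_mult[OF conj_exps_sym[OF pq]]) (auto simp: Hp_bar_iff conj_exps_def intro!: Hinf_Hp simp del: power_Suc)
  also have "\<dots> = (- L / \<beta>) ^ Suc k"
    using gm(2) by (simp add: fourier_conj fourier_Hinf_power_0[OF om_Hinf] fourier_om_0 del: power_Suc)
  also have "cnj ((- L / \<beta>) ^ Suc k) = (L / cnj \<beta>) ^ Suc k"
    by (simp add: cnj_L del: power_Suc)
  finally show ?thesis using L_nz \<beta>_nz by simp
qed

text \<open>\<open>t \<chi>\<^sup>-\<^sup>1\<close> and its inverse are antianalytic, so multiplying a symbol by a power of it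
  preserves invertibility.\<close>

lemma toep_conj_om:
  assumes q: "1 < q" and u: "u \<in> Linf" and bij: "\<And>h. h \<in> Hp q \<Longrightarrow> toep u h = 0 \<Longrightarrow> h = 0" "toep u ` Hp q = Hp q"
  shows "\<And>h. h \<in> Hp q \<Longrightarrow> toep (conj_fun om ^ n * u) h = 0 \<Longrightarrow> h = 0" "toep (conj_fun om ^ n * u) ` Hp q = Hp q"
proof -
  define w where "w = tvar powi (- 1) * \<xi>"
  have cw: "conj_fun w = tvar * conj_fun \<xi>"
    unfolding w_def conj_fun_mult conj_tvar_powi by simp
  have wI: "conj_fun w \<in> Hinf"
  proof -
    have "conj_fun w \<in> Linf" unfolding cw by (intro Linf_mult) auto
    moreover have "fourier (conj_fun w) n = 0" if "n < 0" for n
      unfolding cw conj_chi using that fourier_tvar_powi[of 0 n] fourier_tvar_powi[of 1 n]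
      by (subst fourier_diff) (auto simp: fourier_cscale intro!: cscale_in_Lp Linf_in_Lp[OF tvar_Linf])
    ultimately show ?thesis by (simp add: Hinf_def)
  qed
  have ow: "conj_fun om * w = 1"
  proof -
    have "conj_fun om * w = (tvar * inverse tvar) * (\<xi> * inverse \<xi>)"
      unfolding conj_om w_def by (simp add: mult_ac)
    thus ?thesis by (simp only: tvar_inverse chi_inverse mult_1)
  qed
  have own: "conj_fun om ^ n * w ^ n = 1" "w ^ n * conj_fun om ^ n = 1"
    using ow by (simp_all add: power_mult_distrib[symmetric] mult.commute)
  have oA: "conj_fun (conj_fun om ^ n) \<in> Hinf" "conj_fun (w ^ n) \<in> Hinf"
    using Hinf_power[OF om_Hinf, of n] Hinf_power[OF wI, of n] by (simp_all add: conj_simps)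
  have oL: "conj_fun om ^ n \<in> Linf" "w ^ n \<in> Linf"
    using oA[THEN Hinf_Linf] by simp_all
  have T1: "toep (conj_fun om ^ n) (toep u h) = toep (conj_fun om ^ n * u) h" if "h \<in> Hp q" for h
    by (rule toep_mult_anti[OF q oA(1) u Hp_Lp[OF that]])
  have T2: "toep (w ^ n) (toep (conj_fun om ^ n) h) = h" if "h \<in> Hp q" for h
    using toep_mult_anti[OF q oA(2) oL(1) Hp_Lp[OF that]] own(2) toep_1[OF q that] by simp
  have T3: "toep (conj_fun om ^ n) (toep (w ^ n) h) = h" if "h \<in> Hp q" for h
    using toep_mult_anti[OF q oA(1) oL(2) Hp_Lp[OF that]] own(1) toep_1[OF q that] by simp
  have uH: "toep u h \<in> Hp q" if "h \<in> Hp q" for h using that by (intro toep_Hp q u Hp_Lp)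
  show "h = 0" if "h \<in> Hp q" "toep (conj_fun om ^ n * u) h = 0" for h
  proof (rule bij(1)[OF that(1)])
    have "toep (w ^ n) (toep (conj_fun om ^ n) (toep u h)) = 0" using T1[OF that(1)] that(2) by simp
    thus "toep u h = 0" using T2[OF uH[OF that(1)]] by simp
  qed
  show "toep (conj_fun om ^ n * u) ` Hp q = Hp q"
  proof safe
    fix h assume "h \<in> Hp q"
    thus "toep (conj_fun om ^ n * u) h \<in> Hp q" by (intro toep_Hp q Linf_mult oL u Hp_Lp)
  next
    fix g assume g: "g \<in> Hp q"
    have "toep (w ^ n) g \<in> Hp q" using g by (intro toep_Hp q oL Hp_Lp)
    then obtain h where h: "h \<in> Hp q" "toep (w ^ n) g = toep u h" using bij(2) by (metis (no_types, lifting) imageE)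
    have "toep (conj_fun om ^ n * u) h = g" using T1[OF h(1)] T3[OF g] h(2) by simp
    thus "g \<in> toep (conj_fun om ^ n * u) ` Hp q" using h(1) by (metis imageI)
  qed
qed

end

text \<open>Write T(c) = T(t^-j) T(c t^j) with a bijective second factor. So T(c) is onto, its
  kernel is the preimage of the kernel of T(t^-j), and its index is j.\<close>

lemma toep_rinv_properties:
  assumes pq: "conj_exps p q" and c: "c \<in> Linf" and j: "j \<le> 1"
    and inj: "\<And>h. h \<in> Hp q \<Longrightarrow> toep (c * tvar powi int j) h = 0 \<Longrightarrow> h = 0"
    and onto: "toep (c * tvar powi int j) ` Hp q = Hp q"
  shows "\<forall>u\<in>Hp q. toep_rinv q c u \<in> Hp q \<and> toep c (toep_rinv q c u) = u" "toep_rinv q c 0 = 0"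
    "j = 0 \<Longrightarrow> f \<in> ker_op q (toep c) \<Longrightarrow> f = 0"
    "\<exists>x. \<forall>f\<in>ker_op q (toep c). \<exists>z. f = cscale z x"
proof -
  have p: "p > 1" "q > 1" and q1: "q > 0" "q \<ge> 1" using pq by (auto simp: conj_exps_def)
  note qp = conj_exps_sym[OF pq]
  define X where "X = c * tvar powi int j"
  define ti where "ti = tvar powi (- int j)"
  have XL: "X \<in> Linf" unfolding X_def by (rule Linf_mult[OF c tvar_powi_Linf])
  have ti: "conj_fun ti \<in> Hinf" "ti \<in> Linf" unfolding ti_def by (simp_all only: conj_tvar_powi minus_minus tvar_powi_Linf) (rule Hinf_tvar_powi, simp)
  have tt: "tvar powi int j * ti = 1" unfolding ti_def by (rule circ_powi_inv[OF tvar_inverse])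
  have "ti * X = c * (tvar powi int j * ti)" unfolding X_def by (simp only: mult_ac)
  hence tX: "ti * X = c" by (simp only: tt mult_1_right)
  have cX: "toep c h = toep ti (toep X h)" if "h \<in> Hp q" for h
    using toep_mult_anti[OF p(2) ti(1) XL Hp_Lp[OF that]] by (simp add: tX)
  have up: "tvar powi int j * u \<in> Hp q" "toep (tvar powi int j) u = tvar powi int j * u"
    "toep ti (tvar powi int j * u) = u" if "u \<in> Hp q" for u
  proof -
    have tI: "tvar powi int j \<in> Hinf" by (rule Hinf_tvar_powi) simp
    show "tvar powi int j * u \<in> Hp q" by (rule Hinf_mult_Hp[OF p(2) tI that])
    show "toep (tvar powi int j) u = tvar powi int j * u" by (rule toep_Hinf[OF p(2) tI that])
    have "ti * (tvar powi int j * u) = (tvar powi int j * ti) * u" by (simp only: mult_ac)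
    thus "toep ti (tvar powi int j * u) = u" unfolding toep_def tt using Pproj_id[OF q1(2) that] by simp
  qed
  have XH: "toep X h \<in> Hp q" if "h \<in> Hp q" for h using that by (intro toep_Hp p XL Hp_Lp)
  have inj': "h1 = h2" if "h1 \<in> Hp q" "h2 \<in> Hp q" "toep X h1 = toep X h2" for h1 h2
  proof -
    have "h1 - h2 = 0"
    proof (rule inj)
      show "h1 - h2 \<in> Hp q" by (rule Hp_diff[OF q1(2) that(1,2)])
      show "toep (c * tvar powi int j) (h1 - h2) = 0"
        unfolding X_def[symmetric] using that by (simp add: toep_diff[OF p(2) XL] Hp_Lp)
    qed
    thus ?thesis by simp
  qed
  have io: "inj_on (toep X) (Hp q)" by (rule inj_onI) (rule inj')
  define V where "V = inv_into (Hp q) (toep X)"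
  have V: "V u \<in> Hp q" "toep X (V u) = u" if "u \<in> Hp q" for u
    unfolding V_def using that onto[folded X_def] by (auto intro: inv_into_into f_inv_into_f)
  have "coker_op q (toep c) = {0}"
  proof -
    have "f = 0" if f: "f \<in> ker_op p (toep (conj_fun c))" for f
    proof (rule Hp_annihilator_0[OF qp])
      show fH: "f \<in> Hp p" using f by (simp add: ker_op_def)
      show "pairing u f = 0" if u: "u \<in> Hp q" for u
      proof -
        have "toep c (V (tvar powi int j * u)) = u"
          using cX[OF V(1)[OF up(1)[OF u]]] V(2)[OF up(1)[OF u]] up(3)[OF u] by simp
        hence "pairing u f = pairing (V (tvar powi int j * u)) (toep (conj_fun c) f)"
          using toep_adjoint[OF qp c V(1)[OF up(1)[OF u]] fH] by simp
        thus ?thesis using f by (simp add: ker_op_def)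
      qed
    qed
    thus ?thesis unfolding coker_toep[OF qp c] by (auto simp: ker_op_def)
  qed
  hence ck: "circ.dim (coker_op q (toep c)) = 0" by (simp only: circ_dim_0)
  show k0: "f = 0" if "j = 0" "f \<in> ker_op q (toep c)" for f
    using inj[of f] that by (simp add: ker_op_def)
  define x where "x = V 1"
  have oneH: "1 \<in> Hp q" using Hinf_Hp[OF Hinf_1 q1(1)] .
  have kx: "\<exists>z. f = cscale z x" if f: "f \<in> ker_op q (toep c)" for f
  proof (cases "j = 0")
    case True
    hence "f = cscale 0 x" using k0[OF True f] by simp
    thus ?thesis ..
  next
    case False
    hence j1: "j = 1" using j by simp
    have fH: "f \<in> Hp q" and f0: "toep ti (toep X f) = 0" using f cX by (auto simp: ker_op_def)
    define y where "y = toep X f"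
    have yH: "y \<in> Hp q" unfolding y_def by (rule XH[OF fH])
    have tiy: "ti * y = y * tvar powi (- 1)" by (simp add: ti_def j1 mult.commute)
    have "fourier (ti * y) n = 0" if "n \<ge> 0" for n
      using ker_toep_iff[OF p(2) ti(2), of y] f0 yH that by (simp add: ker_op_def y_def)
    hence sh: "fourier y (n + 1) = 0" if "n \<ge> 0" for n
      using that unfolding tiy fourier_shift by simp
    have "y = cscale (fourier y 0) 1"
    proof (rule fourier_unique)
      show "y \<in> Lp 1" by (rule Lp_mono[OF Hp_Lp[OF yH] q1(2)])
      show "cscale (fourier y 0) 1 \<in> Lp 1" by (intro cscale_in_Lp) simp
      show "fourier y n = fourier (cscale (fourier y 0) 1) n" for n
        using sh[of "n - 1"] Hp_fourier[OF yH, of n] fourier_tvar_powi[of 0 n]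
        by (cases n "0::int" rule: linorder_cases) (auto simp: fourier_cscale)
    qed
    also have "\<dots> = toep X (cscale (fourier y 0) x)"
      using V[OF oneH] by (simp add: toep_cscale[OF p(2) XL] Hp_Lp x_def)
    finally have ye: "toep X f = toep X (cscale (fourier y 0) x)" by (simp only: y_def)
    have "cscale (fourier y 0) x \<in> Hp q" using V(1)[OF oneH] by (simp add: x_def Hp_cscale)
    hence "f = cscale (fourier y 0) x" by (rule inj'[OF fH _ ye])
    thus ?thesis ..
  qed
  thus "\<exists>x. \<forall>f\<in>ker_op q (toep c). \<exists>z. f = cscale z x" by blast
  have dk: "circ.dim (ker_op q (toep c)) = j"
  proof (cases "j = 0")
    case True
    have "0 \<in> ker_op q (toep c)" by (simp add: ker_op_def)
    hence "ker_op q (toep c) = {0}" using k0[OF True] by blast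
    thus ?thesis unfolding True by (simp only: circ_dim_0)
  next
    case False
    hence j1: "j = 1" using j by simp
    have xH: "x \<in> Hp q" "toep X x = 1" using V[OF oneH] by (simp_all add: x_def)
    have x0: "x \<noteq> 0" using xH(2) by auto
    have "toep ti 1 = 0"
      unfolding toep_def mult_1_right ti_def j1 by (rule Pproj_eq_0) (subst fourier_tvar_powi, simp)
    hence xk: "x \<in> ker_op q (toep c)" using xH cX[OF xH(1)] by (simp add: ker_op_def)
    show ?thesis unfolding j1
    proof (rule circ.dim_unique[of "{x}"])
      show "ker_op q (toep c) \<subseteq> circ.span {x}"
      proof
        fix f assume "f \<in> ker_op q (toep c)"
        then obtain z where "f = cscale z x" using kx by blast
        thus "f \<in> circ.span {x}" by (simp add: circ.span_scale circ.span_base)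
      qed
      show "circ.independent {x}" using x0 by (simp add: circ.dependent_single)
    qed (use xk in auto)
  qed
  \<comment> \<open>\<open>toep_rinv\<close> shifts by the index, so only now can it be identified
    with V T(t^j).\<close>
  have ind: "ind q (toep c) = int j" by (simp add: ind_def ck dk)
  have rinv: "toep_rinv q c u = V (toep (tvar powi int j) u)" for u
    by (simp only: toep_rinv_def Let_def ind toep_inv_def V_def X_def)
  show "\<forall>u\<in>Hp q. toep_rinv q c u \<in> Hp q \<and> toep c (toep_rinv q c u) = u"
  proof
    fix u assume u: "u \<in> Hp q"
    show "toep_rinv q c u \<in> Hp q \<and> toep c (toep_rinv q c u) = u"
      unfolding rinv up(2)[OF u] using V[OF up(1)[OF u]] cX[OF V(1)[OF up(1)[OF u]]] up(3)[OF u] by simp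
  qed
  have "V (toep X 0) = 0" unfolding V_def by (rule inv_into_f_f[OF io Hp_0])
  thus "toep_rinv q c 0 = 0" unfolding rinv by simp
qed

context alpha_shift
begin

text \<open>The eigenvalue of \<open>P\<^sub>\<alpha>(c)\<close> on the one-dimensional kernel of \<open>T(c)\<close> is the signature:
  both sides of \<open>J(c f) = \<epsilon> f\<close> are evaluated at \<open>1 / cnj \<beta>\<close>, the image of infinity under \<open>\<alpha>\<close>.\<close>

lemma signature_eigenvalue:
  assumes pq: "conj_exps p q" and wh: "wh_fact q g (- int k) gm gp"
    and cdef: "c = g * inverse \<xi> ^ Suc k" and c: "c \<in> Linf" "c * cpa c = 1"
    and one: "\<And>f. f \<in> ker_op q (toep c) \<Longrightarrow> \<exists>z. f = cscale z x"
  shows "inverse gp \<in> ker_op q (toep c)" "inverse gp \<noteq> 0"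
    "J (c * inverse gp) = cscale (alpha_sig q \<beta> g) (inverse gp)" "alpha_sig q \<beta> g * alpha_sig q \<beta> g = 1"
proof -
  note qp = conj_exps_sym[OF pq]
  note dq = conj_exps_dual[OF qp]
  have p: "p > 1" "q > 1" "q > 0" using pq by (auto simp: conj_exps_def)
  have W: "g = gm * tvar powi int k * gp" "fourier gm 0 = 1" "gp * inverse gp = 1"
    "inverse gp \<in> Hp q" "gm \<in> Hp_bar q"
    using wh by (auto simp: wh_fact_def dq)
  define f where "f = inverse gp"
  have fH: "f \<in> Hp q" using W by (simp add: f_def)
  show f0: "inverse gp \<noteq> 0" using W(3) by auto
  \<comment> \<open>Of the k + 1 factors \<chi>^-1, k combine with t^k to a power of the
    antianalytic function t \<chi>^-1; the last one, the conjugate of \<open>hh\<close>, supplies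
    mean 0.\<close>
  have "c * f = (gp * inverse gp) * (gm * (tvar ^ k * inverse \<xi> ^ k) * inverse \<xi>)"
    unfolding cdef W(1) f_def by (simp add: mult_ac)
  also have "tvar ^ k * inverse \<xi> ^ k = conj_fun om ^ k" by (simp only: conj_om power_mult_distrib)
  finally have cf: "c * f = gm * conj_fun om ^ k * inverse \<xi>" by (simp only: W(3) mult_1)
  have cfz: "fourier (c * f) n = 0" if n: "n \<ge> 0" for n
  proof -
    have e1: "conj_fun (c * f) = conj_fun gm * (om ^ k * hh)" by (simp add: cf conj_simps hh_def mult_ac)
    have oh: "om ^ k * hh \<in> Hinf" by (intro Hinf_mult Hinf_power om_Hinf hh_Hinf)
    have "fourier (om ^ k * hh) 0 = 0"
      by (simp add: fourier_Hinf_mult_0 Hinf_power om_Hinf hh_Hinf fourier_hh_nonpos)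
    hence oz: "fourier (om ^ k * hh) i = 0" if "i < 1" for i
      using that oh by (cases "i = 0") (auto simp: Hinf_def)
    have "conj_fun gm \<in> Hp q" using W(5) by (simp only: Hp_bar_iff)
    moreover have "om ^ k * hh \<in> Lp p" using oh p by (intro Linf_in_Lp) (auto simp: Hinf_def)
    ultimately have "fourier (conj_fun gm * (om ^ k * hh)) (- n) = 0"
      by (rule Hp_Hq_mult(2)[OF qp, where m = 1, OF _ _ oz]) (use n in simp_all)
    hence "fourier (conj_fun (c * f)) (- n) = 0" by (simp only: e1)
    thus ?thesis by (simp add: fourier_conj)
  qed
  show fk: "inverse gp \<in> ker_op q (toep c)"
    using fH cfz by (simp add: ker_toep_iff[OF p(2) c(1)] f_def)
  have cfL: "c * f \<in> Lp q" by (rule Linf_mult_in_Lp[OF c(1) Hp_Lp[OF fH] p(3)])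
  have JH: "J (c * f) \<in> Hp q" by (rule J_Q[OF p(2) cfL cfz])
  have cJ: "c * J (c * f) = J f" unfolding J_mult mult.assoc[symmetric] c(2) by simp
  have "J (c * f) \<in> ker_op q (toep c)"
    using JH J_Hp[OF p(2) fH] by (simp add: ker_toep_iff[OF p(2) c(1)] cJ)
  then obtain z1 where z1: "J (c * f) = cscale z1 x" using one by blast
  obtain z2 where z2: "f = cscale z2 x" using one[OF fk] by (auto simp: f_def)
  have z2n: "z2 \<noteq> 0" using f0 z2 by (auto simp: f_def)
  \<comment> \<open>f -> J (c f) is an involution of the kernel. On a line it acts as a scalar with
    square 1.\<close>
  define \<epsilon> where "\<epsilon> = z1 / z2"
  have "cscale \<epsilon> f = cscale z1 x" by (subst z2) (simp add: \<epsilon>_def z2n)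
  hence ev: "J (c * f) = cscale \<epsilon> f" by (simp only: z1)
  have "f = J (c * J (c * f))" by (simp add: cJ)
  also have "\<dots> = cscale (\<epsilon> * \<epsilon>) f" unfolding ev cscale_mult_right J_cscale by simp
  finally have "cscale 1 f = cscale (\<epsilon> * \<epsilon>) f" by (simp only: cscale_1)
  hence ee: "\<epsilon> * \<epsilon> = 1" using f0 cscale_inj[of f 1 "\<epsilon> * \<epsilon>"] by (simp add: f_def del: cscale_1)
  have JL: "J (c * f) \<in> Lp 1" using Lp_mono[OF Hp_Lp[OF JH]] p by simp
  have fL: "f \<in> Lp 1" using Lp_mono[OF Hp_Lp[OF fH]] p by simp
  have "(L / cnj \<beta>) ^ k = disc_ext (J (c * f)) (1 / cnj \<beta>)"
    by (rule disc_ext_Jc[OF pq W(5,2) fH cf JL, symmetric])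
  also have "\<dots> = \<epsilon> * disc_ext f (1 / cnj \<beta>)"
    unfolding disc_ext_chi[OF JL] disc_ext_chi[OF fL]
    by (simp add: ev cscale_mult_right fourier_cscale)
  finally have de: "disc_ext f (1 / cnj \<beta>) = \<epsilon> * (L / cnj \<beta>) ^ k"
    using ee by (simp add: mult.assoc[symmetric])
  have Lk: "(L / cnj \<beta>) powi (- int k) * (L / cnj \<beta>) ^ k = 1"
    using L_nz \<beta>_nz by (simp add: power_int_minus field_simps)
  have "alpha_sig q \<beta> g = \<epsilon>"
    unfolding alpha_sig_def
  proof (rule the_equality)
    have "\<epsilon> = (L / cnj \<beta>) powi (- int k) * disc_ext (inverse gp) (1 / cnj \<beta>)"
      unfolding f_def[symmetric] de using Lk by (simp only: mult.left_commute[of _ \<epsilon>] mult_1_right)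
    thus "\<exists>n gm gp. wh_fact q g n gm gp \<and> \<epsilon> = (L / cnj \<beta>) powi n * disc_ext (inverse gp) (1 / cnj \<beta>)"
      using wh by blast
    fix \<sigma> assume "\<exists>n gm gp. wh_fact q g n gm gp \<and> \<sigma> = (L / cnj \<beta>) powi n * disc_ext (inverse gp) (1 / cnj \<beta>)"
    then obtain n' gm' gp' where w: "wh_fact q g n' gm' gp'" "\<sigma> = (L / cnj \<beta>) powi n' * disc_ext (inverse gp') (1 / cnj \<beta>)"
      by blast
    have "n' = - int k" "gp' = gp" using wh_fact_unique[OF pq w(1) wh] by auto
    thus "\<sigma> = \<epsilon>" using w(2) de Lk unfolding f_def[symmetric] by (simp only: mult.left_commute[of _ \<epsilon>] mult_1_right f_def[symmetric])
  qed
  thus "J (c * inverse gp) = cscale (alpha_sig q \<beta> g) (inverse gp)" "alpha_sig q \<beta> g * alpha_sig q \<beta> g = 1"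
    using ev ee by (simp_all add: f_def)
qed

section \<open>Passage to the adjoint pair and shift by powers of \<chi>\<close>

lemma coker_toep_hank:
  assumes pq: "conj_exps p q" and a: "a \<in> Linf" and b: "b \<in> Linf" and s: "cnj s = s"
  shows "coker_op p (\<lambda>f. toep a f + cscale s (hank \<beta> b f)) =
    ker_op q (\<lambda>g. toep (conj_fun a) g + cscale s (hank \<beta> (conj_fun (cpa b)) g))"
proof (rule coker_opI[OF pq])
  have p: "p > 1" "q > 1" "p \<ge> 1" "q \<ge> 1" using pq by (auto simp: conj_exps_def)
  have bL: "conj_fun (cpa b) \<in> Linf" using cpa_Linf[OF b] by simp
  have aL: "conj_fun a \<in> Linf" using a by simp
  have Hq: "toep (conj_fun a) g \<in> Hp q" "hank \<beta> (conj_fun (cpa b)) g \<in> Hp q" if "g \<in> Hp q" for g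
    using that by (auto intro: toep_Hp[OF p(2) aL] hank_Hp[OF p(2) bL] Hp_Lp)
  have Hp: "toep a f \<in> Hp p" "hank \<beta> b f \<in> Hp p" if "f \<in> Hp p" for f
    using that by (auto intro: toep_Hp[OF p(1) a] hank_Hp[OF p(1) b] Hp_Lp)
  show "toep (conj_fun a) g + cscale s (hank \<beta> (conj_fun (cpa b)) g) \<in> Hp q" if "g \<in> Hp q" for g
    using Hq[OF that] by (intro Hp_add[OF p(4)] Hp_cscale)
  fix f g assume f: "f \<in> Hp p" and g: "g \<in> Hp q"
  have "pairing (toep a f + cscale s (hank \<beta> b f)) g = pairing (toep a f) g + s * pairing (hank \<beta> b f) g"
    using pairing_add_left[OF pq Hp_Lp[OF Hp(1)[OF f]] cscale_in_Lp[OF Hp_Lp[OF Hp(2)[OF f]]] Hp_Lp[OF g]]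
    by (simp add: pairing_cscale_left)
  also have "\<dots> = pairing f (toep (conj_fun a) g) + pairing f (cscale s (hank \<beta> (conj_fun (cpa b)) g))"
    by (simp add: toep_adjoint[OF pq a f g] hank_adjoint[OF pq b f g] pairing_cscale_right s)
  also have "\<dots> = pairing f (toep (conj_fun a) g + cscale s (hank \<beta> (conj_fun (cpa b)) g))"
    using pairing_add_right[OF pq Hp_Lp[OF f] Hp_Lp[OF Hq(1)[OF g]] cscale_in_Lp[OF Hp_Lp[OF Hq(2)[OF g]]]] by simp
  finally show "pairing (toep a f + cscale s (hank \<beta> b f)) g = \<dots>" .
qed

lemma chi_powi: "\<xi> powi int m = \<xi> ^ m" "\<xi> powi (- int m) = inverse \<xi> ^ m"
  by (simp_all add: power_int_def)

lemma chi_power_inverse: "\<xi> ^ m * inverse \<xi> ^ m = 1" "inverse \<xi> ^ m * \<xi> ^ m = 1"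
  unfolding power_mult_distrib[symmetric] using chi_inverse by (simp_all add: mult.commute)

lemma inverse_power_circ: "inverse (f ^ m) = inverse f ^ m" for f :: circfun
  by (induction m) (simp_all add: circ_inverse_mult)

text \<open>T(\<chi>^m) is multiplication, with left inverse T(\<chi>^-m), and J (\<chi>^m f) =
  \<chi>^-m J f. The two modified symbols therefore undo the multiplication in both
  summands.\<close>

lemma ker_op_chi:
  assumes q: "1 < q"
  shows "ker_op q (\<lambda>g. toep u g + cscale s (hank \<beta> v g)) = toep (inverse \<xi> ^ m) `
    (ker_op q (\<lambda>g. toep (u * inverse \<xi> ^ m) g + cscale s (hank \<beta> (v * \<xi> ^ m) g)) \<inter> toep (\<xi> ^ m) ` Hp q)"
    (is "?K = toep ?Y ` (?K' \<inter> toep ?X ` Hp q)")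
proof -
  have XI: "?X \<in> Hinf" by (rule Hinf_power[OF chi_Hinf])
  have t: "toep ?X f = ?X * f" "?X * f \<in> Hp q" if "f \<in> Hp q" for f
    using toep_Hinf[OF q XI that] Hinf_mult_Hp[OF q XI that] .
  have YX: "toep ?Y (toep ?X f) = f" if "f \<in> Hp q" for f
  proof -
    have "?Y * (?X * f) = f" by (simp only: mult.assoc[symmetric] chi_power_inverse mult_1)
    thus ?thesis unfolding t(1)[OF that] toep_def[of ?Y] using Pproj_id[OF _ that] q by simp
  qed
  have op: "toep (u * ?Y) (toep ?X f) + cscale s (hank \<beta> (v * ?X) (toep ?X f)) = toep u f + cscale s (hank \<beta> v f)"
    if f: "f \<in> Hp q" for f
  proof -
    have "u * ?Y * (?X * f) = (?Y * ?X) * (u * f)" by (simp only: mult_ac)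
    hence 1: "toep (u * ?Y) (?X * f) = toep u f" by (simp only: toep_def chi_power_inverse mult_1)
    have "v * ?X * J (?X * f) = (?X * ?Y) * (v * J f)"
      unfolding J_mult cpa_power cpa_chi by (simp only: mult_ac)
    hence "hank \<beta> (v * ?X) (?X * f) = hank \<beta> v f"
      unfolding hank_eq[OF q t(2)[OF f]] hank_eq[OF q f] by (simp only: chi_power_inverse mult_1)
    thus ?thesis by (simp only: t(1)[OF f] 1)
  qed
  have iff: "toep ?X f \<in> ?K' \<longleftrightarrow> f \<in> ?K" if "f \<in> Hp q" for f
    using that t(2)[OF that] unfolding ker_op_def mem_Collect_eq op[OF that] by (simp add: t(1)[OF that])
  show ?thesis
  proof
    show "?K \<subseteq> toep ?Y ` (?K' \<inter> toep ?X ` Hp q)"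
    proof
      fix f assume f: "f \<in> ?K"
      hence fH: "f \<in> Hp q" by (simp add: ker_op_def)
      show "f \<in> toep ?Y ` (?K' \<inter> toep ?X ` Hp q)"
      proof (rule image_eqI)
        show "f = toep ?Y (toep ?X f)" by (rule YX[OF fH, symmetric])
        show "toep ?X f \<in> ?K' \<inter> toep ?X ` Hp q" using iff[OF fH] f fH by blast
      qed
    qed
    show "toep ?Y ` (?K' \<inter> toep ?X ` Hp q) \<subseteq> ?K"
    proof
      fix x assume "x \<in> toep ?Y ` (?K' \<inter> toep ?X ` Hp q)"
      then obtain f where f: "f \<in> Hp q" "toep ?X f \<in> ?K'" "x = toep ?Y (toep ?X f)" by blast
      thus "x \<in> ?K" using iff YX by simp
    qed
  qed
qed

text \<open>Because \<chi> \<chi>_\<alpha> = 1, the powers of \<chi> cancel in the products of the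
  new symbols with their shifts, leaving the conjugated matching condition.\<close>

lemma adjoint_pair:
  fixes m :: nat
  assumes "matching_pair \<beta> a b"
  defines "a1 \<equiv> conj_fun a * inverse \<xi> ^ m" and "b1 \<equiv> conj_fun (cpa b) * \<xi> ^ m"
  shows "matching_pair \<beta> a1 b1" "sub_c a1 b1 = conj_fun (sub_d \<beta> a b) * inverse \<xi> ^ (2 * m)"
    "sub_d \<beta> a1 b1 = conj_fun (sub_c a b)"
proof -
  note abD = matching_pairD[OF assms(1)]
  have cX: "cpa (\<xi> ^ m) = inverse \<xi> ^ m" "cpa (inverse \<xi> ^ m) = \<xi> ^ m"
    by (simp_all add: cpa_power cpa_chi cpa_inverse)
  have iL: "inverse \<xi> \<in> Linf" by simp
  have PL: "inverse \<xi> ^ m \<in> Linf" "\<xi> ^ m \<in> Linf"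
    using Linf_power[OF iL] Linf_power[OF chi_Linf] by auto
  show "matching_pair \<beta> a1 b1"
    unfolding matching_pair_def invertible_Linf_def
  proof (intro conjI bexI[of _ "conj_fun (inverse a) * \<xi> ^ m"])
    show "a1 \<in> Linf" "a1 \<in> Linf" "b1 \<in> Linf" "conj_fun (inverse a) * \<xi> ^ m \<in> Linf"
      unfolding a1_def b1_def using abD(1-4) PL cpa_Linf[OF abD(2)] by (auto intro!: Linf_mult)
    have "a1 * (conj_fun (inverse a) * \<xi> ^ m) = conj_fun (a * inverse a) * (inverse \<xi> ^ m * \<xi> ^ m)"
      unfolding a1_def conj_fun_mult by (simp only: mult_ac)
    thus "a1 * (conj_fun (inverse a) * \<xi> ^ m) = 1" by (simp only: abD(5) chi_power_inverse conj_fun_1 mult_1)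
    have "a1 * cpa a1 = conj_fun (a * cpa a) * (inverse \<xi> ^ m * \<xi> ^ m)"
      unfolding a1_def cpa_mult cX conj_fun_mult cpa_conj by (simp only: mult_ac)
    also have "\<dots> = b1 * cpa b1"
      unfolding b1_def cpa_mult cX conj_fun_mult cpa_conj cpa_cpa abD(7) by (simp only: mult_ac)
    finally show "a1 * cpa a1 = b1 * cpa b1" .
  qed
  note ca = cpa_nz[OF abD(5)] and cb = cpa_nz[OF abD(6)]
  \<comment> \<open>The matching condition gives d = a (b_\<alpha>)^-1 here and c = b_\<alpha>
    (a_\<alpha>)^-1 below; in this form both appear in the new subordinated pair.\<close>
  have "b * inverse (cpa a) = (cpa b * inverse (cpa b)) * (b * inverse (cpa a))" by (simp only: cb mult_1)
  also have "\<dots> = (b * cpa b) * (inverse (cpa a) * inverse (cpa b))" by (simp only: mult_ac)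
  also have "\<dots> = (cpa a * inverse (cpa a)) * (a * inverse (cpa b))" unfolding abD(7)[symmetric] by (simp only: mult_ac)
  finally have 1: "b * inverse (cpa a) = a * inverse (cpa b)" by (simp only: ca mult_1)
  have "cpa b * inverse (cpa a) = (b * inverse b) * (cpa b * inverse (cpa a))" by (simp only: abD(6) mult_1)
  also have "\<dots> = (b * cpa b) * (inverse (cpa a) * inverse b)" by (simp only: mult_ac)
  also have "\<dots> = (cpa a * inverse (cpa a)) * (a * inverse b)" unfolding abD(7)[symmetric] by (simp only: mult_ac)
  finally have 2: "cpa b * inverse (cpa a) = a * inverse b" by (simp only: ca mult_1)
  have "sub_c a1 b1 = conj_fun (a * inverse (cpa b)) * (inverse \<xi> ^ m * inverse \<xi> ^ m)"
    unfolding sub_c_def a1_def b1_def circ_inverse_mult inverse_power_circ conj_fun_mult conj_fun_inverse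
    by (simp only: mult_ac)
  also have "inverse \<xi> ^ m * inverse \<xi> ^ m = inverse \<xi> ^ (2 * m)" by (simp only: mult_2 power_add)
  finally show "sub_c a1 b1 = conj_fun (sub_d \<beta> a b) * inverse \<xi> ^ (2 * m)" by (simp only: sub_d_def 1)
  have "sub_d \<beta> a1 b1 = (\<xi> ^ m * inverse \<xi> ^ m) * conj_fun (cpa b * inverse (cpa a))"
    unfolding sub_d_def a1_def b1_def cpa_mult cX circ_inverse_mult inverse_power_circ cpa_conj conj_fun_mult conj_fun_inverse
    by (simp only: mult_ac)
  thus "sub_d \<beta> a1 b1 = conj_fun (sub_c a b)" by (simp only: 2 chi_power_inverse mult_1 sub_c_def)
qed

lemma eigsp_ker_toep: "1 < q \<Longrightarrow> c \<in> Linf \<Longrightarrow> f \<in> eigsp q z c \<Longrightarrow> f \<in> ker_op q (toep c)"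
  by (auto simp: eigsp_def ker_toep_iff fourier_cscale J_Hp)

text \<open>J (c f0) = \<sigma> f0, so the line through f0 is the (-s)-eigenspace exactly when
  \<sigma> = -s. The factor (1 - s \<sigma>) / 2 is then 1, and otherwise 0.\<close>

lemma eigsp_one_dimensional:
  assumes q: "1 < q" and c: "c \<in> Linf" and f0: "f0 \<in> Hp q" "f0 \<noteq> 0" "J (c * f0) = cscale \<sigma> f0"
    and \<sigma>: "\<sigma> \<in> {1, -1}" and s: "s \<in> {1, -1}"
    and one: "\<And>f. f \<in> ker_op q (toep c) \<Longrightarrow> \<exists>z. f = cscale z f0"
  shows "eigsp q (- s) c = {cscale ((1 - s * \<sigma>) / 2 * w) f0 | w. True}"
proof -
  have cf: "c * f0 = cscale \<sigma> (J f0)" using arg_cong[OF f0(3), of J] by (simp add: J_cscale)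
  have J0: "J f0 \<noteq> 0"
  proof
    assume "J f0 = 0"
    hence "J (J f0) = 0" by (simp only: J_0)
    thus False using f0(2) by (simp only: J_J)
  qed
  have iff: "cscale z f0 \<in> eigsp q (- s) c \<longleftrightarrow> z = 0 \<or> \<sigma> = - s" for z
  proof -
    have "cscale z f0 \<in> eigsp q (- s) c \<longleftrightarrow> cscale (z * \<sigma>) (J f0) = cscale (- s * z) (J f0)"
      using f0(1) by (simp add: eigsp_def cf cscale_mult_right J_cscale Hp_cscale)
    also have "\<dots> \<longleftrightarrow> z * \<sigma> = - s * z" by (rule cscale_inj[OF J0])
    also have "- s * z = z * - s" by simp
    finally show ?thesis unfolding mult_cancel_left .
  qed
  show ?thesis
  proof
    show "{cscale ((1 - s * \<sigma>) / 2 * w) f0 | w. True} \<subseteq> eigsp q (- s) c"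
    proof
      fix f assume "f \<in> {cscale ((1 - s * \<sigma>) / 2 * w) f0 | w. True}"
      then obtain w where f: "f = cscale ((1 - s * \<sigma>) / 2 * w) f0" by blast
      have "(1 - s * \<sigma>) / 2 * w = 0 \<or> \<sigma> = - s" using s \<sigma> by auto
      thus "f \<in> eigsp q (- s) c" by (simp only: f iff)
    qed
    show "eigsp q (- s) c \<subseteq> {cscale ((1 - s * \<sigma>) / 2 * w) f0 | w. True}"
    proof
      fix f assume f: "f \<in> eigsp q (- s) c"
      obtain z where z: "f = cscale z f0" using one[OF eigsp_ker_toep[OF q c f]] by blast
      have "z = 0 \<or> \<sigma> = - s" using f by (simp only: z iff)
      hence "z = (1 - s * \<sigma>) / 2 * z" using s by auto
      hence "f = cscale ((1 - s * \<sigma>) / 2 * z) f0" unfolding z by (rule arg_cong)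
      thus "f \<in> {cscale ((1 - s * \<sigma>) / 2 * w) f0 | w. True}" by blast
    qed
  qed
qed

text \<open>The part common to both parities. Here j = 2 m - k is the index of T(c1) on H^q, and
  only the eigenspace of c1 is left to be described.\<close>

lemma coker_decomposition:
  fixes a b d s and m :: nat
  assumes pq: "conj_exps p q" and ab: "matching_pair \<beta> a b" and d: "d = sub_d \<beta> a b"
    and fr: "fredholm p (toep d)" and ind: "ind p (toep d) = int k" and k: "k \<ge> 1"
    and j: "2 * m = k + j" "j \<le> 1" and s: "s \<in> {1, -1}"
  defines "c1 \<equiv> conj_fun d * inverse \<xi> ^ (2 * m)"
    and "V \<equiv> phi q \<beta> s (conj_fun a * \<xi> powi (- int m)) (conj_fun (cpa b) * \<xi> powi int m) ` im_Pa_s q \<beta> s (conj_fun (sub_c a b))"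
  shows "coker_op p (\<lambda>f. toep a f + cscale s (hank \<beta> b f)) =
      toep (\<xi> powi (- int m)) ` (set_sum (eigsp q (- s) c1) V \<inter> toep (\<xi> powi int m) ` Hp q)"
    "eigsp q (- s) c1 \<inter> V = {0}" "c1 \<in> Linf" "c1 * cpa c1 = 1" "invertible_Linf d"
    "j = 0 \<Longrightarrow> f \<in> ker_op q (toep c1) \<Longrightarrow> f = 0"
    "\<exists>x. \<forall>f\<in>ker_op q (toep c1). \<exists>z. f = cscale z x"
proof -
  have p: "p > 1" "q > 1" using pq by (auto simp: conj_exps_def)
  define a1 b1 where "a1 = conj_fun a * inverse \<xi> ^ m" and "b1 = conj_fun (cpa b) * \<xi> ^ m"
  note ap = adjoint_pair[OF ab, of m, folded a1_def b1_def d]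
  have ss: "s * s = 1" "cnj s = s" using s by auto
  interpret M: matching \<beta> q s a1 b1
    by unfold_locales (use p ss ap in auto)
  have c1: "c1 = sub_c a1 b1" by (simp only: c1_def ap(2))
  note abD = matching_pairD[OF ab]
  show dI: "invertible_Linf d"
    unfolding invertible_Linf_def d sub_d_def
  proof (intro conjI bexI[of _ "inverse b * cpa a"])
    show "b * inverse (cpa a) \<in> Linf" "inverse b * cpa a \<in> Linf"
      using abD cpa_Linf[OF abD(3)] cpa_Linf[OF abD(1)] by (auto simp: cpa_inverse intro!: Linf_mult)
    have "b * inverse (cpa a) * (inverse b * cpa a) = (b * inverse b) * (cpa a * inverse (cpa a))" by (simp only: mult_ac)
    thus "b * inverse (cpa a) * (inverse b * cpa a) = 1" by (simp only: abD(6) cpa_nz[OF abD(5)] mult_1)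
  qed
  note fa = fredholm_adjoint[OF pq dI fr ind k]
  define u where "u = conj_fun d * tvar powi (- int k)"
  have uL: "u \<in> Linf" unfolding u_def using invertible_LinfD(1)[OF dI] by (intro Linf_mult) auto
  have uinj: "h = 0" if "h \<in> Hp q" "toep u h = 0" for h
  proof -
    obtain C where C: "\<forall>h\<in>Hp q. Lp_norm q h \<le> C * Lp_norm q (toep u h)"
      using fa(1) unfolding u_def by (elim exE conjE)
    have "Lp_norm q h = 0" using bspec[OF C that(1)] Lp_norm_nonneg[of q h] by (simp add: that(2))
    from Lp_norm_eq_0[OF Hp_Lp[OF that(1)] this] show ?thesis using p by simp
  qed
  note bij = toep_conj_om[OF p(2) uL uinj fa(2)[folded u_def], where n = "2 * m"]
  \<comment> \<open>As 2 m - k = j, the factor t^j completes \<chi>^-2m to a power of the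
    antianalytic function t \<chi>^-1 times cnj d t^-k, so T(c1 t^j) inherits bijectivity.\<close>
  have "c1 * tvar powi int j = conj_fun om ^ (2 * m) * u"
  proof -
    have "tvar powi int j = tvar ^ (2 * m) * tvar powi (- int k)"
    proof -
      have "tvar powi int (2 * m) * tvar powi (- int k) = tvar powi (int (2 * m) + - int k)"
        by (rule tvar_powi_add[symmetric])
      also have "int (2 * m) + - int k = int j" using j by simp
      finally show ?thesis unfolding power_int_of_nat ..
    qed
    thus ?thesis unfolding c1_def u_def conj_om power_mult_distrib by (simp only: mult_ac)
  qed
  note bij = bij[folded this]
  show c1L: "c1 \<in> Linf" unfolding c1 by (rule M.sub_Linf)
  note tp = toep_rinv_properties[OF pq c1L j(2) bij]
  show "j = 0 \<Longrightarrow> f \<in> ker_op q (toep c1) \<Longrightarrow> f = 0" by (rule tp(3))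
  show "\<exists>x. \<forall>f\<in>ker_op q (toep c1). \<exists>z. f = cscale z x" by (rule tp(4))
  show "c1 * cpa c1 = 1" unfolding c1 by (rule M.cc)
  have "im_Pa_s q \<beta> s (conj_fun (sub_c a b)) = eigsp q s (conj_fun (sub_c a b))"
    using M.sub_Linf(2) M.dd unfolding ap(3) by (intro im_Pa_eq p ss)
  hence V: "V = phi q \<beta> s a1 b1 ` eigsp q s (sub_d \<beta> a1 b1)"
    unfolding V_def chi_powi a1_def[symmetric] b1_def[symmetric] ap(3) by (simp only:)
  note dec = M.ker_op_decomposition[folded c1, OF tp(1,2), folded V]
  show "eigsp q (- s) c1 \<inter> V = {0}" by (rule dec(2))
  have "coker_op p (\<lambda>f. toep a f + cscale s (hank \<beta> b f)) = toep (inverse \<xi> ^ m) `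
      (ker_op q (\<lambda>g. toep a1 g + cscale s (hank \<beta> b1 g)) \<inter> toep (\<xi> ^ m) ` Hp q)"
    unfolding coker_toep_hank[OF pq abD(1,2) ss(2)] a1_def b1_def by (rule ker_op_chi[OF p(2)])
  also have "ker_op q (\<lambda>g. toep a1 g + cscale s (hank \<beta> b1 g)) = ker_op q M.op"
    by (simp only: M.op_def ker_op_def)
  also note dec(1)
  finally show "coker_op p (\<lambda>f. toep a f + cscale s (hank \<beta> b f)) =
      toep (\<xi> powi (- int m)) ` (set_sum (eigsp q (- s) c1) V \<inter> toep (\<xi> powi int m) ` Hp q)"
    unfolding chi_powi .
qed

end

section \<open>The formula for the cokernel\<close>

theorem theorem5p3:
  fixes p q :: real and \<beta> s :: complex and a b c d :: circfun
    and \<kappa>\<^sub>1 \<kappa>\<^sub>2 :: int and m :: nat and \<phi> :: "circfun \<Rightarrow> circfun"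
  assumes "1 < p" and "1 / p + 1 / q = 1" and "1 < cmod \<beta>"
    and "matching_pair \<beta> a b"
    and "fredholm_pair p \<beta> a b"
    and "c = sub_c a b" and "d = sub_d \<beta> a b"
    and "\<kappa>\<^sub>1 = ind p (toep c)" and "\<kappa>\<^sub>2 = ind p (toep d)"
    and "\<kappa>\<^sub>1 \<le> -1" and "1 \<le> \<kappa>\<^sub>2"
    and "2 * int m - \<kappa>\<^sub>2 \<le> 1" and "0 \<le> 2 * int m - \<kappa>\<^sub>2"
    and "s \<in> {1, -1}"
    and "\<phi> = phi q \<beta> s (conj_fun a * chi \<beta> powi (- int m))
                      (conj_fun (comp_alpha \<beta> b) * chi \<beta> powi int m)"
  shows "(odd \<kappa>\<^sub>2 \<longrightarrow>
           (\<forall>d\<^sub>m d\<^sub>p. wh_fact p d \<kappa>\<^sub>2 d\<^sub>m d\<^sub>p \<longrightarrow>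
              (let U = {cscale ((1 - s * alpha_sig q \<beta> (conj_fun d)) / 2 * w)
                               (conj_fun (inverse d\<^sub>m)) | w. True};
                   V = \<phi> ` im_Pa_s q \<beta> s (conj_fun c)
               in U \<inter> V = {0} \<and>
                  coker_op p (\<lambda>f. toep a f + cscale s (hank \<beta> b f)) =
                    toep (chi \<beta> powi (- int m)) `
                      (set_sum U V \<inter> toep (chi \<beta> powi int m) ` Hp q)))) \<and>
         (even \<kappa>\<^sub>2 \<longrightarrow>
           coker_op p (\<lambda>f. toep a f + cscale s (hank \<beta> b f)) =
             toep (chi \<beta> powi (- int m)) `
               (\<phi> ` im_Pa_s q \<beta> s (conj_fun c) \<inter> toep (chi \<beta> powi int m) ` Hp q))"
proof -
  interpret alpha_shift \<beta> by unfold_locales (rule assms(3))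
  have pq: "conj_exps p q" using assms(1,2) by (rule conj_expsI)
  have p: "p > 1" "q > 1" using pq by (auto simp: conj_exps_def)
  define k where "k = nat \<kappa>\<^sub>2"
  define j where "j = nat (2 * int m - \<kappa>\<^sub>2)"
  have k: "\<kappa>\<^sub>2 = int k" "k \<ge> 1" using assms(11) by (auto simp: k_def)
  have j: "2 * m = k + j" "j \<le> 1" using assms(11-13) by (auto simp: j_def k_def nat_le_iff)
  have fr: "fredholm p (toep d)" using assms(5,7) by (simp add: fredholm_pair_def)
  have ind: "ind p (toep d) = int k" using assms(9) k(1) by simp
  define c1 where "c1 = conj_fun d * inverse (chi \<beta>) ^ (2 * m)"
  define V where "V = \<phi> ` im_Pa_s q \<beta> s (conj_fun c)"
  note D = coker_decomposition[OF pq assms(4,7) fr ind k(2) j assms(14),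
      folded c1_def assms(6) assms(15), folded V_def]
  show ?thesis
    unfolding Let_def V_def[symmetric]
  proof (intro conjI impI allI)
    assume "even \<kappa>\<^sub>2"
    \<comment> \<open>2 m = k + j with j \<le> 1, so j is the parity of k.\<close>
    hence "j = 0" using j k(1) by presburger
    hence "f = 0" if "f \<in> eigsp q (- s) c1" for f using D(6) eigsp_ker_toep[OF p(2) D(3) that] by blast
    moreover have "0 \<in> eigsp q (- s) c1" by (simp add: eigsp_def)
    ultimately have "eigsp q (- s) c1 = {0}" by blast
    hence "set_sum (eigsp q (- s) c1) V = V" by (auto simp: set_sum_def)
    thus "coker_op p (\<lambda>f. toep a f + cscale s (hank \<beta> b f)) =
        toep (chi \<beta> powi (- int m)) ` (V \<inter> toep (chi \<beta> powi int m) ` Hp q)"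
      using D(1) by simp
  next
    fix dm dp assume odd: "odd \<kappa>\<^sub>2" and w: "wh_fact p d \<kappa>\<^sub>2 dm dp"
    have "j = 1" using odd j k(1) by presburger
    hence mk: "2 * m = Suc k" using j by simp
    define z where "z = cnj (fourier dp 0)"
    note wa = wh_fact_adjoint[OF pq D(5) k(2) w[unfolded k(1)], folded z_def]
    obtain x where x: "\<And>f. f \<in> ker_op q (toep c1) \<Longrightarrow> \<exists>z. f = cscale z x" using D(7) by blast
    note sg = signature_eigenvalue[OF pq wa(2) c1_def[unfolded mk] D(3,4) x]
    define \<sigma> where "\<sigma> = alpha_sig q \<beta> (conj_fun d)"
    have \<sigma>: "\<sigma> \<in> {1, -1}" using sg(4) by (simp add: \<sigma>_def square_eq_1_iff)
    define f0 where "f0 = conj_fun (inverse dm)"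
    \<comment> \<open>cnj dm^-1 is the inverse plus factor of cnj d up to the scalar z, hence an
      eigenvector for the same eigenvalue.\<close>
    have f0: "f0 = cscale z (inverse (cscale z (conj_fun dm)))"
      using wa(1) by (simp add: f0_def circ_inverse_cscale conj_fun_inverse)
    have fk: "f0 \<in> ker_op q (toep c1)"
      using sg(1) by (simp add: f0 ker_op_def Hp_cscale toep_cscale[OF p(2) D(3)] Hp_Lp)
    have fn: "f0 \<noteq> 0" unfolding f0 using sg(2) wa(1) cscale_inj[OF sg(2), of z 0] by simp
    have fJ: "J_alpha \<beta> (c1 * f0) = cscale \<sigma> f0"
      using sg(3) by (simp add: f0 cscale_mult_right J_cscale \<sigma>_def mult.commute)
    have one: "\<exists>z. f = cscale z f0" if "f \<in> ker_op q (toep c1)" for f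
    proof -
      from x[OF that] x[OF fk] obtain y y0 where y: "f = cscale y x" "f0 = cscale y0 x" by blast
      have "y0 \<noteq> 0" using fn y(2) by auto
      hence "f = cscale (y / y0) f0" by (simp add: y)
      thus ?thesis ..
    qed
    have E: "eigsp q (- s) c1 = {cscale ((1 - s * alpha_sig q \<beta> (conj_fun d)) / 2 * w) (conj_fun (inverse dm)) |w. True}"
      unfolding f0_def[symmetric] \<sigma>_def[symmetric]
      using fk by (intro eigsp_one_dimensional[OF p(2) D(3) _ fn fJ \<sigma> assms(14) one]) (simp_all add: ker_op_def)
    show "{cscale ((1 - s * alpha_sig q \<beta> (conj_fun d)) / 2 * w) (conj_fun (inverse dm)) |w. True} \<inter> V = {0}"
      unfolding E[symmetric] by (rule D(2))
    show "coker_op p (\<lambda>f. toep a f + cscale s (hank \<beta> b f)) = toep (chi \<beta> powi (- int m)) `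
        (set_sum {cscale ((1 - s * alpha_sig q \<beta> (conj_fun d)) / 2 * w) (conj_fun (inverse dm)) |w. True} V
          \<inter> toep (chi \<beta> powi int m) ` Hp q)"
      unfolding E[symmetric] by (rule D(1))
  qed
qed

end
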